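(* Let $\mathcal K$ be a 2-category in which idempotent 2-cells split. Then the 2-category $\mathsf{EM}_{\mathrm{dm}}(\mathcal K)$ (described explicitly in the context) is the free $\mathbf{Cat}_{\mathbf{cc}}$-completion of $\mathcal K$ under demi-EM-objects; the exhibiting 2-functor $\mathcal K\to\mathsf{EM}_{\mathrm{dm}}(\mathcal K)$ is the inclusion sending an object $A$ to the identity monad $(A,1)$.
   Context: Vertical composition of 2-cells is written $\beta.\alpha$ (first $\alpha$, then $\beta$); horizontal composition is juxtaposition; a 1-cell also denotes its identity 2-cell. Cauchy completion: for a category $B$, $QB$ has as objects pairs $(b,\rho)$ with $\rho:b\to b$ idempotent in $B$; a morphism $(b,\rho)\to(b',\rho')$ is $\phi:b\to b'$ with $\rho'\phi=\phi=\phi\rho$; the identity of $(b,\rho)$ is $\rho$. For a 2-category $\mathcal K$, $Q_*\mathcal K$ has the same objects and hom-categories $Q(\mathcal K(A,B))$. Let $\mathbf{Cat}_{\mathbf{cc}}$ be the 2-category of Cauchy complete categories (those in which idempotents split). A $\mathbf{Cat}_{\mathbf{cc}}$-category is a 2-category in which idempotent 2-cells split. A demimonad in $\mathcal K$ is a monad in $Q_*\mathcal K$. A bicategorical EM-object of a monad $(B,t)$ in a 2-category $\mathcal M$ is an object $B^t$ with an equivalence $\mathcal M(A,B^t)\simeq\mathcal M(A,B)^{\mathcal M(A,t)}$, pseudonatural in $A$, where $\mathcal M(A,t)$ is the induced monad on $\mathcal M(A,B)$ and the right side is its category of algebras. A demi-EM-object of a demimonad in $\mathcal K$ is a bicategorical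 EM-object of it in $Q_*\mathcal K$. $\mathsf{EM}_{\mathrm{dm}}(\mathcal K)$ is the following 2-category. Objects: monads $(A,t)$ in $\mathcal K$ (multiplication $\mu$, unit $\eta$). A 1-cell $(A,t)\to(B,s)$: a 1-cell $f:A\to B$ of $\mathcal K$ with a 2-cell $\phi:sf\to ft$ such that $f\mu.\phi t.s\phi=\phi.\mu f$. A 2-cell $(f,\phi)\to(g,\psi)$: a 2-cell $\rho:f\to gt$ with $g\mu.\psi t.s\rho=g\mu.\rho t.\phi$ and $g\mu.\psi t.\eta gt.\rho=\rho$. The composite of $(f,\phi):(A,t)\to(B,s)$ and $(f',\phi'):(B,s)\to(C,r)$ is $(f'f,\ f'\phi.\phi'f)$. The vertical composite of $\rho:(f,\phi)\to(g,\psi)$ and $\sigma:(g,\psi)\to(h,\theta)$ is $h\mu.\sigma t.\rho$; the identity on $(f,\phi)$ is $\phi.\eta f$. The horizontal composite of $\rho:(f,\phi)\to(g,\psi)$ and $\rho':(f',\phi')\to(g',\psi')$ is $g'g\mu.g'\rho t.g'\phi.\rho'f:f'f\to g'gt$. The inclusion $\mathcal K\to\mathsf{EM}_{\mathrm{dm}}(\mathcal K)$ sends $A$ to $(A,1)$, $f$ to $(f,1_f)$ and a 2-cell to itself. "Free $\mathbf{Cat}_{\mathbf{cc}}$-completion of $\mathcal K$ under demi-EM-objects" means: $\mathsf{EM}_{\mathrm{dm}}(\mathcal K)$ is a $\mathbf{Cat}_{\mathbf{cc}}$-category with all demi-EM-objects, and for every $\mathbf{Cat}_{\mathbf{cc}}$-category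 $\mathcal L$ with demi-EM-objects, restriction along the inclusion is a biequivalence from the 2-category of demi-EM-object-preserving pseudofunctors $\mathsf{EM}_{\mathrm{dm}}(\mathcal K)\to\mathcal L$ (with pseudonatural transformations and modifications) to the 2-category $\mathrm{Hom}(\mathcal K,\mathcal L)$ of all pseudofunctors, pseudonatural transformations and modifications. *)

theory Defs
  imports "HOL-Library.FuncSet"
begin

section \<open>Categories\<close>

record ('o, 'm) cat =
  Ob :: "'o set"
  Mo :: "'m set"
  Dom :: "'m \<Rightarrow> 'o"
  Cod :: "'m \<Rightarrow> 'o"
  Id :: "'o \<Rightarrow> 'm"
  Cmp :: "'m \<Rightarrow> 'm \<Rightarrow> 'm"  (infixr "\<circ>\<index>" 65)

definition mor_in :: "('o, 'm) cat \<Rightarrow> 'm \<Rightarrow> 'o \<Rightarrow> 'o \<Rightarrow> bool" where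
  "mor_in C m x y \<longleftrightarrow> m \<in> Mo C \<and> Dom C m = x \<and> Cod C m = y"

locale category =
  fixes C :: "('o, 'm) cat" (structure)
  assumes Dom_Ob: "m \<in> Mo C \<Longrightarrow> Dom C m \<in> Ob C"
    and Cod_Ob: "m \<in> Mo C \<Longrightarrow> Cod C m \<in> Ob C"
    and Id_in: "x \<in> Ob C \<Longrightarrow> mor_in C (Id C x) x x"
    and Cmp_in: "mor_in C m x y \<Longrightarrow> mor_in C n y z \<Longrightarrow> mor_in C (n \<circ> m) x z"
    and Cmp_Id: "mor_in C m x y \<Longrightarrow> m \<circ> Id C x = m"
    and Id_Cmp: "mor_in C m x y \<Longrightarrow> Id C y \<circ> m = m"
    and Cmp_assoc: "mor_in C m w x \<Longrightarrow> mor_in C n x y \<Longrightarrow> mor_in C p y z \<Longrightarrow>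
                      (p \<circ> n) \<circ> m = p \<circ> (n \<circ> m)"

definition is_iso :: "('o, 'm) cat \<Rightarrow> 'm \<Rightarrow> 'o \<Rightarrow> 'o \<Rightarrow> bool" where
  "is_iso C m x y \<longleftrightarrow> mor_in C m x y \<and>
     (\<exists>n. mor_in C n y x \<and> Cmp C n m = Id C x \<and> Cmp C m n = Id C y)"

definition idempotents_split :: "('o, 'm) cat \<Rightarrow> bool" where
  "idempotents_split C \<longleftrightarrow>
     (\<forall>x e. mor_in C e x x \<and> Cmp C e e = e \<longrightarrow>
        (\<exists>y r s. mor_in C r x y \<and> mor_in C s y x \<and> Cmp C s r = e \<and> Cmp C r s = Id C y))"

record ('o, 'm, 'p, 'n) fctr =
  fob :: "'o \<Rightarrow> 'p"
  fmo :: "'m \<Rightarrow> 'n"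

definition is_functor :: "('o, 'm) cat \<Rightarrow> ('p, 'n) cat \<Rightarrow> ('o, 'm, 'p, 'n) fctr \<Rightarrow> bool" where
  "is_functor C D F \<longleftrightarrow> category C \<and> category D \<and>
     (\<forall>x\<in>Ob C. fob F x \<in> Ob D) \<and>
     (\<forall>m x y. mor_in C m x y \<longrightarrow> mor_in D (fmo F m) (fob F x) (fob F y)) \<and>
     (\<forall>x\<in>Ob C. fmo F (Id C x) = Id D (fob F x)) \<and>
     (\<forall>m n x y z. mor_in C m x y \<and> mor_in C n y z \<longrightarrow>
        fmo F (Cmp C n m) = Cmp D (fmo F n) (fmo F m))"

definition is_nat_iso :: "('o, 'm) cat \<Rightarrow> ('p, 'n) cat \<Rightarrow> ('o, 'm, 'p, 'n) fctr \<Rightarrow>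
    ('o, 'm, 'p, 'n) fctr \<Rightarrow> ('o \<Rightarrow> 'n) \<Rightarrow> bool" where
  "is_nat_iso C D F G \<tau> \<longleftrightarrow>
     (\<forall>x\<in>Ob C. is_iso D (\<tau> x) (fob F x) (fob G x)) \<and>
     (\<forall>m x y. mor_in C m x y \<longrightarrow> Cmp D (\<tau> y) (fmo F m) = Cmp D (fmo G m) (\<tau> x))"

definition id_fctr :: "('o, 'm, 'o, 'm) fctr" where
  "id_fctr = \<lparr>fob = (\<lambda>x. x), fmo = (\<lambda>m. m)\<rparr>"

definition comp_fctr :: "('p, 'n, 'q, 'k) fctr \<Rightarrow> ('o, 'm, 'p, 'n) fctr \<Rightarrow> ('o, 'm, 'q, 'k) fctr" where
  "comp_fctr G F = \<lparr>fob = (\<lambda>x. fob G (fob F x)), fmo = (\<lambda>m. fmo G (fmo F m))\<rparr>"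

definition is_equivalence :: "('o, 'm) cat \<Rightarrow> ('p, 'n) cat \<Rightarrow> ('o, 'm, 'p, 'n) fctr \<Rightarrow> bool" where
  "is_equivalence C D F \<longleftrightarrow> is_functor C D F \<and>
     (\<exists>G \<eta> \<epsilon>. is_functor D C G \<and>
        is_nat_iso C C id_fctr (comp_fctr G F) \<eta> \<and> is_nat_iso D D (comp_fctr F G) id_fctr \<epsilon>)"

text \<open>A monad on a category and its category of algebras. A morphism of algebras carries its
  domain and codomain, since the same underlying morphism may be one for several algebra structures.\<close>

record ('o, 'm) cat_monad =
  efun :: "('o, 'm, 'o, 'm) fctr"
  mul :: "'o \<Rightarrow> 'm"
  unt :: "'o \<Rightarrow> 'm"

definition alg_cat :: "('o, 'm) cat \<Rightarrow> ('o, 'm) cat_monad \<Rightarrow>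
    ('o \<times> 'm, ('o \<times> 'm) \<times> ('o \<times> 'm) \<times> 'm) cat" where
  "alg_cat C T =
     (let Alg = {(x, a). x \<in> Ob C \<and> mor_in C a (fob (efun T) x) x \<and>
                   Cmp C a (fmo (efun T) a) = Cmp C a (mul T x) \<and> Cmp C a (unt T x) = Id C x}
      in \<lparr>Ob = Alg,
          Mo = {((x, a), (y, b), h). (x, a) \<in> Alg \<and> (y, b) \<in> Alg \<and> mor_in C h x y \<and>
                   Cmp C h a = Cmp C b (fmo (efun T) h)},
          Dom = (\<lambda>(p, q, h). p),
          Cod = (\<lambda>(p, q, h). q),
          Id = (\<lambda>(x, a). ((x, a), (x, a), Id C x)),
          Cmp = (\<lambda>(q', r, k) (p, q, h). (p, r, Cmp C k h))\<rparr>)"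

section \<open>2-categories\<close>

record ('o, 'a, 'c) two_cat =
  objs :: "'o set"
  arrs :: "'a set"
  cells :: "'c set"
  src :: "'a \<Rightarrow> 'o"
  trg :: "'a \<Rightarrow> 'o"
  csrc :: "'c \<Rightarrow> 'a"
  ctrg :: "'c \<Rightarrow> 'a"
  one :: "'o \<Rightarrow> 'a"
  cmp :: "'a \<Rightarrow> 'a \<Rightarrow> 'a"  (infixr "\<odot>\<index>" 75)
  idc :: "'a \<Rightarrow> 'c"
  vc :: "'c \<Rightarrow> 'c \<Rightarrow> 'c"  (infixr "\<cdot>\<index>" 65)
  hc :: "'c \<Rightarrow> 'c \<Rightarrow> 'c"  (infixr "\<star>\<index>" 70)

definition arr_in :: "('o, 'a, 'c) two_cat \<Rightarrow> 'a \<Rightarrow> 'o \<Rightarrow> 'o \<Rightarrow> bool"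
    ("\<guillemotleft>_ : _ \<rightarrow>\<index> _\<guillemotright>") where
  "arr_in K f A B \<longleftrightarrow> f \<in> arrs K \<and> src K f = A \<and> trg K f = B"

definition cell_in :: "('o, 'a, 'c) two_cat \<Rightarrow> 'c \<Rightarrow> 'a \<Rightarrow> 'a \<Rightarrow> bool"
    ("\<guillemotleft>_ : _ \<Rightarrow>\<index> _\<guillemotright>") where
  "cell_in K \<alpha> f g \<longleftrightarrow> \<alpha> \<in> cells K \<and> csrc K \<alpha> = f \<and> ctrg K \<alpha> = g"

definition lwhisk :: "('o, 'a, 'c) two_cat \<Rightarrow> 'a \<Rightarrow> 'c \<Rightarrow> 'c"  (infixr "\<triangleleft>\<index>" 70) where
  "lwhisk K f \<alpha> = hc K (idc K f) \<alpha>"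

definition rwhisk :: "('o, 'a, 'c) two_cat \<Rightarrow> 'c \<Rightarrow> 'a \<Rightarrow> 'c"  (infixl "\<triangleright>\<index>" 71) where
  "rwhisk K \<alpha> f = hc K \<alpha> (idc K f)"

definition composable :: "('o, 'a, 'c) two_cat \<Rightarrow> 'a \<Rightarrow> 'a \<Rightarrow> bool" where
  "composable K g f \<longleftrightarrow> g \<in> arrs K \<and> f \<in> arrs K \<and> trg K f = src K g"

locale two_category =
  fixes K :: "('o, 'a, 'c) two_cat" (structure)
  assumes src_objs: "f \<in> arrs K \<Longrightarrow> src K f \<in> objs K"
    and trg_objs: "f \<in> arrs K \<Longrightarrow> trg K f \<in> objs K"
    and csrc_arrs: "\<alpha> \<in> cells K \<Longrightarrow> csrc K \<alpha> \<in> arrs K"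
    and ctrg_arrs: "\<alpha> \<in> cells K \<Longrightarrow> ctrg K \<alpha> \<in> arrs K"
    and src_csrc: "\<alpha> \<in> cells K \<Longrightarrow> src K (csrc K \<alpha>) = src K (ctrg K \<alpha>)"
    and trg_csrc: "\<alpha> \<in> cells K \<Longrightarrow> trg K (csrc K \<alpha>) = trg K (ctrg K \<alpha>)"
    and one_in: "A \<in> objs K \<Longrightarrow> \<guillemotleft>one K A : A \<rightarrow> A\<guillemotright>"
    and cmp_in: "\<guillemotleft>f : A \<rightarrow> B\<guillemotright> \<Longrightarrow> \<guillemotleft>g : B \<rightarrow> C\<guillemotright> \<Longrightarrow> \<guillemotleft>g \<odot> f : A \<rightarrow> C\<guillemotright>"
    and cmp_one: "\<guillemotleft>f : A \<rightarrow> B\<guillemotright> \<Longrightarrow> f \<odot> one K A = f"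
    and one_cmp: "\<guillemotleft>f : A \<rightarrow> B\<guillemotright> \<Longrightarrow> one K B \<odot> f = f"
    and cmp_assoc: "\<guillemotleft>f : A \<rightarrow> B\<guillemotright> \<Longrightarrow> \<guillemotleft>g : B \<rightarrow> C\<guillemotright> \<Longrightarrow> \<guillemotleft>h : C \<rightarrow> D\<guillemotright> \<Longrightarrow>
                      (h \<odot> g) \<odot> f = h \<odot> (g \<odot> f)"
    and idc_in: "f \<in> arrs K \<Longrightarrow> \<guillemotleft>idc K f : f \<Rightarrow> f\<guillemotright>"
    and vc_in: "\<guillemotleft>\<alpha> : f \<Rightarrow> g\<guillemotright> \<Longrightarrow> \<guillemotleft>\<beta> : g \<Rightarrow> h\<guillemotright> \<Longrightarrow> \<guillemotleft>\<beta> \<cdot> \<alpha> : f \<Rightarrow> h\<guillemotright>"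
    and vc_idc: "\<guillemotleft>\<alpha> : f \<Rightarrow> g\<guillemotright> \<Longrightarrow> \<alpha> \<cdot> idc K f = \<alpha>"
    and idc_vc: "\<guillemotleft>\<alpha> : f \<Rightarrow> g\<guillemotright> \<Longrightarrow> idc K g \<cdot> \<alpha> = \<alpha>"
    and vc_assoc: "\<guillemotleft>\<alpha> : f \<Rightarrow> g\<guillemotright> \<Longrightarrow> \<guillemotleft>\<beta> : g \<Rightarrow> h\<guillemotright> \<Longrightarrow> \<guillemotleft>\<gamma> : h \<Rightarrow> k\<guillemotright> \<Longrightarrow>
                      (\<gamma> \<cdot> \<beta>) \<cdot> \<alpha> = \<gamma> \<cdot> (\<beta> \<cdot> \<alpha>)"
    and hc_in: "\<guillemotleft>\<alpha> : f \<Rightarrow> f'\<guillemotright> \<Longrightarrow> \<guillemotleft>\<beta> : g \<Rightarrow> g'\<guillemotright> \<Longrightarrow> trg K f = src K g \<Longrightarrow>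
                      \<guillemotleft>\<beta> \<star> \<alpha> : g \<odot> f \<Rightarrow> g' \<odot> f'\<guillemotright>"
    and hc_idc: "\<guillemotleft>f : A \<rightarrow> B\<guillemotright> \<Longrightarrow> \<guillemotleft>g : B \<rightarrow> C\<guillemotright> \<Longrightarrow> idc K g \<star> idc K f = idc K (g \<odot> f)"
    and interchange: "\<guillemotleft>\<alpha> : f \<Rightarrow> f'\<guillemotright> \<Longrightarrow> \<guillemotleft>\<alpha>' : f' \<Rightarrow> f''\<guillemotright> \<Longrightarrow> \<guillemotleft>\<beta> : g \<Rightarrow> g'\<guillemotright> \<Longrightarrow>
                      \<guillemotleft>\<beta>' : g' \<Rightarrow> g''\<guillemotright> \<Longrightarrow> trg K f = src K g \<Longrightarrow>
                      (\<beta>' \<cdot> \<beta>) \<star> (\<alpha>' \<cdot> \<alpha>) = (\<beta>' \<star> \<alpha>') \<cdot> (\<beta> \<star> \<alpha>)"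
    and hc_one: "\<guillemotleft>\<alpha> : f \<Rightarrow> f'\<guillemotright> \<Longrightarrow> \<alpha> \<star> idc K (one K (src K f)) = \<alpha>"
    and one_hc: "\<guillemotleft>\<alpha> : f \<Rightarrow> f'\<guillemotright> \<Longrightarrow> idc K (one K (trg K f)) \<star> \<alpha> = \<alpha>"
    and hc_assoc: "\<guillemotleft>\<alpha> : f \<Rightarrow> f'\<guillemotright> \<Longrightarrow> \<guillemotleft>\<beta> : g \<Rightarrow> g'\<guillemotright> \<Longrightarrow> \<guillemotleft>\<gamma> : h \<Rightarrow> h'\<guillemotright> \<Longrightarrow>
                      trg K f = src K g \<Longrightarrow> trg K g = src K h \<Longrightarrow>
                      (\<gamma> \<star> \<beta>) \<star> \<alpha> = \<gamma> \<star> (\<beta> \<star> \<alpha>)"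

definition hom_cat :: "('o, 'a, 'c) two_cat \<Rightarrow> 'o \<Rightarrow> 'o \<Rightarrow> ('a, 'c) cat" where
  "hom_cat K A B =
     \<lparr>Ob = {f. arr_in K f A B},
      Mo = {\<alpha> \<in> cells K. arr_in K (csrc K \<alpha>) A B \<and> arr_in K (ctrg K \<alpha>) A B},
      Dom = csrc K, Cod = ctrg K, Id = idc K, Cmp = vc K\<rparr>"

definition Cat_cc_category :: "('o, 'a, 'c) two_cat \<Rightarrow> bool" where
  "Cat_cc_category K \<longleftrightarrow> two_category K \<and>
     (\<forall>A\<in>objs K. \<forall>B\<in>objs K. idempotents_split (hom_cat K A B))"

definition is_iso2 :: "('o, 'a, 'c) two_cat \<Rightarrow> 'c \<Rightarrow> 'a \<Rightarrow> 'a \<Rightarrow> bool" where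
  "is_iso2 K \<alpha> f g \<longleftrightarrow> cell_in K \<alpha> f g \<and>
     (\<exists>\<beta>. cell_in K \<beta> g f \<and> vc K \<beta> \<alpha> = idc K f \<and> vc K \<alpha> \<beta> = idc K g)"

definition equivalent_objs :: "('o, 'a, 'c) two_cat \<Rightarrow> 'o \<Rightarrow> 'o \<Rightarrow> bool" where
  "equivalent_objs K A B \<longleftrightarrow>
     (\<exists>f g \<eta> \<epsilon>. arr_in K f A B \<and> arr_in K g B A \<and>
        is_iso2 K \<eta> (one K A) (cmp K g f) \<and> is_iso2 K \<epsilon> (cmp K f g) (one K B))"

definition full_sub :: "('o, 'a, 'c) two_cat \<Rightarrow> 'o set \<Rightarrow> ('o, 'a, 'c) two_cat" where
  "full_sub K S = K
     \<lparr>objs := objs K \<inter> S,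
      arrs := {f \<in> arrs K. src K f \<in> S \<and> trg K f \<in> S},
      cells := {\<alpha> \<in> cells K. src K (csrc K \<alpha>) \<in> S \<and> trg K (csrc K \<alpha>) \<in> S}\<rparr>"

section \<open>Pseudofunctors, pseudonatural transformations, modifications\<close>

text \<open>The component functions of all these data take the value \<open>undefined\<close> outside their
  carriers, so that equality in HOL is equality of the data.\<close>

record ('o, 'a, 'c, 'p, 'b, 'd) pfun =
  pob :: "'o \<Rightarrow> 'p"
  par :: "'a \<Rightarrow> 'b"
  pce :: "'c \<Rightarrow> 'd"
  pcomp :: "'a \<Rightarrow> 'a \<Rightarrow> 'd"
  punit :: "'o \<Rightarrow> 'd"

locale pseudofunctor = K: two_category K + L: two_category L
  for K :: "('o, 'a, 'c) two_cat" and L :: "('p, 'b, 'd) two_cat" +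
  fixes F :: "('o, 'a, 'c, 'p, 'b, 'd) pfun"
  assumes ext: "pob F \<in> extensional (objs K)" "par F \<in> extensional (arrs K)"
      "pce F \<in> extensional (cells K)" "punit F \<in> extensional (objs K)"
      "\<And>g f. \<not> composable K g f \<Longrightarrow> pcomp F g f = undefined"
    and pob_in: "A \<in> objs K \<Longrightarrow> pob F A \<in> objs L"
    and par_in: "arr_in K f A B \<Longrightarrow> arr_in L (par F f) (pob F A) (pob F B)"
    and pce_in: "cell_in K \<alpha> f g \<Longrightarrow> cell_in L (pce F \<alpha>) (par F f) (par F g)"
    and pce_idc: "f \<in> arrs K \<Longrightarrow> pce F (idc K f) = idc L (par F f)"
    and pce_vc: "cell_in K \<alpha> f g \<Longrightarrow> cell_in K \<beta> g h \<Longrightarrow>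
        pce F (\<beta> \<cdot>\<^bsub>K\<^esub> \<alpha>) = pce F \<beta> \<cdot>\<^bsub>L\<^esub> pce F \<alpha>"
    and pcomp_iso: "composable K g f \<Longrightarrow>
        is_iso2 L (pcomp F g f) (par F g \<odot>\<^bsub>L\<^esub> par F f) (par F (g \<odot>\<^bsub>K\<^esub> f))"
    and punit_iso: "A \<in> objs K \<Longrightarrow> is_iso2 L (punit F A) (one L (pob F A)) (par F (one K A))"
    and pcomp_nat: "cell_in K \<alpha> f f' \<Longrightarrow> cell_in K \<beta> g g' \<Longrightarrow> composable K g f \<Longrightarrow>
        pce F (\<beta> \<star>\<^bsub>K\<^esub> \<alpha>) \<cdot>\<^bsub>L\<^esub> pcomp F g f = pcomp F g' f' \<cdot>\<^bsub>L\<^esub> (pce F \<beta> \<star>\<^bsub>L\<^esub> pce F \<alpha>)"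
    and pcomp_assoc: "composable K h g \<Longrightarrow> composable K g f \<Longrightarrow>
        pcomp F (h \<odot>\<^bsub>K\<^esub> g) f \<cdot>\<^bsub>L\<^esub> (pcomp F h g \<triangleright>\<^bsub>L\<^esub> par F f) =
        pcomp F h (g \<odot>\<^bsub>K\<^esub> f) \<cdot>\<^bsub>L\<^esub> (par F h \<triangleleft>\<^bsub>L\<^esub> pcomp F g f)"
    and pcomp_unit_left: "arr_in K f A B \<Longrightarrow>
        pcomp F (one K B) f \<cdot>\<^bsub>L\<^esub> (punit F B \<triangleright>\<^bsub>L\<^esub> par F f) = idc L (par F f)"
    and pcomp_unit_right: "arr_in K f A B \<Longrightarrow>
        pcomp F f (one K A) \<cdot>\<^bsub>L\<^esub> (par F f \<triangleleft>\<^bsub>L\<^esub> punit F A) = idc L (par F f)"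

definition two_functor :: "('o, 'a, 'c) two_cat \<Rightarrow> ('p, 'b, 'd) two_cat \<Rightarrow>
    ('o, 'a, 'c, 'p, 'b, 'd) pfun \<Rightarrow> bool" where
  "two_functor K L F \<longleftrightarrow> pseudofunctor K L F \<and>
     (\<forall>g f. composable K g f \<longrightarrow>
        par F (cmp K g f) = cmp L (par F g) (par F f) \<and>
        pcomp F g f = idc L (par F (cmp K g f))) \<and>
     (\<forall>A\<in>objs K. par F (one K A) = one L (pob F A) \<and> punit F A = idc L (one L (pob F A)))"

definition comp_pfun :: "('o, 'a, 'c) two_cat \<Rightarrow> ('q, 'e, 'g) two_cat \<Rightarrow>
    ('p, 'b, 'd, 'q, 'e, 'g) pfun \<Rightarrow> ('o, 'a, 'c, 'p, 'b, 'd) pfun \<Rightarrow>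
    ('o, 'a, 'c, 'q, 'e, 'g) pfun" where
  "comp_pfun K L G F =
     \<lparr>pob = (\<lambda>A\<in>objs K. pob G (pob F A)),
      par = (\<lambda>f\<in>arrs K. par G (par F f)),
      pce = (\<lambda>\<alpha>\<in>cells K. pce G (pce F \<alpha>)),
      pcomp = (\<lambda>g f. if composable K g f
                 then pce G (pcomp F g f) \<cdot>\<^bsub>L\<^esub> pcomp G (par F g) (par F f) else undefined),
      punit = (\<lambda>A\<in>objs K. pce G (punit F A) \<cdot>\<^bsub>L\<^esub> punit G (pob F A))\<rparr>"

text \<open>The component of a pseudonatural transformation \<open>\<sigma> : F \<rightarrow> G\<close> at \<open>u : A \<rightarrow> B\<close> is an
  invertible 2-cell \<open>G u \<odot> \<sigma>\<^sub>A \<Rightarrow> \<sigma>\<^sub>B \<odot> F u\<close>.\<close>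

record ('o, 'a, 'c, 'p, 'b, 'd) pnat =
  nsrc :: "('o, 'a, 'c, 'p, 'b, 'd) pfun"
  ntrg :: "('o, 'a, 'c, 'p, 'b, 'd) pfun"
  nob :: "'o \<Rightarrow> 'b"
  nar :: "'a \<Rightarrow> 'd"

definition pseudonat :: "('o, 'a, 'c) two_cat \<Rightarrow> ('p, 'b, 'd) two_cat \<Rightarrow>
    ('o, 'a, 'c, 'p, 'b, 'd) pnat \<Rightarrow> bool" where
  "pseudonat K L \<sigma> \<longleftrightarrow>
     (let F = nsrc \<sigma>; G = ntrg \<sigma> in
      pseudofunctor K L F \<and> pseudofunctor K L G \<and>
      nob \<sigma> \<in> extensional (objs K) \<and> nar \<sigma> \<in> extensional (arrs K) \<and>
      (\<forall>A\<in>objs K. arr_in L (nob \<sigma> A) (pob F A) (pob G A)) \<and>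
      (\<forall>u A B. arr_in K u A B \<longrightarrow>
         is_iso2 L (nar \<sigma> u) (par G u \<odot>\<^bsub>L\<^esub> nob \<sigma> A) (nob \<sigma> B \<odot>\<^bsub>L\<^esub> par F u)) \<and>
      (\<forall>u v A B \<alpha>. arr_in K u A B \<and> cell_in K \<alpha> u v \<longrightarrow>
         nar \<sigma> v \<cdot>\<^bsub>L\<^esub> (pce G \<alpha> \<triangleright>\<^bsub>L\<^esub> nob \<sigma> A) = (nob \<sigma> B \<triangleleft>\<^bsub>L\<^esub> pce F \<alpha>) \<cdot>\<^bsub>L\<^esub> nar \<sigma> u) \<and>
      (\<forall>A\<in>objs K.
         nar \<sigma> (one K A) \<cdot>\<^bsub>L\<^esub> (punit G A \<triangleright>\<^bsub>L\<^esub> nob \<sigma> A) = nob \<sigma> A \<triangleleft>\<^bsub>L\<^esub> punit F A) \<and>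
      (\<forall>u v A B C. arr_in K u A B \<and> arr_in K v B C \<longrightarrow>
         nar \<sigma> (v \<odot>\<^bsub>K\<^esub> u) \<cdot>\<^bsub>L\<^esub> (pcomp G v u \<triangleright>\<^bsub>L\<^esub> nob \<sigma> A) =
         (nob \<sigma> C \<triangleleft>\<^bsub>L\<^esub> pcomp F v u) \<cdot>\<^bsub>L\<^esub> (nar \<sigma> v \<triangleright>\<^bsub>L\<^esub> par F u) \<cdot>\<^bsub>L\<^esub> (par G v \<triangleleft>\<^bsub>L\<^esub> nar \<sigma> u)))"

record ('o, 'a, 'c, 'p, 'b, 'd) modn =
  msrc :: "('o, 'a, 'c, 'p, 'b, 'd) pnat"
  mtrg :: "('o, 'a, 'c, 'p, 'b, 'd) pnat"
  mob :: "'o \<Rightarrow> 'd"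

definition modification :: "('o, 'a, 'c) two_cat \<Rightarrow> ('p, 'b, 'd) two_cat \<Rightarrow>
    ('o, 'a, 'c, 'p, 'b, 'd) modn \<Rightarrow> bool" where
  "modification K L m \<longleftrightarrow>
     (let \<sigma> = msrc m; \<tau> = mtrg m; F = nsrc \<sigma>; G = ntrg \<sigma> in
      pseudonat K L \<sigma> \<and> pseudonat K L \<tau> \<and> nsrc \<tau> = F \<and> ntrg \<tau> = G \<and>
      mob m \<in> extensional (objs K) \<and>
      (\<forall>A\<in>objs K. cell_in L (mob m A) (nob \<sigma> A) (nob \<tau> A)) \<and>
      (\<forall>u A B. arr_in K u A B \<longrightarrow>
         (mob m B \<triangleright>\<^bsub>L\<^esub> par F u) \<cdot>\<^bsub>L\<^esub> nar \<sigma> u = nar \<tau> u \<cdot>\<^bsub>L\<^esub> (par G u \<triangleleft>\<^bsub>L\<^esub> mob m A)))"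

definition comp_pnat :: "('o, 'a, 'c) two_cat \<Rightarrow> ('p, 'b, 'd) two_cat \<Rightarrow>
    ('o, 'a, 'c, 'p, 'b, 'd) pnat \<Rightarrow> ('o, 'a, 'c, 'p, 'b, 'd) pnat \<Rightarrow>
    ('o, 'a, 'c, 'p, 'b, 'd) pnat" where
  "comp_pnat K L \<tau> \<sigma> =
     \<lparr>nsrc = nsrc \<sigma>, ntrg = ntrg \<tau>,
      nob = (\<lambda>A\<in>objs K. nob \<tau> A \<odot>\<^bsub>L\<^esub> nob \<sigma> A),
      nar = (\<lambda>u\<in>arrs K. (nob \<tau> (trg K u) \<triangleleft>\<^bsub>L\<^esub> nar \<sigma> u) \<cdot>\<^bsub>L\<^esub> (nar \<tau> u \<triangleright>\<^bsub>L\<^esub> nob \<sigma> (src K u)))\<rparr>"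

definition Hom :: "('o, 'a, 'c) two_cat \<Rightarrow> ('p, 'b, 'd) two_cat \<Rightarrow>
    (('o, 'a, 'c, 'p, 'b, 'd) pfun, ('o, 'a, 'c, 'p, 'b, 'd) pnat, ('o, 'a, 'c, 'p, 'b, 'd) modn) two_cat"
  where
  "Hom K L =
     \<lparr>objs = {F. pseudofunctor K L F},
      arrs = {\<sigma>. pseudonat K L \<sigma>},
      cells = {m. modification K L m},
      src = nsrc, trg = ntrg, csrc = msrc, ctrg = mtrg,
      one = (\<lambda>F. \<lparr>nsrc = F, ntrg = F, nob = (\<lambda>A\<in>objs K. one L (pob F A)),
                  nar = (\<lambda>u\<in>arrs K. idc L (par F u))\<rparr>),
      cmp = comp_pnat K L,
      idc = (\<lambda>\<sigma>. \<lparr>msrc = \<sigma>, mtrg = \<sigma>, mob = (\<lambda>A\<in>objs K. idc L (nob \<sigma> A))\<rparr>),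
      vc = (\<lambda>n m. \<lparr>msrc = msrc m, mtrg = mtrg n, mob = (\<lambda>A\<in>objs K. mob n A \<cdot>\<^bsub>L\<^esub> mob m A)\<rparr>),
      hc = (\<lambda>n m. \<lparr>msrc = comp_pnat K L (msrc n) (msrc m), mtrg = comp_pnat K L (mtrg n) (mtrg m),
                   mob = (\<lambda>A\<in>objs K. mob n A \<star>\<^bsub>L\<^esub> mob m A)\<rparr>)\<rparr>"

definition restrict_pnat :: "('o, 'a, 'c) two_cat \<Rightarrow> ('p, 'b, 'd) two_cat \<Rightarrow>
    ('o, 'a, 'c, 'q, 'e, 'g) pfun \<Rightarrow> ('q, 'e, 'g, 'p, 'b, 'd) pnat \<Rightarrow>
    ('o, 'a, 'c, 'p, 'b, 'd) pnat" where
  "restrict_pnat K L J \<sigma> =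
     \<lparr>nsrc = comp_pfun K L (nsrc \<sigma>) J, ntrg = comp_pfun K L (ntrg \<sigma>) J,
      nob = (\<lambda>A\<in>objs K. nob \<sigma> (pob J A)), nar = (\<lambda>u\<in>arrs K. nar \<sigma> (par J u))\<rparr>"

definition restrict_modn :: "('o, 'a, 'c) two_cat \<Rightarrow> ('p, 'b, 'd) two_cat \<Rightarrow>
    ('o, 'a, 'c, 'q, 'e, 'g) pfun \<Rightarrow> ('q, 'e, 'g, 'p, 'b, 'd) modn \<Rightarrow>
    ('o, 'a, 'c, 'p, 'b, 'd) modn" where
  "restrict_modn K L J m =
     \<lparr>msrc = restrict_pnat K L J (msrc m), mtrg = restrict_pnat K L J (mtrg m),
      mob = (\<lambda>A\<in>objs K. mob m (pob J A))\<rparr>"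

text \<open>Restriction along a 2-functor \<open>J : K \<rightarrow> M\<close>, as a 2-functor to \<open>Hom K L\<close> from a
  sub-2-category \<open>D\<close> of \<open>Hom M L\<close>.\<close>

definition restriction :: "('o, 'a, 'c) two_cat \<Rightarrow> ('p, 'b, 'd) two_cat \<Rightarrow>
    ('o, 'a, 'c, 'q, 'e, 'g) pfun \<Rightarrow>
    (('q, 'e, 'g, 'p, 'b, 'd) pfun, ('q, 'e, 'g, 'p, 'b, 'd) pnat, ('q, 'e, 'g, 'p, 'b, 'd) modn) two_cat \<Rightarrow>
    (('q, 'e, 'g, 'p, 'b, 'd) pfun, ('q, 'e, 'g, 'p, 'b, 'd) pnat, ('q, 'e, 'g, 'p, 'b, 'd) modn,
     ('o, 'a, 'c, 'p, 'b, 'd) pfun, ('o, 'a, 'c, 'p, 'b, 'd) pnat, ('o, 'a, 'c, 'p, 'b, 'd) modn) pfun"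
  where
  "restriction K L J D =
     \<lparr>pob = (\<lambda>F\<in>objs D. comp_pfun K L F J),
      par = (\<lambda>\<sigma>\<in>arrs D. restrict_pnat K L J \<sigma>),
      pce = (\<lambda>m\<in>cells D. restrict_modn K L J m),
      pcomp = (\<lambda>\<tau> \<sigma>. if composable D \<tau> \<sigma>
                 then idc (Hom K L) (restrict_pnat K L J (cmp D \<tau> \<sigma>)) else undefined),
      punit = (\<lambda>F\<in>objs D. idc (Hom K L) (one (Hom K L) (comp_pfun K L F J)))\<rparr>"

text \<open>Street's definition: locally an equivalence, and surjective on objects up to equivalence.\<close>

definition biequivalence :: "('o, 'a, 'c) two_cat \<Rightarrow> ('p, 'b, 'd) two_cat \<Rightarrow>
    ('o, 'a, 'c, 'p, 'b, 'd) pfun \<Rightarrow> bool" where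
  "biequivalence K L F \<longleftrightarrow> pseudofunctor K L F \<and>
     (\<forall>A\<in>objs K. \<forall>B\<in>objs K.
        is_equivalence (hom_cat K A B) (hom_cat L (pob F A) (pob F B))
          \<lparr>fob = par F, fmo = pce F\<rparr>) \<and>
     (\<forall>Y\<in>objs L. \<exists>X\<in>objs K. equivalent_objs L (pob F X) Y)"

section \<open>Monads and bicategorical EM-objects\<close>

record ('o, 'a, 'c) mnd =
  base :: 'o
  endo :: 'a
  mult :: 'c
  eta :: 'c

definition monad_in :: "('o, 'a, 'c) two_cat \<Rightarrow> ('o, 'a, 'c) mnd \<Rightarrow> bool" where
  "monad_in K T \<longleftrightarrow>
     (let A = base T; t = endo T; \<mu> = mult T; \<eta> = eta T in
      A \<in> objs K \<and> arr_in K t A A \<and> cell_in K \<mu> (t \<odot>\<^bsub>K\<^esub> t) t \<and> cell_in K \<eta> (one K A) t \<and>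
      \<mu> \<cdot>\<^bsub>K\<^esub> (t \<triangleleft>\<^bsub>K\<^esub> \<mu>) = \<mu> \<cdot>\<^bsub>K\<^esub> (\<mu> \<triangleright>\<^bsub>K\<^esub> t) \<and>
      \<mu> \<cdot>\<^bsub>K\<^esub> (t \<triangleleft>\<^bsub>K\<^esub> \<eta>) = idc K t \<and> \<mu> \<cdot>\<^bsub>K\<^esub> (\<eta> \<triangleright>\<^bsub>K\<^esub> t) = idc K t)"

text \<open>The monad \<open>K(A, T)\<close> on \<open>K(A, B)\<close> induced by a monad \<open>T\<close> on \<open>B\<close>; its data do not
  mention \<open>A\<close>.\<close>

definition induced_monad :: "('o, 'a, 'c) two_cat \<Rightarrow> ('o, 'a, 'c) mnd \<Rightarrow> ('a, 'c) cat_monad" where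
  "induced_monad K T =
     \<lparr>efun = \<lparr>fob = (\<lambda>f. endo T \<odot>\<^bsub>K\<^esub> f), fmo = (\<lambda>\<alpha>. endo T \<triangleleft>\<^bsub>K\<^esub> \<alpha>)\<rparr>,
      mul = (\<lambda>f. mult T \<triangleright>\<^bsub>K\<^esub> f), unt = (\<lambda>f. eta T \<triangleright>\<^bsub>K\<^esub> f)\<rparr>"

definition hom_algs :: "('o, 'a, 'c) two_cat \<Rightarrow> ('o, 'a, 'c) mnd \<Rightarrow> 'o \<Rightarrow>
    ('a \<times> 'c, ('a \<times> 'c) \<times> ('a \<times> 'c) \<times> 'c) cat" where
  "hom_algs K T A = alg_cat (hom_cat K A (base T)) (induced_monad K T)"

text \<open>The action of the pseudofunctor \<open>A \<mapsto> hom_algs K T A\<close> on a 1-cell \<open>u : X \<rightarrow> A\<close>, and the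
  component at an algebra \<open>p\<close> of its action on a 2-cell \<open>\<upsilon> : u \<Rightarrow> u'\<close>.\<close>

definition algs_fctr :: "('o, 'a, 'c) two_cat \<Rightarrow> 'a \<Rightarrow>
    ('a \<times> 'c, ('a \<times> 'c) \<times> ('a \<times> 'c) \<times> 'c, 'a \<times> 'c, ('a \<times> 'c) \<times> ('a \<times> 'c) \<times> 'c) fctr" where
  "algs_fctr K u =
     (let r = (\<lambda>(f, a). (f \<odot>\<^bsub>K\<^esub> u, a \<triangleright>\<^bsub>K\<^esub> u))
      in \<lparr>fob = r, fmo = (\<lambda>(p, q, h). (r p, r q, h \<triangleright>\<^bsub>K\<^esub> u))\<rparr>)"

definition algs_cell :: "('o, 'a, 'c) two_cat \<Rightarrow> 'c \<Rightarrow> 'a \<times> 'c \<Rightarrow> ('a \<times> 'c) \<times> ('a \<times> 'c) \<times> 'c" where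
  "algs_cell K \<upsilon> p =
     (fob (algs_fctr K (csrc K \<upsilon>)) p, fob (algs_fctr K (ctrg K \<upsilon>)) p, fst p \<triangleleft>\<^bsub>K\<^esub> \<upsilon>)"

text \<open>\<open>\<Phi>\<close> and \<open>\<Theta>\<close> exhibit \<open>C\<close> as a bicategorical EM-object of \<open>T\<close>: the \<open>\<Phi> A\<close> are
  equivalences from \<open>K(A, C)\<close> to the algebras for \<open>K(A, T)\<close>, and the \<open>\<Theta> u\<close> are the
  pseudonaturality isomorphisms at \<open>u : X \<rightarrow> A\<close>, with components
  \<open>\<Theta> u g : \<Phi> A g \<odot> u \<rightarrow> \<Phi> X (g \<odot> u)\<close> for \<open>g : A \<rightarrow> C\<close>.\<close>

definition EM_object :: "('o, 'a, 'c) two_cat \<Rightarrow> ('o, 'a, 'c) mnd \<Rightarrow> 'o \<Rightarrow>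
    ('o \<Rightarrow> ('a, 'c, 'a \<times> 'c, ('a \<times> 'c) \<times> ('a \<times> 'c) \<times> 'c) fctr) \<Rightarrow>
    ('a \<Rightarrow> 'a \<Rightarrow> ('a \<times> 'c) \<times> ('a \<times> 'c) \<times> 'c) \<Rightarrow> bool" where
  "EM_object K T C \<Phi> \<Theta> \<longleftrightarrow> monad_in K T \<and> C \<in> objs K \<and>
     (\<forall>A\<in>objs K. is_equivalence (hom_cat K A C) (hom_algs K T A) (\<Phi> A)) \<and>
     (\<forall>u X A g. arr_in K u X A \<and> arr_in K g A C \<longrightarrow>
        is_iso (hom_algs K T X) (\<Theta> u g)
          (fob (algs_fctr K u) (fob (\<Phi> A) g)) (fob (\<Phi> X) (g \<odot>\<^bsub>K\<^esub> u))) \<and>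
     (\<forall>u X A \<gamma> g g'. arr_in K u X A \<and> arr_in K g A C \<and> cell_in K \<gamma> g g' \<longrightarrow>
        \<Theta> u g' \<circ>\<^bsub>hom_algs K T X\<^esub> fmo (algs_fctr K u) (fmo (\<Phi> A) \<gamma>) =
        fmo (\<Phi> X) (\<gamma> \<triangleright>\<^bsub>K\<^esub> u) \<circ>\<^bsub>hom_algs K T X\<^esub> \<Theta> u g) \<and>
     (\<forall>u u' X A \<upsilon> g. arr_in K u X A \<and> cell_in K \<upsilon> u u' \<and> arr_in K g A C \<longrightarrow>
        \<Theta> u' g \<circ>\<^bsub>hom_algs K T X\<^esub> algs_cell K \<upsilon> (fob (\<Phi> A) g) =
        fmo (\<Phi> X) (g \<triangleleft>\<^bsub>K\<^esub> \<upsilon>) \<circ>\<^bsub>hom_algs K T X\<^esub> \<Theta> u g) \<and>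
     (\<forall>A g. arr_in K g A C \<longrightarrow> \<Theta> (one K A) g = Id (hom_algs K T A) (fob (\<Phi> A) g)) \<and>
     (\<forall>u v X Y A g. arr_in K v Y X \<and> arr_in K u X A \<and> arr_in K g A C \<longrightarrow>
        \<Theta> (u \<odot>\<^bsub>K\<^esub> v) g = \<Theta> v (g \<odot>\<^bsub>K\<^esub> u) \<circ>\<^bsub>hom_algs K T Y\<^esub> fmo (algs_fctr K v) (\<Theta> u g))"

section \<open>Demimonads\<close>

definition cauchy :: "('o, 'm) cat \<Rightarrow> ('o \<times> 'm, ('o \<times> 'm) \<times> ('o \<times> 'm) \<times> 'm) cat" where
  "cauchy C =
     (let Idem = {(b, \<rho>). b \<in> Ob C \<and> mor_in C \<rho> b b \<and> Cmp C \<rho> \<rho> = \<rho>}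
      in \<lparr>Ob = Idem,
          Mo = {((b, \<rho>), (b', \<rho>'), \<phi>). (b, \<rho>) \<in> Idem \<and> (b', \<rho>') \<in> Idem \<and> mor_in C \<phi> b b' \<and>
                   Cmp C \<rho>' \<phi> = \<phi> \<and> Cmp C \<phi> \<rho> = \<phi>},
          Dom = (\<lambda>(p, q, \<phi>). p),
          Cod = (\<lambda>(p, q, \<phi>). q),
          Id = (\<lambda>(b, \<rho>). ((b, \<rho>), (b, \<rho>), \<rho>)),
          Cmp = (\<lambda>(q', r, \<psi>) (p, q, \<phi>). (p, r, Cmp C \<psi> \<phi>))\<rparr>)"

definition Qstar :: "('o, 'a, 'c) two_cat \<Rightarrow>
    ('o, 'a \<times> 'c, ('a \<times> 'c) \<times> ('a \<times> 'c) \<times> 'c) two_cat" where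
  "Qstar K =
     \<lparr>objs = objs K,
      arrs = (\<Union>A\<in>objs K. \<Union>B\<in>objs K. Ob (cauchy (hom_cat K A B))),
      cells = (\<Union>A\<in>objs K. \<Union>B\<in>objs K. Mo (cauchy (hom_cat K A B))),
      src = (\<lambda>(f, \<rho>). src K f),
      trg = (\<lambda>(f, \<rho>). trg K f),
      csrc = (\<lambda>(p, q, \<phi>). p),
      ctrg = (\<lambda>(p, q, \<phi>). q),
      one = (\<lambda>A. (one K A, idc K (one K A))),
      cmp = (\<lambda>(g, \<sigma>) (f, \<rho>). (g \<odot>\<^bsub>K\<^esub> f, \<sigma> \<star>\<^bsub>K\<^esub> \<rho>)),
      idc = (\<lambda>(f, \<rho>). ((f, \<rho>), (f, \<rho>), \<rho>)),
      vc = (\<lambda>(q', r, \<psi>) (p, q, \<phi>). (p, r, \<psi> \<cdot>\<^bsub>K\<^esub> \<phi>)),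
      hc = (\<lambda>((g, \<sigma>), (g', \<sigma>'), \<psi>) ((f, \<rho>), (f', \<rho>'), \<phi>).
              ((g \<odot>\<^bsub>K\<^esub> f, \<sigma> \<star>\<^bsub>K\<^esub> \<rho>), (g' \<odot>\<^bsub>K\<^esub> f', \<sigma>' \<star>\<^bsub>K\<^esub> \<rho>'), \<psi> \<star>\<^bsub>K\<^esub> \<phi>))\<rparr>"

lemma hom_cat_Qstar:
  assumes "two_category K" "A \<in> objs K" "B \<in> objs K"
  shows "hom_cat (Qstar K) A B = cauchy (hom_cat K A B)"
  using assms
  apply (simp add: hom_cat_def Qstar_def cauchy_def Let_def)
  apply (intro conjI)
  subgoal by (auto simp: arr_in_def mor_in_def two_category.csrc_arrs two_category.ctrg_arrs)
  apply (auto simp: arr_in_def mor_in_def)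
  done

definition demimonad :: "('o, 'a, 'c) two_cat \<Rightarrow> ('o, 'a \<times> 'c, ('a \<times> 'c) \<times> ('a \<times> 'c) \<times> 'c) mnd \<Rightarrow> bool"
  where "demimonad K T \<longleftrightarrow> monad_in (Qstar K) T"

definition has_demi_EM_objects :: "('o, 'a, 'c) two_cat \<Rightarrow> bool" where
  "has_demi_EM_objects K \<longleftrightarrow> (\<forall>T. demimonad K T \<longrightarrow> (\<exists>C \<Phi> \<Theta>. EM_object (Qstar K) T C \<Phi> \<Theta>))"

text \<open>The pseudofunctor \<open>Q\<^sub>*K \<rightarrow> Q\<^sub>*L\<close> induced by a pseudofunctor \<open>F : K \<rightarrow> L\<close>.\<close>

definition Qstar_pfun :: "('o, 'a, 'c) two_cat \<Rightarrow> ('p, 'b, 'd) two_cat \<Rightarrow>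
    ('o, 'a, 'c, 'p, 'b, 'd) pfun \<Rightarrow>
    ('o, 'a \<times> 'c, ('a \<times> 'c) \<times> ('a \<times> 'c) \<times> 'c, 'p, 'b \<times> 'd, ('b \<times> 'd) \<times> ('b \<times> 'd) \<times> 'd) pfun" where
  "Qstar_pfun K L F =
     (let ar = (\<lambda>(f, \<rho>). (par F f, pce F \<rho>))
      in \<lparr>pob = (\<lambda>A\<in>objs K. pob F A),
          par = (\<lambda>p\<in>arrs (Qstar K). ar p),
          pce = restrict (\<lambda>(p, q, \<phi>). (ar p, ar q, pce F \<phi>)) (cells (Qstar K)),
          pcomp = (\<lambda>p q. if composable (Qstar K) p q
             then (ar p \<odot>\<^bsub>Qstar L\<^esub> ar q, ar (p \<odot>\<^bsub>Qstar K\<^esub> q),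
                   pcomp F (fst p) (fst q) \<cdot>\<^bsub>L\<^esub> (pce F (snd p) \<star>\<^bsub>L\<^esub> pce F (snd q)))
             else undefined),
          punit = (\<lambda>A\<in>objs K. (one (Qstar L) (pob F A), ar (one (Qstar K) A), punit F A))\<rparr>)"

definition pfun_monad :: "('p, 'b, 'd) two_cat \<Rightarrow> ('o, 'a, 'c, 'p, 'b, 'd) pfun \<Rightarrow>
    ('o, 'a, 'c) mnd \<Rightarrow> ('p, 'b, 'd) mnd" where
  "pfun_monad L F T =
     \<lparr>base = pob F (base T), endo = par F (endo T),
      mult = pce F (mult T) \<cdot>\<^bsub>L\<^esub> pcomp F (endo T) (endo T),
      eta = pce F (eta T) \<cdot>\<^bsub>L\<^esub> punit F (base T)\<rparr>"

definition pfun_alg :: "('p, 'b, 'd) two_cat \<Rightarrow> ('o, 'a, 'c, 'p, 'b, 'd) pfun \<Rightarrow>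
    ('o, 'a, 'c) mnd \<Rightarrow> 'a \<times> 'c \<Rightarrow> 'b \<times> 'd" where
  "pfun_alg L F T = (\<lambda>(u, a). (par F u, pce F a \<cdot>\<^bsub>L\<^esub> pcomp F (endo T) u))"

text \<open>\<open>F\<close> preserves a demi-EM-object \<open>C\<close> if \<open>F C\<close> is a demi-EM-object of the image demimonad
  whose universal algebra (the image of the identity 1-cell) is isomorphic to the image under
  \<open>F\<close> of the universal algebra of \<open>C\<close>.\<close>

definition preserves_demi_EM_objects :: "('o, 'a, 'c) two_cat \<Rightarrow> ('p, 'b, 'd) two_cat \<Rightarrow>
    ('o, 'a, 'c, 'p, 'b, 'd) pfun \<Rightarrow> bool" where
  "preserves_demi_EM_objects K L F \<longleftrightarrow>
     (\<forall>T C \<Phi> \<Theta>. demimonad K T \<and> EM_object (Qstar K) T C \<Phi> \<Theta> \<longrightarrow>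
        (let QF = Qstar_pfun K L F; FT = pfun_monad (Qstar L) QF T; FC = pob F C in
         \<exists>\<Psi> \<Xi> i. EM_object (Qstar L) FT FC \<Psi> \<Xi> \<and>
           is_iso (hom_algs (Qstar L) FT FC) i
             (pfun_alg (Qstar L) QF T (fob (\<Phi> C) (one (Qstar K) C)))
             (fob (\<Psi> FC) (one (Qstar L) FC))))"

section \<open>The 2-category \<open>EM\<^sub>d\<^sub>m(K)\<close>\<close>

text \<open>1-cells and 2-cells carry their domains and codomains; a 1-cell \<open>(f, \<phi>) : T \<rightarrow> S\<close> is
  encoded as \<open>(T, S, f, \<phi>)\<close>.\<close>

type_synonym ('o, 'a, 'c) EM_dm_arr = "('o, 'a, 'c) mnd \<times> ('o, 'a, 'c) mnd \<times> 'a \<times> 'c"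

type_synonym ('o, 'a, 'c) EM_dm_cell =
  "('o, 'a, 'c) EM_dm_arr \<times> ('o, 'a, 'c) EM_dm_arr \<times> 'c"

definition EM_dm_arrs :: "('o, 'a, 'c) two_cat \<Rightarrow> ('o, 'a, 'c) EM_dm_arr set" where
  "EM_dm_arrs K = {(T, S, f, \<phi>).
     monad_in K T \<and> monad_in K S \<and> arr_in K f (base T) (base S) \<and>
     cell_in K \<phi> (endo S \<odot>\<^bsub>K\<^esub> f) (f \<odot>\<^bsub>K\<^esub> endo T) \<and>
     (f \<triangleleft>\<^bsub>K\<^esub> mult T) \<cdot>\<^bsub>K\<^esub> (\<phi> \<triangleright>\<^bsub>K\<^esub> endo T) \<cdot>\<^bsub>K\<^esub> (endo S \<triangleleft>\<^bsub>K\<^esub> \<phi>) = \<phi> \<cdot>\<^bsub>K\<^esub> (mult S \<triangleright>\<^bsub>K\<^esub> f)}"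

definition EM_dm_cmp :: "('o, 'a, 'c) two_cat \<Rightarrow> ('o, 'a, 'c) EM_dm_arr \<Rightarrow>
    ('o, 'a, 'c) EM_dm_arr \<Rightarrow> ('o, 'a, 'c) EM_dm_arr" where
  "EM_dm_cmp K = (\<lambda>(S', R, f', \<phi>') (T, S, f, \<phi>).
     (T, R, f' \<odot>\<^bsub>K\<^esub> f, (f' \<triangleleft>\<^bsub>K\<^esub> \<phi>) \<cdot>\<^bsub>K\<^esub> (\<phi>' \<triangleright>\<^bsub>K\<^esub> f)))"

definition EM_dm :: "('o, 'a, 'c) two_cat \<Rightarrow>
    (('o, 'a, 'c) mnd, ('o, 'a, 'c) EM_dm_arr, ('o, 'a, 'c) EM_dm_cell) two_cat" where
  "EM_dm K =
     \<lparr>objs = {T. monad_in K T},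
      arrs = EM_dm_arrs K,
      cells = {((T, S, f, \<phi>), (T, S, g, \<psi>), \<rho>) | T S f \<phi> g \<psi> \<rho>.
        (T, S, f, \<phi>) \<in> EM_dm_arrs K \<and> (T, S, g, \<psi>) \<in> EM_dm_arrs K \<and>
        cell_in K \<rho> f (g \<odot>\<^bsub>K\<^esub> endo T) \<and>
        (g \<triangleleft>\<^bsub>K\<^esub> mult T) \<cdot>\<^bsub>K\<^esub> (\<psi> \<triangleright>\<^bsub>K\<^esub> endo T) \<cdot>\<^bsub>K\<^esub> (endo S \<triangleleft>\<^bsub>K\<^esub> \<rho>) =
          (g \<triangleleft>\<^bsub>K\<^esub> mult T) \<cdot>\<^bsub>K\<^esub> (\<rho> \<triangleright>\<^bsub>K\<^esub> endo T) \<cdot>\<^bsub>K\<^esub> \<phi> \<and>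
        (g \<triangleleft>\<^bsub>K\<^esub> mult T) \<cdot>\<^bsub>K\<^esub> (\<psi> \<triangleright>\<^bsub>K\<^esub> endo T) \<cdot>\<^bsub>K\<^esub> (eta S \<triangleright>\<^bsub>K\<^esub> (g \<odot>\<^bsub>K\<^esub> endo T)) \<cdot>\<^bsub>K\<^esub> \<rho> = \<rho>},
      src = (\<lambda>(T, S, f, \<phi>). T),
      trg = (\<lambda>(T, S, f, \<phi>). S),
      csrc = (\<lambda>(p, q, \<rho>). p),
      ctrg = (\<lambda>(p, q, \<rho>). q),
      one = (\<lambda>T. (T, T, one K (base T), idc K (endo T))),
      cmp = EM_dm_cmp K,
      idc = (\<lambda>(T, S, f, \<phi>). ((T, S, f, \<phi>), (T, S, f, \<phi>), \<phi> \<cdot>\<^bsub>K\<^esub> (eta S \<triangleright>\<^bsub>K\<^esub> f))),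
      vc = (\<lambda>(q', (T, S, h, \<theta>), \<sigma>) (p, q, \<rho>).
              (p, (T, S, h, \<theta>), (h \<triangleleft>\<^bsub>K\<^esub> mult T) \<cdot>\<^bsub>K\<^esub> (\<sigma> \<triangleright>\<^bsub>K\<^esub> endo T) \<cdot>\<^bsub>K\<^esub> \<rho>)),
      hc = (\<lambda>(p', (S', R, g', \<psi>'), \<rho>') ((T, S, f, \<phi>), (T', S'', g, \<psi>), \<rho>).
              (EM_dm_cmp K p' (T, S, f, \<phi>),
               EM_dm_cmp K (S', R, g', \<psi>') (T', S'', g, \<psi>),
               ((g' \<odot>\<^bsub>K\<^esub> g) \<triangleleft>\<^bsub>K\<^esub> mult T) \<cdot>\<^bsub>K\<^esub> (g' \<triangleleft>\<^bsub>K\<^esub> (\<rho> \<triangleright>\<^bsub>K\<^esub> endo T)) \<cdot>\<^bsub>K\<^esub>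
                 (g' \<triangleleft>\<^bsub>K\<^esub> \<phi>) \<cdot>\<^bsub>K\<^esub> (\<rho>' \<triangleright>\<^bsub>K\<^esub> f)))\<rparr>"

definition id_monad :: "('o, 'a, 'c) two_cat \<Rightarrow> 'o \<Rightarrow> ('o, 'a, 'c) mnd" where
  "id_monad K A = \<lparr>base = A, endo = one K A, mult = idc K (one K A), eta = idc K (one K A)\<rparr>"

definition EM_dm_incl :: "('o, 'a, 'c) two_cat \<Rightarrow>
    ('o, 'a, 'c, ('o, 'a, 'c) mnd, ('o, 'a, 'c) EM_dm_arr, ('o, 'a, 'c) EM_dm_cell) pfun" where
  "EM_dm_incl K =
     (let ar = (\<lambda>f. (id_monad K (src K f), id_monad K (trg K f), f, idc K f))
      in \<lparr>pob = (\<lambda>A\<in>objs K. id_monad K A),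
          par = (\<lambda>f\<in>arrs K. ar f),
          pce = (\<lambda>\<alpha>\<in>cells K. (ar (csrc K \<alpha>), ar (ctrg K \<alpha>), \<alpha>)),
          pcomp = (\<lambda>g f. if composable K g f then idc (EM_dm K) (ar (g \<odot>\<^bsub>K\<^esub> f)) else undefined),
          punit = (\<lambda>A\<in>objs K. idc (EM_dm K) (ar (one K A)))\<rparr>)"

end

(* In a 2-category whose idempotent 2-cells split, Q_* changes nothing up to local equivalence, so
   demi-EM-objects are the same as universal algebras V : X -> A of monads (A,t), characterised by:
   composition with V is an equivalence from arrows into X to t-algebras.  In EM_dm(K) every object
   (A,t) carries such an algebra V : (A,t) -> (A,1), and every 1-cell into (B,1) out of (A,t) is
   a retract of one of the form f V with f in K.  Hence transformations and modifications are determined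
   by their restrictions to K whenever the target pseudofunctor preserves universal algebras.
   To extend P : K -> L, form the collage of P, whose arrows from X in L to A in K are the arrows
   X -> PA of L.  In EM_dm of the collage, each (A,t) receives a universal arrow from the EM-object
   in L of the monad Pt, and the resulting right biadjoint is the extension. *)
theory Submission imports Defs begin

text \<open>With \<open>L -| V\<close> the adjunction between \<open>(A,1)\<close> and
  \<open>(A,t)\<close>, a monad \<open>S\<close> on \<open>(A,t)\<close> yields the composite monad
  \<open>V S L\<close> on \<open>(A,1)\<close>. Splitting idempotents replaces it by a monad
  \<open>w\<close> of \<open>K\<close>, and \<open>w\<close> itself is the object carrying the
  universal \<open>S\<close>-algebra. Comparing \<open>S\<close>-algebras with
  \<open>V S L\<close>-algebras is a monadicity argument, but no coequalizers are at hand. A section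
  replaces them: the counit becomes a split epimorphism after whiskering with \<open>V S\<close>,
  because \<open>V e\<close> is split and \<open>V S\<close> is a retract of some
  \<open>f V\<close>. The witness so obtained consists of equations and invertible cells only, hence
  it survives the strict 2-functor from \<open>EM_dm K\<close> to \<open>EM_dm\<close> of the
  collage, and the right biadjoint carries it on to \<open>L\<close>; this is why the extension
  preserves demi-EM-objects. In the collage idempotents are known to split only on 1-cells out of
  objects of \<open>L\<close>, so universality is stated for one test object at a time. Prescribing
  the choices at identity monads and at 1-cells of \<open>K\<close> makes the extension restrict to
  \<open>P\<close> exactly, not just up to equivalence.\<close>

abbreviation (input) equivalent :: "bool => bool => bool" (infixr "<->" 25) where "p <-> q == p = q"
notation (input) EM_dm ("E*_" [1000] 1000)
notation (input) Qstar ("Q*_" [1000] 1000)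
notation cmp (infixr "**\<index>" 75)
notation vc (infixr ".:\<index>" 65)
notation lwhisk (infixr "<|\<index>" 70)
notation rwhisk (infixl "|>\<index>" 71)
syntax "_index" :: "logic => index" ("@_" [1000] 1000)

section \<open>Calculus in a 2-category\<close>

declare arr_in_def [simp] cell_in_def [simp]

context two_category
begin

abbreviation "mon == monad_in K"
abbreviation "algs == hom_algs K"
abbreviation "hom == hom_cat K"
abbreviation "inc == EM_dm_incl K"
abbreviation "cell == cell_in K"
abbreviation "arr == arr_in K"
abbreviation "idm == id_monad K"

lemma arr_simps [simp]:
 "f : arrs K ==> src K f : objs K"
 "f : arrs K ==> trg K f : objs K"
 "A : objs K ==> one K A : arrs K"
 "A : objs K ==> src K (one K A) = A"
 "A : objs K ==> trg K (one K A) = A"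
 "f : arrs K ==> g : arrs K ==> trg K f = src K g ==> g**f : arrs K"
 "f : arrs K ==> g : arrs K ==> trg K f = src K g ==> src K (g**f) = src K f"
 "f : arrs K ==> g : arrs K ==> trg K f = src K g ==> trg K (g**f) = trg K g"
 "f : arrs K ==> src K f = A ==> f**one K A = f"
 "f : arrs K ==> trg K f = A ==> one K A**f = f"
 "f : arrs K ==> g : arrs K ==> h : arrs K ==> trg K f = src K g ==> trg K g = src K h ==>
  (h**g)**f = h**g**f"
 using src_objs trg_objs one_in cmp_in cmp_one one_cmp cmp_assoc by auto

lemma cell_simps [simp]:
 "x : cells K ==> csrc K x : arrs K"
 "x : cells K ==> ctrg K x : arrs K"
 "x : cells K ==> src K (ctrg K x) = src K (csrc K x)"
 "x : cells K ==> trg K (ctrg K x) = trg K (csrc K x)"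
 "f : arrs K ==> idc K f : cells K"
 "f : arrs K ==> csrc K (idc K f) = f"
 "f : arrs K ==> ctrg K (idc K f) = f"
 "x : cells K ==> y : cells K ==> ctrg K x = csrc K y ==> y .: x : cells K"
 "x : cells K ==> y : cells K ==> ctrg K x = csrc K y ==> csrc K (y .: x) = csrc K x"
 "x : cells K ==> y : cells K ==> ctrg K x = csrc K y ==> ctrg K (y .: x) = ctrg K y"
 "x : cells K ==> csrc K x = f ==> x .: idc K f = x"
 "x : cells K ==> ctrg K x = f ==> idc K f .: x = x"
 "x : cells K ==> y : cells K ==> z : cells K ==> ctrg K x = csrc K y ==> ctrg K y = csrc K z ==>
  (z .: y) .: x = z .: y .: x"
 using csrc_arrs ctrg_arrs src_csrc trg_csrc idc_in vc_in vc_idc idc_vc vc_assoc by auto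

lemma hc_simps [simp]:
 assumes "x : cells K" "y : cells K" "trg K (csrc K x) = src K (csrc K y)"
 shows "y \<star> x : cells K" "csrc K (y \<star> x) = csrc K y**csrc K x"
  "ctrg K (y \<star> x) = ctrg K y**ctrg K x"
 using hc_in[of x "csrc K x" "ctrg K x" y "csrc K y" "ctrg K y"] assms by auto

lemma idc_hc_idc [simp]:
 "f : arrs K ==> g : arrs K ==> trg K f = src K g ==> idc K g \<star> idc K f = idc K (g**f)"
 using hc_idc by auto

lemma interchange':
 "x : cells K ==> x' : cells K ==> y : cells K ==> y' : cells K ==> ctrg K x = csrc K x' ==>
  ctrg K y = csrc K y' ==> trg K (csrc K x) = src K (csrc K y) ==>
  (y' .: y) \<star> (x' .: x) = (y' \<star> x').:(y \<star> x)"
 using interchange[of x "csrc K x" "ctrg K x" x' "ctrg K x'" y "csrc K y" "ctrg K y" y' "ctrg K y'"] by auto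

lemma hc_assoc':
 "x : cells K ==> y : cells K ==> z : cells K ==> trg K (csrc K x) = src K (csrc K y) ==>
  trg K (csrc K y) = src K (csrc K z) ==> (z \<star> y) \<star> x = z \<star> y \<star> x"
 using hc_assoc[of x "csrc K x" "ctrg K x" y "csrc K y" "ctrg K y" z "csrc K z" "ctrg K z"] by auto

lemma whisk_simps [simp]:
 "x : cells K ==> f : arrs K ==> trg K (csrc K x) = src K f ==> f<|x : cells K"
 "x : cells K ==> f : arrs K ==> trg K (csrc K x) = src K f ==> csrc K (f<|x) = f**csrc K x"
 "x : cells K ==> f : arrs K ==> trg K (csrc K x) = src K f ==> ctrg K (f<|x) = f**ctrg K x"
 "x : cells K ==> f : arrs K ==> src K (csrc K x) = trg K f ==> x|>f : cells K"
 "x : cells K ==> f : arrs K ==> src K (csrc K x) = trg K f ==> csrc K (x|>f) = csrc K x**f"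
 "x : cells K ==> f : arrs K ==> src K (csrc K x) = trg K f ==> ctrg K (x|>f) = ctrg K x**f"
 "f : arrs K ==> g : arrs K ==> trg K f = src K g ==> g<|idc K f = idc K (g**f)"
 "f : arrs K ==> g : arrs K ==> trg K f = src K g ==> idc K g|>f = idc K (g**f)"
 "x : cells K ==> trg K (csrc K x) = A ==> one K A<|x = x"
 "x : cells K ==> src K (csrc K x) = A ==> x|>one K A = x"
 using one_hc[of x] hc_one[of x] by(auto simp: lwhisk_def rwhisk_def)

lemma whisk_vc [simp]:
 "x : cells K ==> y : cells K ==> ctrg K x = csrc K y ==> f : arrs K ==> trg K (csrc K x) = src K f ==>
  f<|(y .: x) = (f<|y).:(f<|x)"
 "x : cells K ==> y : cells K ==> ctrg K x = csrc K y ==> f : arrs K ==> src K (csrc K x) = trg K f ==>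
  (y .: x)|>f = (y|>f).:(x|>f)"
 using interchange'[of x y "idc K f" "idc K f"] interchange'[of "idc K f" "idc K f" x y]
 by(auto simp: lwhisk_def rwhisk_def)

lemma whisk_whisk [simp]:
 "x : cells K ==> f : arrs K ==> g : arrs K ==> trg K (csrc K x) = src K f ==> trg K f = src K g ==>
  (g**f)<|x = g<|f<|x"
 "x : cells K ==> f : arrs K ==> g : arrs K ==> src K (csrc K x) = trg K g ==> trg K f = src K g ==>
  x|>(g**f) = x|>g|>f"
 "x : cells K ==> f : arrs K ==> g : arrs K ==> src K (csrc K x) = trg K f ==> trg K (csrc K x) = src K g ==>
  (g<|x)|>f = g<|(x|>f)"
 using hc_assoc'[of x "idc K f" "idc K g"] hc_assoc'[of "idc K f" "idc K g" x]
  hc_assoc'[of "idc K f" x "idc K g"] by(auto simp: lwhisk_def rwhisk_def)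

lemma hc_whisk:
 assumes "x : cells K" "y : cells K" "trg K (csrc K x) = src K (csrc K y)"
 shows "y \<star> x = (y|>ctrg K x).:(csrc K y<|x)" "y \<star> x = (ctrg K y<|x).:(y|>csrc K x)"
 using interchange'[of x "idc K (ctrg K x)" "idc K (csrc K y)" y]
  interchange'[of "idc K (csrc K x)" x y "idc K (ctrg K y)"] assms
 by(auto simp: lwhisk_def rwhisk_def)

text \<open>This is the form in which naturality enters: most of the numbered squares in later
  calculations are instances of it, possibly whiskered further by \<open>lcong\<close> or
  \<open>rcong\<close>.\<close>

lemma ich:
 assumes "x : cells K" "y : cells K" "trg K (csrc K x) = src K (csrc K y)"
 shows "(y|>ctrg K x).:(csrc K y<|x) = (ctrg K y<|x).:(y|>csrc K x)"
 using hc_whisk assms by metis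

text \<open>Composites are normalised to right-nested form, so an equation \<open>y .: x = z\<close>
  is visible to the simplifier only at the end of a chain. Appending an arbitrary tail
  \<open>r\<close> turns it into a rule that also fires in the middle; \<open>vx3\<close> does this
  for three factors.\<close>

lemma vx2: "y .: x = z ==> x : cells K ==> y : cells K ==> ctrg K x = csrc K y ==> r : cells K ==>
  ctrg K r = csrc K x ==> y .: x .: r = z .: r"
 by(simp flip: cell_simps(13))

lemma vx3: "w .: y .: x = z ==> x : cells K ==> y : cells K ==> w : cells K ==> ctrg K x = csrc K y ==>
  ctrg K y = csrc K w ==> r : cells K ==> ctrg K r = csrc K x ==> w .: y .: x .: r = z .: r"
 by(simp flip: cell_simps(13))

lemma lcong: "x = y ==> f<|x = f<|y" and rcong: "x = y ==> x|>f = y|>f"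
 and vcong: "x = y ==> z .: x = z .: y" and vcongr: "x = y ==> x .: z = y .: z"
 by auto

section \<open>Invertible 2-cells\<close>

definition iso2 :: "'c => bool" where
 "iso2 x <-> is_iso2 K x (csrc K x) (ctrg K x)"

definition inv2 :: "'c => 'c" where
 "inv2 x = (THE y. cell y (ctrg K x) (csrc K x) & y .: x = idc K (csrc K x) & x .: y = idc K (ctrg K x))"

lemma inverse_unique:
 assumes "x : cells K" "cell y (ctrg K x) (csrc K x)" "y .: x = idc K (csrc K x)"
  "cell z (ctrg K x) (csrc K x)" "x .: z = idc K (ctrg K x)"
 shows "y = z"
proof -
 have "y .: x .: z = z" using vx2[OF assms(3), of z] assms(1,2,4) by simp
 moreover have "y .: idc K (ctrg K x) = y" using assms(1,2) by simp
 ultimately show ?thesis using assms(5) by metis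
qed

lemma is_iso2_iff: "is_iso2 K x f g <-> iso2 x & cell x f g"
 by(auto simp: iso2_def is_iso2_def)

lemma iso2_cell: "iso2 x ==> x : cells K"
 by(simp add: iso2_def is_iso2_def)

lemma inv2_unique:
 assumes "x : cells K" "cell y (ctrg K x) (csrc K x)" "y .: x = idc K (csrc K x)" "x .: y = idc K (ctrg K x)"
 shows "inv2 x = y" "iso2 x"
proof -
 have y: "cell y (ctrg K x) (csrc K x) & y .: x = idc K (csrc K x) & x .: y = idc K (ctrg K x)" using assms(2-4) by blast
 show "inv2 x = y" unfolding inv2_def
 proof (rule the_equality, rule y, elim conjE)
  fix z assume "cell z (ctrg K x) (csrc K x)" "z .: x = idc K (csrc K x)"
  then show "z = y" by(rule inverse_unique[OF assms(1) _ _ assms(2,4)])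
 qed
 have "cell x (csrc K x) (ctrg K x)" using assms(1) by simp
 then show "iso2 x" unfolding iso2_def is_iso2_def by(rule conjI, intro exI[of _ y] y)
qed

lemma inv2_simps [simp]:
 assumes "iso2 x"
 shows "inv2 x : cells K" "csrc K (inv2 x) = ctrg K x" "ctrg K (inv2 x) = csrc K x"
  "inv2 x .: x = idc K (csrc K x)" "x .: inv2 x = idc K (ctrg K x)"
  "iso2 (inv2 x)" "inv2 (inv2 x) = x"
proof -
 obtain y where y: "x : cells K" "cell y (ctrg K x) (csrc K x)" "y .: x = idc K (csrc K x)" "x .: y = idc K (ctrg K x)"
  using assms iso2_cell[OF assms] unfolding iso2_def is_iso2_def by blast
 note u = inv2_unique[OF y]
 show "inv2 x : cells K" "csrc K (inv2 x) = ctrg K x" "ctrg K (inv2 x) = csrc K x"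
  "inv2 x .: x = idc K (csrc K x)" "x .: inv2 x = idc K (ctrg K x)"
  unfolding u(1) using y by simp+
 have "cell x (ctrg K y) (csrc K y)" "x .: y = idc K (csrc K y)" "y .: x = idc K (ctrg K y)" using y by simp+
 then show "iso2 (inv2 x)" "inv2 (inv2 x) = x" unfolding u(1) using inv2_unique[of y x] y(2) by simp+
qed

lemma inv2_cancel [simp]:
 assumes "iso2 x" "r : cells K"
 shows "ctrg K r = csrc K x ==> inv2 x .: x .: r = r" "ctrg K r = ctrg K x ==> x .: inv2 x .: r = r"
 using assms iso2_cell[OF assms(1)] vx2[OF inv2_simps(4)[OF assms(1)]] vx2[OF inv2_simps(5)[OF assms(1)]] by auto

lemma iso2_idc [simp]: "f : arrs K ==> iso2 (idc K f)" "f : arrs K ==> inv2 (idc K f) = idc K f"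
 using inv2_unique[of "idc K f" "idc K f"] by simp+

lemma iso2_vc [simp]:
 assumes "iso2 x" "iso2 y" "ctrg K x = csrc K y"
 shows "iso2 (y .: x)" "inv2 (y .: x) = inv2 x .: inv2 y"
 using inv2_unique[of "y .: x" "inv2 x .: inv2 y"] assms iso2_cell[OF assms(1)] iso2_cell[OF assms(2)] by auto

lemma iso2_lwhisk [simp]:
 assumes "iso2 x" "f : arrs K" "trg K (csrc K x) = src K f"
 shows "iso2 (f<|x)" "inv2 (f<|x) = f<|inv2 x"
 using inv2_unique[of "f<|x" "f<|inv2 x"] assms iso2_cell[OF assms(1)] by(auto simp flip: whisk_vc)

lemma iso2_rwhisk [simp]:
 assumes "iso2 x" "f : arrs K" "src K (csrc K x) = trg K f"
 shows "iso2 (x|>f)" "inv2 (x|>f) = inv2 x|>f"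
 using inv2_unique[of "x|>f" "inv2 x|>f"] assms iso2_cell[OF assms(1)] by(auto simp flip: whisk_vc)

lemma iso2_whisk_cancel [simp]:
 assumes "iso2 x" "f : arrs K" "trg K (csrc K x) = src K f"
 shows "(f<|x).:(f<|inv2 x) = idc K (f**ctrg K x)" "(f<|inv2 x).:(f<|x) = idc K (f**csrc K x)"
  "r : cells K ==> ctrg K r = f**ctrg K x ==> (f<|x).:(f<|inv2 x) .: r = r"
  "r : cells K ==> ctrg K r = f**csrc K x ==> (f<|inv2 x).:(f<|x) .: r = r"
 using inv2_simps[of "f<|x"] inv2_cancel[of "f<|x"] assms iso2_cell[OF assms(1)] by auto

lemma iso2_rwhisk_cancel [simp]:
 assumes "iso2 x" "f : arrs K" "src K (csrc K x) = trg K f"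
 shows "(x|>f).:(inv2 x|>f) = idc K (ctrg K x**f)" "(inv2 x|>f).:(x|>f) = idc K (csrc K x**f)"
  "r : cells K ==> ctrg K r = ctrg K x**f ==> (x|>f).:(inv2 x|>f) .: r = r"
  "r : cells K ==> ctrg K r = csrc K x**f ==> (inv2 x|>f).:(x|>f) .: r = r"
 using inv2_simps[of "x|>f"] inv2_cancel[of "x|>f"] assms iso2_cell[OF assms(1)] by auto

lemma iso2_whisk2_cancel [simp]:
 assumes "iso2 x" "f : arrs K" "g : arrs K"
 shows "trg K (csrc K x) = src K g ==> trg K g = src K f ==> (f<|g<|x).:(f<|g<|inv2 x) = idc K (f**g**ctrg K x)"
  "trg K (csrc K x) = src K g ==> trg K g = src K f ==> (f<|g<|inv2 x).:(f<|g<|x) = idc K (f**g**csrc K x)"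
  "trg K (csrc K x) = src K g ==> trg K g = src K f ==> r : cells K ==> ctrg K r = f**g**ctrg K x ==>
  (f<|g<|x).:(f<|g<|inv2 x) .: r = r"
  "trg K (csrc K x) = src K g ==> trg K g = src K f ==> r : cells K ==> ctrg K r = f**g**csrc K x ==>
  (f<|g<|inv2 x).:(f<|g<|x) .: r = r"
  "src K (csrc K x) = trg K g ==> trg K (csrc K x) = src K f ==> (f<|(x|>g)).:(f<|(inv2 x|>g)) = idc K (f**ctrg K x**g)"
  "src K (csrc K x) = trg K g ==> trg K (csrc K x) = src K f ==> (f<|(inv2 x|>g)).:(f<|(x|>g)) = idc K (f**csrc K x**g)"
  "src K (csrc K x) = trg K g ==> trg K (csrc K x) = src K f ==> r : cells K ==> ctrg K r = f**ctrg K x**g ==>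
  (f<|(x|>g)).:(f<|(inv2 x|>g)) .: r = r"
  "src K (csrc K x) = trg K g ==> trg K (csrc K x) = src K f ==> r : cells K ==> ctrg K r = f**csrc K x**g ==>
  (f<|(inv2 x|>g)).:(f<|(x|>g)) .: r = r"
  "src K (csrc K x) = trg K g ==> src K g = trg K f ==> (x|>g|>f).:(inv2 x|>g|>f) = idc K (ctrg K x**g**f)"
  "src K (csrc K x) = trg K g ==> src K g = trg K f ==> (inv2 x|>g|>f).:(x|>g|>f) = idc K (csrc K x**g**f)"
  "src K (csrc K x) = trg K g ==> src K g = trg K f ==> r : cells K ==> ctrg K r = ctrg K x**g**f ==>
  (x|>g|>f).:(inv2 x|>g|>f) .: r = r"
  "src K (csrc K x) = trg K g ==> src K g = trg K f ==> r : cells K ==> ctrg K r = csrc K x**g**f ==>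
  (inv2 x|>g|>f).:(x|>g|>f) .: r = r"
 using assms iso2_cell[OF assms(1)] iso2_whisk_cancel[of "g<|x" f] iso2_whisk_cancel[of "x|>g" f] iso2_rwhisk_cancel[of "x|>g" f]
 by simp+

lemma iso2_cancel_left: "iso2 x ==> x .: y = x .: z ==> y : cells K ==> z : cells K ==>
  ctrg K y = csrc K x ==> ctrg K z = csrc K x ==> y = z"
 by(metis inv2_cancel(1))

lemma iso2_cancel_right:
 assumes "iso2 x" "y .: x = z .: x" "y : cells K" "z : cells K" "csrc K y = ctrg K x" "csrc K z = ctrg K x"
 shows "y = z"
 using vcongr[OF assms(2), of "inv2 x"] assms(1,3-) iso2_cell[OF assms(1)] by simp

lemma inv2_swap:
 assumes "iso2 a" "iso2 b" "y .: a = b .: x" "x : cells K" "y : cells K" "csrc K y = ctrg K a" "ctrg K x = csrc K b"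
  "ctrg K a = csrc K y" "csrc K x = csrc K a" "ctrg K y = ctrg K b"
 shows "inv2 b .: y = x .: inv2 a"
proof (rule iso2_cancel_right[of a])
 show "(inv2 b .: y) .: a = (x .: inv2 a) .: a" using assms iso2_cell[OF assms(1)] iso2_cell[OF assms(2)] by simp
qed (use assms iso2_cell[OF assms(1)] iso2_cell[OF assms(2)] in auto)

end

section \<open>Equivalences of categories\<close>

context category
begin

lemma mor_simps: "mor_in C m x y ==> x : Ob C & y : Ob C"
 using Dom_Ob Cod_Ob by(auto simp: mor_in_def)

lemma iso_inv:
 "is_iso C m x y ==> EX n. is_iso C n y x & Cmp C n m = Id C x & Cmp C m n = Id C y"
 unfolding is_iso_def by blast

lemma cancel_iso:
 assumes "is_iso C m x y" "mor_in C p y z" "mor_in C q y z" "Cmp C p m = Cmp C q m"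
 shows "p = q"
proof -
 obtain n where n: "is_iso C n y x" "Cmp C m n = Id C y" using iso_inv[OF assms(1)] by metis
 have "Cmp C (Cmp C p m) n = Cmp C (Cmp C q m) n" using assms(4) by simp
 then show ?thesis
  using Cmp_assoc[of n y x m y] n assms(1-3) Cmp_Id[of p] Cmp_Id[of q] unfolding is_iso_def by metis
qed

end

lemma is_functorD:
 assumes "is_functor C D F"
 shows "category C" "category D" "x : Ob C ==> fob F x : Ob D"
  "mor_in C m x y ==> mor_in D (fmo F m) (fob F x) (fob F y)"
  "x : Ob C ==> fmo F (Id C x) = Id D (fob F x)"
  "mor_in C m x y ==> mor_in C n y z ==> fmo F (Cmp C n m) = Cmp D (fmo F n) (fmo F m)"
 using assms unfolding is_functor_def by blast+

lemma equivalence_eso: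
 assumes "is_equivalence C D F" "d : Ob D"
 shows "EX c:Ob C. EX i. is_iso D i (fob F c) d"
proof -
 obtain G e where "is_functor D C G" "is_nat_iso D D (comp_fctr F G) id_fctr e"
  using assms by(auto simp: is_equivalence_def)
 with assms(2) show ?thesis
  by(auto simp: is_nat_iso_def comp_fctr_def id_fctr_def is_functor_def intro!: bexI[of _ "fob G d"])
qed

text \<open>Naturality of \<open>t\<close> equates \<open>m\<close> and \<open>n\<close> after
  composing with the invertible \<open>t y\<close>, which then cancels. Applied to the two
  composites of an equivalence, this makes both functors faithful.\<close>

lemma faithful_by_iso:
 assumes "category C" "is_nat_iso C C id_fctr H t" "mor_in C m x y" "mor_in C n x y" "fmo H m = fmo H n"
 shows "m = n"
proof -
 interpret category C by fact
 have o: "x : Ob C" "y : Ob C" using mor_simps assms(3) by auto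
 obtain n' where n': "is_iso C n' (fob H y) y" "Cmp C n' (t y) = Id C y"
  using iso_inv[of "t y" y "fob H y"] assms(2) o unfolding is_nat_iso_def id_fctr_def fctr.simps by metis
 have "Cmp C (t y) m = Cmp C (t y) n" using assms by(auto simp: is_nat_iso_def id_fctr_def)
 then have "Cmp C (Cmp C n' (t y)) m = Cmp C (Cmp C n' (t y)) n" using Cmp_assoc[OF assms(3), of "t y" "fob H y" n' y] Cmp_assoc[OF assms(4), of "t y" "fob H y" n' y] n'(1) assms(2) o
  by(auto simp: is_nat_iso_def id_fctr_def is_iso_def)
 then show ?thesis using n' Id_Cmp assms(3,4) by simp
qed

lemma nat_iso_inverse:
 assumes "category D" "is_nat_iso C D F G t" "is_functor C D F" "is_functor C D G"
 shows "EX t'. is_nat_iso C D G F t'"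
proof -
 interpret category D by fact
 obtain t' where t': "!!x. x : Ob C ==> is_iso D (t' x) (fob G x) (fob F x) & Cmp D (t' x) (t x) = Id D (fob F x) &
  Cmp D (t x) (t' x) = Id D (fob G x)"
  using assms(2) unfolding is_nat_iso_def is_iso_def by metis
 have "Cmp D (t' y) (fmo G m) = Cmp D (fmo F m) (t' x)" if m: "mor_in C m x y" for m x y
 proof (rule cancel_iso[of "t x" "fob F x" "fob G x" _ "fob F y"])
  have o: "x : Ob C" "y : Ob C" using category.mor_simps[OF is_functorD(1)[OF assms(3)] m] by auto
  note F = is_functorD(4)[OF assms(3) m] is_functorD(4)[OF assms(4) m]
  show "is_iso D (t x) (fob F x) (fob G x)" using assms(2) o by(auto simp: is_nat_iso_def)
  have t: "mor_in D (t x) (fob F x) (fob G x)" "mor_in D (t' x) (fob G x) (fob F x)"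
  "mor_in D (t y) (fob F y) (fob G y)" "mor_in D (t' y) (fob G y) (fob F y)"
  using t' assms(2) o unfolding is_nat_iso_def is_iso_def by auto
  show "mor_in D (Cmp D (t' y) (fmo G m)) (fob G x) (fob F y)" "mor_in D (Cmp D (fmo F m) (t' x)) (fob G x) (fob F y)" using t F Cmp_in by blast+
  have "Cmp D (t y) (fmo F m) = Cmp D (fmo G m) (t x)" using assms(2) m by(auto simp: is_nat_iso_def)
  then show "Cmp D (Cmp D (t' y) (fmo G m)) (t x) = Cmp D (Cmp D (fmo F m) (t' x)) (t x)" using Cmp_assoc[OF t(1) F(2) t(4)] Cmp_assoc[OF t(1,2) F(1)] Cmp_assoc[OF F(1) t(3,4)] t' o
  Id_Cmp[OF F(1)] Cmp_Id[OF F(1)] by simp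
 qed
 then show ?thesis using t' unfolding is_nat_iso_def by metis
qed

lemma functor_comp:
 "is_functor C D F ==> is_functor D E G ==> is_functor C E (comp_fctr G F)"
 unfolding is_functor_def comp_fctr_def by(simp, metis)

lemma functor_id: "category C ==> is_functor C C id_fctr"
 by(auto simp: is_functor_def id_fctr_def)

lemma equivalence_ff:
 assumes "is_equivalence C D F" "x : Ob C" "y : Ob C" "mor_in D n (fob F x) (fob F y)"
 shows "EX! m. mor_in C m x y & fmo F m = n"
proof -
 obtain G s e where F: "is_functor C D F" and G: "is_functor D C G" and
  s: "is_nat_iso C C id_fctr (comp_fctr G F) s" and e: "is_nat_iso D D (comp_fctr F G) id_fctr e"
  using assms by(auto simp: is_equivalence_def)
 interpret C: category C + D: category D using F by(auto simp: is_functor_def)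
 obtain e' where e': "is_nat_iso D D id_fctr (comp_fctr F G) e'"
  using nat_iso_inverse[OF D.category_axioms e functor_comp[OF G F] functor_id[OF D.category_axioms]] by auto
 obtain s' where s': "is_nat_iso C C (comp_fctr G F) id_fctr s'"
  using nat_iso_inverse[OF C.category_axioms s functor_id[OF C.category_axioms] functor_comp[OF F G]] by auto
 have faith: "m = m'" if "mor_in C m x y" "mor_in C m' x y" "fmo F m = fmo F m'" for m m'
  using faithful_by_iso[OF C.category_axioms s] that by(auto simp: comp_fctr_def)
 have sx: "mor_in C (s x) x (fob G (fob F x))" and sy: "is_iso C (s y) y (fob G (fob F y))" using s assms by(auto simp: is_nat_iso_def is_iso_def comp_fctr_def id_fctr_def)
 obtain sy' where sy': "mor_in C sy' (fob G (fob F y)) y" "Cmp C (s y) sy' = Id C (fob G (fob F y))"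
  using C.iso_inv[OF sy] unfolding is_iso_def by metis
 have Gn: "mor_in C (fmo G n) (fob G (fob F x)) (fob G (fob F y))" using G assms by(auto simp: is_functor_def)
 \<comment> \<open>The conjugate of \<open>fmo G n\<close> by the unit isomorphisms. Naturality of
   \<open>s\<close> gives \<open>fmo G (fmo F m) = fmo G n\<close>, and faithfulness of
   \<open>G\<close> does the rest.\<close>
 define m where "m = Cmp C sy' (Cmp C (fmo G n) (s x))"
 have gs: "mor_in C (Cmp C (fmo G n) (s x)) x (fob G (fob F y))" using C.Cmp_in sx Gn by blast
 have m: "mor_in C m x y" unfolding m_def using C.Cmp_in gs sy'(1) by blast
 have Fm: "mor_in D (fmo F m) (fob F x) (fob F y)" using F m by(auto simp: is_functor_def)
 have "Cmp C (fmo G (fmo F m)) (s x) = Cmp C (s y) m" using s m by(auto simp: is_nat_iso_def comp_fctr_def id_fctr_def)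
 also have "... = Cmp C (fmo G n) (s x)" unfolding m_def using C.Cmp_assoc[OF gs sy'(1)] sy' sy C.Id_Cmp[OF gs] by(metis is_iso_def)
 finally have "fmo G (fmo F m) = fmo G n" using C.cancel_iso[of "s x" x _ "fmo G (fmo F m)" _ "fmo G n"] s assms(2) Gn is_functorD(4)[OF G Fm]
  by(auto simp: is_nat_iso_def comp_fctr_def id_fctr_def)
 then have "fmo F m = n" using faithful_by_iso[OF D.category_axioms e' Fm assms(4)] by(auto simp: comp_fctr_def)
 with m faith show ?thesis by blast
qed

text \<open>The inverse functor chooses preimages \<open>g d\<close> with isomorphisms
  \<open>e d\<close> and sends \<open>n\<close> to the unique lift of its conjugate by them.
  Functoriality and the unit are checked after applying the faithful \<open>F\<close>.\<close>

lemma equivalenceI: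
 assumes F: "is_functor C D F"
  and ff: "!!x y n. x : Ob C ==> y : Ob C ==> mor_in D n (fob F x) (fob F y) ==> EX! m. mor_in C m x y & fmo F m = n"
  and eso: "!!d. d : Ob D ==> EX c:Ob C. EX i. is_iso D i (fob F c) d"
 shows "is_equivalence C D F"
proof -
 interpret C: category C + D: category D using F by(auto simp: is_functor_def)
 note F' = is_functorD[OF F]
 obtain g e where ge: "!!d. d : Ob D ==> g d : Ob C" "!!d. d : Ob D ==> is_iso D (e d) (fob F (g d)) d"
  using eso by metis
 obtain e' where e': "!!d. d : Ob D ==> is_iso D (e' d) d (fob F (g d))"
  "!!d. d : Ob D ==> Cmp D (e' d) (e d) = Id D (fob F (g d)) & Cmp D (e d) (e' d) = Id D d"
  using D.iso_inv[OF ge(2)] by metis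
 have em: "d : Ob D ==> mor_in D (e d) (fob F (g d)) d & mor_in D (e' d) d (fob F (g d))" for d
  using ge e' by(auto simp: is_iso_def)
 define l where "l x y n = (THE m. mor_in C m x y & fmo F m = n)" for x y n
 have l: "mor_in C (l x y n) x y & fmo F (l x y n) = n"
  if "x : Ob C" "y : Ob C" "mor_in D n (fob F x) (fob F y)" for x y n
  unfolding l_def using theI'[OF ff[OF that]] .
 have lu: "m = m'" if "mor_in C m x y" "mor_in C m' x y" "fmo F m = fmo F m'" for m m' x y
  using ff[of x y "fmo F m"] that F'(4) C.mor_simps by metis
 define G where "G = (|fob = g, fmo = %n. l (g (Dom D n)) (g (Cod D n)) (Cmp D (e' (Cod D n)) (Cmp D n (e (Dom D n))))|)"
 have G: "mor_in C (fmo G n) (g x) (g y) & fmo F (fmo G n) = Cmp D (e' y) (Cmp D n (e x)) &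
  Cmp D (e y) (fmo F (fmo G n)) = Cmp D n (e x)" if n: "mor_in D n x y" for n x y
 proof -
  have o: "x : Ob D" "y : Ob D" using D.mor_simps n by auto
  have c: "mor_in D (Cmp D n (e x)) (fob F (g x)) y" using n em o D.Cmp_in by blast
  have "mor_in D (Cmp D (e' y) (Cmp D n (e x))) (fob F (g x)) (fob F (g y))" using c em o D.Cmp_in by blast
  then have 1: "mor_in C (fmo G n) (g x) (g y) & fmo F (fmo G n) = Cmp D (e' y) (Cmp D n (e x))" using l[of "g x" "g y"] ge o n by(auto simp: G_def mor_in_def)
  moreover have "Cmp D (e y) (Cmp D (e' y) (Cmp D n (e x))) = Cmp D n (e x)" using D.Cmp_assoc[OF c, of "e' y" "fob F (g y)" "e y" y] em o e' D.Id_Cmp[OF c] by simp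
  ultimately show ?thesis by simp
 qed
 have eq: "n = n'" if "mor_in D n z (fob F (g y))" "mor_in D n' z (fob F (g y))" "y : Ob D" "Cmp D (e y) n = Cmp D (e y) n'" for n n' z y
 proof -
  have "Cmp D (e' y) (Cmp D (e y) n) = Cmp D (e' y) (Cmp D (e y) n')" using that by simp
  then show ?thesis
  using D.Cmp_assoc[OF that(1), of "e y" y "e' y" "fob F (g y)"] D.Cmp_assoc[OF that(2), of "e y" y "e' y" "fob F (g y)"]
  em e' that D.Id_Cmp[OF that(1)] D.Id_Cmp[OF that(2)] by simp
 qed
 have GF: "is_functor D C G" unfolding is_functor_def
 proof (intro conjI C.category_axioms D.category_axioms allI impI ballI)
  show "fob G x : Ob C" if "x : Ob D" for x using ge that by(simp add: G_def)
  show "mor_in C (fmo G m) (fob G x) (fob G y)" if "mor_in D m x y" for m x y using G[OF that] by(simp add: G_def)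
  show "fmo G (Id D x) = Id C (fob G x)" if x: "x : Ob D" for x
  proof (rule lu[of _ "g x" "g x"])
  show "fmo F (fmo G (Id D x)) = fmo F (Id C (fob G x))" using G[OF D.Id_in[OF x]] em[OF x] D.Id_Cmp[of "e x" "fob F (g x)" x] e'(2)[OF x] F'(5) ge(1)[OF x] by(simp add: G_def)
  qed (use G[OF D.Id_in[OF x]] C.Id_in ge x in \<open>auto simp: G_def\<close>)
  show "fmo G (Cmp D n m) = Cmp C (fmo G n) (fmo G m)" if "mor_in D m x y & mor_in D n y z" for m n x y z
  proof (rule lu[of _ "g x" "g z"])
  have m: "mor_in D m x y" and n: "mor_in D n y z" using that by auto
  have o: "x : Ob D" "y : Ob D" "z : Ob D" using D.mor_simps m n by auto
  have nm: "mor_in D (Cmp D n m) x z" using D.Cmp_in[OF m n] .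
  note Gm = G[OF m] and Gn = G[OF n] and Gnm = G[OF nm]
  have Fm: "mor_in D (fmo F (fmo G m)) (fob F (g x)) (fob F (g y))" "mor_in D (fmo F (fmo G n)) (fob F (g y)) (fob F (g z))"
  by(fact F'(4)[OF conjunct1[OF Gm]] F'(4)[OF conjunct1[OF Gn]])+
  show "mor_in C (fmo G (Cmp D n m)) (g x) (g z)" "mor_in C (Cmp C (fmo G n) (fmo G m)) (g x) (g z)" using Gm Gn Gnm C.Cmp_in by blast+
  have "Cmp D (e z) (Cmp D (fmo F (fmo G n)) (fmo F (fmo G m))) = Cmp D (Cmp D n (e y)) (fmo F (fmo G m))" using D.Cmp_assoc[OF Fm conjunct1[OF em[OF o(3)]]] Gn by metis
  also have "... = Cmp D (Cmp D n m) (e x)" using D.Cmp_assoc[OF Fm(1) conjunct1[OF em[OF o(2)]] n] D.Cmp_assoc[OF conjunct1[OF em[OF o(1)]] m n] Gm by metis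
  finally show "fmo F (fmo G (Cmp D n m)) = fmo F (Cmp C (fmo G n) (fmo G m))" unfolding F'(6)[OF conjunct1[OF Gm] conjunct1[OF Gn]]
  using eq[OF F'(4)[OF conjunct1[OF Gnm]] D.Cmp_in[OF Fm] o(3)] Gnm by metis
  qed
 qed
 have GF1: "EX s. is_nat_iso C C id_fctr (comp_fctr G F) s"
 proof (intro exI)
  show "is_nat_iso C C id_fctr (comp_fctr G F) (%x. l x (g (fob F x)) (e' (fob F x)))" unfolding is_nat_iso_def
  proof (intro conjI ballI allI impI)
  fix x assume x: "x : Ob C"
  have Fx: "fob F x : Ob D" and gx: "g (fob F x) : Ob C" using F'(3) ge x by auto
  note a = l[OF x gx conjunct2[OF em[OF Fx]]] l[OF gx x conjunct1[OF em[OF Fx]]]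
  have b: "Cmp C (l (g (fob F x)) x (e (fob F x))) (l x (g (fob F x)) (e' (fob F x))) = Id C x"
  using a F'(6)[OF conjunct1[OF a(1)] conjunct1[OF a(2)]] F'(5)[OF x] e'(2)[OF Fx] C.Cmp_in C.Id_in[OF x]
  by(intro lu[of _ x x]) (blast, blast, metis)
  have c: "Cmp C (l x (g (fob F x)) (e' (fob F x))) (l (g (fob F x)) x (e (fob F x))) = Id C (g (fob F x))"
  using a F'(6)[OF conjunct1[OF a(2)] conjunct1[OF a(1)]] F'(5)[OF gx] e'(2)[OF Fx] C.Cmp_in C.Id_in[OF gx]
  by(intro lu[of _ "g (fob F x)" "g (fob F x)"]) (blast, blast, metis)
  show "is_iso C (l x (g (fob F x)) (e' (fob F x))) (fob id_fctr x) (fob (comp_fctr G F) x)" using a b c by(auto simp: is_iso_def id_fctr_def comp_fctr_def G_def)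
  next
  fix m x y assume m: "mor_in C m x y"
  have o: "x : Ob C" "y : Ob C" using C.mor_simps m by auto
  have Fx: "fob F x : Ob D" "fob F y : Ob D" and gx: "g (fob F x) : Ob C" "g (fob F y) : Ob C" using F'(3) ge o by auto
  note a = l[OF o(1) gx(1) conjunct2[OF em[OF Fx(1)]]] l[OF o(2) gx(2) conjunct2[OF em[OF Fx(2)]]]
  note Fm = F'(4)[OF m] and Gm = G[OF F'(4)[OF m]]
  show "Cmp C (l y (g (fob F y)) (e' (fob F y))) (fmo id_fctr m) = Cmp C (fmo (comp_fctr G F) m) (l x (g (fob F x)) (e' (fob F x)))"
  proof (rule lu[of _ x "g (fob F y)"])
  have 1: "mor_in D (Cmp D (fmo F m) (e (fob F x))) (fob F (g (fob F x))) (fob F y)" using D.Cmp_in Fm em Fx by blast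
  have "Cmp D (fmo F (fmo G (fmo F m))) (e' (fob F x)) = Cmp D (e' (fob F y)) (fmo F m)" using Gm D.Cmp_assoc[OF conjunct2[OF em[OF Fx(1)]] 1 conjunct2[OF em[OF Fx(2)]]]
  D.Cmp_assoc[OF conjunct2[OF em[OF Fx(1)]] conjunct1[OF em[OF Fx(1)]] Fm] e'(2)[OF Fx(1)] D.Cmp_Id[OF Fm] by metis
  then show "fmo F (Cmp C (l y (g (fob F y)) (e' (fob F y))) (fmo id_fctr m)) =
  fmo F (Cmp C (fmo (comp_fctr G F) m) (l x (g (fob F x)) (e' (fob F x))))"
  using F'(6)[OF m conjunct1[OF a(2)]] F'(6)[OF conjunct1[OF a(1)] conjunct1[OF Gm]] a
  by(simp add: id_fctr_def comp_fctr_def)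
  qed (use a m Gm C.Cmp_in in \<open>simp_all add: id_fctr_def comp_fctr_def, blast+\<close>)
  qed
 qed
 have Gob: "fob G = g" by(simp add: G_def)
 have G3: "Cmp D (e y) (fmo F (fmo G n)) = Cmp D n (e x)" if "mor_in D n x y" for n x y using G[OF that] by blast
 have "is_nat_iso D D (comp_fctr F G) id_fctr e" using ge(2) G3 Gob by(auto simp: is_nat_iso_def comp_fctr_def id_fctr_def)
 with GF1 show ?thesis using F GF unfolding is_equivalence_def by blast
qed

section \<open>Algebras and universal algebras\<close>

text \<open>An object of the category of algebras for \<open>K(X,T)\<close>, freed from the record
  encoding of \<open>hom_algs\<close>. Likewise \<open>algm\<close> is the condition on a morphism,
  without requiring its ends to be algebras.\<close>

definition alg :: "('o, 'a, 'c) two_cat => ('o, 'a, 'c) mnd => 'o => 'a => 'c => bool" where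
 "alg K T X x b <-> arr_in K x X (base T) & cell_in K b (endo T**@K x) x &
  b .:@K(endo T<|@K b) = b .:@K(mult T|>@K x) & b .:@K(eta T|>@K x) = idc K x"

definition algm :: "('o, 'a, 'c) two_cat => ('o, 'a, 'c) mnd => 'a => 'c => 'a => 'c => 'c => bool" where
 "algm K T x b y c h <-> cell_in K h x y & h .:@K b = c .:@K(endo T<|@K h)"

text \<open>Full faithfulness of the functor from \<open>K(X, src u)\<close> to the algebras at
  \<open>X\<close> that sends \<open>g\<close> to \<open>(u g, a g)\<close>; \<open>univ_eso\<close>
  is its essential surjectivity.\<close>

definition univ_ff :: "('o, 'a, 'c) two_cat => ('o, 'a, 'c) mnd => 'a => 'c => 'o => bool" where
 "univ_ff K T u a X <-> (ALL g g' h. arr_in K g X (src K u) & arr_in K g' X (src K u) &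
  algm K T (u**@K g) (a|>@K g) (u**@K g') (a|>@K g') h --> (EX! x. cell_in K x g g' & u<|@K x = h))"

definition univ_eso :: "('o, 'a, 'c) two_cat => ('o, 'a, 'c) mnd => 'a => 'c => 'o => bool" where
 "univ_eso K T u a X <-> (ALL x b. alg K T X x b --> (EX g k. arr_in K g X (src K u) &
  is_iso2 K k (u**@K g) x & algm K T (u**@K g) (a|>@K g) x b k))"

text \<open>The test object \<open>X\<close> is fixed. In the collage the property will be obtained
  only for \<open>X\<close> coming from \<open>L\<close>, so the results below are proved one test
  object at a time.\<close>

definition univ :: "('o, 'a, 'c) two_cat => ('o, 'a, 'c) mnd => 'a => 'c => 'o => bool" where
 "univ K T u a X <-> alg K T (src K u) u a & univ_ff K T u a X & univ_eso K T u a X"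

definition universal :: "('o, 'a, 'c) two_cat => ('o, 'a, 'c) mnd => 'a => 'c => bool" where
 "universal K T u a <-> alg K T (src K u) u a & (ALL X:objs K. univ K T u a X)"

context two_category
begin

lemma monad_simps:
 assumes "mon T"
 shows "base T : objs K" "endo T : arrs K" "src K (endo T) = base T" "trg K (endo T) = base T"
  "mult T : cells K" "csrc K (mult T) = endo T**endo T" "ctrg K (mult T) = endo T"
  "eta T : cells K" "csrc K (eta T) = one K (base T)" "ctrg K (eta T) = endo T"
  "mult T .: (endo T<|eta T) = idc K (endo T)" "mult T .: (eta T|>endo T) = idc K (endo T)"
  "mult T .: (endo T<|mult T) = mult T .: (mult T|>endo T)"
 using assms by(auto simp: monad_in_def Let_def)

lemmas monad_types [simp] = monad_simps(1-10)

lemma monad_ext: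
 assumes "mon T" "r : cells K"
 shows "ctrg K r = endo T ==> mult T .: (endo T<|eta T) .: r = r"
  "ctrg K r = endo T ==> mult T .: (eta T|>endo T) .: r = r"
  "ctrg K r = endo T**endo T**endo T ==> mult T .: (endo T<|mult T) .: r = mult T .: (mult T|>endo T) .: r"
 using assms(2) vx2[OF monad_simps(11)[OF assms(1)]] vx2[OF monad_simps(12)[OF assms(1)]]
  vx2[OF monad_simps(13)[OF assms(1)]] monad_simps[OF assms(1)] by simp+

lemma mor_in_hom: "mor_in (hom A B) x f g <-> cell x f g & arr f A B & arr g A B"
 by(auto simp: mor_in_def hom_cat_def)

lemma hom_cat_simps: "Ob (hom A B) = {f. arr f A B}" "Id (hom A B) = idc K" "Cmp (hom A B) = vc K"
 by(auto simp: hom_cat_def)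

lemma category_hom: "category (hom A B)"
 by unfold_locales (auto simp: mor_in_def hom_cat_def)

lemma is_iso_hom: "is_iso (hom A B) x f g <-> is_iso2 K x f g & arr f A B & arr g A B"
 unfolding is_iso_def is_iso2_def mor_in_hom hom_cat_simps by blast

lemma algD:
 assumes "alg K T X x b"
 shows "x : arrs K" "src K x = X" "trg K x = base T" "b : cells K" "csrc K b = endo T**x" "ctrg K b = x"
  "b .: (endo T<|b) = b .: (mult T|>x)" "b .: (eta T|>x) = idc K x"
 using assms by(auto simp: alg_def)

lemma algmD:
 assumes "algm K T x b y c h"
 shows "h : cells K" "csrc K h = x" "ctrg K h = y" "h .: b = c .: (endo T<|h)"
 using assms by(auto simp: algm_def)

lemma alg_act:
 assumes "mon T" "alg K T X x b" "arr g Y X"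
 shows "alg K T Y (x**g) (b|>g)"
 using rcong[OF algD(7)[OF assms(2)], of g] rcong[OF algD(8)[OF assms(2)], of g] assms(1,3) algD(1-6)[OF assms(2)]
 by(simp add: alg_def)

lemma algm_act:
 assumes "mon T" "alg K T X x b" "alg K T X y c" "algm K T x b y c h" "arr g Y X"
 shows "algm K T (x**g) (b|>g) (y**g) (c|>g) (h|>g)"
 using rcong[OF algmD(4)[OF assms(4)], of g] assms(1,5) algD(1-6)[OF assms(2)] algD(1-6)[OF assms(3)] algmD(1-3)[OF assms(4)]
 by(simp add: algm_def)

lemma algm_lwhisk:
 assumes "mon T" "alg K T X x b" "cell w g g'" "arr g Y X"
 shows "algm K T (x**g) (b|>g) (x**g') (b|>g') (x<|w)"
 using ich[of w b] assms algD[OF assms(2)] cell_simps(2-4)[of w] by(simp add: algm_def)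

lemma algm_comp:
 assumes "mon T" "alg K T X x b" "alg K T X y c" "alg K T X z d" "algm K T x b y c h" "algm K T y c z d k"
 shows "algm K T x b z d (k .: h)"
 using assms(1) algD[OF assms(2)] algD[OF assms(3)] algD[OF assms(4)] algmD[OF assms(5)] algmD[OF assms(6)]
  vx2[OF algmD(4)[OF assms(6)], of "endo T<|h"]
 by(simp add: algm_def)

lemma algm_inv:
 assumes "mon T" "alg K T X x b" "alg K T X y c" "algm K T x b y c h" "iso2 h"
 shows "algm K T y c x b (inv2 h)"
proof -
 note [simp] = assms(1,5) algD[OF assms(2)] algD[OF assms(3)] algmD(1-3)[OF assms(4)]
 have "(inv2 h .: c).:(endo T<|h) = (b .: (endo T<|inv2 h)).:(endo T<|h)" using algmD(4)[OF assms(4)] by(simp flip: algmD(4)[OF assms(4)])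
 then have "inv2 h .: c = b .: (endo T<|inv2 h)" by(rule iso2_cancel_right[rotated]) simp_all
 then show ?thesis by(simp add: algm_def)
qed

lemma algm_idc:
 assumes "mon T" "alg K T X x b"
 shows "algm K T x b x b (idc K x)"
 using assms(1) algD[OF assms(2)] by(simp add: algm_def)

lemma hom_algs_eq:
 assumes "mon T"
 shows "algs T A = (|Ob = {(x, b). alg K T A x b},
  Mo = {((x, b), (y, c), h). alg K T A x b & alg K T A y c & algm K T x b y c h},
  Dom = (%(p, q, h). p), Cod = (%(p, q, h). q), Id = (%(x, b). ((x, b), (x, b), idc K x)),
  Cmp = (%(q', r, k) (p, q, h). (p, r, k .: h))|)"
proof -
 have 1: "{(x, b). x : Ob (hom A (base T)) & mor_in (hom A (base T)) b (endo T**x) x &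
  b .: (endo T<|b) = b .: (mult T|>x) & b .: (eta T|>x) = idc K x} = {(x, b). alg K T A x b}"
  using assms by(simp add: alg_def mor_in_hom hom_cat_simps cong: conj_cong)
 have 2: "{((x, b), (y, c), h). alg K T A x b & alg K T A y c & mor_in (hom A (base T)) h x y &
  h .: b = c .: (endo T<|h)} = {((x, b), (y, c), h). alg K T A x b & alg K T A y c & algm K T x b y c h}"
  unfolding mor_in_hom algm_def using algD(1-3) by(auto simp del: cell_in_def)
 show ?thesis
  unfolding hom_algs_def alg_cat_def induced_monad_def Let_def cat_monad.simps fctr.simps
  using 1 2 by(simp add: hom_cat_simps)
qed

lemma Ob_algs: "mon T ==> (x, b) : Ob (algs T A) <-> alg K T A x b"
 by(simp add: hom_algs_eq)

lemma mor_in_algs: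
 assumes "mon T"
 shows "mor_in (algs T A) n p q <-> (EX h. n = (p, q, h) & alg K T A (fst p) (snd p) &
  alg K T A (fst q) (snd q) & algm K T (fst p) (snd p) (fst q) (snd q) h)"
 unfolding mor_in_def hom_algs_eq[OF assms] by auto

lemma algs_simps: "Id (algs T A) (x, b) = ((x, b), (x, b), idc K x)"
  "Cmp (algs T A) (q', r, k) (p, q, h) = (p, r, k .: h)"
 by(auto simp: hom_algs_def alg_cat_def Let_def hom_cat_simps)

lemma category_algs:
 assumes "mon T"
 shows "category (algs T A)"
proof
 fix m assume "m : Mo (algs T A)"
 then have "mor_in (algs T A) m (Dom (algs T A) m) (Cod (algs T A) m)" by(simp add: mor_in_def)
 then show "Dom (algs T A) m : Ob (algs T A)" "Cod (algs T A) m : Ob (algs T A)" by(metis mor_in_algs[OF assms] Ob_algs[OF assms] prod.collapse)+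
next
 fix x assume "x : Ob (algs T A)"
 then show "mor_in (algs T A) (Id (algs T A) x) x x" using algm_idc[OF assms] by(cases x) (auto simp: mor_in_algs[OF assms] Ob_algs[OF assms] algs_simps)
next
 fix m n x y z assume "mor_in (algs T A) m x y" "mor_in (algs T A) n y z"
 then show "mor_in (algs T A) (Cmp (algs T A) n m) x z" using algm_comp[OF assms] by(auto simp: mor_in_algs[OF assms] algs_simps)
next
 fix m x y assume "mor_in (algs T A) m x y"
 then show "Cmp (algs T A) m (Id (algs T A) x) = m" "Cmp (algs T A) (Id (algs T A) y) m = m" by(cases x; cases y; auto simp: mor_in_algs[OF assms] algs_simps algm_def)+
next
 fix m n p w x y z
 assume "mor_in (algs T A) m w x" "mor_in (algs T A) n x y" "mor_in (algs T A) p y z"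
 then show "Cmp (algs T A) (Cmp (algs T A) p n) m = Cmp (algs T A) p (Cmp (algs T A) n m)" by(auto simp: mor_in_algs[OF assms] algs_simps algm_def)
qed

lemma is_iso_algs:
 assumes "mon T"
 shows "is_iso (algs T A) n p q <-> (EX h. n = (p, q, h) & alg K T A (fst p) (snd p) &
  alg K T A (fst q) (snd q) & algm K T (fst p) (snd p) (fst q) (snd q) h & iso2 h)"
proof (cases p; cases q)
 fix x b y c assume pq: "p = (x, b)" "q = (y, c)"
 show ?thesis
 proof
  assume "is_iso (algs T A) n p q"
  then obtain h k where h: "n = (p, q, h)" "alg K T A x b" "alg K T A y c" "algm K T x b y c h" "algm K T y c x b k"
  "k .: h = idc K x" "h .: k = idc K y"
  by(auto simp: is_iso_def mor_in_algs[OF assms] algs_simps pq)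
  then have "iso2 h" using algmD[OF h(4)] algmD[OF h(5)] inv2_unique(2)[of h k] by simp
  with h show "EX h. n = (p, q, h) & alg K T A (fst p) (snd p) & alg K T A (fst q) (snd q) &
  algm K T (fst p) (snd p) (fst q) (snd q) h & iso2 h" by(auto simp: pq)
 next
  assume "EX h. n = (p, q, h) & alg K T A (fst p) (snd p) & alg K T A (fst q) (snd q) &
  algm K T (fst p) (snd p) (fst q) (snd q) h & iso2 h"
  then obtain h where h: "n = (p, q, h)" "alg K T A x b" "alg K T A y c" "algm K T x b y c h" "iso2 h" by(auto simp: pq)
  then show "is_iso (algs T A) n p q" unfolding is_iso_def
  using algm_inv[OF assms h(2-5)] algmD[OF h(4)]
  by(auto simp: mor_in_algs[OF assms] algs_simps pq intro!: exI[of _ "((y, c), (x, b), inv2 h)"])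
 qed
qed

end

section \<open>Universal algebras and bicategorical EM-objects\<close>

definition act_fctr :: "('o, 'a, 'c) two_cat => 'a => 'c =>
  ('a, 'c, 'a \<times> 'c, ('a \<times> 'c) \<times> ('a \<times> 'c) \<times> 'c) fctr" where
 "act_fctr K u a = (|fob = %g. (u**@K g, a|>@K g),
  fmo = %x. ((u**@K csrc K x, a|>@K csrc K x), (u**@K ctrg K x, a|>@K ctrg K x), u<|@K x)|)"

context two_category
begin

lemma functor_act:
 assumes "mon T" "alg K T C u a"
 shows "is_functor (hom A C) (algs T A) (act_fctr K u a)"
 unfolding is_functor_def
proof (intro conjI ballI allI impI category_hom category_algs[OF assms(1)])
 note [simp] = algD(1-6)[OF assms(2)] assms(1)
 show "fob (act_fctr K u a) x : Ob (algs T A)" if "x : Ob (hom A C)" for x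
  using alg_act[OF assms, of x A] that by(simp add: act_fctr_def Ob_algs hom_cat_simps)
 show "mor_in (algs T A) (fmo (act_fctr K u a) m) (fob (act_fctr K u a) x) (fob (act_fctr K u a) y)"
  if "mor_in (hom A C) m x y" for m x y
  using that alg_act[OF assms, of x A] alg_act[OF assms, of y A] algm_lwhisk[OF assms, of m x y A]
  by(simp add: act_fctr_def mor_in_hom mor_in_algs)
 show "fmo (act_fctr K u a) (Id (hom A C) x) = Id (algs T A) (fob (act_fctr K u a) x)"
  if "x : Ob (hom A C)" for x
  using that by(simp add: act_fctr_def hom_cat_simps algs_simps)
 show "fmo (act_fctr K u a) (Cmp (hom A C) n m) =
  Cmp (algs T A) (fmo (act_fctr K u a) n) (fmo (act_fctr K u a) m)"
  if "mor_in (hom A C) m x y & mor_in (hom A C) n y z" for m n x y z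
  using that by(simp add: act_fctr_def mor_in_hom hom_cat_simps algs_simps)
qed

lemma equivalence_act:
 assumes "mon T" "univ K T u a A"
 shows "is_equivalence (hom A (src K u)) (algs T A) (act_fctr K u a)"
proof (rule equivalenceI)
 have a: "alg K T (src K u) u a" and ff: "univ_ff K T u a A" and eso: "univ_eso K T u a A" using assms(2) by(auto simp: univ_def)
 show "is_functor (hom A (src K u)) (algs T A) (act_fctr K u a)" using functor_act[OF assms(1) a] .
 show "EX! m. mor_in (hom A (src K u)) m x y & fmo (act_fctr K u a) m = n"
  if n: "x : Ob (hom A (src K u))" "y : Ob (hom A (src K u))"
  "mor_in (algs T A) n (fob (act_fctr K u a) x) (fob (act_fctr K u a) y)" for x y n
 proof -
  obtain h where h: "algm K T (u**x) (a|>x) (u**y) (a|>y) h" "n = (fob (act_fctr K u a) x, fob (act_fctr K u a) y, h)"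
  using n by(auto simp: mor_in_algs[OF assms(1)] act_fctr_def)
  then have "EX! w. cell w x y & u<|w = h" using ff n unfolding univ_ff_def by(simp add: hom_cat_simps)
  then show ?thesis using n by(auto simp: mor_in_hom hom_cat_simps h(2) act_fctr_def)
 qed
 show "EX c:Ob (hom A (src K u)). EX i. is_iso (algs T A) i (fob (act_fctr K u a) c) d"
  if "d : Ob (algs T A)" for d
 proof -
  obtain x b where d: "d = (x, b)" by(cases d)
  then have x: "alg K T A x b" using that Ob_algs[OF assms(1)] by auto
  then obtain g k where g: "arr g A (src K u)" "is_iso2 K k (u**g) x" "algm K T (u**g) (a|>g) x b k" using eso unfolding univ_eso_def by blast
  then show ?thesis using x alg_act[OF assms(1) a g(1)]
  by(intro bexI[of _ g] exI[of _ "((u**g, a|>g), d, k)"])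
  (auto simp: hom_cat_simps is_iso_algs[OF assms(1)] d act_fctr_def is_iso2_iff)
 qed
qed

text \<open>Acting by a fixed algebra is strictly natural in the test object, so identities serve as
  pseudonaturality cells, and the algebra is recovered as the image of the identity 1-cell.\<close>

lemma EM_objectI:
 assumes "mon T" "universal K T u a"
 shows "EX \<Phi> \<Theta>. EM_object K T (src K u) \<Phi> \<Theta> & fob (\<Phi> (src K u)) (one K (src K u)) = (u, a)"
proof (intro exI conjI)
 have a: "alg K T (src K u) u a" using assms(2) by(auto simp: universal_def)
 note [simp] = assms(1) algD(1,3-8)[OF a]
 let ?\<Theta> = "%w g. ((u**g**w, a|>(g**w)), (u**g**w, a|>(g**w)), idc K (u**g**w))"
 show "EM_object K T (src K u) (%A. act_fctr K u a) ?\<Theta>" unfolding EM_object_def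
 proof (intro conjI allI impI ballI)
  show "is_equivalence (hom A (src K u)) (algs T A) (act_fctr K u a)" if "A : objs K" for A
  using assms(2) that unfolding universal_def by(intro equivalence_act assms(1)) blast
  show "is_iso (algs T X) (?\<Theta> w g) (fob (algs_fctr K w) (fob (act_fctr K u a) g)) (fob (act_fctr K u a) (g**w))"
  if "arr w X A & arr g A (src K u)" for w X A g
  using that alg_act[OF assms(1) a, of "g**w" X] algm_idc[OF assms(1) alg_act[OF assms(1) a, of "g**w" X]]
  by(simp add: is_iso_algs algs_fctr_def Let_def act_fctr_def)
 qed (insert a, simp_all add: algs_simps algs_fctr_def Let_def algs_cell_def act_fctr_def)
 show "fob (act_fctr K u a) (one K (src K u)) = (u, a)" by(simp add: act_fctr_def)
qed

text \<open>A Yoneda argument: \<open>\<Theta>\<close> at the identity of \<open>C\<close> gives an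
  algebra isomorphism from \<open>u g\<close> to the value of \<open>\<Phi>\<close> at
  \<open>g\<close>. Hence \<open>\<Phi>\<close> is isomorphic to the action of \<open>u\<close>, and
  being an equivalence passes to that action.\<close>

lemma EM_objectD:
 assumes "EM_object K T C \<Phi> \<Theta>" "fob (\<Phi> C) (one K C) = (u, a)"
 shows "universal K T u a & src K u = C"
proof -
 have T: "mon T" and C: "C : objs K" using assms by(auto simp: EM_object_def)
 note [simp] = T C
 have eq: "is_equivalence (hom A C) (algs T A) (\<Phi> A)" if "A : objs K" for A
  using assms that by(auto simp: EM_object_def)
 have fct: "is_functor (hom A C) (algs T A) (\<Phi> A)" if "A : objs K" for A
  using eq[OF that] by(auto simp: is_equivalence_def)
 have "(u, a) : Ob (algs T C)" using is_functorD(3)[OF fct[OF C], of "one K C"] assms(2) by(simp add: hom_cat_simps)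
 then have a: "alg K T C u a" using Ob_algs by auto
 note [simp] = algD[OF a]
 \<comment> \<open>The algebra \<open>(x g, b g)\<close> is the value of \<open>\<Phi>\<close> at
   \<open>g\<close>, and \<open>k g\<close> is the isomorphism onto it from the restriction of
   \<open>(u, a)\<close> along \<open>g\<close>.\<close>
 define x where "x g = fst (fob (\<Phi> (src K g)) g)" for g
 define b where "b g = snd (fob (\<Phi> (src K g)) g)" for g
 define k where "k g = snd (snd (\<Theta> g (one K C)))" for g
 have k': "alg K T A (x g) (b g) & algm K T (u**g) (a|>g) (x g) (b g) (k g) & iso2 (k g) &
  \<Theta> g (one K C) = ((u**g, a|>g), (x g, b g), k g)" if g: "arr g A C" for g A
 proof -
  have "is_iso (algs T A) (\<Theta> g (one K C)) (fob (algs_fctr K g) (u, a)) (fob (\<Phi> A) g)" using assms g unfolding EM_object_def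
  by(metis (no_types, lifting) C one_cmp one_in)
  then show ?thesis using g by(auto simp: is_iso_algs algs_fctr_def Let_def k_def x_def b_def)
 qed
 have k: "alg K T A (x g) (b g) & algm K T (u**g) (a|>g) (x g) (b g) (k g) & iso2 (k g)"
  and k0: "\<Theta> g (one K C) = ((u**g, a|>g), (x g, b g), k g)" if "arr g A C" for g A
  using k'[OF that] by blast+
 \<comment> \<open>Naturality of \<open>\<Theta>\<close> in the 2-cell \<open>w\<close>, taken at
   the identity 1-cell, determines \<open>fmo (\<Phi> A) w\<close> as the conjugate of
   \<open>u\<close> whiskered with \<open>w\<close>.\<close>
 have nat: "fmo (\<Phi> A) w = ((x g, b g), (x g', b g'), k g' .: (u<|w) .: inv2 (k g)) &
  (k g' .: (u<|w) .: inv2 (k g)) .: k g = k g' .: (u<|w)"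
  if g: "arr g A C" "cell w g g'" for g g' A w
 proof -
  have g': "arr g' A C" using g cell_simps(2-4)[of w] by auto
  note [simp] = algD[OF conjunct1[OF k[OF g(1)]]] algD[OF conjunct1[OF k[OF g']]]
  algmD(1-3)[OF conjunct1[OF conjunct2[OF k[OF g(1)]]]] algmD(1-3)[OF conjunct1[OF conjunct2[OF k[OF g']]]]
  conjunct2[OF conjunct2[OF k[OF g(1)]]] conjunct2[OF conjunct2[OF k[OF g']]]
  have A: "A : objs K" using g by auto
  have m: "mor_in (algs T A) (fmo (\<Phi> A) w) (x g, b g) (x g', b g')" using is_functorD(4)[OF fct[OF A], of w g g'] g g' by(simp add: mor_in_hom x_def b_def)
  then obtain h where h: "fmo (\<Phi> A) w = ((x g, b g), (x g', b g'), h)" "algm K T (x g) (b g) (x g') (b g') h" by(auto simp: mor_in_algs)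
  note [simp] = algmD(1-3)[OF h(2)]
  note t = k0[OF g(1)] k0[OF g']
  have "Cmp (algs T A) (\<Theta> g' (one K C)) (algs_cell K w (fob (\<Phi> C) (one K C))) =
  Cmp (algs T A) (fmo (\<Phi> A) (one K C<|w)) (\<Theta> g (one K C))"
  using assms(1) g C one_in[OF C] unfolding EM_object_def by blast
  then have e: "k g' .: (u<|w) = h .: k g" using g by(simp add: t h assms(2) algs_cell_def algs_simps)
  have "h = (h .: k g) .: inv2 (k g)" using g by simp
  then have "h = k g' .: (u<|w) .: inv2 (k g)" using g unfolding e[symmetric] by simp
  with e h show ?thesis by simp
 qed
 have "univ K T u a A" if A: "A : objs K" for A
  unfolding univ_def
 proof (intro conjI)
  show "alg K T (src K u) u a" using a by simp
  show "univ_ff K T u a A" unfolding univ_ff_def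
  proof (intro allI impI; elim conjE)
  fix g g' h assume g0: "arr g A (src K u)" "arr g' A (src K u)" and h: "algm K T (u**g) (a|>g) (u**g') (a|>g') h"
  then have g: "arr g A C" "arr g' A C" by auto
  note kg = k[OF g(1)] and kg' = k[OF g(2)]
  note [simp] = algD[OF conjunct1[OF kg]] algD[OF conjunct1[OF kg']]
  algmD(1-3)[OF conjunct1[OF conjunct2[OF kg]]] algmD(1-3)[OF conjunct1[OF conjunct2[OF kg']]]
  conjunct2[OF conjunct2[OF kg]] conjunct2[OF conjunct2[OF kg']] algmD(1-3)[OF h]
  let ?h = "k g' .: h .: inv2 (k g)"
  have "algm K T (x g) (b g) (x g') (b g') ?h"
  using algm_comp[OF T _ alg_act[OF T a g(2)] _ algm_comp[OF T _ alg_act[OF T a g(1)] alg_act[OF T a g(2)] algm_inv[OF T alg_act[OF T a g(1)]] h]]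
  kg kg' alg_act[OF T a] g by blast
  then have "mor_in (algs T A) ((x g, b g), (x g', b g'), ?h) (fob (\<Phi> A) g) (fob (\<Phi> A) g')" using g kg kg' by(auto simp: mor_in_algs x_def b_def)
  then have ex: "EX! m. mor_in (hom A C) m g g' & fmo (\<Phi> A) m = ((x g, b g), (x g', b g'), ?h)" using equivalence_ff[OF eq[OF A]] g by(auto simp: hom_cat_simps)
  have "(mor_in (hom A C) m g g' & fmo (\<Phi> A) m = ((x g, b g), (x g', b g'), ?h)) <-> (cell m g g' & u<|m = h)" for m
  proof (cases "cell m g g'")
  case True
  have "k g' .: (u<|m) .: inv2 (k g) = ?h <-> u<|m = h"
  proof
  assume e: "k g' .: (u<|m) .: inv2 (k g) = ?h"
  have 1: "(u<|m) .: inv2 (k g) = h .: inv2 (k g)" by(rule iso2_cancel_left[OF _ e]) (use True g in simp_all)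
  show "u<|m = h" by(rule iso2_cancel_right[OF _ 1]) (use True g in simp_all)
  qed simp
  then show ?thesis using nat[OF g(1) True] True g by(simp add: mor_in_hom)
  qed (auto simp: mor_in_hom)
  with ex show "EX! m. cell m g g' & u<|m = h" by simp
  qed
  show "univ_eso K T u a A" unfolding univ_eso_def
  proof (intro allI impI)
  fix y c assume y: "alg K T A y c"
  then obtain g i where g: "arr g A C" "is_iso (algs T A) i (fob (\<Phi> A) g) (y, c)" using equivalence_eso[OF eq[OF A], of "(y, c)"] by(auto simp: Ob_algs hom_cat_simps)
  then obtain h where h: "algm K T (x g) (b g) y c h" "iso2 h" by(auto simp: is_iso_algs x_def b_def)
  note kg = k[OF g(1)]
  have "algm K T (u**g) (a|>g) y c (h .: k g)" using algm_comp[OF T alg_act[OF T a g(1)] _ y _ h(1)] kg by blast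
  then show "EX g k. arr g A (src K u) & is_iso2 K k (u**g) y & algm K T (u**g) (a|>g) y c k" using g h kg algmD[OF h(1)] algmD[OF conjunct1[OF conjunct2[OF kg]]]
  by(intro exI[of _ g] exI[of _ "h .: k g"]) (auto simp: is_iso2_iff)
  qed
 qed
 with a show ?thesis by(auto simp: universal_def)
qed

end

section \<open>Invariance and uniqueness of universal algebras\<close>

definition monad_iso :: "('o, 'a, 'c) two_cat => ('o, 'a, 'c) mnd => ('o, 'a, 'c) mnd => 'c => bool" where
 "monad_iso K T T' t <-> monad_in K T & monad_in K T' & base T = base T' & is_iso2 K t (endo T) (endo T') &
  t .:@K mult T = mult T' .:@K(t|>@K endo T') .:@K(endo T<|@K t) & t .:@K eta T = eta T'"

definition equiv_arr :: "('o, 'a, 'c) two_cat => 'a => bool" where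
 "equiv_arr K e <-> (EX e' n m. e : arrs K & arr_in K e' (trg K e) (src K e) &
  is_iso2 K n (one K (src K e)) (e'**@K e) & is_iso2 K m (e**@K e') (one K (trg K e)))"

context two_category
begin

lemma univD:
 assumes "univ K T u a X"
 shows "alg K T (src K u) u a"
  "!!g g' h. arr g X (src K u) ==> arr g' X (src K u) ==>
  algm K T (u**g) (a|>g) (u**g') (a|>g') h ==> EX! x. cell x g g' & u<|x = h"
  "!!x b. alg K T X x b ==> EX g k. arr g X (src K u) & iso2 k & algm K T (u**g) (a|>g) x b k"
 using assms unfolding univ_def univ_ff_def univ_eso_def is_iso2_iff by blast+

lemma univI:
 assumes "alg K T (src K u) u a"
  "!!g g' h. arr g X (src K u) ==> arr g' X (src K u) ==>
  algm K T (u**g) (a|>g) (u**g') (a|>g') h ==> EX! x. cell x g g' & u<|x = h"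
  "!!x b. alg K T X x b ==> EX g k. arr g X (src K u) & iso2 k & algm K T (u**g) (a|>g) x b k"
 shows "univ K T u a X"
 unfolding univ_def univ_ff_def univ_eso_def is_iso2_iff
proof (intro conjI allI impI assms(1); (elim conjE)?)
 show "EX g k. arr g X (src K u) & (iso2 k & cell k (u**g) x) & algm K T (u**g) (a|>g) x b k"
  if b: "alg K T X x b" for x b
  using assms(3)[OF b] algmD(1-3) unfolding cell_in_def by blast
qed (rule assms(2))

lemma univ_faithful:
 assumes "mon T" "univ K T u a X" "arr g X (src K u)" "cell x g g'" "cell y g g'" "u<|x = u<|y"
 shows "x = y"
proof -
 have "arr g' X (src K u)" using assms(3,4) cell_simps(2-4)[of x] by auto
 from univD(2)[OF assms(2,3) this algm_lwhisk[OF assms(1) univD(1)[OF assms(2)] assms(4,3)]]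
 show ?thesis using assms(4-6) by metis
qed

lemma monad_isoD:
 assumes "monad_iso K T T' t"
 shows "mon T" "mon T'" "base T' = base T" "iso2 t" "t : cells K" "csrc K t = endo T" "ctrg K t = endo T'"
  "t .: mult T = mult T' .: (t|>endo T').:(endo T<|t)" "t .: eta T = eta T'"
 using assms by(auto simp: monad_iso_def is_iso2_iff)

text \<open>Restriction of scalars along the monad isomorphism \<open>t\<close>: it slides past the
  action \<open>b\<close> by interchange and is compatible with multiplication and unit.\<close>

lemma alg_change:
 assumes "monad_iso K T T' t" "alg K T' X x b"
 shows "alg K T X x (b .: (t|>x))"
proof -
 note [simp] = monad_isoD(1-7)[OF assms(1)] algD(1-6)[OF assms(2)]
 have 1: "(endo T'<|b).:(t|>endo T'|>x) = (t|>x).:(endo T<|b)" using ich[of b t] by simp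
 have "(b .: (t|>x)).:(endo T<|(b .: (t|>x))) = b .: ((endo T'<|b).:(t|>endo T'|>x)).:(endo T<|t|>x)" unfolding 1 by simp
 also have "... = b .: (mult T'|>x).:(t|>endo T'|>x).:(endo T<|t|>x)" using vx2[OF algD(7)[OF assms(2)]] by simp
 also have "... = (b .: (t|>x)).:(mult T|>x)" using rcong[OF monad_isoD(8)[OF assms(1)], of x] by simp
 finally have "(b .: (t|>x)).:(endo T<|(b .: (t|>x))) = (b .: (t|>x)).:(mult T|>x)" .
 moreover have "(b .: (t|>x)).:(eta T|>x) = idc K x" using rcong[OF monad_isoD(9)[OF assms(1)], of x] algD(8)[OF assms(2)] by simp
 ultimately show ?thesis by(simp add: alg_def)
qed

text \<open>The two linearity conditions differ by the invertible factor \<open>t|>x\<close>, so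
  they have the same solutions \<open>h\<close>.\<close>

lemma algm_change:
 assumes "monad_iso K T T' t" "alg K T' X x b" "alg K T' X y c"
 shows "algm K T x (b .: (t|>x)) y (c .: (t|>y)) h <-> algm K T' x b y c h"
proof (cases "cell h x y")
 case True
 note [simp] = monad_isoD(1-7)[OF assms(1)] algD(1-6)[OF assms(2)] algD(1-6)[OF assms(3)] True[simplified]
 have 1: "(t|>y).:(endo T<|h) = (endo T'<|h).:(t|>x)" using ich[of h t] by simp
 show ?thesis
 proof
  assume "algm K T x (b .: (t|>x)) y (c .: (t|>y)) h"
  then have "(h .: b).:(t|>x) = (c .: (endo T'<|h)).:(t|>x)" by(simp add: algm_def 1)
  then have "h .: b = c .: (endo T'<|h)" by(rule iso2_cancel_right[rotated]) simp_all
  then show "algm K T' x b y c h" by(simp add: algm_def)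
 next
  assume "algm K T' x b y c h"
  then have "h .: b = c .: (endo T'<|h)" by(simp add: algm_def)
  then show "algm K T x (b .: (t|>x)) y (c .: (t|>y)) h" using vx2[of h b _ "t|>x"] by(simp add: algm_def 1)
 qed
qed (auto simp: algm_def)

lemma monad_iso_inv:
 assumes "monad_iso K T T' t"
 shows "monad_iso K T' T (inv2 t)"
proof -
 note [simp] = monad_isoD(1-7)[OF assms]
 have ic: "(inv2 t|>endo T').:(endo T'<|t) = (endo T<|t).:(inv2 t|>endo T)" using ich[of t "inv2 t"] by simp
 have "inv2 t .: mult T' = mult T .: (inv2 t|>endo T).:(endo T'<|inv2 t)"
 proof (rule iso2_cancel_left[of t])
  have "t .: mult T .: (inv2 t|>endo T).:(endo T'<|inv2 t) =
  (mult T' .: (t|>endo T')).:((endo T<|t).:(inv2 t|>endo T)).:(endo T'<|inv2 t)"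
  using vx2[OF monad_isoD(8)[OF assms]] by simp
  also have "... = mult T'" unfolding ic[symmetric] by simp
  finally show "t .: inv2 t .: mult T' = t .: mult T .: (inv2 t|>endo T).:(endo T'<|inv2 t)" by simp
 qed simp_all
 moreover have "inv2 t .: eta T' = eta T" by(simp flip: monad_isoD(9)[OF assms])
 ultimately show ?thesis by(simp add: monad_iso_def is_iso2_iff)
qed

lemma univ_change_monad:
 assumes "monad_iso K T T' t" "univ K T' u a X"
 shows "univ K T u (a .: (t|>u)) X"
proof -
 have a: "alg K T' (src K u) u a" using univD[OF assms(2)] by auto
 note [simp] = monad_isoD(1-7)[OF assms(1)] algD(1,3-6)[OF a]
 have w: "(a .: (t|>u))|>g = (a|>g).:(t|>u**g)" if "arr g X (src K u)" for g using that by simp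
 show ?thesis
 proof (rule univI)
  show "alg K T (src K u) u (a .: (t|>u))" using alg_change[OF assms(1) a] .
  show "EX! x. cell x g g' & u<|x = h" if "arr g X (src K u)" "arr g' X (src K u)"
  "algm K T (u**g) ((a .: (t|>u))|>g) (u**g') ((a .: (t|>u))|>g') h" for g g' h
  using univD(2)[OF assms(2) that(1,2)] that(3) alg_act[OF _ a]
  unfolding w[OF that(1)] w[OF that(2)]
  by(simp only: algm_change[OF assms(1) alg_act[OF monad_isoD(2)[OF assms(1)] a that(1)] alg_act[OF monad_isoD(2)[OF assms(1)] a that(2)]])
  show "EX g k. arr g X (src K u) & iso2 k & algm K T (u**g) ((a .: (t|>u))|>g) x b k"
  if b: "alg K T X x b" for x b
  proof -
  note [simp] = algD(1-6)[OF b]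
  let ?b = "b .: (inv2 t|>x)"
  have b': "alg K T' X x ?b" using alg_change[OF monad_iso_inv[OF assms(1)] b] .
  then obtain g k where g: "arr g X (src K u)" "iso2 k" "algm K T' (u**g) (a|>g) x ?b k" using univD(3)[OF assms(2)] by blast
  have "algm K T (u**g) ((a|>g).:(t|>(u**g))) x (?b .: (t|>x)) k" using g algm_change[OF assms(1) alg_act[OF monad_isoD(2)[OF assms(1)] a g(1)] b'] by blast
  moreover have "?b .: (t|>x) = b" by simp
  ultimately show ?thesis using g w[OF g(1)] by metis
  qed
 qed
qed

text \<open>Conjugation with \<open>p\<close> matches algebra morphisms between restrictions of
  \<open>u'\<close> with those between restrictions of \<open>u\<close>, so unique lifts correspond;
  factorisations are changed by composing with the inverse of \<open>p\<close>.\<close>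

lemma univ_change_alg:
 assumes T: "mon T" and u: "univ K T u a X" and p: "alg K T (src K u) u' a'" "algm K T u a u' a' p" "iso2 p"
 shows "univ K T u' a' X"
proof -
 have a: "alg K T (src K u) u a" using univD[OF u] by auto
 note [simp] = algD(1,3-6)[OF a] algD(1-6)[OF p(1)] algmD(1-3)[OF p(2)] p(3) T
 note al = alg_act[OF T a] alg_act[OF T p(1)] and am = algm_act[OF T a p(1,2)]
 show ?thesis
 proof (rule univI)
  show "alg K T (src K u') u' a'" using p by simp
  show "EX! x. cell x g g' & u'<|x = h" if g: "arr g X (src K u')" "arr g' X (src K u')"
  "algm K T (u'**g) (a'|>g) (u'**g') (a'|>g') h" for g g' h
  proof -
  have g1: "arr g X (src K u)" "arr g' X (src K u)" using g by auto
  note [simp] = algmD(1-3)[OF g(3)]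
  let ?h = "(inv2 p|>g') .: h .: (p|>g)"
  have ip: "algm K T (u'**g') (a'|>g') (u**g') (a|>g') (inv2 p|>g')" using algm_act[OF T p(1) a algm_inv[OF T a p]] g1 by blast
  have "algm K T (u**g) (a|>g) (u**g') (a|>g') ?h"
  by(intro algm_comp[OF T al(1)[OF g1(1)] al(2)[OF g1(2)] al(1)[OF g1(2)] algm_comp[OF T al(1)[OF g1(1)] al(2)[OF g1(1)] al(2)[OF g1(2)] am[OF g1(1)] g(3)] ip])
  from univD(2)[OF u g1 this] have ex: "EX! x. cell x g g' & u<|x = ?h" .
  have "u<|x = ?h <-> u'<|x = h" if x: "cell x g g'" for x
  proof -
  have i: "(p|>g').:(u<|x) = (u'<|x).:(p|>g)" using ich[of x p] x g1 by simp
  have "u<|x = ?h <-> (p|>g').:(u<|x) = (p|>g') .: ?h" by(rule iffI, simp, erule iso2_cancel_left[rotated]) (use x g1 in simp_all)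
  also have "... <-> (u'<|x).:(p|>g) = h .: (p|>g)" unfolding i using x g1 by simp
  also have "... <-> u'<|x = h" by(rule iffI, erule iso2_cancel_right[rotated]) (use x g1 in simp_all)
  finally show ?thesis .
  qed
  with ex show ?thesis by(metis (mono_tags, lifting))
  qed
  show "EX g k. arr g X (src K u') & iso2 k & algm K T (u'**g) (a'|>g) x b k" if b: "alg K T X x b" for x b
  proof -
  obtain g k where g: "arr g X (src K u)" "iso2 k" "algm K T (u**g) (a|>g) x b k" using univD(3)[OF u b] by blast
  have "algm K T (u'**g) (a'|>g) x b (k .: (inv2 p|>g))" using algm_comp[OF T al(2)[OF g(1)] al(1)[OF g(1)] b algm_act[OF T p(1) a algm_inv[OF T a p] g(1)] g(3)] .
  then show ?thesis using g algmD(1-3)[OF g(3)] by(intro exI[of _ g] exI[of _ "k .: (inv2 p|>g)"]) simp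
  qed
 qed
qed

text \<open>The form needed when the monad and its algebra are both known only up to
  isomorphism.\<close>

lemma univ_transport:
 assumes t: "monad_iso K T T' t" and u: "univ K T u a X" and a': "alg K T' (src K u) u' a'"
  and p: "is_iso2 K p u u'" "p .: a = a' .: (t|>u').:(endo T<|p)"
 shows "univ K T' u' a' X"
proof -
 note T = monad_isoD(1,2)[OF t]
 have c: "alg K T (src K u) u' (a' .: (t|>u'))" using alg_change[OF t a'] .
 note [simp] = monad_isoD(1-7)[OF t] algD(1-6)[OF a'] algD(1,3-6)[OF univD(1)[OF u]]
 have "univ K T u' (a' .: (t|>u')) X" using univ_change_alg[OF T(1) u c, of p] p by(simp add: algm_def is_iso2_iff)
 from univ_change_monad[OF monad_iso_inv[OF t] this] show ?thesis by simp
qed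

text \<open>Whiskering \<open>n\<close> and \<open>m\<close> supplies the two natural isomorphisms;
  their naturality is interchange.\<close>

lemma equiv_arr_equivalence:
 assumes "equiv_arr K e"
 shows "is_equivalence (hom X (src K e)) (hom X (trg K e)) (|fob = %g. e**g, fmo = %x. e<|x|)"
proof -
 obtain e' n m where e: "e : arrs K" "arr e' (trg K e) (src K e)"
  "iso2 n" "cell n (one K (src K e)) (e'**e)" "iso2 m" "cell m (e**e') (one K (trg K e))"
  using assms unfolding equiv_arr_def is_iso2_iff by blast
 note [simp] = e(1,3,5) e(2,4,6)[simplified]
 have F: "is_functor (hom X (src K f)) (hom X (trg K f)) (|fob = %g. f**g, fmo = %x. f<|x|)" if "f : arrs K" for f
  using that by(simp add: is_functor_def category_hom mor_in_hom hom_cat_simps)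
 show ?thesis unfolding is_equivalence_def
 proof (rule conjI[OF F[OF e(1)]], rule exI[of _ "(|fob = %g. e'**g, fmo = %x. e'<|x|)"],
  rule exI[of _ "%g. n|>g"], rule exI[of _ "%g. m|>g"], intro conjI)
  show "is_functor (hom X (trg K e)) (hom X (src K e)) (|fob = %g. e'**g, fmo = %x. e'<|x|)" using F[of e'] e by simp
  have "(e'<|e<|h).:(n|>f) = (n|>g) .: h" if "cell h f g" "arr f X (src K e)" for h f g
  using ich[of h n] that cell_simps(2-4)[of h] by simp
  then show "is_nat_iso (hom X (src K e)) (hom X (src K e)) id_fctr
  (comp_fctr (|fob = %g. e'**g, fmo = %x. e'<|x|) (|fob = %g. e**g, fmo = %x. e<|x|)) (%g. n|>g)"
  by(simp add: is_nat_iso_def id_fctr_def comp_fctr_def mor_in_hom hom_cat_simps is_iso_hom is_iso2_iff)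
  have "(m|>g).:(e<|e'<|h) = h .: (m|>f)" if "cell h f g" "arr f X (trg K e)" for h f g
  using ich[of h m] that cell_simps(2-4)[of h] by simp
  then show "is_nat_iso (hom X (trg K e)) (hom X (trg K e))
  (comp_fctr (|fob = %g. e**g, fmo = %x. e<|x|) (|fob = %g. e'**g, fmo = %x. e'<|x|)) id_fctr (%g. m|>g)"
  by(simp add: is_nat_iso_def id_fctr_def comp_fctr_def mor_in_hom hom_cat_simps is_iso_hom is_iso2_iff)
 qed
qed

text \<open>Composition with \<open>e\<close> is an equivalence of hom-categories, and acting by
  \<open>u e\<close> is that equivalence followed by acting by \<open>u\<close>.\<close>

lemma univ_precomp:
 assumes T: "mon T" and u: "univ K T u a X" and e: "equiv_arr K e" "trg K e = src K u"
 shows "univ K T (u**e) (a|>e) X"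
proof -
 have a: "alg K T (src K u) u a" using univD[OF u] by auto
 have [simp]: "e : arrs K" "trg K e = src K u" using e by(auto simp: equiv_arr_def)
 note [simp] = algD(1,3-6)[OF a] T
 note eq = equiv_arr_equivalence[OF e(1), of X]
 show ?thesis
 proof (rule univI)
  show "alg K T (src K (u**e)) (u**e) (a|>e)" using alg_act[OF T a, of e "src K e"] by simp
  show "EX! x. cell x g g' & (u**e)<|x = h" if g: "arr g X (src K (u**e))" "arr g' X (src K (u**e))"
  "algm K T ((u**e)**g) ((a|>e)|>g) ((u**e)**g') ((a|>e)|>g') h" for g g' h
  proof -
  obtain y where y: "cell y (e**g) (e**g')" "u<|y = h" "!!y'. cell y' (e**g) (e**g') ==> u<|y' = h ==> y' = y"
  using univD(2)[OF u, of "e**g" "e**g'" h] g by auto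
  have "EX! m. mor_in (hom X (src K e)) m g g' & e<|m = y" using equivalence_ff[OF eq, of g g' y] g y(1) by(simp add: hom_cat_simps mor_in_hom)
  moreover have "mor_in (hom X (src K e)) m g g' & e<|m = y <-> cell m g g' & (u**e)<|m = h" for m
  using g y(1,2) y(3)[of "e<|m"] by(auto simp: mor_in_hom)
  ultimately show ?thesis by simp
  qed
  show "EX g k. arr g X (src K (u**e)) & iso2 k & algm K T ((u**e)**g) ((a|>e)|>g) x b k" if b: "alg K T X x b" for x b
  proof -
  obtain g k where g: "arr g X (src K u)" "iso2 k" "algm K T (u**g) (a|>g) x b k" using univD(3)[OF u b] by blast
  obtain f i where f: "arr f X (src K e)" "is_iso2 K i (e**f) g"
  using equivalence_eso[OF eq, of g] g by(auto simp: hom_cat_simps is_iso_hom)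
  then have i: "iso2 i" "cell i (e**f) g" by(auto simp: is_iso2_iff)
  have "algm K T (u**e**f) (a|>(e**f)) (u**g) (a|>g) (u<|i)" using algm_lwhisk[OF T a i(2)] f i by simp
  have "alg K T X (u**e**f) (a|>(e**f))" using alg_act[OF T a, of "e**f" X] f by simp
  from algm_comp[OF T this alg_act[OF T a g(1)] b \<open>algm K T (u**e**f) _ _ _ _\<close> g(3)] f g i algmD(1-3)[OF g(3)]
  show ?thesis by(intro exI[of _ f] exI[of _ "k .: (u<|i)"]) simp
  qed
 qed
qed

text \<open>Each universal algebra factors through the other up to isomorphism. After whiskering
  with the universal algebra a round trip becomes isomorphic to the identity, and full faithfulness
  lifts that isomorphism.\<close>

lemma universal_unique:
 assumes T: "mon T" and u: "universal K T u a" and v: "universal K T v b"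
 shows "EX e k. equiv_arr K e & arr e (src K v) (src K u) & iso2 k & algm K T (u**e) (a|>e) v b k"
proof -
 have main: "EX e k. arr e (src K v) (src K u) & iso2 k & algm K T (u**e) (a|>e) v b k"
  if "universal K T u a" "universal K T v b" for u v a b
  using that algD(1)[of T _ v b] src_objs univD(3)[of T u a "src K v" v b] unfolding universal_def by metis
 have iso: "EX n. is_iso2 K n (one K (src K u)) (e'**e)"
  if u: "universal K T u a" and v: "universal K T v b" and
  e: "arr e (src K u) (src K v)" "iso2 k" "algm K T (v**e) (b|>e) u a k" and
  e': "arr e' (src K v) (src K u)" "iso2 k'" "algm K T (u**e') (a|>e') v b k'" for u v a b e e' k k'
 proof -
  have a: "alg K T (src K u) u a" and b: "alg K T (src K v) v b" using u v unfolding universal_def by auto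
  have ua: "univ K T u a (src K u)" using u src_objs[OF algD(1)[OF a]] unfolding universal_def by blast
  note [simp] = T algD(1,3-6)[OF a] algD(1,3-6)[OF b] e(1,2)[simplified] e'(1,2)[simplified] algmD(1-3)[OF e(3)] algmD(1-3)[OF e'(3)]
  let ?q = "k .: (k'|>e)"
  have ee: "arr (e'**e) (src K u) (src K u)" "arr (one K (src K u)) (src K u) (src K u)" by simp+
  have q: "algm K T (u**e'**e) (a|>(e'**e)) u a ?q" using algm_comp[OF T alg_act[OF T a ee(1)] alg_act[OF T b e(1)] a _ e(3)]
  algm_act[OF T alg_act[OF T a e'(1)] b e'(3) e(1)] by simp
  have q': "algm K T u a (u**e'**e) (a|>(e'**e)) (inv2 ?q)" using algm_inv[OF T alg_act[OF T a ee(1)] a q] by simp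
  obtain n where n: "cell n (one K (src K u)) (e'**e)" "u<|n = inv2 ?q"
  using univD(2)[OF ua ee(2,1), of "inv2 ?q"] q' by auto
  obtain m where m: "cell m (e'**e) (one K (src K u))" "u<|m = ?q"
  using univD(2)[OF ua ee, of ?q] q by auto
  note [simp] = n(1)[simplified] m(1)[simplified]
  have "m .: n = idc K (one K (src K u))" using univ_faithful[OF T ua ee(2), of "m .: n" _ "idc K (one K (src K u))"] n(2) m(2) by simp
  moreover have "n .: m = idc K (e'**e)" using univ_faithful[OF T ua ee(1), of "n .: m" _ "idc K (e'**e)"] n(2) m(2) by simp
  ultimately have "iso2 n" using inv2_unique(2)[of n m] by simp
  then show ?thesis using n by(auto simp: is_iso2_iff)
 qed
 obtain e k e' k' where e: "arr e (src K v) (src K u)" "iso2 k" "algm K T (u**e) (a|>e) v b k"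
  and e': "arr e' (src K u) (src K v)" "iso2 k'" "algm K T (v**e') (b|>e') u a k'"
  using main[OF u v] main[OF v u] by blast
 obtain n m where n: "is_iso2 K n (one K (src K v)) (e'**e)" and m: "is_iso2 K m (one K (src K u)) (e**e')"
  using iso[OF v u e e'] iso[OF u v e' e] by blast
 have "is_iso2 K (inv2 m) (e**e') (one K (src K u))" using m by(simp add: is_iso2_iff)
 then have "equiv_arr K e" using e(1) e'(1) n unfolding equiv_arr_def by(intro exI[of _ e'] exI[of _ n] exI[of _ "inv2 m"]) simp
 with e show ?thesis by blast
qed

end

section \<open>Algebras along an adjunction\<close>

text \<open>\<open>L\<close> is left adjoint to \<open>V\<close>, with counit \<open>e\<close> and
  unit \<open>n\<close>.\<close>

definition adjunction :: "('o, 'a, 'c) two_cat => 'a => 'a => 'c => 'c => bool" where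
 "adjunction K V L e n <-> V : arrs K & arr_in K L (trg K V) (src K V) &
  cell_in K e (L**@K V) (one K (src K V)) & cell_in K n (one K (trg K V)) (V**@K L) &
  (V<|@K e) .:@K(n|>@K V) = idc K V & (e|>@K L) .:@K(L<|@K n) = idc K L"

definition adj_monad :: "('o, 'a, 'c) two_cat => 'a => 'a => 'c => 'c => ('o, 'a, 'c) mnd" where
 "adj_monad K V L e n = (|base = trg K V, endo = V**@K L, mult = V<|@K(e|>@K L), eta = n|)"

text \<open>The monad \<open>V S L\<close> that would arise by composing \<open>L -| V\<close> with
  an adjunction generating \<open>S\<close>; in the multiplication the counit removes the inner
  \<open>L V\<close> before the two copies of \<open>S\<close> are multiplied.\<close>

definition comp_monad :: "('o, 'a, 'c) two_cat => 'a => 'a => 'c => 'c => ('o, 'a, 'c) mnd => ('o, 'a, 'c) mnd" where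
 "comp_monad K V L e n S = (|base = trg K V, endo = V**@K endo S**@K L,
  mult = (V<|@K(mult S|>@K L)) .:@K(V<|@K endo S<|@K(e|>@K(endo S**@K L))),
  eta = (V<|@K(eta S|>@K L)) .:@K n|)"

text \<open>The \<open>V S L\<close>-action on \<open>V x\<close>: the counit removes
  \<open>L V\<close>, then \<open>b\<close> acts.\<close>

definition comp_alg :: "('o, 'a, 'c) two_cat => 'a => 'c => ('o, 'a, 'c) mnd => 'a => 'c => 'c" where
 "comp_alg K V e S x b = (V<|@K b) .:@K(V<|@K endo S<|@K(e|>@K x))"

locale adj_comp = two_category K for K :: "('o, 'a, 'c) two_cat" (structure) +
 fixes V L e n S
 assumes adj: "adjunction K V L e n" and S: "monad_in K S" "base S = src K V"
begin

lemma adjD: "V : arrs K" "L : arrs K" "src K L = trg K V" "trg K L = src K V"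
  "e : cells K" "csrc K e = L**V" "ctrg K e = one K (src K V)"
  "n : cells K" "csrc K n = one K (trg K V)" "ctrg K n = V**L"
  "(V<|e).:(n|>V) = idc K V" "(e|>L).:(L<|n) = idc K L"
 using adj by(auto simp: adjunction_def)

lemmas adj_types [simp] = adjD(1-10)

abbreviation (input) "s == endo S"
abbreviation (input) "W == comp_monad K V L e n S"
abbreviation (input) "\<Phi> == comp_alg K V e S"

declare S [simp]

lemma e_nat: "z : cells K ==> a : arrs K ==> trg K (csrc K z) = src K V ==> src K a = src K V ==>
  (a<|(e|>ctrg K z)).:(a<|L<|V<|z) = (a<|z).:(a<|(e|>csrc K z))"
 using lcong[OF ich[of z e], of a] by simp

lemma triangle_ext:
 "x : arrs K ==> trg K x = src K V ==> r : cells K ==> ctrg K r = V**x ==> (V<|(e|>x)).:(n|>V|>x) .: r = r"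
 "x : arrs K ==> trg K x = src K V ==> (V<|(e|>x)).:(n|>V|>x) = idc K (V**x)"
proof -
 show 2: "(V<|(e|>x)).:(n|>V|>x) = idc K (V**x)" if "x : arrs K" "trg K x = src K V" for x
  using rcong[OF adjD(11), of x] that by simp
 show "x : arrs K ==> trg K x = src K V ==> r : cells K ==> ctrg K r = V**x ==> (V<|(e|>x)).:(n|>V|>x) .: r = r" using vx2[OF 2, of x r] by simp
qed

lemma monad_adj: "mon (adj_monad K V L e n)"
proof -
 have "(V<|(e|>L)).:(V<|L<|n) = idc K (V**L)" using lcong[OF adjD(12), of V] by simp
 moreover have "(V<|(e|>L)).:(n|>V|>L) = idc K (V**L)" by(simp add: triangle_ext)
 moreover have "(V<|(e|>L)).:(V<|L<|V<|(e|>L)) = (V<|(e|>L)).:(V<|(e|>L|>V|>L))" using e_nat[of "e|>L" V] by simp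
 ultimately show ?thesis by(simp add: monad_in_def adj_monad_def)
qed

text \<open>Facts 4 to 6 are the monad laws of \<open>S\<close>, facts 9 and 10 are the triangle
  identities, and the others slide the counit past the structure of \<open>S\<close>.\<close>

lemma monad_comp: "mon W"
proof -
 have 1: "(V<|s<|(e|>s|>L)).:(V<|s<|L<|V<|(mult S|>L)) = (V<|s<|(mult S|>L)).:(V<|s<|(e|>s|>s|>L))" using e_nat[of "mult S|>L" "V**s"] by simp
 have 2: "(V<|s<|(e|>s|>L)).:(V<|(mult S|>L|>V|>s|>L)) = (V<|(mult S|>s|>L)).:(V<|s<|s<|(e|>s|>L))" using lcong[OF ich[of "e|>s|>L" "mult S"], of V] by simp
 have 3: "(V<|s<|(e|>s|>s|>L)).:(V<|s<|L<|V<|s<|(e|>s|>L)) = (V<|s<|s<|(e|>s|>L)).:(V<|s<|(e|>s|>L|>V|>s|>L))" using e_nat[of "s<|(e|>s|>L)" "V**s"] by simp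
 have 4: "(V<|(mult S|>L)).:(V<|s<|(mult S|>L)) = (V<|(mult S|>L)).:(V<|(mult S|>s|>L))" using lcong[OF rcong[OF monad_simps(13)[OF S(1)], of L], of V] by simp
 have 5: "(V<|(mult S|>L)).:(V<|s<|(eta S|>L)) = idc K (V**s**L)" using lcong[OF rcong[OF monad_simps(11)[OF S(1)], of L], of V] by simp
 have 6: "(V<|(mult S|>L)).:(V<|(eta S|>s|>L)) = idc K (V**s**L)" using lcong[OF rcong[OF monad_simps(12)[OF S(1)], of L], of V] by simp
 have 7: "(V<|s<|(e|>s|>L)).:(V<|s<|L<|V<|(eta S|>L)) = (V<|s<|(eta S|>L)).:(V<|s<|(e|>L))" using e_nat[of "eta S|>L" "V**s"] by simp
 have 8: "(V<|s<|(e|>s|>L)).:(V<|(eta S|>L|>V|>s|>L)) = (V<|(eta S|>s|>L)).:(V<|(e|>s|>L))" using lcong[OF ich[of "e|>s|>L" "eta S"], of V] by simp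
 have 9: "(V<|s<|(e|>L)).:(V<|s<|L<|n) = idc K (V**s**L)" using lcong[OF adjD(12), of "V**s"] by simp
 have 10: "(V<|(e|>s|>L)).:(n|>V|>s|>L) = idc K (V**s**L)" using triangle_ext(2)[of "s**L"] by simp
 show ?thesis
  unfolding monad_in_def comp_monad_def Let_def mnd.simps
  by(intro conjI) (simp_all add: vx2[OF 1] vx2[OF 2] 3 vx2[OF 4] 5 vx2[OF 5] 6 vx2[OF 6] vx2[OF 7] vx2[OF 8] 9 vx2[OF 9] 10)
qed

lemma comp_algI:
 assumes "alg K S X x b"
 shows "alg K W X (V**x) (\<Phi> x b)"
proof -
 note [simp] = algD(1-6)[OF assms]
 have 1: "(V<|s<|(e|>x)).:(V<|s<|L<|V<|b) = (V<|s<|b).:(V<|s<|(e|>s|>x))" using e_nat[of b "V**s"] by simp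
 have 2: "(V<|s<|(e|>s|>x)).:(V<|s<|L<|V<|s<|(e|>x)) = (V<|s<|s<|(e|>x)).:(V<|s<|(e|>s|>L|>V|>x))" using e_nat[of "s<|(e|>x)" "V**s"] by simp
 have 3: "(V<|s<|(e|>x)).:(V<|(mult S|>L|>V|>x)) = (V<|(mult S|>x)).:(V<|s<|s<|(e|>x))" using lcong[OF ich[of "e|>x" "mult S"], of V] by simp
 have 4: "(V<|b).:(V<|s<|b) = (V<|b).:(V<|(mult S|>x))" using lcong[OF algD(7)[OF assms], of V] by simp
 have 5: "(V<|s<|(e|>x)).:(V<|(eta S|>L|>V|>x)) = (V<|(eta S|>x)).:(V<|(e|>x))" using lcong[OF ich[of "e|>x" "eta S"], of V] by simp
 have 6: "(V<|b).:(V<|(eta S|>x)) = idc K (V**x)" using lcong[OF algD(8)[OF assms], of V] by simp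
 show ?thesis unfolding alg_def comp_monad_def comp_alg_def mnd.simps
  by(intro conjI) (simp_all add: vx2[OF 1] 2 vx2[OF 3] vx2[OF 4] vx2[OF 5] 6 vx2[OF 6] triangle_ext)
qed

lemma comp_algm:
 assumes "alg K S X x b" "alg K S X y c" "algm K S x b y c k"
 shows "algm K W (V**x) (\<Phi> x b) (V**y) (\<Phi> y c) (V<|k)"
proof -
 note [simp] = algD(1-6)[OF assms(1)] algD(1-6)[OF assms(2)] algmD(1-3)[OF assms(3)]
 have 1: "(V<|s<|(e|>y)).:(V<|s<|L<|V<|k) = (V<|s<|k).:(V<|s<|(e|>x))" using e_nat[of k "V**s"] by simp
 have 2: "(V<|k).:(V<|b) = (V<|c).:(V<|s<|k)" using lcong[OF algmD(4)[OF assms(3)], of V] by simp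
 show ?thesis by(simp add: algm_def comp_monad_def comp_alg_def 1 vx2[OF 2])
qed

end

text \<open>The hypotheses of a monadicity argument at the test object \<open>X\<close>:
  \<open>V\<close> is universal for the monad of its own adjunction, and \<open>j\<close> is a
  section of \<open>V S e\<close>. The section takes the place of a coequalizer preserved by
  \<open>V\<close> and \<open>S\<close>.\<close>

locale adj_comp_univ = adj_comp +
 fixes X j
 assumes V_univ: "univ K (adj_monad K V L e n) V (V<|e) X"
  and j: "cell_in K j (V**endo S) (V**endo S**L**V)" "(V<|endo S<|e) .: j = idc K (V**endo S)"
begin

lemma j_simps [simp]: "j : cells K" "csrc K j = V**endo S" "ctrg K j = V**endo S**L**V"
 using j(1) by auto

lemma j_split [simp]: "x : arrs K ==> trg K x = src K V ==> (V<|s<|(e|>x)).:(j|>x) = idc K (V**s**x)"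
 using rcong[OF j(2), of x] by simp

lemma cancel_VSe:
 assumes "y .: (V<|s<|(e|>x)) = z .: (V<|s<|(e|>x))" "y : cells K" "z : cells K" "csrc K y = V**s**x"
  "csrc K z = V**s**x" "x : arrs K" "trg K x = src K V"
 shows "y = z"
 using vcongr[OF assms(1), of "j|>x"] assms(2-) by simp

lemma V_faithful: "cell k x y ==> cell k' x y ==> arr x X (src K V) ==> V<|k = V<|k' ==> k = k'"
 using univ_faithful[OF monad_adj V_univ] by blast

lemma V_full:
 assumes "arr x X (src K V)" "arr y X (src K V)" "cell h (V**x) (V**y)"
  "h .: (V<|(e|>x)) = (V<|(e|>y)).:(V<|L<|h)"
 shows "EX k. cell k x y & V<|k = h"
 using univD(2)[OF V_univ assms(1,2), of h] assms by(auto simp: algm_def adj_monad_def)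

text \<open>Restriction along the unit of \<open>S\<close> turns \<open>V S L\<close>-algebras into
  \<open>V L\<close>-algebras; on an induced action the unit law of \<open>b\<close> leaves only the
  counit.\<close>

lemma comp_eta_restrict:
 assumes "alg K S X x b"
 shows "\<Phi> x b .: (V<|(eta S|>L|>V|>x)) = V<|(e|>x)"
proof -
 note [simp] = algD(1-6)[OF assms]
 have 1: "(V<|s<|(e|>x)).:(V<|(eta S|>L|>V|>x)) = (V<|(eta S|>x)).:(V<|(e|>x))" using lcong[OF ich[of "e|>x" "eta S"], of V] by simp
 have 2: "(V<|b).:(V<|(eta S|>x)) = idc K (V**x)" using lcong[OF algD(8)[OF assms], of V] by simp
 show ?thesis by(simp add: comp_alg_def 1 vx2[OF 2])
qed

text \<open>A \<open>V S L\<close>-linear cell is in particular \<open>V L\<close>-linear, hence of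
  the form \<open>V k\<close>. That \<open>k\<close> is \<open>S\<close>-linear is checked after
  whiskering with \<open>V\<close>, where the split epimorphism \<open>V S e\<close> can be
  cancelled.\<close>

lemma comp_ff:
 assumes b: "alg K S X x b" and c: "alg K S X y c" and h: "algm K W (V**x) (\<Phi> x b) (V**y) (\<Phi> y c) h"
 shows "EX k. algm K S x b y c k & V<|k = h"
proof -
 note [simp] = algD(1-6)[OF b] algD(1-6)[OF c] algmD(1-3)[OF h]
 have [simp]: "\<Phi> x b : cells K" "csrc K (\<Phi> x b) = V**s**L**V**x" "ctrg K (\<Phi> x b) = V**x"
  "\<Phi> y c : cells K" "csrc K (\<Phi> y c) = V**s**L**V**y" "ctrg K (\<Phi> y c) = V**y"
  by(simp_all add: comp_alg_def)
 have hm: "h .: \<Phi> x b = \<Phi> y c .: (V<|s<|L<|h)" using algmD(4)[OF h] by(simp add: comp_monad_def)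
 have 1: "(V<|s<|L<|h).:(V<|(eta S|>L|>V|>x)) = (V<|(eta S|>L|>V|>y)).:(V<|L<|h)" using lcong[OF ich[of "L<|h" "eta S"], of V] by simp
 have "h .: (V<|(e|>x)) = (h .: \<Phi> x b).:(V<|(eta S|>L|>V|>x))" by(simp add: comp_eta_restrict[OF b])
 also have "... = (V<|(e|>y)).:(V<|L<|h)" unfolding hm by(simp add: 1 vx2[OF comp_eta_restrict[OF c]])
 finally obtain k where k: "cell k x y" "V<|k = h" using V_full[of x y h] by auto
 note [simp] = k(1)[simplified]
 have 2: "(V<|s<|(e|>y)).:(V<|s<|L<|V<|k) = (V<|s<|k).:(V<|s<|(e|>x))" using e_nat[of k "V**s"] by simp
 have "(V<|(k .: b)).:(V<|s<|(e|>x)) = h .: \<Phi> x b" by(simp add: comp_alg_def flip: k(2))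
 also have "... = \<Phi> y c .: (V<|s<|L<|h)" by(rule hm)
 also have "... = (V<|(c .: (s<|k))).:(V<|s<|(e|>x))" by(simp add: comp_alg_def 2 flip: k(2))
 finally have "V<|(k .: b) = V<|(c .: (s<|k))" by(rule cancel_VSe) simp_all
 then have "k .: b = c .: (s<|k)" by(rule V_faithful[rotated 3, of _ _ "s**x" y]) simp_all
 then show ?thesis using k(2) by(intro exI[of _ k]) (simp add: algm_def)
qed

text \<open>The action \<open>c\<close> has equal composites with the parallel pair
  \<open>V S L V e\<close> and \<open>V S e L V\<close>, so the section \<open>j\<close> factors it
  through \<open>V S e\<close>. The factor is \<open>V L\<close>-linear and therefore lifts to a
  cell on \<open>x\<close>, which is the desired \<open>S\<close>-action.\<close>

lemma comp_descend:
 assumes x: "arr x X (src K V)" and c: "alg K W X (V**x) c"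
  and cx: "c .: (V<|(eta S|>L|>V|>x)) = V<|(e|>x)"
 shows "EX b. alg K S X x b & \<Phi> x b = c"
proof -
 note [simp] = x[simplified] algD(4)[OF c]
 have [simp]: "csrc K c = V**s**L**V**x" "ctrg K c = V**x" using algD(5,6)[OF c] by(simp_all add: comp_monad_def)
 have cc: "c .: (V<|s<|L<|c) = c .: (V<|(mult S|>L|>V|>x)).:(V<|s<|(e|>s|>L|>V|>x))" using algD(7)[OF c] by(simp add: comp_monad_def)
 have 1: "(V<|s<|(e|>s|>L|>V|>x)).:(V<|s<|L<|V<|(eta S|>L|>V|>x)) = (V<|s<|(eta S|>L|>V|>x)).:(V<|s<|(e|>L|>V|>x))" using e_nat[of "eta S|>L|>V|>x" "V**s"] by simp
 have 2: "(V<|(mult S|>L|>V|>x)).:(V<|s<|(eta S|>L|>V|>x)) = idc K (V**s**L**V**x)" using lcong[OF rcong[OF monad_simps(11)[OF S(1)], of "L**V**x"], of V] by simp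
 have 3: "(V<|s<|L<|c).:(V<|s<|L<|V<|(eta S|>L|>V|>x)) = V<|s<|L<|V<|(e|>x)" using lcong[OF cx, of "V**s**L"] by simp
 \<comment> \<open>Associativity of \<open>c\<close> is evaluated on the unit of \<open>S\<close>
   inserted in the inner copy: there \<open>cx\<close> turns the inner action into the counit, while
   on the other side a unit law removes the multiplication.\<close>
 have fork: "c .: (V<|s<|L<|V<|(e|>x)) = c .: (V<|s<|(e|>L|>V|>x))" using vcongr[OF cc, of "V<|s<|L<|V<|(eta S|>L|>V|>x)"] by(simp add: 3 1 vx2[OF 2])
 \<comment> \<open>The candidate for \<open>V b\<close>: the factor of \<open>c\<close> through
   \<open>V S e\<close> given by the section.\<close>
 let ?b = "c .: (j|>x)"
 have 4: "(j|>x).:(V<|s<|(e|>x)) = (V<|s<|L<|V<|(e|>x)).:(j|>L|>V|>x)" using ich[of "e|>x" j] by simp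
 have bt: "?b .: (V<|s<|(e|>x)) = c" using vx2[OF fork, of "j|>L|>V|>x"] j_split[of "L**V**x"] by(simp add: 4)
 \<comment> \<open>Linearity over \<open>V L\<close>, needed to lift \<open>?b\<close> through
   \<open>V\<close>. It is verified after precomposition with \<open>V L V S e\<close>, which is
   split by a whiskering of \<open>j\<close>.\<close>
 have "?b .: (V<|(e|>s|>x)) = (V<|(e|>x)).:(V<|L<|?b)"
 proof -
  have 5: "(V<|(e|>s|>x)).:(V<|L<|V<|s<|(e|>x)) = (V<|s<|(e|>x)).:(V<|(e|>s|>L|>V|>x))" using e_nat[of "s<|(e|>x)" V] by simp
  have 6: "(V<|s<|L<|c).:(V<|(eta S|>L|>V|>s|>L|>V|>x)) = (V<|(eta S|>L|>V|>x)).:(V<|L<|c)" using lcong[OF ich[of "L<|c" "eta S"], of V] by simp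
  have 7: "(V<|s<|(e|>s|>L|>V|>x)).:(V<|(eta S|>L|>V|>s|>L|>V|>x)) = (V<|(eta S|>s|>L|>V|>x)).:(V<|(e|>s|>L|>V|>x))" using lcong[OF ich[of "e|>s|>L|>V|>x" "eta S"], of V] by simp
  have 8: "(V<|(mult S|>L|>V|>x)).:(V<|(eta S|>s|>L|>V|>x)) = idc K (V**s**L**V**x)" using lcong[OF rcong[OF monad_simps(12)[OF S(1)], of "L**V**x"], of V] by simp
  have 9: "(V<|(e|>x)).:(V<|L<|c) = c .: (V<|(e|>s|>L|>V|>x))"
  proof -
  have "(V<|(e|>x)).:(V<|L<|c) = (c .: (V<|s<|L<|c)).:(V<|(eta S|>L|>V|>s|>L|>V|>x))" unfolding cx[symmetric] by(simp add: 6)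
  also have "... = c .: (V<|(e|>s|>L|>V|>x))" unfolding cc by(simp add: 7 vx2[OF 8])
  finally show ?thesis .
  qed
  have 10: "(V<|L<|c).:(V<|L<|(j|>x)).:(V<|L<|V<|s<|(e|>x)) = V<|L<|c" using lcong[OF bt, of "V**L"] by simp
  have 11: "(?b .: (V<|(e|>s|>x))).:(V<|L<|V<|s<|(e|>x)) = ((V<|(e|>x)).:(V<|L<|?b)).:(V<|L<|V<|s<|(e|>x))" using bt vx3[OF bt[simplified], of "V<|(e|>s|>L|>V|>x)"] by(simp add: 5 9 10)
  have "(V<|L<|V<|s<|(e|>x)).:(V<|L<|(j|>x)) = idc K (V**L**V**s**x)" using lcong[OF rcong[OF j(2), of x], of "V**L"] by(simp del: j_split)
  with vcongr[OF 11, of "V<|L<|(j|>x)"] show ?thesis by simp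
 qed
 then obtain b where b: "cell b (s**x) x" "V<|b = ?b" using V_full[of "s**x" x ?b] by auto
 note [simp] = b(1)[simplified]
 have Vb: "(V<|b).:(V<|s<|(e|>x)) = c" using bt b(2) by simp
 have "V<|(b .: (eta S|>x)) = V<|idc K x"
 proof -
  have 5: "(V<|(eta S|>x)).:(V<|(e|>x)) = (V<|s<|(e|>x)).:(V<|(eta S|>L|>V|>x))" using lcong[OF ich[of "e|>x" "eta S"], of V] by simp
  have "(V<|(b .: (eta S|>x))).:(V<|(e|>x)) = V<|(e|>x)" by(simp add: 5 vx2[OF Vb] cx)
  from vcongr[OF this, of "n|>V|>x"] show ?thesis by(simp add: triangle_ext)
 qed
 then have unit: "b .: (eta S|>x) = idc K x" by(rule V_faithful[rotated 3, of _ _ x x]) simp_all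
 \<comment> \<open>The two sides are compared on \<open>V S L V S e\<close> followed by
   \<open>V S e S\<close>, where both become \<open>c\<close> composed with \<open>V S L c\<close>.
   Each of these two cells is split by a whiskering of \<open>j\<close>, so both can be
   cancelled.\<close>
 have "V<|(b .: (s<|b)) = V<|(b .: (mult S|>x))"
 proof -
  let ?P = "(V<|s<|s<|(e|>x)).:(V<|s<|(e|>s|>L|>V|>x))"
  have P: "(V<|s<|(e|>s|>x)).:(V<|s<|L<|V<|s<|(e|>x)) = ?P" using e_nat[of "s<|(e|>x)" "V**s"] by simp
  have 5: "(V<|s<|b).:(V<|s<|(e|>s|>x)) = (V<|s<|(e|>x)).:(V<|s<|L<|V<|b)" using e_nat[of b "V**s"] by simp
  have 6: "(V<|(mult S|>x)).:(V<|s<|s<|(e|>x)) = (V<|s<|(e|>x)).:(V<|(mult S|>L|>V|>x))" using lcong[OF ich[of "e|>x" "mult S"], of V] by simp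
  have 7: "(V<|s<|L<|V<|b).:(V<|s<|L<|V<|s<|(e|>x)) = V<|s<|L<|c" using lcong[OF Vb, of "V**s**L"] by simp
  have "(V<|(b .: (s<|b))).:(V<|s<|(e|>s|>x)).:(V<|s<|L<|V<|s<|(e|>x)) = c .: (V<|s<|L<|c)" by(simp add: vx2[OF 5] vx2[OF Vb] 7)
  moreover have "(V<|(b .: (mult S|>x))) .: ?P = c .: (V<|s<|L<|c)" unfolding cc by(simp add: vx2[OF 6] vx2[OF Vb])
  ultimately have 11: "((V<|(b .: (s<|b))).:(V<|s<|(e|>s|>x))).:(V<|s<|L<|V<|s<|(e|>x)) =
  ((V<|(b .: (mult S|>x))).:(V<|s<|(e|>s|>x))).:(V<|s<|L<|V<|s<|(e|>x))"
  by(simp flip: P)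
  have "(V<|s<|L<|V<|s<|(e|>x)).:(V<|s<|L<|(j|>x)) = idc K (V**s**L**V**s**x)" using lcong[OF rcong[OF j(2), of x], of "V**s**L"] by(simp del: j_split)
  with vcongr[OF 11, of "V<|s<|L<|(j|>x)"]
  have "(V<|(b .: (s<|b))).:(V<|s<|(e|>s|>x)) = (V<|(b .: (mult S|>x))).:(V<|s<|(e|>s|>x))" by simp
  from vcongr[OF this, of "j|>s|>x"] j_split[of "s**x"] show ?thesis by simp
 qed
 then have "b .: (s<|b) = b .: (mult S|>x)" by(rule V_faithful[rotated 3, of _ _ "s**s**x" x]) simp_all
 with unit have "alg K S X x b" by(simp add: alg_def)
 moreover have "\<Phi> x b = c" using Vb by(simp add: comp_alg_def)
 ultimately show ?thesis by blast
qed

text \<open>Restriction along the unit of \<open>S\<close> makes \<open>y\<close> a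
  \<open>V L\<close>-algebra, so \<open>y\<close> is \<open>V x\<close> up to an isomorphism
  \<open>p\<close>. Transported along \<open>p\<close>, the action satisfies the hypothesis of
  \<open>comp_descend\<close>.\<close>

lemma comp_eso:
 assumes c: "alg K W X y c"
 shows "EX x b h. alg K S X x b & algm K W (V**x) (\<Phi> x b) y c h & iso2 h"
proof -
 note [simp] = algD(1,2,4,6)[OF c]
 have [simp]: "trg K y = trg K V" "csrc K c = V**s**L**y" using algD(3,5)[OF c] by(simp_all add: comp_monad_def)
 have cc: "c .: (V<|s<|L<|c) = c .: (V<|(mult S|>L|>y)).:(V<|s<|(e|>s|>L|>y))"
  and cu: "c .: (V<|(eta S|>L|>y)).:(n|>y) = idc K y"
  using algD(7,8)[OF c] by(simp_all add: comp_monad_def)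
 let ?d = "c .: (V<|(eta S|>L|>y))"
 have "?d .: (V<|L<|?d) = ?d .: (V<|(e|>L|>y))"
 proof -
  have 1: "(V<|s<|L<|c).:(V<|(eta S|>L|>V|>s|>L|>y)) = (V<|(eta S|>L|>y)).:(V<|L<|c)" using lcong[OF ich[of "L<|c" "eta S"], of V] by simp
  have 2: "(V<|s<|(e|>s|>L|>y)).:(V<|(eta S|>L|>V|>s|>L|>y)) = (V<|(eta S|>s|>L|>y)).:(V<|(e|>s|>L|>y))" using lcong[OF ich[of "e|>s|>L|>y" "eta S"], of V] by simp
  have 3: "(V<|(mult S|>L|>y)).:(V<|(eta S|>s|>L|>y)) = idc K (V**s**L**y)" using lcong[OF rcong[OF monad_simps(12)[OF S(1)], of "L**y"], of V] by simp
  have 4: "(V<|(e|>s|>L|>y)).:(V<|L<|V<|(eta S|>L|>y)) = (V<|(eta S|>L|>y)).:(V<|(e|>L|>y))" using e_nat[of "eta S|>L|>y" V] by simp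
  have "?d .: (V<|L<|?d) = (c .: (V<|s<|L<|c)).:(V<|(eta S|>L|>V|>s|>L|>y)).:(V<|L<|V<|(eta S|>L|>y))" by(simp add: vx2[OF 1])
  also have "... = ?d .: (V<|(e|>L|>y))" unfolding cc by(simp add: vx2[OF 2] vx2[OF 3] 4)
  finally show ?thesis .
 qed
 then have "alg K (adj_monad K V L e n) X y ?d" using cu by(simp add: alg_def adj_monad_def)
 from univD(3)[OF V_univ this] obtain x p where x: "arr x X (src K V)" "iso2 p"
  "algm K (adj_monad K V L e n) (V**x) (V<|e|>x) y ?d p" by auto
 have p: "cell p (V**x) y" "p .: (V<|(e|>x)) = ?d .: (V<|L<|p)" using x algmD[OF x(3)] by(simp_all add: adj_monad_def)
 note [simp] = x(1)[simplified] x(2) p(1)[simplified]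
 let ?c = "inv2 p .: c .: (V<|s<|L<|p)"
 have 1: "(V<|(mult S|>L|>y)).:(V<|s<|(e|>s|>L|>y)).:(V<|s<|L<|V<|s<|L<|p) =
  (V<|s<|L<|p).:(V<|(mult S|>L|>V|>x)).:(V<|s<|(e|>s|>L|>V|>x))"
 proof -
  have 1: "(V<|s<|(e|>s|>L|>y)).:(V<|s<|L<|V<|s<|L<|p) = (V<|s<|s<|L<|p).:(V<|s<|(e|>s|>L|>V|>x))" using e_nat[of "s<|L<|p" "V**s"] by simp
  have 2: "(V<|(mult S|>L|>y)).:(V<|s<|s<|L<|p) = (V<|s<|L<|p).:(V<|(mult S|>L|>V|>x))" using lcong[OF ich[of "L<|p" "mult S"], of V] by simp
  show ?thesis by(simp add: 1 vx2[OF 2])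
 qed
 have 2: "(V<|s<|L<|p).:(V<|(eta S|>L|>V|>x)) = (V<|(eta S|>L|>y)).:(V<|L<|p)" using lcong[OF ich[of "L<|p" "eta S"], of V] by simp
 have 3: "(V<|L<|p).:(n|>V|>x) = (n|>y) .: p" using ich[of p n] by simp
 have 4: "(V<|s<|L<|p).:(V<|s<|L<|inv2 p) .: r = r" if "r : cells K" "ctrg K r = V**s**L**y" for r
  using iso2_whisk_cancel(3)[of p "V**s**L" r] that by simp
 have "alg K W X (V**x) ?c" unfolding alg_def comp_monad_def mnd.simps
  by(intro conjI) (simp_all add: 4 vx2[OF cc] 1 vx2[OF 2] 3 vx3[OF cu])
 moreover have "?c .: (V<|(eta S|>L|>V|>x)) = V<|(e|>x)"
 proof -
  have "c .: (V<|(eta S|>L|>y)).:(V<|L<|p) = p .: (V<|(e|>x))" using p(2) by simp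
  then show ?thesis by(simp add: 2)
 qed
 ultimately obtain b where b: "alg K S X x b" "\<Phi> x b = ?c" using comp_descend[OF x(1)] by blast
 have "algm K W (V**x) ?c y c p" by(simp add: algm_def comp_monad_def)
 with b show ?thesis by(intro exI[of _ x] exI[of _ b] exI[of _ p]) simp
qed

lemma comp_act: "alg K S X' u a ==> arr g Y X' ==> \<Phi> (u**g) (a|>g) = \<Phi> u a|>g"
 using algD(1-6)[of S X' u a] by(simp add: comp_alg_def)

text \<open>By the preceding lemmas \<open>V\<close> induces an equivalence from
  \<open>S\<close>-algebras to \<open>V S L\<close>-algebras at \<open>X\<close>, compatible with
  restriction along 1-cells, so acting by \<open>u\<close> is an equivalence exactly when acting by
  \<open>V u\<close> is.\<close>

theorem univ_comp_iff:
 assumes a: "alg K S (src K u) u a"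
 shows "univ K S u a X <-> univ K W (V**u) (\<Phi> u a) X"
proof
 note [simp] = algD(1,3-6)[OF a]
 have g: "alg K S X (u**g) (a|>g)" "\<Phi> u a|>g = \<Phi> (u**g) (a|>g)" if "arr g X (src K u)" for g
  using alg_act[OF S(1) a that] comp_act[OF a that] by auto
 {
  assume u: "univ K S u a X"
  show "univ K W (V**u) (\<Phi> u a) X"
  proof (rule univI)
  show "alg K W (src K (V**u)) (V**u) (\<Phi> u a)" using comp_algI[OF a] by simp
  show "EX! x. cell x f g & (V**u)<|x = h" if f: "arr f X (src K (V**u))" "arr g X (src K (V**u))"
  "algm K W ((V**u)**f) (\<Phi> u a|>f) ((V**u)**g) (\<Phi> u a|>g) h" for f g h
  proof -
  have fg: "arr f X (src K u)" "arr g X (src K u)" using f by auto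
  obtain k where k: "algm K S (u**f) (a|>f) (u**g) (a|>g) k" "V<|k = h"
  using comp_ff[OF g(1)[OF fg(1)] g(1)[OF fg(2)], of h] f g(2)[OF fg(1)] g(2)[OF fg(2)] fg by auto
  have "(V**u)<|x = h <-> u<|x = k" if "cell x f g" for x
  using V_faithful[of "u<|x" "u**f" "u**g" k] that fg algmD(1-3)[OF k(1)] k(2) by auto
  with univD(2)[OF u fg k(1)] show ?thesis by(metis (mono_tags, lifting))
  qed
  show "EX f k. arr f X (src K (V**u)) & iso2 k & algm K W ((V**u)**f) (\<Phi> u a|>f) y c k"
  if c: "alg K W X y c" for y c
  proof -
  obtain x b h where b: "alg K S X x b" "algm K W (V**x) (\<Phi> x b) y c h" "iso2 h" using comp_eso[OF c] by blast
  obtain f k where f: "arr f X (src K u)" "iso2 k" "algm K S (u**f) (a|>f) x b k" using univD(3)[OF u b(1)] by blast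
  have "algm K W (V**u**f) (\<Phi> (u**f) (a|>f)) y c (h .: (V<|k))"
  using algm_comp[OF monad_comp comp_algI[OF g(1)[OF f(1)]] comp_algI[OF b(1)] c comp_algm[OF g(1)[OF f(1)] b(1) f(3)] b(2)] .
  then show ?thesis using f b g(2)[OF f(1)] algmD(1-3)[OF f(3)] algmD(1-3)[OF b(2)] algD(1-3)[OF b(1)]
  by(intro exI[of _ f] exI[of _ "h .: (V<|k)"]) simp
  qed
  qed
 }
 {
  assume u: "univ K W (V**u) (\<Phi> u a) X"
  show "univ K S u a X"
  proof (rule univI)
  show "alg K S (src K u) u a" by fact
  show "EX! x. cell x f f' & u<|x = h" if f: "arr f X (src K u)" "arr f' X (src K u)"
  "algm K S (u**f) (a|>f) (u**f') (a|>f') h" for f f' h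
  proof -
  have "algm K W (V**u**f) (\<Phi> u a|>f) (V**u**f') (\<Phi> u a|>f') (V<|h)" using comp_algm[OF g(1)[OF f(1)] g(1)[OF f(2)] f(3)] g(2)[OF f(1)] g(2)[OF f(2)] by simp
  then have "EX! x. cell x f f' & (V**u)<|x = V<|h" using univD(2)[OF u, of f f' "V<|h"] f by simp
  moreover have "(V**u)<|x = V<|h <-> u<|x = h" if "cell x f f'" for x
  using V_faithful[of "u<|x" "u**f" "u**f'" h] that f algmD(1-3)[OF f(3)] by auto
  ultimately show ?thesis by(metis (mono_tags, lifting))
  qed
  show "EX f k. arr f X (src K u) & iso2 k & algm K S (u**f) (a|>f) x b k" if b: "alg K S X x b" for x b
  proof -
  obtain f h where f: "arr f X (src K u)" "iso2 h" "algm K W (V**u**f) (\<Phi> u a|>f) (V**x) (\<Phi> x b) h"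
  using univD(3)[OF u comp_algI[OF b]] by auto
  note [simp] = algD(1-6)[OF b] f(1)[simplified] f(2) algmD(1-3)[OF f(3)]
  note ga = g(1)[OF f(1)]
  obtain k where k: "algm K S (u**f) (a|>f) x b k" "V<|k = h"
  using comp_ff[OF ga b, of h] f(3) g(2)[OF f(1)] by auto
  have "algm K W (V**x) (\<Phi> x b) (V**u**f) (\<Phi> (u**f) (a|>f)) (inv2 h)" using algm_inv[OF monad_comp comp_algI[OF ga] comp_algI[OF b]] f(3) g(2)[OF f(1)] by simp
  then obtain k' where k': "algm K S x b (u**f) (a|>f) k'" "V<|k' = inv2 h" using comp_ff[OF b ga] by blast
  note [simp] = algmD(1-3)[OF k(1)] algmD(1-3)[OF k'(1)]
  have "k' .: k = idc K (u**f)" by(rule V_faithful[of _ "u**f" "u**f"]) (simp_all add: k k')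
  moreover have "k .: k' = idc K x" by(rule V_faithful[of _ x x]) (simp_all add: k k')
  ultimately have "iso2 k" using inv2_unique(2)[of k k'] by simp
  with k f show ?thesis by blast
  qed
  qed
 }
qed

end

section \<open>The 2-category \<open>EM\<^sub>d\<^sub>m(K)\<close>\<close>

context two_category
begin

definition dm_arr :: "('o, 'a, 'c) mnd => ('o, 'a, 'c) mnd => 'a => 'c => bool" where
 "dm_arr T S f p <-> (T, S, f, p) : EM_dm_arrs K"

text \<open>The extension of \<open>r : f => g t\<close> to a 2-cell \<open>s f => g t\<close>. Both
  sides of the compatibility law of a 2-cell are equal to it, and horizontal composites are simplest
  in terms of it.\<close>

definition kap :: "('o, 'a, 'c) mnd => 'c => 'a => 'c => 'c" where
 "kap T p g r = (g<|mult T).:(r|>endo T) .: p"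

definition dm_cell :: "('o, 'a, 'c) mnd => ('o, 'a, 'c) mnd => 'a => 'c => 'a => 'c => 'c => bool" where
 "dm_cell T S f p g q r <-> dm_arr T S f p & dm_arr T S g q & cell r f (g**endo T) &
  (g<|mult T).:(q|>endo T).:(endo S<|r) = kap T p g r &
  (g<|mult T).:(q|>endo T).:(eta S|>(g**endo T)) .: r = r"

lemma dm_arrD:
 assumes "dm_arr T S f p"
 shows "mon T" "mon S" "f : arrs K" "src K f = base T" "trg K f = base S"
  "p : cells K" "csrc K p = endo S**f" "ctrg K p = f**endo T"
  "(f<|mult T).:(p|>endo T).:(endo S<|p) = p .: (mult S|>f)"
 using assms by(auto simp: dm_arr_def EM_dm_arrs_def)

lemma dm_arrI:
 assumes "mon T" "mon S" "arr f (base T) (base S)" "cell p (endo S**f) (f**endo T)"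
  "(f<|mult T).:(p|>endo T).:(endo S<|p) = p .: (mult S|>f)"
 shows "dm_arr T S f p"
 using assms by(simp add: dm_arr_def EM_dm_arrs_def)

lemma dm_cellD:
 assumes "dm_cell T S f p g q r"
 shows "dm_arr T S f p" "dm_arr T S g q" "r : cells K" "csrc K r = f" "ctrg K r = g**endo T"
  "(g<|mult T).:(q|>endo T).:(endo S<|r) = kap T p g r"
  "(g<|mult T).:(q|>endo T).:(eta S|>(g**endo T)) .: r = r"
 using assms by(auto simp: dm_cell_def)

text \<open>A 2-cell may be replaced by its extension: the extension is linear over the structures
  of both 1-cells, and restricting it along the unit of \<open>S\<close> returns
  \<open>r\<close>.\<close>

lemma dm_cell_kap:
 assumes "dm_cell T S f p g q r"
 shows "kap T p g r : cells K" "csrc K (kap T p g r) = endo S**f" "ctrg K (kap T p g r) = g**endo T"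
  "(g<|mult T).:(q|>endo T).:(endo S<|kap T p g r) = kap T p g r .: (mult S|>f)"
  "(g<|mult T).:(kap T p g r|>endo T).:(endo S<|p) = kap T p g r .: (mult S|>f)"
  "kap T p g r .: (eta S|>f) = r"
proof -
 note [simp] = dm_arrD(1-8)[OF dm_cellD(1)[OF assms]] dm_arrD(3-8)[OF dm_cellD(2)[OF assms]] dm_cellD(3-5)[OF assms]
 let ?t = "endo T" and ?s = "endo S"
 show [simp]: "kap T p g r : cells K" "csrc K (kap T p g r) = ?s**f" "ctrg K (kap T p g r) = g**?t" by(simp_all add: kap_def)
 have 1: "(q|>?t).:(?s<|g<|mult T) = (g<|?t<|mult T).:(q|>?t|>?t)" using ich[of "mult T" q] by simp
 have 2: "(g<|mult T).:(g<|?t<|mult T) = (g<|mult T).:(g<|(mult T|>?t))" using lcong[OF monad_simps(13), of T g] by simp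
 have 3: "(g<|(mult T|>?t)).:(q|>?t|>?t).:(?s<|(r|>?t)) = kap T p g r|>?t" using rcong[OF dm_cellD(6)[OF assms], of ?t] by simp
 have 5: "(r|>?t).:(f<|mult T) = (g<|?t<|mult T).:(r|>?t|>?t)" using ich[of "mult T" r] by simp
 show *: "(g<|mult T).:(kap T p g r|>?t).:(?s<|p) = kap T p g r .: (mult S|>f)"
 proof -
  have "(g<|mult T).:(kap T p g r|>?t).:(?s<|p) =
  (g<|mult T).:(r|>?t).:((f<|mult T).:(p|>?t).:(?s<|p))"
  by(simp add: kap_def vx2[OF 2] vx2[OF 5])
  also have "... = kap T p g r .: (mult S|>f)" unfolding dm_arrD(9)[OF dm_cellD(1)[OF assms]] by(simp add: kap_def)
  finally show ?thesis .
 qed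
 have "(g<|mult T).:(q|>?t).:(?s<|kap T p g r) =
  (g<|mult T).:((g<|(mult T|>?t)).:(q|>?t|>?t).:(?s<|(r|>?t))).:(?s<|p)"
  by(simp add: kap_def vx2[OF 1] vx2[OF 2])
 then show "(g<|mult T).:(q|>?t).:(?s<|kap T p g r) = kap T p g r .: (mult S|>f)" unfolding 3 * .
 have 6: "(?s<|r).:(eta S|>f) = (eta S|>g|>?t) .: r" using ich[of r "eta S"] by simp
 show "kap T p g r .: (eta S|>f) = r" using dm_cellD(7)[OF assms] by(simp add: 6 flip: dm_cellD(6)[OF assms])
qed

lemmas dm_cell_types = dm_cellD(3-5) dm_cell_kap(1-3)

text \<open>Multiplicativity of \<open>p\<close> and a unit law of \<open>S\<close> cancel the unit
  inserted in the identity 2-cell, so the identity extends to the structure cell itself.\<close>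

lemma dm_id_kap:
 assumes "dm_arr T S f p"
 shows "kap T p f (p .: (eta S|>f)) = p"
proof -
 note [simp] = dm_arrD(1-8)[OF assms]
 have 1: "(eta S|>f|>endo T) .: p = (endo S<|p).:(eta S|>endo S|>f)" using ich[of p "eta S"] by simp
 have 2: "(mult S|>f).:(eta S|>endo S|>f) = idc K (endo S**f)" using rcong[OF monad_simps(12), of S f] by simp
 show ?thesis
  using vx3[OF dm_arrD(9)[OF assms], of "eta S|>endo S|>f"] by(simp add: kap_def 1 2)
qed

lemma dm_id:
 assumes "dm_arr T S f p"
 shows "dm_cell T S f p f p (p .: (eta S|>f))"
proof -
 note [simp] = dm_arrD(1-8)[OF assms]
 have 1: "(mult S|>f).:(endo S<|(eta S|>f)) = idc K (endo S**f)" using rcong[OF monad_simps(11), of S f] by simp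
 have 2: "(f<|mult T).:(p|>endo T).:(endo S<|p).:(endo S<|(eta S|>f)) = p" using vx3[OF dm_arrD(9)[OF assms], of "endo S<|(eta S|>f)"] by(simp add: 1)
 have 3: "(f<|mult T).:(p|>endo T).:(eta S|>f|>endo T) .: p .: (eta S|>f) = p .: (eta S|>f)" using vcongr[OF dm_id_kap[OF assms], of "eta S|>f"] by(simp add: kap_def)
 show ?thesis using assms by(simp add: dm_cell_def dm_id_kap 2 3)
qed

lemma dm_vc:
 assumes r: "dm_cell T S f p g q r" and z: "dm_cell T S g q h w z"
 shows "dm_cell T S f p h w ((h<|mult T).:(z|>endo T) .: r)"
  "kap T p h ((h<|mult T).:(z|>endo T) .: r) = (h<|mult T).:(z|>endo T) .: kap T p g r"
proof -
 note [simp] = dm_arrD(1-8)[OF dm_cellD(1)[OF r]] dm_arrD(3-8)[OF dm_cellD(2)[OF r]] dm_arrD(3-8)[OF dm_cellD(2)[OF z]]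
  dm_cell_types[OF r] dm_cell_types[OF z]
 let ?t = "endo T" and ?s = "endo S" and ?v = "(h<|mult T).:(z|>endo T) .: r"
 have 1: "(h<|mult T).:(h<|?t<|mult T) = (h<|mult T).:(h<|(mult T|>?t))" using lcong[OF monad_simps(13), of T h] by simp
 have 2: "(z|>?t).:(g<|mult T) = (h<|?t<|mult T).:(z|>?t|>?t)" using ich[of "mult T" z] by simp
 show k: "kap T p h ?v = (h<|mult T).:(z|>?t) .: kap T p g r" by(simp add: kap_def vx2[OF 2] vx2[OF 1])
 have 3: "(w|>?t).:(?s<|h<|mult T) = (h<|?t<|mult T).:(w|>?t|>?t)" using ich[of "mult T" w] by simp
 have 4: "(h<|(mult T|>?t)).:(w|>?t|>?t).:(?s<|(z|>?t)) = (h<|(mult T|>?t)).:(z|>?t|>?t).:(q|>?t)" using rcong[OF dm_cellD(6)[OF z], of ?t] by(simp add: kap_def)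
 have 5: "(h<|mult T).:(w|>?t).:(?s<|?v) = kap T p h ?v"
 proof -
  have "(h<|mult T).:(w|>?t).:(?s<|?v) =
  (h<|mult T).:((h<|(mult T|>?t)).:(w|>?t|>?t).:(?s<|(z|>?t))).:(?s<|r)"
  by(simp add: vx2[OF 3] vx2[OF 1])
  also have "... = (h<|mult T).:(z|>?t).:((g<|mult T).:(q|>?t).:(?s<|r))" unfolding 4 by(simp add: vx2[OF 2] vx2[OF 1])
  finally show ?thesis unfolding dm_cellD(6)[OF r] k .
 qed
 have 6: "(?s<|?v).:(eta S|>f) = (eta S|>h|>?t) .: ?v" using ich[of ?v "eta S"] by simp
 have 7: "kap T p h ?v .: (eta S|>f) = ?v" unfolding k using dm_cell_kap(6)[OF r] by simp
 have "(h<|mult T).:(w|>?t).:(eta S|>(h**?t)) .: ?v = ?v"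
 proof -
  have "(h<|mult T).:(w|>?t).:(eta S|>(h**?t)) .: ?v = ((h<|mult T).:(w|>?t).:(?s<|?v)).:(eta S|>f)" using 6 by simp
  also have "... = ?v" unfolding 5 by(rule 7)
  finally show ?thesis .
 qed
 with 5 show "dm_cell T S f p h w ?v" using dm_cellD(1)[OF r] dm_cellD(2)[OF z] by(simp add: dm_cell_def)
qed

lemma dm_cmp:
 assumes a: "dm_arr T S f p" and b: "dm_arr S R f' p'"
 shows "dm_arr T R (f'**f) ((f'<|p).:(p'|>f))"
proof -
 note [simp] = dm_arrD(1-8)[OF a] dm_arrD(2-8)[OF b]
 have 1: "(p'|>f|>endo T).:(endo R<|f'<|p) = (f'<|endo S<|p).:(p'|>endo S|>f)" using ich[of p p'] by simp
 have 2: "(f'<|f<|mult T).:(f'<|(p|>endo T)).:(f'<|endo S<|p) = (f'<|p).:(f'<|(mult S|>f))" using lcong[OF dm_arrD(9)[OF a], of f'] by simp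
 have 3: "(f'<|(mult S|>f)).:(p'|>endo S|>f).:(endo R<|(p'|>f)) = (p'|>f).:(mult R|>f'|>f)" using rcong[OF dm_arrD(9)[OF b], of f] by simp
 show ?thesis by(rule dm_arrI) (simp_all add: vx2[OF 1] vx3[OF 2] 3)
qed

text \<open>In terms of extensions horizontal composition is mere pasting. This second equation is
  what makes associativity of horizontal composition immediate.\<close>

lemma dm_hc:
 assumes r: "dm_cell T S f p g q r" and z: "dm_cell S R f' p' g' q' z"
 defines "w == (g'<|kap T p g r).:(z|>f)"
 shows "dm_cell T R (f'**f) ((f'<|p).:(p'|>f)) (g'**g) ((g'<|q).:(q'|>g)) w"
  "kap T ((f'<|p).:(p'|>f)) (g'**g) w = (g'<|kap T p g r).:(kap S p' g' z|>f)"
proof -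
 note a = dm_cellD(1,2)[OF r] dm_cellD(1,2)[OF z]
 note [simp] = dm_arrD(1-8)[OF a(1)] dm_arrD(3-8)[OF a(2)] dm_arrD(2-8)[OF a(3)] dm_arrD(3-8)[OF a(4)]
  dm_cell_types[OF r] dm_cell_types[OF z]
 let ?t = "endo T" and ?s = "endo S" and ?u = "endo R" and ?k = "kap T p g r" and ?k' = "kap S p' g' z"
 let ?p = "(f'<|p).:(p'|>f)" and ?q = "(g'<|q).:(q'|>g)"
 have w [simp]: "w : cells K" "csrc K w = f'**f" "ctrg K w = g'**g**?t" by(simp_all add: w_def)
 have 1: "(z|>f|>?t).:(f'<|p) = (g'<|?s<|p).:(z|>?s|>f)" using ich[of p z] by simp
 have 2: "(g'<|g<|mult T).:(g'<|(?k|>?t)).:(g'<|?s<|p) = (g'<|?k).:(g'<|(mult S|>f))" using lcong[OF dm_cell_kap(5)[OF r], of g'] by simp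
 have 3: "(g'<|(mult S|>f)).:(z|>?s|>f).:(p'|>f) = ?k'|>f" by(simp add: kap_def)
 show k: "kap T ?p (g'**g) w = (g'<|?k).:(?k'|>f)" unfolding kap_def[of T ?p] by(simp add: w_def vx2[OF 1] vx3[OF 2] 3)
 have 4: "(q'|>g|>?t).:(?u<|g'<|?k) = (g'<|?s<|?k).:(q'|>?s|>f)" using ich[of ?k q'] by simp
 have 5: "(g'<|g<|mult T).:(g'<|(q|>?t)).:(g'<|?s<|?k) = (g'<|?k).:(g'<|(mult S|>f))" using lcong[OF dm_cell_kap(4)[OF r], of g'] by simp
 have 6: "(g'<|(mult S|>f)).:(q'|>?s|>f).:(?u<|(z|>f)) = ?k'|>f" using rcong[OF dm_cellD(6)[OF z], of f] by simp
 have 7: "((g'**g)<|mult T).:(?q|>?t).:(?u<|w) = kap T ?p (g'**g) w" unfolding k by(simp add: w_def vx2[OF 4] vx3[OF 5] 6)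
 have 8: "(?u<|w).:(eta R|>f'|>f) = (eta R|>g'|>g|>?t) .: w" using ich[of w "eta R"] by simp
 have 9: "((g'<|?k).:(?k'|>f)).:(eta R|>f'|>f) = w" using rcong[OF dm_cell_kap(6)[OF z], of f] by(simp add: w_def)
 have "((g'**g)<|mult T).:(?q|>?t).:(eta R|>((g'**g)**?t)) .: w = w"
 proof -
  have "((g'**g)<|mult T).:(?q|>?t).:(eta R|>((g'**g)**?t)) .: w =
  (((g'**g)<|mult T).:(?q|>?t).:(?u<|w)).:(eta R|>f'|>f)" using 8 by simp
  also have "... = w" unfolding 7 k by(rule 9)
  finally show ?thesis .
 qed
 with 7 show "dm_cell T R (f'**f) ?p (g'**g) ?q w" using dm_cmp[OF a(1,3)] dm_cmp[OF a(2,4)] by(simp add: dm_cell_def)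
qed

lemma dm_one: "mon T ==> dm_arr T T (one K (base T)) (idc K (endo T))"
 by(rule dm_arrI) simp_all

lemma EM_dm_simps:
 "objs E*K = {T. mon T}" "(T, S, f, p) : arrs E*K <-> dm_arr T S f p"
 "src E*K (T, S, f, p) = T" "trg E*K (T, S, f, p) = S"
 "csrc E*K (a, b, r) = a" "ctrg E*K (a, b, r) = b"
 "one E*K T = (T, T, one K (base T), idc K (endo T))"
 "cmp E*K (S', R, f', p') (T, S, f, p) = (T, R, f'**f, (f'<|p).:(p'|>f))"
 "idc E*K (T, S, f, p) = ((T, S, f, p), (T, S, f, p), p .: (eta S|>f))"
 "vc E*K (b, (T, S, h, w), z) (a, b', r) = (a, (T, S, h, w), (h<|mult T).:(z|>endo T) .: r)"
 by(auto simp: EM_dm_def dm_arr_def EM_dm_cmp_def)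

lemma EM_dm_cell: "((T, S, f, p), (T', S', g, q), r) : cells E*K <-> T' = T & S' = S & dm_cell T S f p g q r"
proof -
 have "dm_cell T S f p g q r <-> (T, S, f, p) : EM_dm_arrs K & (T, S, g, q) : EM_dm_arrs K & cell r f (g**endo T) &
  (g<|mult T).:(q|>endo T).:(endo S<|r) = (g<|mult T).:(r|>endo T) .: p &
  (g<|mult T).:(q|>endo T).:(eta S|>(g**endo T)) .: r = r"
  by(auto simp: dm_cell_def dm_arr_def kap_def)
 then show ?thesis by(auto simp: EM_dm_def)
qed

lemma EM_dm_cellE:
 assumes "x : cells E*K"
 obtains T S f p g q r where "x = ((T, S, f, p), (T, S, g, q), r)" "dm_cell T S f p g q r"
 using assms EM_dm_cell by(cases x) auto

lemma EM_dm_hc: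
 assumes "dm_cell T S f p g q r" "dm_cell S R f' p' g' q' z"
 shows "hc E*K ((S, R, f', p'), (S, R, g', q'), z) ((T, S, f, p), (T, S, g, q), r) =
  ((T, R, f'**f, (f'<|p).:(p'|>f)), (T, R, g'**g, (g'<|q).:(q'|>g)), (g'<|kap T p g r).:(z|>f))"
proof -
 note a = dm_cellD(1,2)[OF assms(1)] dm_cellD(1,2)[OF assms(2)]
 note [simp] = dm_arrD(1-8)[OF a(1)] dm_arrD(3-8)[OF a(2)] dm_arrD(2-8)[OF a(3)] dm_arrD(3-8)[OF a(4)]
  dm_cellD(3-5)[OF assms(1)] dm_cellD(3-5)[OF assms(2)]
 show ?thesis by(simp add: EM_dm_def EM_dm_cmp_def kap_def)
qed

end

section \<open>The 2-category laws, local splitting and the inclusion\<close>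

context two_category
begin

theorem EM_dm_two_category: "two_category E*K"
proof
 fix f assume f: "f : arrs E*K"
 then show "src E*K f : objs E*K" "trg E*K f : objs E*K" using dm_arrD(1,2) by(cases f; auto simp: EM_dm_simps)+
 show "cell_in E*K (idc E*K f) f f" using f dm_id by(cases f) (auto simp: EM_dm_simps EM_dm_cell)
next
 fix x assume "x : cells E*K"
 then show "csrc E*K x : arrs E*K" "ctrg E*K x : arrs E*K"
  "src E*K (csrc E*K x) = src E*K (ctrg E*K x)"
  "trg E*K (csrc E*K x) = trg E*K (ctrg E*K x)"
  using dm_cellD(1,2) by(auto simp: EM_dm_simps elim!: EM_dm_cellE)
next
 fix T assume "T : objs E*K"
 then show "arr_in E*K (one E*K T) T T" using dm_one by(auto simp: EM_dm_simps)
next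
 fix f A B g C assume fg: "arr_in E*K f A B" "arr_in E*K g B C"
 obtain u p where f: "f = (A, B, u, p)" "dm_arr A B u p" using fg by(cases f) (auto simp: EM_dm_simps)
 obtain v q where g: "g = (B, C, v, q)" "dm_arr B C v q" using fg by(cases g) (auto simp: EM_dm_simps)
 show "arr_in E*K (cmp E*K g f) A C" using dm_cmp[OF f(2) g(2)] by(simp add: f(1) g(1) EM_dm_simps)
 note [simp] = dm_arrD(1-8)[OF f(2)] dm_arrD(2-8)[OF g(2)]
 have "hc E*K (idc E*K g) (idc E*K f) =
  ((A, C, v**u, (v<|p).:(q|>u)), (A, C, v**u, (v<|p).:(q|>u)), (v<|p).:((q .: (eta C|>v))|>u))"
  by(simp only: f(1) g(1) EM_dm_simps EM_dm_hc[OF dm_id[OF f(2)] dm_id[OF g(2)]] dm_id_kap[OF f(2)])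
 then show "hc E*K (idc E*K g) (idc E*K f) = idc E*K (cmp E*K g f)" by(simp add: f(1) g(1) EM_dm_simps)
 fix h D assume "arr_in E*K h C D"
 then obtain w m where h: "h = (C, D, w, m)" "dm_arr C D w m" by(cases h) (auto simp: EM_dm_simps)
 note [simp] = dm_arrD(2-8)[OF h(2)]
 show "cmp E*K (cmp E*K h g) f = cmp E*K h (cmp E*K g f)" by(simp add: f(1) g(1) h(1) EM_dm_simps)
next
 fix f A B assume "arr_in E*K f A B"
 then obtain u p where f: "f = (A, B, u, p)" "dm_arr A B u p" by(cases f) (auto simp: EM_dm_simps)
 note [simp] = dm_arrD(1-8)[OF f(2)]
 show "cmp E*K f (one E*K A) = f" "cmp E*K (one E*K B) f = f" by(simp_all add: f(1) EM_dm_simps)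
next
 fix x f g assume x0: "cell_in E*K x f g"
 then obtain T S u p v q r where x: "x = ((T, S, u, p), (T, S, v, q), r)" "dm_cell T S u p v q r" "f = (T, S, u, p)" "g = (T, S, v, q)" by(auto simp: EM_dm_simps elim!: EM_dm_cellE)
 note [simp] = dm_arrD(1-8)[OF dm_cellD(1)[OF x(2)]] dm_arrD(3-8)[OF dm_cellD(2)[OF x(2)]] dm_cell_types[OF x(2)]
 have 1: "(v<|mult T).:(r|>endo T) .: p = kap T p v r" by(simp add: kap_def)
 show "vc E*K x (idc E*K f) = x" using vx3[OF 1, of "eta S|>u"] dm_cell_kap(6)[OF x(2)] by(simp add: x EM_dm_simps)
 show "vc E*K (idc E*K g) x = x" using dm_cellD(7)[OF x(2)] by(simp add: x EM_dm_simps)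
 have 2: "(v<|mult T).:(v<|(eta T|>endo T)) = idc K (v**endo T)" using lcong[OF monad_simps(12), of T v] by simp
 show "hc E*K x (idc E*K (one E*K (src E*K f))) = x" using EM_dm_hc[OF dm_id[OF dm_one[of T]] x(2)] by(simp add: x EM_dm_simps kap_def vx2[OF 2])
 show "hc E*K (idc E*K (one E*K (trg E*K f))) x = x" using EM_dm_hc[OF x(2) dm_id[OF dm_one[of S]]] dm_cell_kap(6)[OF x(2)] by(simp add: x EM_dm_simps)
 fix h y assume "cell_in E*K y g h"
 then obtain w m z where y: "y = ((T, S, v, q), (T, S, w, m), z)" "dm_cell T S v q w m z" "h = (T, S, w, m)" using x(4) by(auto simp: EM_dm_simps elim!: EM_dm_cellE)
 show "cell_in E*K (vc E*K y x) f h" using dm_vc(1)[OF x(2) y(2)] by(simp add: x y EM_dm_simps EM_dm_cell)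
 note [simp] = dm_arrD(3-8)[OF dm_cellD(2)[OF y(2)]] dm_cell_types[OF y(2)]
 fix k t assume "cell_in E*K t h k"
 then obtain w' m' z' where t: "t = ((T, S, w, m), (T, S, w', m'), z')" "dm_cell T S w m w' m' z'" "k = (T, S, w', m')" using y(3) by(auto simp: EM_dm_simps elim!: EM_dm_cellE)
 note [simp] = dm_arrD(3-8)[OF dm_cellD(2)[OF t(2)]] dm_cell_types[OF t(2)]
 have 3: "(w'<|mult T).:(w'<|endo T<|mult T) = (w'<|mult T).:(w'<|(mult T|>endo T))" using lcong[OF monad_simps(13), of T w'] by simp
 have 4: "(z'|>endo T).:(w<|mult T) = (w'<|endo T<|mult T).:(z'|>endo T|>endo T)" using ich[of "mult T" z'] by simp
 show "vc E*K (vc E*K t y) x = vc E*K t (vc E*K y x)" by(simp add: x y t EM_dm_simps vx2[OF 4] vx2[OF 3])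
next
 fix x f f' y g g' assume "cell_in E*K x f f'" "cell_in E*K y g g'" "trg E*K f = src E*K g"
 then obtain T S u p u' p' r R v q v' q' z where
  x: "x = ((T, S, u, p), (T, S, u', p'), r)" "dm_cell T S u p u' p' r" "f = (T, S, u, p)" "f' = (T, S, u', p')" and
  y: "y = ((S, R, v, q), (S, R, v', q'), z)" "dm_cell S R v q v' q' z" "g = (S, R, v, q)" "g' = (S, R, v', q')"
  by(auto simp: EM_dm_simps elim!: EM_dm_cellE)
 show "cell_in E*K (hc E*K y x) (cmp E*K g f) (cmp E*K g' f')" using dm_hc(1)[OF x(2) y(2)] by(simp add: x y EM_dm_simps EM_dm_cell EM_dm_hc[OF x(2) y(2)])
 note [simp] = dm_arrD(1-8)[OF dm_cellD(1)[OF x(2)]] dm_arrD(3-8)[OF dm_cellD(2)[OF x(2)]] dm_cell_types[OF x(2)]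
  dm_arrD(1-8)[OF dm_cellD(1)[OF y(2)]] dm_arrD(3-8)[OF dm_cellD(2)[OF y(2)]] dm_cell_types[OF y(2)]
 {
  fix f'' g'' x' y' assume "cell_in E*K x' f' f''" "cell_in E*K y' g' g''"
  then obtain u'' p'' r' v'' q'' z' where
  x': "x' = ((T, S, u', p'), (T, S, u'', p''), r')" "dm_cell T S u' p' u'' p'' r'" and
  y': "y' = ((S, R, v', q'), (S, R, v'', q''), z')" "dm_cell S R v' q' v'' q'' z'"
  using x y by(auto simp: EM_dm_simps elim!: EM_dm_cellE)
  note [simp] = dm_arrD(3-8)[OF dm_cellD(2)[OF x'(2)]] dm_cell_types[OF x'(2)]
  dm_arrD(3-8)[OF dm_cellD(2)[OF y'(2)]] dm_cell_types[OF y'(2)]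
  let ?k = "kap T p u' r" and ?k' = "kap T p' u'' r'"
  \<comment> \<open>The pasting of the two extensions is the extension of the vertical composite
    preceded by the multiplication of \<open>S\<close>; this is the core of interchange.\<close>
  have 1: "(u''<|mult T).:(?k'|>endo T).:(endo S<|?k) = (u''<|mult T).:(r'|>endo T) .: ?k .: (mult S|>u)"
  proof -
  have 2: "(r'|>endo T).:(u'<|mult T) = (u''<|endo T<|mult T).:(r'|>endo T|>endo T)" using ich[of "mult T" r'] by simp
  have 3: "(u''<|mult T).:(u''<|endo T<|mult T) = (u''<|mult T).:(u''<|(mult T|>endo T))" using lcong[OF monad_simps(13), of T u''] by simp
  have "(u''<|mult T).:(?k'|>endo T).:(endo S<|?k) =
  (u''<|mult T).:(r'|>endo T).:((u'<|mult T).:(p'|>endo T).:(endo S<|?k))"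
  unfolding kap_def[of T p' u''] by(simp add: vx2[OF 2] vx2[OF 3])
  then show ?thesis unfolding dm_cell_kap(4)[OF x(2)] .
  qed
  have 2: "(z'|>u'|>endo T).:(v'<|?k) = (v''<|endo S<|?k).:(z'|>endo S|>u)" using ich[of ?k z'] by simp
  have 3: "(v''<|u''<|mult T).:(v''<|(?k'|>endo T)).:(v''<|endo S<|?k) =
  (v''<|u''<|mult T).:(v''<|(r'|>endo T)).:(v''<|?k).:(v''<|(mult S|>u))"
  using lcong[OF 1, of v''] by simp
  show "hc E*K (vc E*K y' y) (vc E*K x' x) = vc E*K (hc E*K y' x') (hc E*K y x)" unfolding x(1) y(1) x'(1) y'(1) EM_dm_simps EM_dm_hc[OF x(2) y(2)] EM_dm_hc[OF x'(2) y'(2)]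
  EM_dm_hc[OF dm_vc(1)[OF x(2) x'(2)] dm_vc(1)[OF y(2) y'(2)]] dm_vc(2)[OF x(2) x'(2)]
  by(simp add: vx2[OF 2] vx3[OF 3])
 }
 fix w h h' assume w0: "cell_in E*K w h h'" and t: "trg E*K g = src E*K h"
 from w0 have "w : cells E*K" by simp
 then obtain R' Q a m a' m' t where w1: "w = ((R', Q, a, m), (R', Q, a', m'), t)" "dm_cell R' Q a m a' m' t" by(rule EM_dm_cellE)
 moreover have "R' = R" using w0 t unfolding y(3) w1(1) by(auto simp: EM_dm_simps)
 ultimately have w: "w = ((R, Q, a, m), (R, Q, a', m'), t)" "dm_cell R Q a m a' m' t" by simp+
 note [simp] = dm_arrD(2-8)[OF dm_cellD(1)[OF w(2)]] dm_arrD(3-8)[OF dm_cellD(2)[OF w(2)]] dm_cell_types[OF w(2)]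
 show "hc E*K (hc E*K w y) x = hc E*K w (hc E*K y x)" unfolding x(1) y(1) w(1) EM_dm_hc[OF y(2) w(2)] EM_dm_hc[OF x(2) y(2)] EM_dm_hc[OF x(2) dm_hc(1)[OF y(2) w(2)]]
  EM_dm_hc[OF dm_hc(1)[OF x(2) y(2)] w(2)] dm_hc(2)[OF x(2) y(2)]
  by simp
qed

text \<open>An idempotent \<open>r\<close> on \<open>(f, p)\<close> splits through
  \<open>(f, kap r)\<close>: the underlying 1-cell stays, its structure absorbs the idempotent, and
  \<open>r\<close> itself represents both halves of the splitting.\<close>

theorem EM_dm_Cat_cc: "Cat_cc_category E*K"
 unfolding Cat_cc_category_def
proof (intro conjI ballI EM_dm_two_category)
 interpret M: two_category "E*K" by(rule EM_dm_two_category)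
 fix A B assume "A : objs E*K" "B : objs E*K"
 show "idempotents_split (hom_cat E*K A B)" unfolding idempotents_split_def M.mor_in_hom M.hom_cat_simps
 proof (intro allI impI)
  fix n e assume e0: "(cell_in E*K e n n & arr_in E*K n A B & arr_in E*K n A B) & vc E*K e e = e"
  then obtain f p r where n: "n = (A, B, f, p)" and e: "e = (n, n, r)" and r: "dm_cell A B f p f p r" by(auto simp: EM_dm_simps elim!: EM_dm_cellE)
  note [simp] = dm_arrD(1-8)[OF dm_cellD(1)[OF r]] dm_cell_types[OF r]
  have rr: "(f<|mult A).:(r|>endo A) .: r = r" using e0 by(simp add: e n EM_dm_simps)
  let ?k = "kap A p f r"
  have k: "(f<|mult A).:(r|>endo A) .: ?k = ?k" using dm_vc(2)[OF r r] rr by simp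
  have 1: "(r|>endo A).:(f<|mult A) = (f<|endo A<|mult A).:(r|>endo A|>endo A)" using ich[of "mult A" r] by simp
  have 2: "(f<|mult A).:(f<|endo A<|mult A) = (f<|mult A).:(f<|(mult A|>endo A))" using lcong[OF monad_simps(13), of A f] by simp
  have 3: "(f<|mult A).:(?k|>endo A).:(endo B<|?k) = ?k .: (mult B|>f)"
  proof -
  have "(f<|mult A).:(?k|>endo A).:(endo B<|?k) =
  (f<|mult A).:(r|>endo A).:((f<|mult A).:(p|>endo A).:(endo B<|?k))"
  unfolding kap_def[of A p f] by(simp add: vx2[OF 1] vx2[OF 2])
  also have "... = ((f<|mult A).:(r|>endo A) .: ?k).:(mult B|>f)" unfolding dm_cell_kap(4)[OF r] by simp
  finally show ?thesis unfolding k .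
  qed
  have a: "dm_arr A B f ?k" by(rule dm_arrI) (simp_all add: 3)
  have k1: "(f<|mult A).:(r|>endo A) .: p = ?k" by(simp add: kap_def)
  have k2: "(f<|mult A).:(?k|>endo A).:(endo B<|r) = ?k"
  proof -
  have "(f<|mult A).:(?k|>endo A).:(endo B<|r) =
  (f<|mult A).:(r|>endo A).:((f<|mult A).:(p|>endo A).:(endo B<|r))"
  unfolding kap_def[of A p f] by(simp add: vx2[OF 1] vx2[OF 2])
  then show ?thesis unfolding dm_cellD(6)[OF r] k .
  qed
  have 4: "(endo B<|r).:(eta B|>f) = (eta B|>f|>endo A) .: r" using ich[of r "eta B"] by simp
  have k3: "(f<|mult A).:(?k|>endo A).:(eta B|>f|>endo A) .: r = r" using vx3[OF k2, of "eta B|>f"] dm_cell_kap(6)[OF r] by(simp add: 4)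
  have c1: "dm_cell A B f p f ?k r" using a dm_cellD(1)[OF r] k2 k3 by(simp add: dm_cell_def)
  have c2: "dm_cell A B f ?k f p r" using a dm_cellD(1,6,7)[OF r] k by(simp add: dm_cell_def kap_def[of A ?k])
  show "EX y ra s. (cell_in E*K ra n y & arr_in E*K n A B & arr_in E*K y A B) &
  (cell_in E*K s y n & arr_in E*K y A B & arr_in E*K n A B) &
  vc E*K s ra = e & vc E*K ra s = idc E*K y"
  using a c1 c2 dm_cellD(1)[OF r] rr dm_cell_kap(6)[OF r]
  by(intro exI[of _ "(A, B, f, ?k)"] exI[of _ "((A, B, f, p), (A, B, f, ?k), r)"] exI[of _ "((A, B, f, ?k), (A, B, f, p), r)"])
  (simp add: n e EM_dm_simps EM_dm_cell)
 qed
qed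

lemma monad_id: "A : objs K ==> mon (idm A)"
 by(simp add: monad_in_def id_monad_def)

lemma id_monad_simps [simp]:
 "base (idm A) = A" "endo (idm A) = one K A" "mult (idm A) = idc K (one K A)"
 "eta (idm A) = idc K (one K A)"
 by(simp_all add: id_monad_def)

lemma dm_arr_id: "f : arrs K ==> dm_arr (idm (src K f)) (idm (trg K f)) f (idc K f)"
 by(rule dm_arrI) (simp_all add: monad_id)

lemma dm_cell_id: "x : cells K ==> f = csrc K x ==> g = ctrg K x ==> A = src K f ==> B = trg K f ==>
  dm_cell (idm A) (idm B) f (idc K f) g (idc K g) x"
 using dm_arr_id[of "csrc K x"] dm_arr_id[of "ctrg K x"] by(simp add: dm_cell_def kap_def)

lemma incl_simps:
 "A : objs K ==> pob inc A = idm A"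
 "f : arrs K ==> par inc f = (idm (src K f), idm (trg K f), f, idc K f)"
 "x : cells K ==> pce inc x = (par inc (csrc K x), par inc (ctrg K x), x)"
 by(simp_all add: EM_dm_incl_def Let_def)

theorem EM_dm_incl_two_functor: "two_functor K E*K inc"
proof -
 interpret M: two_category "E*K" by(rule EM_dm_two_category)
 have ar: "(idm (src K f), idm (trg K f), f, idc K f) : arrs E*K" if "f : arrs K" for f
  using dm_arr_id[OF that] by(simp add: EM_dm_simps)
 have c: "cmp E*K (par inc g) (par inc f) = par inc (g**f)"
  if "g : arrs K" "f : arrs K" "trg K f = src K g" for g f
  using that by(simp add: incl_simps EM_dm_simps)
 have pc: "pcomp inc g f = (if composable K g f then idc E*K (par inc (g**f)) else undefined)" for g f
  by(auto simp: EM_dm_incl_def Let_def composable_def)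
 have pu: "punit inc A = idc E*K (par inc (one K A))" if "A : objs K" for A
  using that by(simp add: EM_dm_incl_def Let_def)
 have one: "par inc (one K A) = one E*K (idm A)" if "A : objs K" for A
  using that by(simp add: incl_simps EM_dm_simps)
 have o: "idm A : objs E*K" if "A : objs K" for A using monad_id[OF that] by(simp add: EM_dm_simps)
 have p: "par inc f : arrs E*K" "src E*K (par inc f) = idm (src K f)"
  "trg E*K (par inc f) = idm (trg K f)" if "f : arrs K" for f
  using ar[OF that] that by(simp_all add: incl_simps EM_dm_simps)
 have q: "pce inc x : cells E*K" "csrc E*K (pce inc x) = par inc (csrc K x)"
  "ctrg E*K (pce inc x) = par inc (ctrg K x)" if "x : cells K" for x
  using that dm_cell_id[OF that refl refl refl refl] by(simp_all add: incl_simps EM_dm_simps EM_dm_cell)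
 have h: "pce inc (y \<star> x) = hc E*K (pce inc y) (pce inc x)"
  if "x : cells K" "y : cells K" "trg K (csrc K x) = src K (csrc K y)" for x y
  using that EM_dm_hc[OF dm_cell_id[OF that(1) refl refl refl refl] dm_cell_id[OF that(2) refl refl that(3) refl]]
  by(simp add: incl_simps kap_def hc_whisk(2))
 have "pseudofunctor K E*K inc"
 proof (intro pseudofunctor.intro two_category_axioms EM_dm_two_category pseudofunctor_axioms.intro)
  show "pob inc : extensional (objs K)" "par inc : extensional (arrs K)"
  "pce inc : extensional (cells K)" "punit inc : extensional (objs K)"
  "\<not> composable K g f ==> pcomp inc g f = undefined" for g f
  by(auto simp: EM_dm_incl_def Let_def)
  show "pob inc A : objs E*K" if "A : objs K" for A
  using that monad_id by(simp add: incl_simps EM_dm_simps)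
  show "arr_in E*K (par inc f) (pob inc A) (pob inc B)" if "arr f A B" for f A B
  using p[of f] that by(auto simp: incl_simps(1))
  show "cell_in E*K (pce inc x) (par inc f) (par inc g)" if "cell x f g" for x f g
  using q[of x] that by auto
  show "pce inc (idc K f) = idc E*K (par inc f)" if "f : arrs K" for f
  using that by(simp add: incl_simps EM_dm_simps)
  show "pce inc (y .: x) = vc E*K (pce inc y) (pce inc x)"
  if "cell x f g" "cell y g h" for x f g y h
  using that cell_simps(1-4)[of x] cell_simps(1-4)[of y] by(simp add: incl_simps EM_dm_simps)
  show "is_iso2 E*K (pcomp inc g f) (cmp E*K (par inc g) (par inc f)) (par inc (g**f))"
  if "composable K g f" for g f
  using that p[of "g**f"] by(simp add: pc c composable_def M.is_iso2_iff)
  show "is_iso2 E*K (punit inc A) (one E*K (pob inc A)) (par inc (one K A))" if "A : objs K" for A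
  using that p[of "one K A"] by(simp add: pu one incl_simps(1) M.is_iso2_iff)
 qed (auto simp: composable_def pc pu c h o p q one incl_simps(1) lwhisk_def[of "E*K"] rwhisk_def[of "E*K"])
 then show ?thesis
  unfolding two_functor_def composable_def by(simp add: pc c pu one incl_simps(1) composable_def)
qed

end

section \<open>Strict 2-functors\<close>

text \<open>The inclusion into \<open>EM_dm\<close>, the embedding into \<open>Qstar\<close> and the
  embeddings into the collage are strict, so bare functions with equations replace the record with
  coherence cells. Nothing is prescribed outside the carriers.\<close>

locale strict_fun = A: two_category A + B: two_category B
 for A :: "('o, 'a, 'c) two_cat" and B :: "('p, 'b, 'd) two_cat" +
 fixes Fo :: "'o => 'p" and Fa :: "'a => 'b" and Fc :: "'c => 'd"
 assumes Fo [simp]: "X : objs A ==> Fo X : objs B"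
  and Fa [simp]: "f : arrs A ==> Fa f : arrs B" "f : arrs A ==> src B (Fa f) = Fo (src A f)"
  "f : arrs A ==> trg B (Fa f) = Fo (trg A f)"
  and Fc [simp]: "x : cells A ==> Fc x : cells B" "x : cells A ==> csrc B (Fc x) = Fa (csrc A x)"
  "x : cells A ==> ctrg B (Fc x) = Fa (ctrg A x)"
  and F_one [simp]: "X : objs A ==> Fa (one A X) = one B (Fo X)"
  and F_cmp [simp]: "f : arrs A ==> g : arrs A ==> trg A f = src A g ==> Fa (g**@A f) = Fa g**@B Fa f"
  and F_idc [simp]: "f : arrs A ==> Fc (idc A f) = idc B (Fa f)"
  and F_vc [simp]: "x : cells A ==> y : cells A ==> ctrg A x = csrc A y ==> Fc (y .:@A x) = Fc y .:@B Fc x"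
  and F_hc: "x : cells A ==> y : cells A ==> trg A (csrc A x) = src A (csrc A y) ==> Fc (hc A y x) = hc B (Fc y) (Fc x)"
begin

lemma F_whisk [simp]:
 "x : cells A ==> f : arrs A ==> trg A (csrc A x) = src A f ==> Fc (f<|@A x) = Fa f<|@B Fc x"
 "x : cells A ==> f : arrs A ==> src A (csrc A x) = trg A f ==> Fc (x|>@A f) = Fc x|>@B Fa f"
 by(simp_all add: lwhisk_def rwhisk_def F_hc)

lemma F_iso2 [simp]:
 assumes "A.iso2 x"
 shows "B.iso2 (Fc x)" "Fc (A.inv2 x) = B.inv2 (Fc x)"
proof -
 note x = A.iso2_cell[OF assms]
 have "Fc (A.inv2 x) .:@B Fc x = idc B (Fa (csrc A x))" "Fc x .:@B Fc (A.inv2 x) = idc B (Fa (ctrg A x))" using assms x F_vc[of x "A.inv2 x"] F_vc[of "A.inv2 x" x] by simp+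
 then show "B.iso2 (Fc x)" "Fc (A.inv2 x) = B.inv2 (Fc x)" using B.inv2_unique[of "Fc x" "Fc (A.inv2 x)"] x assms by simp+
qed

definition Fm :: "('o, 'a, 'c) mnd => ('p, 'b, 'd) mnd" where
 "Fm T = (|base = Fo (base T), endo = Fa (endo T), mult = Fc (mult T), eta = Fc (eta T)|)"

lemma Fm_simps [simp]: "base (Fm T) = Fo (base T)" "endo (Fm T) = Fa (endo T)" "mult (Fm T) = Fc (mult T)" "eta (Fm T) = Fc (eta T)"
 by(simp_all add: Fm_def)

lemma F_monad [simp]:
 assumes "monad_in A T"
 shows "monad_in B (Fm T)"
proof -
 note [simp] = assms
 have e: "Fc (mult T) .:@B(Fa (endo T)<|@B Fc (mult T)) = Fc (mult T) .:@B(Fc (mult T)|>@B Fa (endo T))"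
  "Fc (mult T) .:@B(Fa (endo T)<|@B Fc (eta T)) = idc B (Fa (endo T))"
  "Fc (mult T) .:@B(Fc (eta T)|>@B Fa (endo T)) = idc B (Fa (endo T))"
  using arg_cong[OF A.monad_simps(13)[OF assms], of Fc] arg_cong[OF A.monad_simps(11)[OF assms], of Fc]
  arg_cong[OF A.monad_simps(12)[OF assms], of Fc] by simp+
 show ?thesis unfolding monad_in_def Let_def Fm_simps by(intro conjI e) simp_all
qed

lemma F_alg:
 assumes "monad_in A T" "alg A T X x b"
 shows "alg B (Fm T) (Fo X) (Fa x) (Fc b)"
proof -
 note [simp] = A.algD(1-6)[OF assms(2)] assms(1)
 have "Fc (b .:@A(endo T<|@A b)) = Fc (b .:@A(mult T|>@A x))" "Fc (b .:@A(eta T|>@A x)) = Fc (idc A x)" using A.algD(7,8)[OF assms(2)] by simp+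
 then show ?thesis by(simp add: alg_def)
qed

lemma F_algm:
 assumes "monad_in A T" "alg A T X x b" "alg A T X y c" "algm A T x b y c h"
 shows "algm B (Fm T) (Fa x) (Fc b) (Fa y) (Fc c) (Fc h)"
proof -
 note [simp] = A.algD(1-6)[OF assms(2)] A.algD(1-6)[OF assms(3)] A.algmD(1-3)[OF assms(4)] assms(1)
 have "Fc (h .:@A b) = Fc (c .:@A(endo T<|@A h))" using A.algmD(4)[OF assms(4)] by simp
 then show ?thesis by(simp add: algm_def)
qed

lemma F_monad_iso:
 assumes "monad_iso A T T' t"
 shows "monad_iso B (Fm T) (Fm T') (Fc t)"
proof -
 note [simp] = A.monad_isoD(1-7)[OF assms]
 have "Fc (t .:@A mult T) = Fc (mult T' .:@A(t|>@A endo T') .:@A(endo T<|@A t))" "Fc (t .:@A eta T) = Fc (eta T')" using A.monad_isoD(8,9)[OF assms] by simp+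
 then show ?thesis by(simp add: monad_iso_def B.is_iso2_iff)
qed

lemma F_equiv_arr:
 assumes "equiv_arr A e"
 shows "equiv_arr B (Fa e)"
proof -
 obtain e' n m where e: "e : arrs A" "arr_in A e' (trg A e) (src A e)"
  "A.iso2 n" "cell_in A n (one A (src A e)) (e'**@A e)" "A.iso2 m" "cell_in A m (e**@A e') (one A (trg A e))"
  using assms unfolding equiv_arr_def A.is_iso2_iff by blast
 show ?thesis unfolding equiv_arr_def B.is_iso2_iff
  using e by(intro exI[of _ "Fa e'"] exI[of _ "Fc n"] exI[of _ "Fc m"]) simp
qed

end

section \<open>The adjunction and the universal algebra at each object of EM_dm(K)\<close>

definition Ja :: "('o, 'a, 'c) two_cat => 'a => ('o, 'a, 'c) EM_dm_arr" where
 "Ja K f = (id_monad K (src K f), id_monad K (trg K f), f, idc K f)"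

definition Jc :: "('o, 'a, 'c) two_cat => 'c => ('o, 'a, 'c) EM_dm_cell" where
 "Jc K x = (Ja K (csrc K x), Ja K (ctrg K x), x)"

text \<open>The forgetful 1-cell from \<open>(A,t)\<close> to \<open>(A,1)\<close>. Its left adjoint
  is \<open>dmL\<close>, with counit \<open>dme\<close>; the unit is the included
  \<open>eta T\<close>.\<close>

definition dmV :: "('o, 'a, 'c) two_cat => ('o, 'a, 'c) mnd => ('o, 'a, 'c) EM_dm_arr" where
 "dmV K T = (T, id_monad K (base T), one K (base T), eta T)"

definition dmL :: "('o, 'a, 'c) two_cat => ('o, 'a, 'c) mnd => ('o, 'a, 'c) EM_dm_arr" where
 "dmL K T = (id_monad K (base T), T, endo T, mult T)"

definition dme :: "('o, 'a, 'c) two_cat => ('o, 'a, 'c) mnd => ('o, 'a, 'c) EM_dm_cell" where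
 "dme K T = ((T, T, endo T, (endo T<|@K eta T) .:@K mult T), (T, T, one K (base T), idc K (endo T)), idc K (endo T))"

text \<open>The counit whiskered by \<open>V\<close>, that is, the action of \<open>t\<close> on
  \<open>V\<close>.\<close>

definition dma :: "('o, 'a, 'c) two_cat => ('o, 'a, 'c) mnd => ('o, 'a, 'c) EM_dm_cell" where
 "dma K T = ((T, id_monad K (base T), endo T, endo T<|@K eta T), dmV K T, idc K (endo T))"

locale em = two_category K + M: two_category "E*K" for K :: "('o, 'a, 'c) two_cat" (structure)

lemma (in two_category) em: "em K"
 by(intro em.intro two_category_axioms EM_dm_two_category)

sublocale em \<subseteq> J: strict_fun K "E*K" "id_monad K" "Ja K" "Jc K"
proof
 show "f : arrs K ==> Ja K f : arrs E*K" for f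
  using dm_arr_id by(simp add: Ja_def EM_dm_simps)
 show "x : cells K ==> Jc K x : cells E*K" for x
  using dm_cell_id[of x] by(simp add: Jc_def Ja_def EM_dm_cell)
 show "Jc K (y \<star> x) = hc E*K (Jc K y) (Jc K x)"
  if "x : cells K" "y : cells K" "trg K (csrc K x) = src K (csrc K y)" for x y
  using that EM_dm_hc[OF dm_cell_id[OF that(1) refl refl refl refl] dm_cell_id[OF that(2) refl refl that(3) refl]]
  by(simp add: Jc_def Ja_def kap_def hc_whisk(2))
qed (auto simp: Ja_def Jc_def EM_dm_simps monad_id)

lemmas (in two_category) monad_eqs = monad_simps(11-13)

context em
begin

abbreviation "dV == dmV K"

abbreviation (input) "M == EM_dm K"
abbreviation "Jm == J.Fm"

lemma objs_M [simp]: "T : objs M <-> mon T"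
 by(simp add: EM_dm_simps)

lemma dm_V: "mon T ==> dm_arr T (idm (base T)) (one K (base T)) (eta T)"
 by(rule dm_arrI) (simp_all add: monad_id vx2[OF monad_eqs(2)])

lemma dm_L: "mon T ==> dm_arr (idm (base T)) T (endo T) (mult T)"
 by(rule dm_arrI) (simp_all add: monad_id monad_eqs(3))

lemma dm_e:
 assumes "mon T"
 shows "dm_cell T T (endo T) ((endo T<|eta T) .: mult T) (one K (base T)) (idc K (endo T)) (idc K (endo T))"
  "kap T ((endo T<|eta T) .: mult T) (one K (base T)) (idc K (endo T)) = mult T"
  "dm_cell T (idm (base T)) (endo T) (endo T<|eta T) (one K (base T)) (eta T) (idc K (endo T))"
  "kap T (endo T<|eta T) (one K (base T)) (idc K (endo T)) = idc K (endo T)"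
proof -
 note [simp] = assms
 show 1: "kap T ((endo T<|eta T) .: mult T) (one K (base T)) (idc K (endo T)) = mult T"
  "kap T (endo T<|eta T) (one K (base T)) (idc K (endo T)) = idc K (endo T)"
  by(simp_all add: kap_def vx2[OF monad_eqs(1)] monad_eqs)
 have "dm_arr T T (endo T) ((endo T<|eta T) .: mult T)" using dm_cmp[OF dm_V[OF assms] dm_L[OF assms]] by simp
 then show "dm_cell T T (endo T) ((endo T<|eta T) .: mult T) (one K (base T)) (idc K (endo T)) (idc K (endo T))" using dm_one[of T] by(simp add: dm_cell_def 1 monad_eqs)
 have "dm_arr T (idm (base T)) (endo T) (endo T<|eta T)" using dm_cmp[OF dm_V[OF assms], of "idm (base T)" "endo T" "idc K (endo T)"] dm_arr_id[of "endo T"] by simp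
 then show "dm_cell T (idm (base T)) (endo T) (endo T<|eta T) (one K (base T)) (eta T) (idc K (endo T))" using dm_V[of T] by(simp add: dm_cell_def 1 monad_eqs)
qed

lemma V_simps [simp]:
 assumes "mon T"
 shows "dV T : arrs M" "src M (dV T) = T" "trg M (dV T) = idm (base T)"
  "dmL K T : arrs M" "src M (dmL K T) = idm (base T)" "trg M (dmL K T) = T"
  "cmp M (dV T) (dmL K T) = Ja K (endo T)"
  "dme K T : cells M" "csrc M (dme K T) = cmp M (dmL K T) (dV T)" "ctrg M (dme K T) = one M T"
  "dma K T : cells M" "csrc M (dma K T) = cmp M (Ja K (endo T)) (dV T)" "ctrg M (dma K T) = dV T"
  "dV T<|@M dme K T = dma K T"
proof -
 note [simp] = assms
 show "dV T : arrs M" "src M (dV T) = T" "trg M (dV T) = idm (base T)"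
  "dmL K T : arrs M" "src M (dmL K T) = idm (base T)" "trg M (dmL K T) = T"
  using dm_V dm_L by(simp_all add: dmV_def dmL_def EM_dm_simps)
 show "cmp M (dV T) (dmL K T) = Ja K (endo T)" by(simp add: dmV_def dmL_def Ja_def EM_dm_simps monad_eqs)
 show "dme K T : cells M" "csrc M (dme K T) = cmp M (dmL K T) (dV T)" "ctrg M (dme K T) = one M T"
  "dma K T : cells M" "csrc M (dma K T) = cmp M (Ja K (endo T)) (dV T)" "ctrg M (dma K T) = dV T"
  using dm_e[OF assms] by(simp_all add: dme_def dma_def EM_dm_cell EM_dm_simps dmV_def dmL_def Ja_def)
 show "dV T<|@M dme K T = dma K T" unfolding lwhisk_def[of M] dme_def dmV_def EM_dm_simps EM_dm_hc[OF dm_e(1)[OF assms] dm_id[OF dm_V[OF assms]]] dm_e(2)[OF assms]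
  by(simp add: dma_def dmV_def monad_eqs)
qed

end

lemma (in two_category) monad_lw:
 assumes "mon T" "f : arrs K" "src K f = base T"
 shows "(f<|mult T).:(f<|(eta T|>endo T)) = idc K (f**endo T)" "(f<|mult T).:(f<|endo T<|eta T) = idc K (f**endo T)"
  "r : cells K ==> ctrg K r = f**endo T ==> (f<|mult T).:(f<|(eta T|>endo T)) .: r = r"
  "r : cells K ==> ctrg K r = f**endo T ==> (f<|mult T).:(f<|endo T<|eta T) .: r = r"
proof -
 note [simp] = assms
 show 1: "(f<|mult T).:(f<|(eta T|>endo T)) = idc K (f**endo T)" using lcong[OF monad_eqs(2)[OF assms(1)], of f] by simp
 show 2: "(f<|mult T).:(f<|endo T<|eta T) = idc K (f**endo T)" using lcong[OF monad_eqs(1)[OF assms(1)], of f] by simp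
 show "r : cells K ==> ctrg K r = f**endo T ==> (f<|mult T).:(f<|(eta T|>endo T)) .: r = r"
  "r : cells K ==> ctrg K r = f**endo T ==> (f<|mult T).:(f<|endo T<|eta T) .: r = r"
  using vx2[OF 1, of r] vx2[OF 2, of r] by simp+
qed

context em
begin

declare monad_id [simp]

lemma M_lwhisk:
 assumes "dm_cell T S f p g q r" "dm_arr S R h w"
 shows "(S, R, h, w)<|@M((T, S, f, p), (T, S, g, q), r) =
  ((T, R, h**f, (h<|p).:(w|>f)), (T, R, h**g, (h<|q).:(w|>g)), (h<|kap T p g r).:((w .: (eta R|>h))|>f))"
 unfolding lwhisk_def[of M] EM_dm_simps EM_dm_hc[OF assms(1) dm_id[OF assms(2)]] ..

lemma M_rwhisk:
 assumes "dm_arr T S f p" "dm_cell S R f' p' g' q' z"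
 shows "((S, R, f', p'), (S, R, g', q'), z)|>@M(T, S, f, p) =
  ((T, R, f'**f, (f'<|p).:(p'|>f)), (T, R, g'**f, (g'<|p).:(q'|>f)), (g'<|p).:(z|>f))"
 unfolding rwhisk_def[of M] EM_dm_simps EM_dm_hc[OF dm_id[OF assms(1)] assms(2)] dm_id_kap[OF assms(1)] ..

lemma adj:
 assumes T: "mon T"
 shows "adjunction M (dV T) (dmL K T) (dme K T) (Jc K (eta T))"
proof -
 note [simp] = T
 have c: "dm_cell (idm (base T)) (idm (base T)) (one K (base T)) (idc K (one K (base T))) (endo T) (idc K (endo T)) (eta T)" by(rule dm_cell_id) simp_all
 have 1: "Jc K (eta T)|>@M dV T = ((T, idm (base T), one K (base T), eta T), csrc M (dma K T), (endo T<|eta T) .: eta T)"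
  unfolding dmV_def Jc_def Ja_def using M_rwhisk[OF dm_V[OF T] c] by(simp add: dma_def EM_dm_simps)
 have 2: "vc M (dma K T) (Jc K (eta T)|>@M dV T) = idc M (dV T)" unfolding 1 by(simp add: dma_def dmV_def EM_dm_simps vx2[OF monad_eqs(1)])
 have 3: "dme K T|>@M dmL K T = (cmp M (cmp M (dmL K T) (dV T)) (dmL K T), dmL K T, mult T)" unfolding dme_def dmL_def using M_rwhisk[OF dm_L[OF T] dm_e(1)[OF T]]
  by(simp add: dmV_def EM_dm_simps)
 have 4: "dmL K T<|@M Jc K (eta T) = (dmL K T, cmp M (cmp M (dmL K T) (dV T)) (dmL K T), endo T<|eta T)" unfolding dmL_def Jc_def Ja_def using M_lwhisk[OF c dm_L[OF T]]
  by(simp add: dmV_def EM_dm_simps kap_def monad_eqs monad_lw)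
 have "vc M (dme K T|>@M dmL K T) (dmL K T<|@M Jc K (eta T)) = idc M (dmL K T)" unfolding 3 4 by(simp add: dmL_def EM_dm_simps monad_eqs)
 then show ?thesis using 2 by(simp add: adjunction_def)
qed

lemma V_triangle: "mon T ==> vc M (dma K T) (Jc K (eta T)|>@M dV T) = idc M (dV T)"
 using adj[of T] by(simp add: adjunction_def)

text \<open>The adjunction generates the included monad, so algebras for the included monad are the
  ones to which the general argument on composite monads applies.\<close>

lemma adj_monad_eq:
 assumes T: "mon T"
 shows "adj_monad M (dV T) (dmL K T) (dme K T) (Jc K (eta T)) = Jm T"
proof -
 note [simp] = T
 have "dV T<|@M(dme K T|>@M dmL K T) = dma K T|>@M dmL K T" using M.whisk_whisk(3)[of "dme K T" "dmL K T" "dV T"] by simp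
 also have "... = Jc K (mult T)" unfolding dma_def dmV_def dmL_def using M_rwhisk[OF dm_L[OF T] dm_e(3)[OF T]]
  by(simp add: Jc_def Ja_def monad_eqs monad_lw)
 finally show ?thesis by(simp add: adj_monad_def J.Fm_def)
qed

text \<open>The associativity law for an action on \<open>(f, w)\<close> is exactly the law that
  makes its underlying cell \<open>r\<close> the structure of a 1-cell from \<open>R\<close> to
  \<open>T\<close>, and the unit law says that \<open>w\<close> is the restriction of
  \<open>r\<close> along the unit. Algebras at \<open>R\<close> are thus 1-cells into
  \<open>T\<close>.\<close>

lemma dm_algE:
 assumes T: "mon T" and b: "alg M (Jm T) R x b"
 obtains f w r where "x = (R, idm (base T), f, w)" "dm_arr R (idm (base T)) f w"
  "b = ((R, idm (base T), endo T**f, endo T<|w), x, r)" "dm_arr R T f r" "r .: (eta T|>f) = w"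
  "dm_cell R (idm (base T)) (endo T**f) (endo T<|w) f w r" "kap R (endo T<|w) f r = r"
proof -
 note [simp] = T
 let ?A = "idm (base T)"
 note b' = M.algD[OF b]
 obtain f w where x: "x = (R, ?A, f, w)" and w: "dm_arr R ?A f w"
  using b' by(cases x) (simp add: EM_dm_simps)
 note [simp] = dm_arrD(1,3-8)[OF w, simplified]
 have "csrc M b = (R, ?A, endo T**f, endo T<|w)" "ctrg M b = x" using b'(5,6) by(simp_all add: x Ja_def EM_dm_simps)
 then obtain r where r: "b = ((R, ?A, endo T**f, endo T<|w), (R, ?A, f, w), r)" by(cases b) (simp add: x EM_dm_simps)
 have c: "dm_cell R ?A (endo T**f) (endo T<|w) f w r" using b'(4) by(simp add: r EM_dm_cell)
 note [simp] = dm_cellD(3-5)[OF c]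
 have k: "kap R (endo T<|w) f r = r" using dm_cellD(6,7)[OF c] by simp
 have m: "dm_cell ?A ?A (endo T**endo T) (idc K (endo T**endo T)) (endo T) (idc K (endo T)) (mult T)"
  and n: "dm_cell ?A ?A (one K (base T)) (idc K (one K (base T))) (endo T) (idc K (endo T)) (eta T)"
  by(rule dm_cell_id; simp)+
 have k': "(f<|mult R).:(r|>endo R).:(endo T<|w) = r" using k by(simp add: kap_def)
 have a: "dm_arr ?A ?A (endo T) (idc K (endo T))" using dm_arr_id[of "endo T"] by simp
 have 1: "Ja K (endo T)<|@M b = ((R, ?A, endo T**endo T**f, endo T<|endo T<|w), (R, ?A, endo T**f, endo T<|w), endo T<|r)" unfolding r Ja_def using M_lwhisk[OF c a] by(simp add: k)
 have 2: "Jc K (mult T)|>@M x = ((R, ?A, endo T**endo T**f, endo T<|endo T<|w), (R, ?A, endo T**f, endo T<|w), (endo T<|w).:(mult T|>f))"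
  unfolding x Jc_def Ja_def using M_rwhisk[OF w m] by simp
 have "vc M b (Ja K (endo T)<|@M b) = vc M b (Jc K (mult T)|>@M x)" using b'(7) by simp
 then have 3: "(f<|mult R).:(r|>endo R).:(endo T<|r) = r .: (mult T|>f)" unfolding 1 2 unfolding r by(simp add: EM_dm_simps vx3[OF k'])
 have 4: "Jc K (eta T)|>@M x = (x, (R, ?A, endo T**f, endo T<|w), (endo T<|w).:(eta T|>f))" unfolding x Jc_def Ja_def using M_rwhisk[OF w n] by simp
 have "vc M b (Jc K (eta T)|>@M x) = idc M x" using b'(8) by simp
 then have 5: "r .: (eta T|>f) = w" unfolding 4 unfolding r x by(simp add: EM_dm_simps vx3[OF k'])
 have "dm_arr R T f r" by(rule dm_arrI) (simp_all add: 3)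
 then show ?thesis using that x w r c k 5 by blast
qed

lemma V_cmp:
 assumes "dm_arr R T f r"
 shows "cmp M (dV T) (R, T, f, r) = (R, idm (base T), f, r .: (eta T|>f))"
  "dma K T|>@M(R, T, f, r) = ((R, idm (base T), endo T**f, endo T<|(r .: (eta T|>f))),
  (R, idm (base T), f, r .: (eta T|>f)), r)"
proof -
 note [simp] = dm_arrD(1-8)[OF assms]
 show "cmp M (dV T) (R, T, f, r) = (R, idm (base T), f, r .: (eta T|>f))" by(simp add: dmV_def EM_dm_simps)
 have 1: "(endo T<|r).:(endo T<|(eta T|>f)) = endo T<|(r .: (eta T|>f))" by simp
 show "dma K T|>@M(R, T, f, r) = ((R, idm (base T), endo T**f, endo T<|(r .: (eta T|>f))),
  (R, idm (base T), f, r .: (eta T|>f)), r)"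
  unfolding dma_def dmV_def using M_rwhisk[OF assms dm_e(3)[of T]] by simp
qed

lemma V_lwhisk:
 assumes "dm_cell R T f p g q r"
 shows "dV T<|@M((R, T, f, p), (R, T, g, q), r) =
  ((R, idm (base T), f, p .: (eta T|>f)), (R, idm (base T), g, q .: (eta T|>g)), r)"
proof -
 note [simp] = dm_arrD(1-8)[OF dm_cellD(1)[OF assms]] dm_arrD(3-8)[OF dm_cellD(2)[OF assms]] dm_cell_types[OF assms]
 show ?thesis
  unfolding dmV_def using M_lwhisk[OF assms dm_V[of T]] dm_cell_kap(6)[OF assms] by simp
qed

lemma V_alg: "mon T ==> alg M (Jm T) T (dV T) (dma K T)"
proof -
 assume T: "mon T"
 note [simp] = T
 have 1: "Ja K (endo T)<|@M dma K T = ((T, idm (base T), endo T**endo T, endo T<|endo T<|eta T), csrc M (dma K T), idc K (endo T**endo T))"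
  unfolding dma_def dmV_def Ja_def using M_lwhisk[OF dm_e(3)[OF T] dm_arr_id[of "endo T", simplified]]
  by(simp add: EM_dm_simps dm_e(4)[OF T])
 have m: "dm_cell (idm (base T)) (idm (base T)) (endo T**endo T) (idc K (endo T**endo T)) (endo T) (idc K (endo T)) (mult T)" by(rule dm_cell_id) simp_all
 have 2: "Jc K (mult T)|>@M dV T = ((T, idm (base T), endo T**endo T, endo T<|endo T<|eta T), csrc M (dma K T), (endo T<|eta T) .: mult T)"
  unfolding dmV_def Jc_def Ja_def using M_rwhisk[OF dm_V[OF T] m] by(simp add: dma_def EM_dm_simps)
 have 3: "vc M (dma K T) (Ja K (endo T)<|@M dma K T) = vc M (dma K T) (Jc K (mult T)|>@M dV T)" unfolding 1 2 by(simp add: dma_def dmV_def EM_dm_simps vx2[OF monad_eqs(1)])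
 have "vc M (dma K T) (Jc K (eta T)|>@M dV T) = idc M (dV T)" by(rule V_triangle[OF T])
 then show ?thesis using 3 by(simp add: alg_def)
qed

text \<open>By \<open>dm_algE\<close> an algebra is literally a 1-cell \<open>(f, r)\<close>
  followed by \<open>V\<close>, so the lift is an equality and not merely an isomorphism.\<close>

lemma V_lift:
 assumes T: "mon T" and b: "alg M (Jm T) R x b"
 shows "EX g. arr_in M g R T & cmp M (dV T) g = x & dma K T|>@M g = b"
proof -
 let ?A = "idm (base T)"
 obtain f w r where x: "x = (R, ?A, f, w)" and bb: "b = ((R, ?A, endo T**f, endo T<|w), x, r)" and r: "dm_arr R T f r"
  and rw: "r .: (eta T|>f) = w" using dm_algE[OF T b] by metis
 have e: "cmp M (dV T) (R, T, f, r) = x" "dma K T|>@M(R, T, f, r) = b" using V_cmp[OF r] by(simp_all only: x bb rw)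
 show ?thesis using r by(intro exI[of _ "(R, T, f, r)"]) (simp add: e EM_dm_simps(2-4))
qed

text \<open>Whiskering with \<open>V\<close> keeps the underlying cell of a 2-cell, and linearity
  over the action is the compatibility law of a 2-cell into \<open>T\<close>; this gives full
  faithfulness. Essential surjectivity is \<open>V_lift\<close>.\<close>

theorem V_univ:
 assumes T: "mon T" and R: "mon R"
 shows "univ M (Jm T) (dV T) (dma K T) R"
proof (rule M.univI)
 note [simp] = T R
 let ?A = "idm (base T)"
 show "alg M (Jm T) (src M (dV T)) (dV T) (dma K T)" using V_alg[OF T] by simp
 show "EX g k. arr_in M g R (src M (dV T)) & M.iso2 k & algm M (Jm T) (cmp M (dV T) g) (dma K T|>@M g) x b k"
  if b: "alg M (Jm T) R x b" for x b
  using V_lift[OF T b] M.algm_idc[OF J.F_monad[OF T] b] M.algD(1)[OF b] by(metis M.iso2_idc(1) V_simps(2)[OF T])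
 fix g g' h assume g: "arr_in M g R (src M (dV T))" "arr_in M g' R (src M (dV T))"
  "algm M (Jm T) (cmp M (dV T) g) (dma K T|>@M g) (cmp M (dV T) g') (dma K T|>@M g') h"
 obtain f p where gf: "g = (R, T, f, p)" and p: "dm_arr R T f p" using g(1) by(cases g) (simp add: EM_dm_simps)
 obtain f' p' where gf': "g' = (R, T, f', p')" and p': "dm_arr R T f' p'" using g(2) by(cases g') (simp add: EM_dm_simps)
 note [simp] = dm_arrD(3-8)[OF p] dm_arrD(3-8)[OF p']
 note h = M.algmD[OF g(3)]
 obtain r where r: "h = ((R, ?A, f, p .: (eta T|>f)), (R, ?A, f', p' .: (eta T|>f')), r)"
  using h(2,3) V_cmp(1)[OF p] V_cmp(1)[OF p'] by(cases h) (simp add: gf gf' EM_dm_simps)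
 have c: "dm_cell R ?A f (p .: (eta T|>f)) f' (p' .: (eta T|>f')) r" using h(1) by(simp add: r EM_dm_cell)
 note [simp] = dm_cell_types[OF c]
 have C2: "(f'<|mult R).:(p'|>endo R).:(eta T|>f'|>endo R) .: r = r" using dm_cellD(7)[OF c] by simp
 have k: "kap R (p .: (eta T|>f)) f' r = r" using dm_cellD(6)[OF c] C2 by simp
 have a: "dm_arr ?A ?A (endo T) (idc K (endo T))" using dm_arr_id[of "endo T"] by simp
 have 1: "Ja K (endo T)<|@M h = ((R, ?A, endo T**f, endo T<|(p .: (eta T|>f))), (R, ?A, endo T**f', endo T<|(p' .: (eta T|>f'))), endo T<|r)"
  unfolding r Ja_def using M_lwhisk[OF c a] by(simp add: k)
 have "(f'<|mult R).:(r|>endo R) .: p = (f'<|mult R).:(p'|>endo R).:(endo T<|r)"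
  using h(4) unfolding gf gf' J.Fm_simps 1 V_cmp(2)[OF p] V_cmp(2)[OF p'] unfolding r by(simp add: EM_dm_simps)
 then have c': "dm_cell R T f p f' p' r" using p p' C2 by(simp add: dm_cell_def kap_def)
 show "EX! x. cell_in M x g g' & dV T<|@M x = h"
 proof (rule ex1I[of _ "(g, g', r)"])
  show "cell_in M (g, g', r) g g' & dV T<|@M(g, g', r) = h" using V_lwhisk[OF c'] c' by(simp add: gf gf' r EM_dm_cell EM_dm_simps)
  fix x assume x: "cell_in M x g g' & dV T<|@M x = h"
  then obtain z where z: "x = (g, g', z)" by(cases x) (simp add: EM_dm_simps)
  then have "dm_cell R T f p f' p' z" using x by(simp add: gf gf' EM_dm_cell)
  from V_lwhisk[OF this] x show "x = (g, g', r)" by(simp add: z gf gf' r)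
 qed
qed

text \<open>For a 1-cell \<open>(f, p)\<close> into an identity monad, \<open>p : f => f t\<close>
  represents the inclusion into \<open>f V\<close> as well as the retraction onto
  \<open>(f, p)\<close>.\<close>

definition ret_in :: "('o, 'a, 'c) EM_dm_arr => ('o, 'a, 'c) EM_dm_cell" where
 "ret_in n = (case n of (T, S, f, p) => (n, cmp M (Ja K f) (dV T), p))"

definition ret_out :: "('o, 'a, 'c) EM_dm_arr => ('o, 'a, 'c) EM_dm_cell" where
 "ret_out n = (case n of (T, S, f, p) => (cmp M (Ja K f) (dV T), n, p))"

abbreviation dmf :: "('o, 'a, 'c) EM_dm_arr => 'a" where
 "dmf n == fst (snd (snd n))"

lemma JV_cmp: "mon T ==> f : arrs K ==> src K f = base T ==> cmp M (Ja K f) (dV T) = (T, idm (trg K f), f, f<|eta T)"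
 by(simp add: Ja_def dmV_def EM_dm_simps)

text \<open>With a trivial monad at the target the law of a 1-cell says that \<open>p\<close>
  absorbs itself under the multiplication of \<open>T\<close>. The same equation yields
  compatibility of both cells and the fact that they compose to the identity of
  \<open>n\<close>.\<close>

lemma retract:
 assumes "arr_in M n T (idm B)"
 shows "arr (dmf n) (base T) B"
  "cell_in M (ret_in n) n (cmp M (Ja K (dmf n)) (dV T))" "cell_in M (ret_out n) (cmp M (Ja K (dmf n)) (dV T)) n"
  "vc M (ret_out n) (ret_in n) = idc M n"
proof -
 obtain f p where n: "n = (T, idm B, f, p)" and p: "dm_arr T (idm B) f p"
  using assms by(cases n) (simp add: EM_dm_simps)
 have B: "B : objs K" using src_objs[of "endo (idm B)"] dm_arrD(2)[OF p] monad_types(1)[OF dm_arrD(2)[OF p]] by simp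
 note [simp] = B dm_arrD(1,3-8)[OF p, simplified]
 have 1: "(f<|mult T).:(p|>endo T) .: p = p" using dm_arrD(9)[OF p] by simp
 have 3: "(f<|mult T).:(p|>endo T).:(f<|eta T) = p"
 proof -
  have "(p|>endo T).:(f<|eta T) = (f<|endo T<|eta T) .: p" using ich[of "eta T" p] by simp
  then show ?thesis by(simp add: monad_lw)
 qed
 have q: "dm_arr T (idm B) f (f<|eta T)" using dm_cmp[OF dm_V[of T], of "idm B" f "idc K f"] dm_arr_id[of f] by simp
 have i: "dm_cell T (idm B) f p f (f<|eta T) p" and o: "dm_cell T (idm B) f (f<|eta T) f p p" using p q by(simp_all add: dm_cell_def kap_def 1 3 monad_lw)
 show "arr (dmf n) (base T) B" "cell_in M (ret_in n) n (cmp M (Ja K (dmf n)) (dV T))"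
  "cell_in M (ret_out n) (cmp M (Ja K (dmf n)) (dV T)) n" "vc M (ret_out n) (ret_in n) = idc M n"
  using i o by(simp_all add: n ret_in_def ret_out_def JV_cmp EM_dm_cell EM_dm_simps 1)
qed

text \<open>The underlying cell of \<open>x\<close> is some \<open>r : f => g t\<close>, and
  \<open>x\<close> is the included \<open>r\<close> whiskered by \<open>V\<close>, followed by the
  action. Hence data on \<open>K\<close> and on the universal algebra control all 2-cells between
  such composites.\<close>

lemma JV_cell:
 assumes T: "mon T" and f: "f : arrs K" "src K f = base T" and g: "arr g (base T) (trg K f)"
  and x: "cell_in M x (cmp M (Ja K f) (dV T)) (cmp M (Ja K g) (dV T))"
 shows "EX r. cell r f (g**endo T) & x = vc M (Ja K g<|@M dma K T) (Jc K r|>@M dV T)"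
proof -
 note [simp] = T f g[simplified]
 let ?B = "idm (trg K f)" and ?A = "idm (base T)"
 obtain r where r: "x = ((T, ?B, f, f<|eta T), (T, ?B, g, g<|eta T), r)" "dm_cell T ?B f (f<|eta T) g (g<|eta T) r"
  using x by(cases x) (simp add: JV_cmp EM_dm_simps EM_dm_cell)
 note [simp] = dm_cellD(3-5)[OF r(2)]
 have c: "dm_cell ?A ?B f (idc K f) (g**endo T) (idc K (g**endo T)) r" by(rule dm_cell_id) simp_all
 have a: "dm_arr ?A ?B g (idc K g)" using dm_arr_id[of g] by simp
 have 1: "Jc K r|>@M dV T = ((T, ?B, f, f<|eta T), (T, ?B, g**endo T, g<|endo T<|eta T), (g<|endo T<|eta T) .: r)" unfolding Jc_def Ja_def dmV_def using M_rwhisk[OF dm_V[OF T] c] by simp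
 have 2: "Ja K g<|@M dma K T = ((T, ?B, g**endo T, g<|endo T<|eta T), (T, ?B, g, g<|eta T), idc K (g**endo T))"
  unfolding Ja_def dma_def dmV_def using M_lwhisk[OF dm_e(3)[OF T] a] by(simp add: dm_e(4)[OF T])
 show ?thesis by(rule exI[of _ r]) (simp add: 1 2 r(1) EM_dm_simps monad_lw)
qed

text \<open>On \<open>V\<close> the counit is split by the unit of the adjunction. Whiskering
  carries the splitting to \<open>f V\<close>, and \<open>n\<close> inherits it as a retract of
  \<open>f V\<close>.\<close>

lemma split_counit:
 assumes n: "arr_in M n T (idm B)"
 shows "EX j. cell_in M j n (cmp M n (cmp M (dmL K T) (dV T))) & vc M (n<|@M dme K T) j = idc M n"
proof -
 note R = retract[OF n]
 have T [simp]: "mon T" using M.src_objs[of n] n by simp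
 have [simp]: "n : arrs M" "src M n = T" "trg M n = idm B" using n by auto
 have [simp]: "dmf n : arrs K" "src K (dmf n) = base T" "trg K (dmf n) = B" using R(1) by auto
 let ?h = "Ja K (dmf n)" and ?V = "dV T" and ?L = "dmL K T" and ?e = "dme K T" and ?r = "ret_out n" and ?i = "ret_in n"
 have [simp]: "?r : cells M" "csrc M ?r = cmp M ?h ?V" "ctrg M ?r = n" "?i : cells M" "csrc M ?i = n" "ctrg M ?i = cmp M ?h ?V" using R(2,3) by auto
 have 1: "vc M (?h<|@M dma K T) (?h<|@M(Jc K (eta T)|>@M ?V)) = idc M (cmp M ?h ?V)" using M.lcong[OF V_triangle[OF T], of ?h] by simp
 have 2: "vc M (n<|@M ?e) (?r|>@M cmp M ?L ?V) = vc M ?r (?h<|@M dma K T)" using M.ich[of ?e ?r] by simp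
 have "vc M (n<|@M ?e) (vc M (?r|>@M ?L|>@M ?V) (vc M (?h<|@M(Jc K (eta T)|>@M ?V)) ?i)) = idc M n" using R(4) 2 M.vx2[OF 2[simplified]] M.vx2[OF 1] by simp
 then show ?thesis
  by(intro exI[of _ "vc M (?r|>@M ?L|>@M ?V) (vc M (?h<|@M(Jc K (eta T)|>@M ?V)) ?i)"]) simp
qed

end

section \<open>Transport of structure and local equivalences\<close>

lemma (in two_category) cc_split:
 assumes "Cat_cc_category K" "cell e f f" "arr f A B" "e .: e = e"
 shows "EX g r s. arr g A B & cell r f g & cell s g f & s .: r = e & r .: s = idc K g"
proof -
 have "A : objs K" "B : objs K" using assms(3) by auto
 then show ?thesis
  using assms unfolding Cat_cc_category_def idempotents_split_def mor_in_hom hom_cat_simps by blast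
qed

lemma (in two_category) monad_transport:
 assumes W: "mon W" and k: "iso2 k" "cell k f (endo W)" "arr f (base W) (base W)"
 defines "T == (|base = base W, endo = f, mult = inv2 k .: mult W .: (k|>endo W).:(f<|k), eta = inv2 k .: eta W|)"
 shows "monad_iso K T W k"
proof -
 note [simp] = W k(1) k(2,3)[simplified]
 let ?w = "endo W" and ?m = "inv2 k .: mult W .: (k|>endo W).:(f<|k)"
 have T [simp]: "base T = base W" "endo T = f" "mult T = ?m" "eta T = inv2 k .: eta W" by(simp_all add: T_def)
 have 1: "(k|>?w).:(f<|mult W) = (?w<|mult W).:(k|>?w|>?w)" using ich[of "mult W" k] by simp
 have 2: "(k|>?w).:(f<|k) = (?w<|k).:(k|>f)" using ich[of k k] by simp
 have 3: "(mult W|>?w).:(?w<|?w<|k) = (?w<|k).:(mult W|>f)" using ich[of k "mult W"] by simp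
 have 4: "mult W .: (?w<|mult W) .: r = mult W .: (mult W|>?w) .: r" if "r : cells K" "ctrg K r = ?w**?w**?w" for r
  using monad_ext(3)[OF W that(1)] that by simp
 have a: "?m .: (f<|?m) = ?m .: (?m|>f)"
 proof -
  have "?m .: (f<|?m) = inv2 k .: mult W .: (mult W|>?w).:(k|>?w|>?w).:(f<|(k|>?w)).:(f<|f<|k)" by(simp add: vx2[OF 1] 4)
  also have "(k|>?w|>?w).:(f<|(k|>?w)).:(f<|f<|k) = (?w<|?w<|k).:(k|>?w|>f).:(f<|(k|>f))"
  proof -
  have "(f<|(k|>?w)).:(f<|f<|k) = (f<|?w<|k).:(f<|(k|>f))" using lcong[OF 2, of f] by simp
  moreover have "(k|>?w|>?w).:(f<|?w<|k) = (?w<|?w<|k).:(k|>?w|>f)" using ich[of "?w<|k" k] by simp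
  ultimately show ?thesis using vx2[of "k|>?w|>?w" "f<|?w<|k" _ "f<|(k|>f)"] by simp
  qed
  also have "inv2 k .: mult W .: (mult W|>?w).:(?w<|?w<|k).:(k|>?w|>f).:(f<|(k|>f)) = ?m .: (?m|>f)"
  proof -
  have "?m .: (?m|>f) = inv2 k .: mult W .: (?w<|k).:(k|>f).:(?m|>f)" using vx2[OF 2] by simp
  then show ?thesis by(simp add: vx2[OF 3])
  qed
  finally show ?thesis .
 qed
 have 5: "mult W .: (?w<|eta W) = idc K ?w" "mult W .: (eta W|>?w) = idc K ?w" using monad_eqs[OF W] by auto
 have b: "?m .: (f<|(inv2 k .: eta W)) = idc K f"
 proof -
  have "(k|>?w).:(f<|eta W) = (?w<|eta W) .: k" using ich[of "eta W" k] by simp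
  then show ?thesis using vx2[OF 5(1)] by simp
 qed
 have c: "?m .: ((inv2 k .: eta W)|>f) = idc K f"
 proof -
  have "(?w<|k).:(eta W|>f) = (eta W|>?w) .: k" using ich[of k "eta W"] by simp
  then show ?thesis using vx2[OF 5(2)] by(simp add: vx2[OF 2])
 qed
 have "mon T" unfolding monad_in_def Let_def T using a b c by(intro conjI) simp_all
 then show ?thesis by(simp add: monad_iso_def is_iso2_iff)
qed

lemma (in two_category) alg_transport:
 assumes T: "mon T" and c: "alg K T X y c" and k: "iso2 k" "cell k x y"
 shows "alg K T X x (inv2 k .: c .: (endo T<|k))" "algm K T x (inv2 k .: c .: (endo T<|k)) y c k"
proof -
 have x: "arr x X (base T)" using iso2_cell[OF k(1)] k(2) csrc_arrs src_csrc trg_csrc algD(2,3)[OF c] unfolding arr_in_def cell_in_def by metis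
 note [simp] = T algD(1-6)[OF c] k(1) k(2)[simplified] x[simplified]
 have 1: "(mult T|>y).:(endo T<|endo T<|k) = (endo T<|k).:(mult T|>x)" using ich[of k "mult T"] by simp
 have 2: "(endo T<|k).:(eta T|>x) = (eta T|>y) .: k" using ich[of k "eta T"] by simp
 show "alg K T X x (inv2 k .: c .: (endo T<|k))" unfolding alg_def using vx2[OF algD(7)[OF c], of "endo T<|endo T<|k"] vx2[OF algD(8)[OF c], of k] by(simp add: 1 2)
 show "algm K T x (inv2 k .: c .: (endo T<|k)) y c k" by(simp add: algm_def)
qed

text \<open>Bijective on 2-cells between images, and essentially surjective on 1-cells whose source
  comes from \<open>S\<close>. For the inclusion of the collage \<open>S\<close> consists of the
  objects of \<open>L\<close>; in the other instances it contains all objects.\<close>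

locale loc_equiv = strict_fun +
 fixes S
 assumes S: "S \<subseteq> objs A"
  and full: "f : arrs A ==> g : arrs A ==> cell_in B y (Fa f) (Fa g) ==> EX x. cell_in A x f g & Fc x = y"
  and faithful: "Fc x = Fc x' ==> x = x'"
  and ess: "arr_in B z (Fo X) (Fo Y) ==> X : S ==> Y : objs A ==>
  EX f k. arr_in A f X Y & B.iso2 k & cell_in B k (Fa f) z"
begin

text \<open>The endo-1-cell is replaced by an isomorphic image, the monad structure is transported
  to it, and fullness and faithfulness pull the structure and its laws back to
  \<open>A\<close>.\<close>

lemma monad_replete:
 assumes W: "monad_in B W" "base W = Fo X" and X0: "X : S"
 shows "EX w k. monad_in A w & monad_iso B (Fm w) W k"
proof -
 have X: "X : objs A" using X0 S by blast
 note [simp] = W X0 X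
 obtain f k where k: "arr_in A f X X" "B.iso2 k" "cell_in B k (Fa f) (endo W)"
  using ess[of "endo W" X X] by auto
 note [simp] = k(1)[simplified] k(2) k(3)[simplified]
 let ?m = "B.inv2 k .:@B mult W .:@B(k|>@B endo W) .:@B(Fa f<|@B k)" and ?e = "B.inv2 k .:@B eta W"
 have "cell_in B ?m (Fa (f**@A f)) (Fa f)" "cell_in B ?e (Fa (one A X)) (Fa f)" by simp+
 then obtain m e where m: "cell_in A m (f**@A f) f" "Fc m = ?m" and e: "cell_in A e (one A X) f" "Fc e = ?e" using full[of "f**@A f" f ?m] full[of "one A X" f ?e] by auto
 define w where "w = (|base = X, endo = f, mult = m, eta = e|)"
 have Jw: "Fm w = (|base = base W, endo = Fa f, mult = ?m, eta = ?e|)" by(simp add: w_def Fm_def m e)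
 have mi: "monad_iso B (Fm w) W k" unfolding Jw by(rule B.monad_transport) simp_all
 note [simp] = m(1)[simplified] e(1)[simplified]
 note Jm = B.monad_eqs[OF B.monad_isoD(1)[OF mi]]
 have "Fc (m .:@A(f<|@A m)) = Fc (m .:@A(m|>@A f))" "Fc (m .:@A(f<|@A e)) = Fc (idc A f)" "Fc (m .:@A(e|>@A f)) = Fc (idc A f)" using Jm by(simp_all add: w_def)
 from this[THEN faithful] have "monad_in A w" by(simp add: monad_in_def w_def)
 with mi show ?thesis by blast
qed

lemma iso_reflect:
 assumes "B.iso2 (Fc x)" "x : cells A"
 shows "A.iso2 x"
proof -
 note [simp] = assms
 obtain y where y: "cell_in A y (ctrg A x) (csrc A x)" "Fc y = B.inv2 (Fc x)" using full[of "ctrg A x" "csrc A x" "B.inv2 (Fc x)"] by auto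
 have "Fc (y .:@A x) = Fc (idc A (csrc A x))" "Fc (x .:@A y) = Fc (idc A (ctrg A x))" using y by simp+
 from this[THEN faithful] show ?thesis by(rule A.inv2_unique(2)[OF assms(2) y(1)])
qed

lemma alg_reflect:
 assumes T: "monad_in A T" and x: "arr_in A x X (base T)" "cell_in A b (endo T**@A x) x" and b: "alg B (Fm T) Y (Fa x) (Fc b)"
 shows "alg A T X x b"
proof -
 note [simp] = T x[simplified]
 have "Fc (b .:@A(endo T<|@A b)) = Fc (b .:@A(mult T|>@A x))" "Fc (b .:@A(eta T|>@A x)) = Fc (idc A x)" using B.algD(7,8)[OF b] by simp+
 from this[THEN faithful] show ?thesis by(simp add: alg_def)
qed

lemma algm_reflect:
 assumes T: "monad_in A T" and b: "alg A T X x b" and c: "alg A T X y c" and h: "algm B (Fm T) (Fa x) (Fc b) (Fa y) (Fc c) h"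
 shows "EX k. algm A T x b y c k & Fc k = h"
proof -
 note [simp] = T A.algD(1-6)[OF b] A.algD(1-6)[OF c]
 obtain k where k: "cell_in A k x y" "Fc k = h" using full[of x y h] B.algmD(1-3)[OF h] by auto
 note [simp] = k(1)[simplified]
 have "Fc (k .:@A b) = Fc (c .:@A(endo T<|@A k))" using B.algmD(4)[OF h] k(2) by simp
 from this[THEN faithful] show ?thesis using k(2) by(intro exI[of _ k]) (simp add: algm_def)
qed

lemma alg_ess:
 assumes T: "monad_in A T" and X0: "X : S" and c: "alg B (Fm T) (Fo X) z c"
 shows "EX x b k. alg A T X x b & B.iso2 k & algm B (Fm T) (Fa x) (Fc b) z c k"
proof -
 have X: "X : objs A" using X0 S by blast
 note [simp] = T X0 X B.algD(1-6)[OF c, simplified]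
 obtain x k where k: "arr_in A x X (base T)" "B.iso2 k" "cell_in B k (Fa x) z" using ess[of z X "base T"] by auto
 note [simp] = k(1)[simplified] k(2) k(3)[simplified]
 let ?c = "B.inv2 k .:@B c .:@B(Fa (endo T)<|@B k)"
 obtain b where b: "cell_in A b (endo T**@A x) x" "Fc b = ?c" using full[of "endo T**@A x" x ?c] by auto
 have c': "alg B (Fm T) (Fo X) (Fa x) ?c" "algm B (Fm T) (Fa x) ?c z c k" using B.alg_transport[OF F_monad[OF T] c, of k "Fa x"] by simp+
 then show ?thesis using alg_reflect[OF T k(1) b(1)] b(2) k(2) by metis
qed

text \<open>The hom-categories out of \<open>X\<close> are equivalent to those out of
  \<open>Fo X\<close>, and so are the categories of algebras, compatibly with acting by
  \<open>u\<close>. So one action is an equivalence exactly when the other is.\<close>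

lemma univ_iff:
 assumes T: "monad_in A T" and a: "alg A T (src A u) u a" and X0: "X : S"
 shows "univ A T u a X <-> univ B (Fm T) (Fa u) (Fc a) (Fo X)"
proof
 have X: "X : objs A" using X0 S by blast
 note [simp] = T X0 X A.algD(1,3-6)[OF a]
 note T' = F_monad[OF T] and a' = F_alg[OF T a]
 have act: "alg A T X (u**@A g) (a|>@A g)" "alg B (Fm T) (Fo X) (Fa u**@B Fa g) (Fc a|>@B Fa g)" if "arr_in A g X (src A u)" for g
  using A.alg_act[OF T a that] B.alg_act[OF T' a', of "Fa g" "Fo X"] that by simp+
 {
  assume u: "univ B (Fm T) (Fa u) (Fc a) (Fo X)"
  show "univ A T u a X"
  proof (rule A.univI[OF a])
  fix g g' h assume g: "arr_in A g X (src A u)" "arr_in A g' X (src A u)" and h: "algm A T (u**@A g) (a|>@A g) (u**@A g') (a|>@A g') h"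
  note [simp] = g[simplified] A.algmD(1-3)[OF h]
  have "algm B (Fm T) (Fa u**@B Fa g) (Fc a|>@B Fa g) (Fa u**@B Fa g') (Fc a|>@B Fa g') (Fc h)" using F_algm[OF T act(1)[OF g(1)] act(1)[OF g(2)] h] by simp
  then have ex: "EX! y. cell_in B y (Fa g) (Fa g') & Fa u<|@B y = Fc h" using B.univD(2)[OF u, of "Fa g" "Fa g'" "Fc h"] by simp
  then obtain y where y: "cell_in B y (Fa g) (Fa g')" "Fa u<|@B y = Fc h" by blast
  obtain x where x: "cell_in A x g g'" "Fc x = y" using full[OF _ _ y(1)] by auto
  show "EX! x. cell_in A x g g' & u<|@A x = h"
  proof (rule ex1I[of _ x])
  have "Fc (u<|@A x) = Fc h" using x y by simp
  from faithful[OF this] show "cell_in A x g g' & u<|@A x = h" using x(1) by blast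
  fix z assume z: "cell_in A z g g' & u<|@A z = h"
  then have "cell_in B (Fc z) (Fa g) (Fa g') & Fa u<|@B Fc z = Fc h" using F_whisk(1)[of z u] by auto
  then have "Fc z = Fc x" using ex y x(2) by blast
  then show "z = x" by(rule faithful)
  qed
  next
  fix x b assume b: "alg A T X x b"
  obtain G k where G: "arr_in B G (Fo X) (Fo (src A u))" "B.iso2 k" "algm B (Fm T) (Fa u**@B G) (Fc a|>@B G) (Fa x) (Fc b) k"
  using B.univD(3)[OF u F_alg[OF T b]] by auto
  obtain g p where g: "arr_in A g X (src A u)" "B.iso2 p" "cell_in B p (Fa g) G" using ess[OF G(1)] by auto
  note [simp] = g(1)[simplified] g(2) g(3)[simplified] G(1)[simplified] G(2) B.algmD(1-3)[OF G(3)]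
  have 1: "algm B (Fm T) (Fa u**@B Fa g) (Fc a|>@B Fa g) (Fa u**@B G) (Fc a|>@B G) (Fa u<|@B p)" using B.algm_lwhisk[OF T' a' g(3), of "Fo X"] by simp
  have 2: "algm B (Fm T) (Fa (u**@A g)) (Fc (a|>@A g)) (Fa x) (Fc b) (k .:@B(Fa u<|@B p))"
  using B.algm_comp[OF T' act(2)[OF g(1)] B.alg_act[OF T' a' ] F_alg[OF T b] 1 G(3)] G(1) by simp
  obtain h where h: "algm A T (u**@A g) (a|>@A g) x b h" "Fc h = k .:@B(Fa u<|@B p)"
  using algm_reflect[OF T act(1)[OF g(1)] b 2] by blast
  have "A.iso2 h" by(rule iso_reflect) (use A.algmD(1)[OF h(1)] in \<open>simp_all add: h(2)\<close>)
  then show "EX g k. arr_in A g X (src A u) & A.iso2 k & algm A T (u**@A g) (a|>@A g) x b k" using h g(1) by blast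
  qed
 }
 {
  assume u: "univ A T u a X"
  show "univ B (Fm T) (Fa u) (Fc a) (Fo X)"
  proof (rule B.univI)
  show "alg B (Fm T) (src B (Fa u)) (Fa u) (Fc a)" using a' by simp
  fix G G' h assume G: "arr_in B G (Fo X) (src B (Fa u))" "arr_in B G' (Fo X) (src B (Fa u))"
  and h: "algm B (Fm T) (Fa u**@B G) (Fc a|>@B G) (Fa u**@B G') (Fc a|>@B G') h"
  obtain g p where g: "arr_in A g X (src A u)" "B.iso2 p" "cell_in B p (Fa g) G" using ess[of G X "src A u"] G by auto
  obtain g' p' where g': "arr_in A g' X (src A u)" "B.iso2 p'" "cell_in B p' (Fa g') G'" using ess[of G' X "src A u"] G by auto
  note [simp] = g(1)[simplified] g(2) g(3)[simplified] g'(1)[simplified] g'(2) g'(3)[simplified] G[simplified] B.algmD(1-3)[OF h]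
  let ?h = "(Fa u<|@B B.inv2 p') .:@B h .:@B(Fa u<|@B p)"
  have aG: "alg B (Fm T) (Fo X) (Fa u**@B G) (Fc a|>@B G)" "alg B (Fm T) (Fo X) (Fa u**@B G') (Fc a|>@B G')"
  using B.alg_act[OF T' a', of G "Fo X"] B.alg_act[OF T' a', of G' "Fo X"] by simp+
  have 1: "algm B (Fm T) (Fa u**@B Fa g) (Fc a|>@B Fa g) (Fa u**@B G) (Fc a|>@B G) (Fa u<|@B p)"
  "algm B (Fm T) (Fa u**@B G') (Fc a|>@B G') (Fa u**@B Fa g') (Fc a|>@B Fa g') (Fa u<|@B B.inv2 p')"
  using B.algm_lwhisk[OF T' a' g(3), of "Fo X"] B.algm_lwhisk[OF T' a', of "B.inv2 p'" G' "Fa g'" "Fo X"] by simp+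
  have "algm B (Fm T) (Fa u**@B Fa g) (Fc a|>@B Fa g) (Fa u**@B Fa g') (Fc a|>@B Fa g') ?h"
  by(rule B.algm_comp[OF T' act(2)[OF g(1)] aG(2) act(2)[OF g'(1)] B.algm_comp[OF T' act(2)[OF g(1)] aG 1(1) h] 1(2)])
  then have "algm B (Fm T) (Fa (u**@A g)) (Fc (a|>@A g)) (Fa (u**@A g')) (Fc (a|>@A g')) ?h" by simp
  then obtain k where k: "algm A T (u**@A g) (a|>@A g) (u**@A g') (a|>@A g') k" "Fc k = ?h" using algm_reflect[OF T act(1)[OF g(1)] act(1)[OF g'(1)]] by blast
  obtain x where x: "cell_in A x g g'" "u<|@A x = k" using A.univD(2)[OF u g(1) g'(1) k(1)] by blast
  note [simp] = x(1)[simplified]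
  have ux: "Fa u<|@B Fc x = ?h" using x k(2) F_whisk(1)[of x u] by simp
  show "EX! y. cell_in B y G G' & Fa u<|@B y = h"
  proof (rule ex1I[of _ "p' .:@B Fc x .:@B B.inv2 p"])
  show "cell_in B (p' .:@B Fc x .:@B B.inv2 p) G G' & Fa u<|@B(p' .:@B Fc x .:@B B.inv2 p) = h" using ux by simp
  fix y assume y: "cell_in B y G G' & Fa u<|@B y = h"
  then have [simp]: "y : cells B" "csrc B y = G" "ctrg B y = G'" and uy: "Fa u<|@B y = h" by auto
  obtain z where z: "cell_in A z g g'" "Fc z = B.inv2 p' .:@B y .:@B p" using full[of g g' "B.inv2 p' .:@B y .:@B p"] by auto
  note [simp] = z(1)[simplified]
  have "Fc (u<|@A z) = Fc (u<|@A x)" using ux uy z(2) by simp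
  from faithful[OF this] have "z = x" by(rule A.univ_faithful[OF T u g(1) z(1) x(1)])
  then show "y = p' .:@B Fc x .:@B B.inv2 p" using z(2) by simp
  qed
  next
  fix z c assume c: "alg B (Fm T) (Fo X) z c"
  obtain x b k where b: "alg A T X x b" "B.iso2 k" "algm B (Fm T) (Fa x) (Fc b) z c k" using alg_ess[OF T X0 c] by blast
  obtain g h where g: "arr_in A g X (src A u)" "A.iso2 h" "algm A T (u**@A g) (a|>@A g) x b h" using A.univD(3)[OF u b(1)] by blast
  have 1: "algm B (Fm T) (Fa u**@B Fa g) (Fc a|>@B Fa g) (Fa x) (Fc b) (Fc h)" using F_algm[OF T act(1)[OF g(1)] b(1) g(3)] g(1) by simp
  have "algm B (Fm T) (Fa u**@B Fa g) (Fc a|>@B Fa g) z c (k .:@B Fc h)" by(rule B.algm_comp[OF T' act(2)[OF g(1)] F_alg[OF T b(1)] c 1 b(3)])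
  then show "EX g k. arr_in B g (Fo X) (src B (Fa u)) & B.iso2 k & algm B (Fm T) (Fa u**@B g) (Fc a|>@B g) z c k"
  using g b(2) A.algmD(1-3)[OF g(3)] B.algmD(1-3)[OF b(3)] by(intro exI[of _ "Fa g"] exI[of _ "k .:@B Fc h"]) simp
  qed
 }
qed

end

section \<open>Universal algebras for monads in EM_dm(K)\<close>

context em
begin

lemma J_full:
 assumes "cell_in M y (Ja K f) (Ja K g)" "f : arrs K" "g : arrs K"
 shows "EX r. cell r f g & y = Jc K r"
proof -
 obtain r where y: "y = (Ja K f, Ja K g, r)" using assms(1) by(cases y) (simp add: EM_dm_simps)
 have c: "idm (src K g) = idm (src K f)" "dm_cell (idm (src K f)) (idm (trg K f)) f (idc K f) g (idc K g) r" using assms(1) unfolding y cell_in_def Ja_def EM_dm_cell by simp+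
 have "src K g = src K f" using arg_cong[OF c(1), of base] by simp
 then have "cell r f g" using dm_cellD(3-5)[OF c(2)] assms(2,3) by simp
 then show ?thesis using y by(auto simp: Jc_def)
qed

lemma J_faithful: "Jc K r = Jc K r' ==> r = r'"
 by(simp add: Jc_def)

text \<open>Between identity monads the law of a 1-cell says that \<open>p\<close> is idempotent,
  and the identity of \<open>(f, p)\<close> is \<open>p\<close>. The halves of a splitting of
  \<open>p\<close> are therefore mutually inverse. Splitting is assumed for one hom-category only,
  so that the lemma can be used in the collage.\<close>

lemma J_ess:
 assumes cc: "!!f e. arr f A B ==> cell e f f ==> e .: e = e ==>
  EX g r s. arr g A B & cell r f g & cell s g f & s .: r = e & r .: s = idc K g" and x: "arr_in M x (idm A) (idm B)" and AB: "A : objs K" "B : objs K"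
 shows "EX f k. arr f A B & M.iso2 k & cell_in M k (Ja K f) x"
proof -
 note [simp] = AB
 obtain f p where x': "x = (idm A, idm B, f, p)" and p: "dm_arr (idm A) (idm B) f p"
  using x by(cases x) (simp add: EM_dm_simps)
 note [simp] = dm_arrD(3-8)[OF p, simplified]
 have pp: "p .: p = p" using dm_arrD(9)[OF p] by simp
 then obtain f0 r s where s: "cell r f f0" "cell s f0 f" "arr f0 A B" "s .: r = p" "r .: s = idc K f0" using cc[of f p] by auto
 note [simp] = s(1-3)[simplified]
 have ps: "p .: s = s" "r .: p = r" unfolding s(4)[symmetric] using s(5) vx2[OF s(5)] by simp+
 have k: "dm_cell (idm A) (idm B) f0 (idc K f0) f p s" "dm_cell (idm A) (idm B) f p f0 (idc K f0) r" using p dm_arr_id[of f0] by(simp_all add: dm_cell_def kap_def ps)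
 have "M.iso2 (Ja K f0, x, s)" by(rule M.inv2_unique(2)[of _ "(x, Ja K f0, r)"]) (use k in \<open>simp_all add: x' Ja_def EM_dm_simps EM_dm_cell s(4,5)\<close>)
 then show ?thesis using k by(intro exI[of _ f0] exI[of _ "(Ja K f0, x, s)"]) (simp add: x' Ja_def EM_dm_simps EM_dm_cell)
qed

lemma J_loc_equiv:
 assumes "Cat_cc_category K"
 shows "loc_equiv K M idm (Ja K) (Jc K) (objs K)"
proof (intro loc_equiv.intro J.strict_fun_axioms loc_equiv_axioms.intro)
 show "EX r. cell r f g & Jc K r = y" if "f : arrs K" "g : arrs K" "cell_in M y (Ja K f) (Ja K g)" for f g y
  using J_full[OF that(3,1,2)] by auto
 show "EX f k. arr f X Y & M.iso2 k & cell_in M k (Ja K f) z" if "arr_in M z (idm X) (idm Y)" "X : objs K" "Y : objs K" for z X Y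
  by(rule J_ess[OF cc_split[OF assms] that])
qed (use J_faithful in blast)+

abbreviation "compM S == comp_monad M (dV (base S)) (dmL K (base S)) (dme K (base S)) (Jc K (eta (base S))) S"
abbreviation "compA S == comp_alg M (dV (base S)) (dme K (base S)) S"

lemma adj_compI:
 assumes S: "monad_in M S"
 shows "adj_comp M (dV (base S)) (dmL K (base S)) (dme K (base S)) (Jc K (eta (base S))) S"
 using M.monad_types(1)[OF S] adj[of "base S"] S by(intro adj_comp.intro adj_comp_axioms.intro M.two_category_axioms) simp_all

text \<open>The section \<open>j\<close> comes from \<open>split_counit\<close> applied to
  \<open>V S\<close>, a 1-cell into an identity monad; universality of \<open>V\<close> at
  \<open>X\<close> is \<open>V_univ\<close>.\<close>

lemma adj_comp_univI:
 assumes S: "monad_in M S" and X: "mon X"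
 obtains j where "adj_comp_univ M (dV (base S)) (dmL K (base S)) (dme K (base S)) (Jc K (eta (base S))) S X j"
proof -
 have T [simp]: "mon (base S)" using M.monad_types(1)[OF S] by simp
 note [simp] = S
 obtain j where "cell_in M j (cmp M (dV (base S)) (endo S))
  (cmp M (cmp M (dV (base S)) (endo S)) (cmp M (dmL K (base S)) (dV (base S))))"
  "vc M (cmp M (dV (base S)) (endo S)<|@M dme K (base S)) j = idc M (cmp M (dV (base S)) (endo S))"
  using split_counit[of "cmp M (dV (base S)) (endo S)" "base S" "base (base S)"] by auto
 then have "adj_comp_univ M (dV (base S)) (dmL K (base S)) (dme K (base S)) (Jc K (eta (base S))) S X j" using V_univ[OF T X] adj_compI[OF S] adj_monad_eq[OF T]
  by(intro adj_comp_univ.intro adj_comp_univ_axioms.intro) simp_all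
 then show ?thesis by(rule that)
qed

text \<open>A certificate that \<open>(x, b)\<close> is universal: the inclusion of \<open>w\<close>
  is isomorphic to the composite monad, and \<open>V x\<close> with its induced action is isomorphic
  to the universal algebra of \<open>w\<close>. Only equations and invertible cells occur, so strict
  2-functors preserve certificates, whereas preservation of universality is not evident from its
  definition.\<close>

definition em_data where
 "em_data S w k x b h <-> monad_in M S & mon w & monad_iso M (Jm w) (compM S) k & alg M S (src M x) x b &
  M.iso2 h & algm M (compM S) (cmp M (dV (base S)) x) (compA S x b) (dV w) (vc M (dma K w) (M.inv2 k|>@M dV w)) h"

text \<open>The algebra \<open>dV w\<close> is universal for its own monad. Along the isomorphisms
  of the certificate \<open>V x\<close> is then universal for the composite monad, and
  \<open>univ_comp_iff\<close> removes \<open>V\<close>.\<close>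

lemma em_data_universal:
 assumes "em_data S w k x b h"
 shows "universal M S x b"
proof -
 have S [simp]: "monad_in M S" and w [simp]: "mon w" and k: "monad_iso M (Jm w) (compM S) k" and b: "alg M S (src M x) x b"
  and h: "M.iso2 h" "algm M (compM S) (cmp M (dV (base S)) x) (compA S x b) (dV w) (vc M (dma K w) (M.inv2 k|>@M dV w)) h"
  using assms by(auto simp: em_data_def)
 have T [simp]: "mon (base S)" using M.monad_types(1)[OF S] by simp
 note C = adj_compI[OF S]
 note [simp] = M.algD(1,3-6)[OF b] M.algmD(1-3)[OF h(2)]
 have sx: "src M x = w" using M.cell_simps(3)[OF M.algmD(1)[OF h(2)]] by simp
 have "univ M S x b X" if X: "mon X" for X
 proof -
  obtain j where j: "adj_comp_univ M (dV (base S)) (dmL K (base S)) (dme K (base S)) (Jc K (eta (base S))) S X j"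
  using adj_comp_univI[OF S X] .
  have u: "univ M (compM S) (dV w) (vc M (dma K w) (M.inv2 k|>@M dV w)) X" by(rule M.univ_change_monad[OF M.monad_iso_inv[OF k] V_univ[OF w X]])
  have a: "alg M (compM S) w (cmp M (dV (base S)) x) (compA S x b)" using adj_comp.comp_algI[OF C b] sx by simp
  have "univ M (compM S) (cmp M (dV (base S)) x) (compA S x b) X"
  using M.univ_change_alg[OF adj_comp.monad_comp[OF C] u _ M.algm_inv[OF adj_comp.monad_comp[OF C] a _ h(2,1)]] a M.univD(1)[OF u] h(1) by simp
  then show ?thesis using adj_comp_univ.univ_comp_iff[OF j b] by simp
 qed
 with b show ?thesis by(simp add: universal_def)
qed

text \<open>Splitting of idempotents in \<open>K\<close> provides \<open>w\<close>, and
  \<open>comp_eso\<close> at the test object \<open>w\<close> lifts the universal algebra of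
  \<open>w\<close> to an \<open>S\<close>-algebra.\<close>

lemma em_data_ex:
 assumes cc: "Cat_cc_category K" and S: "monad_in M S"
 shows "EX w k x b h. em_data S w k x b h"
proof -
 note [simp] = S
 have T [simp]: "mon (base S)" using M.monad_types(1)[OF S] by simp
 note C = adj_compI[OF S]
 have "base (compM S) = idm (base (base S))" by(simp add: comp_monad_def)
 from loc_equiv.monad_replete[OF J_loc_equiv[OF cc] adj_comp.monad_comp[OF C] this monad_types(1)[OF T]]
 obtain w k where w: "mon w" and k: "monad_iso M (Jm w) (compM S) k" by blast
 note [simp] = w
 obtain j where j: "adj_comp_univ M (dV (base S)) (dmL K (base S)) (dme K (base S)) (Jc K (eta (base S))) S w j"
  using adj_comp_univI[OF S w] .
 have "alg M (compM S) w (dV w) (vc M (dma K w) (M.inv2 k|>@M dV w))" by(rule M.alg_change[OF M.monad_iso_inv[OF k] V_alg[OF w]])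
 from adj_comp_univ.comp_eso[OF j this] obtain x b h where x: "alg M S w x b"
  "algm M (compM S) (cmp M (dV (base S)) x) (compA S x b) (dV w) (vc M (dma K w) (M.inv2 k|>@M dV w)) h" "M.iso2 h"
  by blast
 then have "em_data S w k x b h" using M.algD(2)[OF x(1)] k w by(simp add: em_data_def)
 then show ?thesis by blast
qed

end

theorem (in two_category) EM_dm_universal_ex:
 assumes "Cat_cc_category K" "monad_in E*K S"
 shows "EX x b. universal E*K S x b"
 using em.em_data_ex[OF em assms] em.em_data_universal[OF em] by blast

section \<open>Functoriality of EM_dm and preservation of universal algebras\<close>

context strict_fun
begin

definition EFa :: "('o, 'a, 'c) EM_dm_arr => ('p, 'b, 'd) EM_dm_arr" where
 "EFa = (%(T, S, f, p). (Fm T, Fm S, Fa f, Fc p))"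

definition EFc :: "('o, 'a, 'c) EM_dm_cell => ('p, 'b, 'd) EM_dm_cell" where
 "EFc = (%(a, b, r). (EFa a, EFa b, Fc r))"

lemma F_dm_arr:
 assumes "A.dm_arr T S f p"
 shows "B.dm_arr (Fm T) (Fm S) (Fa f) (Fc p)"
proof -
 note [simp] = A.dm_arrD(1-8)[OF assms]
 have "Fc ((f<|@A mult T) .:@A(p|>@A endo T) .:@A(endo S<|@A p)) = Fc (p .:@A(mult S|>@A f))" using A.dm_arrD(9)[OF assms] by simp
 then show ?thesis by(intro B.dm_arrI) simp_all
qed

lemma F_dm_cell:
 assumes "A.dm_cell T S f p g q r"
 shows "B.dm_cell (Fm T) (Fm S) (Fa f) (Fc p) (Fa g) (Fc q) (Fc r)" "Fc (A.kap T p g r) = B.kap (Fm T) (Fc p) (Fa g) (Fc r)"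
proof -
 note a = A.dm_cellD(1,2)[OF assms]
 note [simp] = A.dm_arrD(1-8)[OF a(1)] A.dm_arrD(3-8)[OF a(2)] A.dm_cellD(3-5)[OF assms]
 show k: "Fc (A.kap T p g r) = B.kap (Fm T) (Fc p) (Fa g) (Fc r)" by(simp add: A.kap_def B.kap_def)
 have "Fc ((g<|@A mult T) .:@A(q|>@A endo T) .:@A(endo S<|@A r)) = Fc (A.kap T p g r)"
  "Fc ((g<|@A mult T) .:@A(q|>@A endo T) .:@A(eta S|>@A(g**@A endo T)) .:@A r) = Fc r"
  using A.dm_cellD(6,7)[OF assms] by simp+
 then show "B.dm_cell (Fm T) (Fm S) (Fa f) (Fc p) (Fa g) (Fc q) (Fc r)" using F_dm_arr[OF a(1)] F_dm_arr[OF a(2)] by(simp add: B.dm_cell_def k)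
qed

theorem EF: "strict_fun E*A E*B Fm EFa EFc"
proof (intro strict_fun.intro A.EM_dm_two_category B.EM_dm_two_category strict_fun_axioms.intro)
 show "X : objs E*A ==> Fm X : objs E*B" for X by(simp add: A.EM_dm_simps B.EM_dm_simps)
 fix f assume f: "f : arrs E*A"
 then show "EFa f : arrs E*B" "src E*B (EFa f) = Fm (src E*A f)" "trg E*B (EFa f) = Fm (trg E*A f)"
  "EFc (idc E*A f) = idc E*B (EFa f)"
  using F_dm_arr by(cases f; auto simp: EFa_def EFc_def A.EM_dm_simps B.EM_dm_simps A.dm_arrD(1-8))+
 fix g assume "g : arrs E*A" "trg E*A f = src E*A g"
 with f show "EFa (cmp E*A g f) = cmp E*B (EFa g) (EFa f)" by(cases f; cases g) (auto simp: EFa_def A.EM_dm_simps B.EM_dm_simps A.dm_arrD(1-8))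
next
 fix x assume "x : cells E*A"
 then obtain T S f p g q r where x: "x = ((T, S, f, p), (T, S, g, q), r)" "A.dm_cell T S f p g q r" by(rule A.EM_dm_cellE)
 note cx = F_dm_cell[OF x(2)]
 show "EFc x : cells E*B" "csrc E*B (EFc x) = EFa (csrc E*A x)" "ctrg E*B (EFc x) = EFa (ctrg E*A x)"
  using cx by(simp_all add: x(1) EFa_def EFc_def A.EM_dm_simps B.EM_dm_simps B.EM_dm_cell)
 note [simp] = A.dm_arrD(1-8)[OF A.dm_cellD(1)[OF x(2)]] A.dm_arrD(3-8)[OF A.dm_cellD(2)[OF x(2)]] A.dm_cell_types[OF x(2)]
 fix y assume y0: "y : cells E*A"
 then obtain T' S' f' p' g' q' z where y: "y = ((T', S', f', p'), (T', S', g', q'), z)" "A.dm_cell T' S' f' p' g' q' z" by(rule A.EM_dm_cellE)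
 {
  assume "ctrg E*A x = csrc E*A y"
  then have e: "T' = T" "S' = S" "f' = g" "p' = q" by(simp_all add: x(1) y(1) A.EM_dm_simps)
  note y' = y(2)[unfolded e]
  note [simp] = A.dm_arrD(3-8)[OF A.dm_cellD(2)[OF y']] A.dm_cell_types[OF y']
  from e show "EFc (vc E*A y x) = vc E*B (EFc y) (EFc x)" by(simp add: x(1) y(1) EFa_def EFc_def A.EM_dm_simps B.EM_dm_simps)
 next
  assume "trg E*A (csrc E*A x) = src E*A (csrc E*A y)"
  then have T': "T' = S" by(simp add: x(1) y(1) A.EM_dm_simps)
  note y' = y(2)[unfolded T'] and cy = F_dm_cell(1)[OF y(2)[unfolded T']]
  note [simp] = A.dm_arrD(1-8)[OF A.dm_cellD(1)[OF y']] A.dm_arrD(3-8)[OF A.dm_cellD(2)[OF y']] A.dm_cell_types[OF y']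
  show "EFc (hc E*A y x) = hc E*B (EFc y) (EFc x)" unfolding x(1) y(1) T' A.EM_dm_hc[OF x(2) y'] EFc_def EFa_def prod.case B.EM_dm_hc[OF cx(1) cy] by(simp add: cx(2))
 }
qed (simp add: EFa_def A.EM_dm_simps B.EM_dm_simps)

lemma Fm_id: "X : objs A ==> Fm (id_monad A X) = id_monad B (Fo X)"
 by(simp add: Fm_def id_monad_def)

lemma EF_simps:
 "f : arrs A ==> EFa (Ja A f) = Ja B (Fa f)" "x : cells A ==> EFc (Jc A x) = Jc B (Fc x)"
 "monad_in A T ==> EFa (dmV A T) = dmV B (Fm T)" "monad_in A T ==> EFa (dmL A T) = dmL B (Fm T)"
 "monad_in A T ==> EFc (dme A T) = dme B (Fm T)" "monad_in A T ==> EFc (dma A T) = dma B (Fm T)"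
 by(simp_all add: EFa_def EFc_def Ja_def Jc_def dmV_def dmL_def dme_def dma_def Fm_id)

lemma F_comp_monad:
 assumes "adj_comp A V L e n S"
 shows "Fm (comp_monad A V L e n S) = comp_monad B (Fa V) (Fa L) (Fc e) (Fc n) (Fm S)"
  "alg A S X x b ==> Fc (comp_alg A V e S x b) = comp_alg B (Fa V) (Fc e) (Fm S) (Fa x) (Fc b)"
proof -
 interpret C: adj_comp A V L e n S by fact
 show "Fm (comp_monad A V L e n S) = comp_monad B (Fa V) (Fa L) (Fc e) (Fc n) (Fm S)" unfolding comp_monad_def Fm_def by simp
 assume b: "alg A S X x b"
 note [simp] = A.algD(1-6)[OF b]
 show "Fc (comp_alg A V e S x b) = comp_alg B (Fa V) (Fc e) (Fm S) (Fa x) (Fc b)" by(simp add: comp_alg_def)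
qed

text \<open>Some universal algebra of \<open>S\<close> has a certificate, whose image is again a
  certificate. The given one differs from it by an equivalence (\<open>universal_unique\<close>),
  and strict 2-functors preserve equivalences. The collage will serve as \<open>B\<close>, where
  splitting is available only for 1-cells out of \<open>L\<close>.\<close>

theorem EM_image_universal:
 assumes cc: "Cat_cc_category A" and u: "universal E*A S x b" and S: "monad_in E*A S"
 shows "universal E*B (strict_fun.Fm Fm EFa EFc S) (EFa x) (EFc b)"
proof -
 interpret EF: strict_fun "EM_dm A" "EM_dm B" Fm EFa EFc by(rule EF)
 interpret MA: em A by(rule A.em)
 interpret MB: em B by(rule B.em)
 note [simp] = S
 have T [simp]: "monad_in A (base S)" using EF.A.monad_types(1)[OF S] by simp
 obtain w k y c h where d: "MA.em_data S w k y c h" using MA.em_data_ex[OF cc S] by blast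
 then have v: "universal E*A S y c" by(rule MA.em_data_universal)
 note C = MA.adj_compI[OF S]
 have w [simp]: "monad_in A w" and k: "monad_iso E*A (MA.Jm w) (MA.compM S) k" and c: "alg E*A S (src E*A y) y c"
  and h: "EF.A.iso2 h" "algm E*A (MA.compM S) (cmp E*A (dmV A (base S)) y) (MA.compA S y c) (dmV A w)
  (vc E*A (dma A w) (EF.A.inv2 k |>@E*A dmV A w)) h"
  using d by(auto simp: MA.em_data_def)
 note [simp] = EF.A.algD(1,3-6)[OF c] EF.A.monad_isoD(1-7)[OF k]
 have eA: "base (EF.Fm S) = Fm (base S)" by simp
 have W: "EF.Fm (MA.compM S) = MB.compM (EF.Fm S)" "EFc (MA.compA S y c) = MB.compA (EF.Fm S) (EFa y) (EFc c)" using F_comp_monad EF.F_comp_monad[OF C] c by(simp_all add: EF_simps)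
 have Jw: "EF.Fm (MA.Jm w) = MB.Jm (Fm w)" by(simp add: EF.Fm_def MA.J.Fm_def MB.J.Fm_def EF_simps Fm_id)
 have k': "monad_iso E*B (MB.Jm (Fm w)) (MB.compM (EF.Fm S)) (EFc k)" using EF.F_monad_iso[OF k] unfolding W Jw .
 have c': "alg E*B (EF.Fm S) (src E*B (EFa y)) (EFa y) (EFc c)" using EF.F_alg[OF S c] by simp
 have a1: "alg E*A (MA.compM S) (src E*A y) (cmp E*A (dmV A (base S)) y) (MA.compA S y c)" by(rule adj_comp.comp_algI[OF C c])
 have a2: "alg E*A (MA.compM S) w (dmV A w) (vc E*A (dma A w) (EF.A.inv2 k |>@E*A dmV A w))" by(rule EF.A.alg_change[OF EF.A.monad_iso_inv[OF k] MA.V_alg[OF w]])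
 note [simp] = EF.A.algmD(1-3)[OF h(2)]
 have sy: "src E*A y = w" using EF.A.cell_simps(3)[OF EF.A.algmD(1)[OF h(2)]] by simp
 have ek: "endo (MA.Jm w) = Ja A (endo w)" by simp
 have h': "algm E*B (MB.compM (EF.Fm S)) (cmp E*B (dmV B (Fm (base S))) (EFa y)) (MB.compA (EF.Fm S) (EFa y) (EFc c))
  (dmV B (Fm w)) (vc E*B (dma B (Fm w)) (EF.B.inv2 (EFc k) |>@E*B dmV B (Fm w))) (EFc h)"
  using EF.F_algm[OF adj_comp.monad_comp[OF C] a1[unfolded sy] a2 h(2)] unfolding W
  by(simp add: EF_simps)
 have "MB.em_data (EF.Fm S) (Fm w) (EFc k) (EFa y) (EFc c) (EFc h)" using k' c' h' h(1) by(simp add: MB.em_data_def)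
 then have v': "universal E*B (EF.Fm S) (EFa y) (EFc c)" by(rule MB.em_data_universal)
 obtain e q where e: "equiv_arr E*A e" "arr_in E*A e (src E*A x) (src E*A y)" "EF.A.iso2 q"
  "algm E*A S (cmp E*A y e) (c |>@E*A e) x b q" using EF.A.universal_unique[OF S v u] by blast
 have b: "alg E*A S (src E*A x) x b" using u by(simp add: universal_def)
 note [simp] = EF.A.algD(1,3-6)[OF b] e(2)[simplified] e(3)
 have S': "monad_in E*B (EF.Fm S)" by simp
 have "univ E*B (EF.Fm S) (EFa x) (EFc b) X" if "X : objs E*B" for X
 proof -
  have 1: "univ E*B (EF.Fm S) (cmp E*B (EFa y) (EFa e)) (EFc c |>@E*B EFa e) X"
  by(rule EF.B.univ_precomp[OF S' _ EF.F_equiv_arr[OF e(1)]]) (use v' that in \<open>simp_all add: universal_def\<close>)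
  have 2: "alg E*B (EF.Fm S) (src E*B (EFa x)) (EFa x) (EFc b)" using EF.F_alg[OF S b] by simp
  have 3: "algm E*B (EF.Fm S) (cmp E*B (EFa y) (EFa e)) (EFc c |>@E*B EFa e) (EFa x) (EFc b) (EFc q)" using EF.F_algm[OF S EF.A.alg_act[OF S c e(2)] b e(4)] by simp
  show ?thesis by(rule EF.B.univ_change_alg[OF S' 1 _ 3]) (use 2 in simp_all)
 qed
 then show ?thesis using EF.F_alg[OF S b] by(simp add: universal_def)
qed

end

section \<open>Pseudofunctors on monads and algebras\<close>

context pseudofunctor
begin

lemma P_simps [simp]:
 "A : objs K ==> pob F A : objs L"
 "f : arrs K ==> par F f : arrs L" "f : arrs K ==> src L (par F f) = pob F (src K f)" "f : arrs K ==> trg L (par F f) = pob F (trg K f)"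
 "x : cells K ==> pce F x : cells L" "x : cells K ==> csrc L (pce F x) = par F (csrc K x)" "x : cells K ==> ctrg L (pce F x) = par F (ctrg K x)"
 "f : arrs K ==> pce F (idc K f) = idc L (par F f)"
 "x : cells K ==> y : cells K ==> ctrg K x = csrc K y ==> pce F (y .:@K x) = pce F y .:@L pce F x"
 using pob_in par_in[of f "src K f" "trg K f"] pce_in[of x "csrc K x" "ctrg K x"] pce_idc pce_vc[of x "csrc K x" "ctrg K x" y "ctrg K y"] by auto

lemma pc_simps [simp]:
 assumes "f : arrs K" "g : arrs K" "trg K f = src K g"
 shows "L.iso2 (pcomp F g f)" "pcomp F g f : cells L" "csrc L (pcomp F g f) = par F g**@L par F f" "ctrg L (pcomp F g f) = par F (g**@K f)"
 using pcomp_iso[of g f] assms by(auto simp: composable_def L.is_iso2_iff)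

lemma pu_simps [simp]:
 assumes "A : objs K"
 shows "L.iso2 (punit F A)" "punit F A : cells L" "csrc L (punit F A) = one L (pob F A)" "ctrg L (punit F A) = par F (one K A)"
 using punit_iso[of A] assms by(auto simp: L.is_iso2_iff)

lemma pce_iso [simp]:
 assumes "K.iso2 x"
 shows "L.iso2 (pce F x)" "pce F (K.inv2 x) = L.inv2 (pce F x)"
proof -
 note x = K.iso2_cell[OF assms]
 have "pce F (K.inv2 x) .:@L pce F x = idc L (par F (csrc K x))" "pce F x .:@L pce F (K.inv2 x) = idc L (par F (ctrg K x))"
  using assms x P_simps(9)[of x "K.inv2 x"] P_simps(9)[of "K.inv2 x" x] by simp+
 then show "L.iso2 (pce F x)" "pce F (K.inv2 x) = L.inv2 (pce F x)" using L.inv2_unique[of "pce F x" "pce F (K.inv2 x)"] x assms by simp+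
qed

lemma pc_nat:
 "x : cells K ==> y : cells K ==> trg K (csrc K x) = src K (csrc K y) ==>
  pce F (hc K y x) .:@L pcomp F (csrc K y) (csrc K x) = pcomp F (ctrg K y) (ctrg K x) .:@L hc L (pce F y) (pce F x)"
 using pcomp_nat[of x "csrc K x" "ctrg K x" y "csrc K y" "ctrg K y"] by(simp add: composable_def)

lemma pc_lw:
 "x : cells K ==> f : arrs K ==> trg K (csrc K x) = src K f ==>
  pce F (f<|@K x) .:@L pcomp F f (csrc K x) = pcomp F f (ctrg K x) .:@L(par F f<|@L pce F x)"
 using pc_nat[of x "idc K f"] by(simp add: lwhisk_def)

lemma pc_rw:
 "x : cells K ==> f : arrs K ==> src K (csrc K x) = trg K f ==>
  pce F (x|>@K f) .:@L pcomp F (csrc K x) f = pcomp F (ctrg K x) f .:@L(pce F x|>@L par F f)"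
 using pc_nat[of "idc K f" x] by(simp add: rwhisk_def)

lemma pc_assoc:
 "f : arrs K ==> g : arrs K ==> h : arrs K ==> trg K f = src K g ==> trg K g = src K h ==>
  pcomp F (h**@K g) f .:@L(pcomp F h g|>@L par F f) = pcomp F h (g**@K f) .:@L(par F h<|@L pcomp F g f)"
 using pcomp_assoc[of h g f] by(simp add: composable_def)

lemma pu_left: "f : arrs K ==> trg K f = B ==> pcomp F (one K B) f .:@L(punit F B|>@L par F f) = idc L (par F f)"
 and pu_right: "f : arrs K ==> src K f = A ==> pcomp F f (one K A) .:@L(par F f<|@L punit F A) = idc L (par F f)"
 using pcomp_unit_left[of f "src K f" "trg K f"] pcomp_unit_right[of f "src K f" "trg K f"] by auto

lemma pfun_monad_simps [simp]:
 "base (pfun_monad L F T) = pob F (base T)" "endo (pfun_monad L F T) = par F (endo T)"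
 "mult (pfun_monad L F T) = pce F (mult T) .:@L pcomp F (endo T) (endo T)" "eta (pfun_monad L F T) = pce F (eta T) .:@L punit F (base T)"
 by(simp_all add: pfun_monad_def)

lemma P_alg:
 assumes T: "monad_in K T" and b: "alg K T X x b"
 shows "alg L (pfun_monad L F T) (pob F X) (par F x) (pce F b .:@L pcomp F (endo T) x)"
proof -
 note [simp] = T K.algD(1-6)[OF b]
 let ?t = "endo T"
 have 1: "pcomp F ?t x .:@L(par F ?t<|@L pce F b) = pce F (?t<|@K b) .:@L pcomp F ?t (?t**@K x)" using pc_lw[of b ?t] by simp
 have 2: "pcomp F ?t x .:@L(pce F (mult T)|>@L par F x) = pce F (mult T|>@K x) .:@L pcomp F (?t**@K ?t) x" using pc_rw[of "mult T" x] by simp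
 have 3: "pcomp F ?t x .:@L(pce F (eta T)|>@L par F x) = pce F (eta T|>@K x) .:@L pcomp F (one K (base T)) x" using pc_rw[of "eta T" x] by simp
 have 4: "pce F b .:@L pce F (?t<|@K b) = pce F b .:@L pce F (mult T|>@K x)" "pce F b .:@L pce F (eta T|>@K x) = idc L (par F x)"
  using arg_cong[OF K.algD(7)[OF b], of "pce F"] arg_cong[OF K.algD(8)[OF b], of "pce F"] by simp+
 have 5: "pcomp F (one K (base T)) x .:@L(punit F (base T)|>@L par F x) = idc L (par F x)" by(rule pu_left) simp_all
 show ?thesis
  by(simp add: alg_def L.vx2[OF 1] L.vx2[OF 2] L.vx2[OF 3] L.vx2[OF 4(1)] L.vx2[OF 4(2)] pc_assoc 4(2) 5)
qed

lemma P_monad: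
 assumes T: "monad_in K T"
 shows "monad_in L (pfun_monad L F T)"
proof -
 note [simp] = T
 let ?t = "endo T"
 \<comment> \<open>The monad acts on its own 1-cell, so associativity and one unit law of the image
   monad are the laws of \<open>P_alg\<close> for this algebra. Only the other unit law is
   computed.\<close>
 have a: "alg K T (base T) ?t (mult T)" by(simp add: alg_def K.monad_eqs)
 have 1: "pcomp F ?t ?t .:@L(par F ?t<|@L pce F (eta T)) = pce F (?t<|@K eta T) .:@L pcomp F ?t (one K (base T))" using pc_lw[of "eta T" ?t] by simp
 have 2: "pce F (mult T) .:@L pce F (?t<|@K eta T) = idc L (par F ?t)" using arg_cong[OF K.monad_eqs(1)[OF T], of "pce F"] by simp
 have 3: "pcomp F ?t (one K (base T)) .:@L(par F ?t<|@L punit F (base T)) = idc L (par F ?t)" by(rule pu_right) simp_all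
 have "(pce F (mult T) .:@L pcomp F ?t ?t) .:@L(par F ?t<|@L(pce F (eta T) .:@L punit F (base T))) = idc L (par F ?t)" by(simp add: L.vx2[OF 1] 2 3)
 note e = L.algD(7,8)[OF P_alg[OF T a], unfolded pfun_monad_simps] this
 show ?thesis unfolding monad_in_def Let_def pfun_monad_simps by(intro conjI e) simp_all
qed

lemma P_monad_iso:
 assumes t: "monad_iso K T T' t"
 shows "monad_iso L (pfun_monad L F T) (pfun_monad L F T') (pce F t)"
proof -
 note [simp] = K.monad_isoD(1-7)[OF t]
 have 1: "pcomp F (endo T') (endo T') .:@L(pce F t|>@L par F (endo T')) = pce F (t|>@K endo T') .:@L pcomp F (endo T) (endo T')" using pc_rw[of t "endo T'"] by simp
 have 2: "pcomp F (endo T) (endo T') .:@L(par F (endo T)<|@L pce F t) = pce F (endo T<|@K t) .:@L pcomp F (endo T) (endo T)" using pc_lw[of t "endo T"] by simp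
 have 3: "pce F t .:@L pce F (mult T) = pce F (mult T') .:@L pce F (t|>@K endo T') .:@L pce F (endo T<|@K t)"
  "pce F t .:@L pce F (eta T) = pce F (eta T')"
  using arg_cong[OF K.monad_isoD(8)[OF t], of "pce F"] arg_cong[OF K.monad_isoD(9)[OF t], of "pce F"] by simp+
 show ?thesis
  using P_monad[OF K.monad_isoD(1)[OF t]] P_monad[OF K.monad_isoD(2)[OF t]]
  by(simp add: monad_iso_def L.is_iso2_iff L.vx2[OF 1] 2 L.vx2[OF 3(1)] L.vx2[OF 3(2)])
qed

text \<open>Compares the images of an algebra on \<open>u\<close> and of an algebra on
  \<open>u'\<close> along \<open>p\<close> when their monads differ by \<open>t\<close>. The
  conclusion has the shape demanded by \<open>univ_transport\<close>.\<close>

lemma P_alg_nat: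
 assumes t: "monad_in K T" "base T' = base T" "cell_in K t (endo T) (endo T')" and u': "arr_in K u' X (base T)"
  and a: "cell_in K a (endo T**@K u) u" "cell_in K a' (endo T'**@K u') u'" and p: "cell_in K p u u'"
  and e: "p .:@K a = a' .:@K(t|>@K u') .:@K(endo T<|@K p)"
 shows "pce F p .:@L(pce F a .:@L pcomp F (endo T) u) =
  (pce F a' .:@L pcomp F (endo T') u') .:@L(pce F t|>@L par F u') .:@L(par F (endo T)<|@L pce F p)"
proof -
 have u: "arr_in K u X (base T)" "arr_in K (endo T') (base T) (base T)"
  using p t u' K.csrc_arrs K.ctrg_arrs K.src_csrc K.trg_csrc K.monad_types(2-4)[OF t(1)] unfolding arr_in_def cell_in_def by metis+
 note [simp] = t[simplified] u'[simplified] a[simplified] p[simplified] u[simplified]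
 have 1: "pcomp F (endo T') u' .:@L(pce F t|>@L par F u') = pce F (t|>@K u') .:@L pcomp F (endo T) u'" using pc_rw[of t u'] by simp
 have 2: "pcomp F (endo T) u' .:@L(par F (endo T)<|@L pce F p) = pce F (endo T<|@K p) .:@L pcomp F (endo T) u" using pc_lw[of p "endo T"] by simp
 have 3: "pce F p .:@L pce F a = pce F a' .:@L pce F (t|>@K u') .:@L pce F (endo T<|@K p)" using arg_cong[OF e, of "pce F"] by simp
 show ?thesis by(simp add: L.vx2[OF 1] 2 L.vx2[OF 3])
qed

end

section \<open>Demi-EM-objects in terms of universal algebras\<close>

text \<open>The embedding of \<open>K\<close> into \<open>Qstar K\<close>: a 1-cell carries its
  identity as idempotent.\<close>

definition Qa :: "('o, 'a, 'c) two_cat => 'a => 'a \<times> 'c" where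
 "Qa K f = (f, idc K f)"

definition Qc :: "('o, 'a, 'c) two_cat => 'c => ('a \<times> 'c) \<times> ('a \<times> 'c) \<times> 'c" where
 "Qc K x = (Qa K (csrc K x), Qa K (ctrg K x), x)"

context two_category
begin

lemma Q_simps:
 "objs Q*K = objs K"
 "(f, r) : arrs Q*K <-> f : arrs K & cell r f f & r .: r = r"
 "src Q*K (f, r) = src K f" "trg Q*K (f, r) = trg K f" "csrc Q*K (p, q, x) = p" "ctrg Q*K (p, q, x) = q"
 "one Q*K A = (one K A, idc K (one K A))" "cmp Q*K (g, s) (f, r) = (g**f, s \<star> r)"
 "idc Q*K (f, r) = ((f, r), (f, r), r)" "vc Q*K (q', z, y) (p, q, x) = (p, z, y .: x)"
 "hc Q*K ((g, s), (g', s'), y) ((f, r), (f', r'), x) = ((g**f, s \<star> r), (g'**f', s' \<star> r'), y \<star> x)"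
 by(auto simp: Qstar_def cauchy_def Let_def mor_in_hom hom_cat_simps)

lemma Q_cell:
 "((f, r), (g, s), x) : cells Q*K <-> f : arrs K & cell r f f & r .: r = r & g : arrs K & cell s g g & s .: s = s &
  cell x f g & s .: x = x & x .: r = x"
proof
 show "((f, r), (g, s), x) : cells Q*K ==> f : arrs K & cell r f f & r .: r = r & g : arrs K & cell s g g & s .: s = s &
  cell x f g & s .: x = x & x .: r = x"
  by(auto simp: Qstar_def cauchy_def Let_def mor_in_hom hom_cat_simps)
 assume a: "f : arrs K & cell r f f & r .: r = r & g : arrs K & cell s g g & s .: s = s &
  cell x f g & s .: x = x & x .: r = x"
 then have "src K g = src K f" "trg K g = trg K f" using cell_simps(3,4)[of x] by auto
 with a show "((f, r), (g, s), x) : cells Q*K" by(simp add: Qstar_def cauchy_def Let_def mor_in_hom hom_cat_simps)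
qed

lemma Q_cellE:
 assumes "x : cells Q*K"
 obtains f r g s z where "x = ((f, r), (g, s), z)" "f : arrs K" "r : cells K" "csrc K r = f" "ctrg K r = f" "r .: r = r"
  "g : arrs K" "s : cells K" "csrc K s = g" "ctrg K s = g" "s .: s = s" "z : cells K" "csrc K z = f" "ctrg K z = g"
  "s .: z = z" "z .: r = z" "src K g = src K f" "trg K g = trg K f"
proof -
 obtain f r g s z where x: "x = ((f, r), (g, s), z)" by(cases x) auto
 then have c: "((f, r), (g, s), z) : cells Q*K" using assms by simp
 then have "src K g = src K f" "trg K g = trg K f" using cell_simps(3,4)[of z] unfolding Q_cell by auto
 with that[OF x] c show ?thesis unfolding Q_cell by simp
qed

theorem Qstar_two_category: "two_category Q*K"
proof
 fix f assume "f : arrs Q*K"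
 then show "src Q*K f : objs Q*K" "trg Q*K f : objs Q*K" "cell_in Q*K (idc Q*K f) f f" by(cases f; simp add: Q_simps Q_cell)+
next
 fix x assume "x : cells Q*K"
 then obtain f r g s z where x: "x = ((f, r), (g, s), z)" "f : arrs K" "r : cells K" "csrc K r = f" "ctrg K r = f" "r .: r = r"
  "g : arrs K" "s : cells K" "csrc K s = g" "ctrg K s = g" "s .: s = s" "src K g = src K f" "trg K g = trg K f" by(rule Q_cellE)
 then show "csrc Q*K x : arrs Q*K" "ctrg Q*K x : arrs Q*K"
  "src Q*K (csrc Q*K x) = src Q*K (ctrg Q*K x)" "trg Q*K (csrc Q*K x) = trg Q*K (ctrg Q*K x)"
  by(simp_all add: Q_simps)
next
 show "arr_in Q*K (one Q*K A) A A" if "A : objs Q*K" for A using that by(simp add: Q_simps)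
next
 fix f A B g C assume f: "arr_in Q*K f A B" and g: "arr_in Q*K g B C"
 show "arr_in Q*K (cmp Q*K g f) A C" "hc Q*K (idc Q*K g) (idc Q*K f) = idc Q*K (cmp Q*K g f)" using f g by(cases f; cases g; simp add: Q_simps flip: interchange')+
 fix h D assume "arr_in Q*K h C D"
 then show "cmp Q*K (cmp Q*K h g) f = cmp Q*K h (cmp Q*K g f)" using f g by(cases f; cases g; cases h) (simp add: Q_simps hc_assoc')
next
 fix f A B assume "arr_in Q*K f A B"
 then show "cmp Q*K f (one Q*K A) = f" "cmp Q*K (one Q*K B) f = f" by(cases f; simp add: Q_simps flip: rwhisk_def lwhisk_def)+
next
 fix x f g assume xf: "cell_in Q*K x f g"
 then have "x : cells Q*K" by simp
 then obtain fa r ga s z where x: "x = ((fa, r), (ga, s), z)" and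
  xs: "fa : arrs K" "r : cells K" "csrc K r = fa" "ctrg K r = fa" "r .: r = r"
  "ga : arrs K" "s : cells K" "csrc K s = ga" "ctrg K s = ga" "s .: s = s" "z : cells K" "csrc K z = fa" "ctrg K z = ga"
  "s .: z = z" "z .: r = z" "src K ga = src K fa" "trg K ga = trg K fa" by(rule Q_cellE)
 have fg: "f = (fa, r)" "g = (ga, s)" using xf by(simp_all add: x Q_simps)
 show "vc Q*K x (idc Q*K f) = x" "vc Q*K (idc Q*K g) x = x" using xs by(simp_all add: x fg Q_simps)
 show "hc Q*K x (idc Q*K (one Q*K (src Q*K f))) = x"
  "hc Q*K (idc Q*K (one Q*K (trg Q*K f))) x = x"
  using xs by(simp_all add: x fg Q_simps flip: rwhisk_def lwhisk_def)
 fix h y assume yf: "cell_in Q*K y g h"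
 then have "y : cells Q*K" by simp
 then obtain g2 s2 ha t w where y: "y = ((g2, s2), (ha, t), w)" and
  ys: "ha : arrs K" "t : cells K" "csrc K t = ha" "ctrg K t = ha" "t .: t = t" "w : cells K" "csrc K w = g2" "ctrg K w = ha"
  "t .: w = w" "w .: s2 = w" by(rule Q_cellE)
 have g2: "g2 = ga" "s2 = s" "h = (ha, t)" using yf by(simp_all add: y fg Q_simps)
 have "t .: w .: z = w .: z" "w .: z .: r = w .: z" using xs ys g2 vx2[of t w w z] by simp+
 then show "cell_in Q*K (vc Q*K y x) f h" using xs ys g2 by(simp add: x y fg Q_simps Q_cell)
 fix k q assume qf: "cell_in Q*K q h k"
 then have "q : cells Q*K" by simp
 then obtain h2 t2 ka m n where q: "q = ((h2, t2), (ka, m), n)" "n : cells K" "csrc K n = h2" by(rule Q_cellE)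
 have "h2 = ha" using qf by(simp add: q g2 Q_simps)
 then show "vc Q*K (vc Q*K q y) x = vc Q*K q (vc Q*K y x)" using xs ys g2 q by(simp add: x y Q_simps)
next
 fix x f f' y g g' assume xf: "cell_in Q*K x f f'" and yf: "cell_in Q*K y g g'" and t: "trg Q*K f = src Q*K g"
 then have xy: "x : cells Q*K" "y : cells Q*K" by auto
 obtain fa r fb r' z where x: "x = ((fa, r), (fb, r'), z)" and
  xs: "fa : arrs K" "r : cells K" "csrc K r = fa" "ctrg K r = fa" "r .: r = r"
  "fb : arrs K" "r' : cells K" "csrc K r' = fb" "ctrg K r' = fb" "r' .: r' = r'" "z : cells K" "csrc K z = fa" "ctrg K z = fb"
  "r' .: z = z" "z .: r = z" "src K fb = src K fa" "trg K fb = trg K fa" using xy(1) by(rule Q_cellE)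
 obtain ga s gb s' w where y: "y = ((ga, s), (gb, s'), w)" and
  ys: "ga : arrs K" "s : cells K" "csrc K s = ga" "ctrg K s = ga" "s .: s = s"
  "gb : arrs K" "s' : cells K" "csrc K s' = gb" "ctrg K s' = gb" "s' .: s' = s'" "w : cells K" "csrc K w = ga" "ctrg K w = gb"
  "s' .: w = w" "w .: s = w" "src K gb = src K ga" "trg K gb = trg K ga" using xy(2) by(rule Q_cellE)
 have fg: "f = (fa, r)" "f' = (fb, r')" "g = (ga, s)" "g' = (gb, s')" using xf yf by(simp_all add: x y Q_simps)
 have tt: "trg K fa = src K ga" using t by(simp add: fg Q_simps)
 show "cell_in Q*K (hc Q*K y x) (cmp Q*K g f) (cmp Q*K g' f')" using xs ys tt by(simp add: x y fg Q_simps Q_cell flip: interchange')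
 {
  fix f'' x' g'' y' assume "cell_in Q*K x' f' f''" "cell_in Q*K y' g' g''"
  then have x'f: "cell_in Q*K x' f' f''" "x' : cells Q*K" and y'f: "cell_in Q*K y' g' g''" "y' : cells Q*K" by simp+
  obtain fc r1 fd r2 z' where x': "x' = ((fc, r1), (fd, r2), z')" "z' : cells K" "csrc K z' = fc" using x'f(2) by(rule Q_cellE)
  obtain gc s1 gd s2 w' where y': "y' = ((gc, s1), (gd, s2), w')" "w' : cells K" "csrc K w' = gc" using y'f(2) by(rule Q_cellE)
  have "fc = fb" "gc = gb" using x'f(1) y'f(1) by(simp_all add: x'(1) y'(1) fg Q_simps)
  then show "hc Q*K (vc Q*K y' y) (vc Q*K x' x) = vc Q*K (hc Q*K y' x') (hc Q*K y x)" using xs ys x' y' tt by(simp add: x y x'(1) y'(1) Q_simps interchange')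
 }
 fix q h h' assume qf: "cell_in Q*K q h h'" and t': "trg Q*K g = src Q*K h"
 then have "q : cells Q*K" by simp
 then obtain ha m hb m' n where q: "q = ((ha, m), (hb, m'), n)" and
  qs: "ha : arrs K" "m : cells K" "csrc K m = ha" "ctrg K m = ha" "hb : arrs K" "m' : cells K" "csrc K m' = hb" "ctrg K m' = hb"
  "n : cells K" "csrc K n = ha" "ctrg K n = hb" "src K hb = src K ha" by(rule Q_cellE)
 have "h = (ha, m)" using qf by(simp add: q Q_simps)
 then have "trg K ga = src K ha" using t' by(simp add: fg Q_simps)
 then show "hc Q*K (hc Q*K q y) x = hc Q*K q (hc Q*K y x)" using xs ys qs tt by(simp add: x y q Q_simps hc_assoc')
qed

text \<open>A 1-cell \<open>(f, e)\<close> of \<open>Qstar K\<close> is isomorphic to the 1-cell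
  through which \<open>e\<close> splits.\<close>

lemma Q_loc_equiv:
 assumes cc: "Cat_cc_category K"
 shows "loc_equiv K Q*K (%A. A) (Qa K) (Qc K) (objs K)"
proof (intro loc_equiv.intro strict_fun.intro two_category_axioms Qstar_two_category strict_fun_axioms.intro loc_equiv_axioms.intro)
 interpret Q: two_category "Q*K" by(rule Qstar_two_category)
 show "EX x. cell x f g & Qc K x = y" if "f : arrs K" "g : arrs K" "cell_in Q*K y (Qa K f) (Qa K g)" for f g y
  using that by(cases y) (auto simp: Q_simps Q_cell Qa_def Qc_def)
 show "Qc K x = Qc K x' ==> x = x'" for x x' by(simp add: Qc_def)
 show "EX f k. arr f X Y & Q.iso2 k & cell_in Q*K k (Qa K f) z" if z: "arr_in Q*K z X Y" for z X Y
 proof -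
  obtain f e where fe: "z = (f, e)" "arr f X Y" "cell e f f" "e .: e = e" using z by(cases z) (auto simp: Q_simps)
  obtain g r s where g: "arr g X Y" "cell r f g" "cell s g f" "s .: r = e" "r .: s = idc K g"
  using cc_split[OF cc fe(3,2,4)] by blast
  note [simp] = fe(2,3)[simplified] g(1-3)[simplified] fe(4)
  have es: "e .: s = s" "r .: e = r" unfolding g(4)[symmetric] using g(5) vx2[OF g(5)] by simp+
  have "Q.iso2 (Qa K g, z, s)" by(rule Q.inv2_unique(2)[of _ "(z, Qa K g, r)"]) (simp_all add: fe(1) Qa_def Q_simps Q_cell es g(4,5))
  then show ?thesis by(intro exI[of _ g] exI[of _ "(Qa K g, z, s)"]) (simp add: fe(1) Qa_def Q_simps Q_cell es)
 qed
qed (simp_all add: Qa_def Qc_def Q_simps Q_cell)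

abbreviation "Qm == strict_fun.Fm (%A. A) (Qa K) (Qc K)"

lemma Q_universal_iff:
 assumes cc: "Cat_cc_category K" and T: "mon T" and a: "alg K T (src K u) u a"
 shows "universal K T u a <-> universal Q*K (Qm T) (Qa K u) (Qc K a)"
proof -
 interpret Q: loc_equiv K "Q*K" "%A. A" "Qa K" "Qc K" "objs K" by(rule Q_loc_equiv[OF cc])
 show ?thesis using Q.univ_iff[OF T a] Q.F_alg[OF T a] a algD(1)[OF a] by(simp add: universal_def Q_simps(1))
qed

text \<open>The embedded monad has a universal algebra in \<open>Qstar K\<close>. Essential
  surjectivity replaces it by the image of an algebra in \<open>K\<close>, and
  \<open>Q_universal_iff\<close> reflects universality.\<close>

lemma universal_of_has_demi:
 assumes cc: "Cat_cc_category K" and d: "has_demi_EM_objects K" and T: "mon T"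
 shows "EX u a. universal K T u a"
proof -
 interpret Q: loc_equiv K "Q*K" "%A. A" "Qa K" "Qc K" "objs K" by(rule Q_loc_equiv[OF cc])
 note T' = Q.F_monad[OF T]
 obtain C \<Phi> \<Theta> where "EM_object Q*K (Qm T) C \<Phi> \<Theta>" using d T' unfolding has_demi_EM_objects_def demimonad_def by blast
 then obtain z c where zc: "universal Q*K (Qm T) z c" using Q.B.EM_objectD by(metis surj_pair)
 then have c: "alg Q*K (Qm T) (src Q*K z) z c" by(simp add: universal_def)
 have "src Q*K z : objs K" using Q.B.src_objs[OF Q.B.algD(1)[OF c]] by(simp add: Q_simps)
 then obtain x b k where b: "alg K T (src Q*K z) x b" "Q.B.iso2 k" "algm Q*K (Qm T) (Qa K x) (Qc K b) z c k" using Q.alg_ess[OF T _ c] by blast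
 have sx: "src K x = src Q*K z" using algD(2)[OF b(1)] .
 note Fb = Q.F_alg[OF T b(1)]
 have "univ Q*K (Qm T) (Qa K x) (Qc K b) X" if "X : objs Q*K" for X
  using Q.B.univ_change_alg[OF T' _ Fb Q.B.algm_inv[OF T' Fb c b(3,2)]] zc that b(2) unfolding universal_def by simp
 then have "universal Q*K (Qm T) (Qa K x) (Qc K b)" using Fb algD(1,2)[OF b(1)] by(simp add: universal_def)
 then show ?thesis using Q_universal_iff[OF cc T b(1)[folded sx]] by blast
qed

text \<open>Every demimonad is isomorphic to an embedded monad, whose universal algebra is embedded
  along with it and then transported along the isomorphism.\<close>

lemma has_demi_of_universal:
 assumes cc: "Cat_cc_category K" and u: "!!T. mon T ==> EX u a. universal K T u a"
 shows "has_demi_EM_objects K"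
 unfolding has_demi_EM_objects_def demimonad_def
proof (intro allI impI)
 interpret Q: loc_equiv K "Q*K" "%A. A" "Qa K" "Qc K" "objs K" by(rule Q_loc_equiv[OF cc])
 fix T assume T: "monad_in Q*K T"
 then have "base T : objs K" using Q.B.monad_types(1)[OF T] by(simp add: Q_simps)
 then obtain w k where w: "mon w" "monad_iso Q*K (Qm w) T k" using Q.monad_replete[OF T] by blast
 obtain u a where ua: "universal K w u a" using u[OF w(1)] by blast
 then have a: "alg K w (src K u) u a" by(simp add: universal_def)
 have "universal Q*K (Qm w) (Qa K u) (Qc K a)" using Q_universal_iff[OF cc w(1) a] ua by simp
 then have "universal Q*K T (Qa K u) (vc Q*K (Qc K a) (Q.B.inv2 k |>@Q*K Qa K u))"
  using Q.B.univ_change_monad[OF Q.B.monad_iso_inv[OF w(2)]] Q.B.univD(1) Q.B.alg_change[OF Q.B.monad_iso_inv[OF w(2)]] unfolding universal_def by blast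
 from Q.B.EM_objectI[OF T this] show "EX C \<Phi> \<Theta>. EM_object Q*K T C \<Phi> \<Theta>" by blast
qed

end

section \<open>The induced pseudofunctor on local Cauchy completions\<close>

context pseudofunctor
begin

abbreviation "QF == Qstar_pfun K L F"

lemma QF_simps:
 "A : objs K ==> pob QF A = pob F A"
 "(f, r) : arrs Q*K ==> par QF (f, r) = (par F f, pce F r)"
 "((f, r), (g, s), x) : cells Q*K ==> pce QF ((f, r), (g, s), x) = ((par F f, pce F r), (par F g, pce F s), pce F x)"
 "composable Q*K (g, s) (f, r) ==> pcomp QF (g, s) (f, r) =
  ((par F g**@L par F f, hc L (pce F s) (pce F r)), (par F (g**@K f), pce F (hc K s r)), pcomp F g f .:@L hc L (pce F s) (pce F r))"
 "A : objs K ==> punit QF A =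
  ((one L (pob F A), idc L (one L (pob F A))), (par F (one K A), idc L (par F (one K A))), punit F A)"
 by(auto simp: Qstar_pfun_def Let_def K.Q_simps(1) K.Q_simps(7) K.Q_simps(8) L.Q_simps)

lemma pc_hc:
 assumes "x : cells K" "y : cells K" "trg K (csrc K x) = src K (csrc K y)"
 shows "pcomp F (ctrg K y) (ctrg K x) .:@L hc L (pce F y) (pce F x) = pce F (hc K y x) .:@L pcomp F (csrc K y) (csrc K x)"
 using pc_nat[OF assms] by simp

text \<open>The coherence cells are those of \<open>F\<close> cut down by idempotents. Each axiom
  follows from the corresponding one for \<open>F\<close> by moving the idempotents past coherence
  cells and absorbing them.\<close>

theorem QF_pseudofunctor: "pseudofunctor Q*K Q*L QF"
proof (intro pseudofunctor.intro K.Qstar_two_category L.Qstar_two_category pseudofunctor_axioms.intro)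
 interpret QK: two_category "Q*K" by(rule K.Qstar_two_category)
 interpret QL: two_category "Q*L" by(rule L.Qstar_two_category)
 show "pob QF : extensional (objs Q*K)" "par QF : extensional (arrs Q*K)" "pce QF : extensional (cells Q*K)"
  "punit QF : extensional (objs Q*K)" "!!g f. \<not> composable Q*K g f ==> pcomp QF g f = undefined"
  by(auto simp: Qstar_pfun_def Let_def K.Q_simps(1))
 show "pob QF A : objs Q*L" if "A : objs Q*K" for A
  using that by(simp add: K.Q_simps(1) L.Q_simps(1) QF_simps)
 have idem: "pce F r .:@L pce F r = pce F r" if "cell_in K r f f" "r .:@K r = r" for r f
  using that P_simps(9)[of r r] by simp
 show "arr_in Q*L (par QF f) (pob QF A) (pob QF B)" if f: "arr_in Q*K f A B" for f A B
  using f idem by(cases f) (auto simp: QF_simps K.Q_simps L.Q_simps)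
 show "cell_in Q*L (pce QF x) (par QF f) (par QF g)" if x: "cell_in Q*K x f g" for x f g
 proof -
  have "x : cells Q*K" using x by simp
  then obtain a r b s z where z: "x = ((a, r), (b, s), z)" and
  c: "a : arrs K" "r : cells K" "csrc K r = a" "ctrg K r = a" "r .:@K r = r" "b : arrs K" "s : cells K" "csrc K s = b"
  "ctrg K s = b" "s .:@K s = s" "z : cells K" "csrc K z = a" "ctrg K z = b" "s .:@K z = z" "z .:@K r = z" by(rule K.Q_cellE)
  have "pce F s .:@L pce F z = pce F z" "pce F z .:@L pce F r = pce F z" using c P_simps(9)[of z s] P_simps(9)[of r z] by simp+
  then show ?thesis using x c idem by(auto simp: z QF_simps K.Q_simps L.Q_simps L.Q_cell K.Q_cell)
 qed
 show "pce QF (idc Q*K f) = idc Q*L (par QF f)" if f: "f : arrs Q*K" for f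
  using f QK.cell_simps(5)[OF f] by(cases f) (simp add: QF_simps K.Q_simps L.Q_simps)
 show "pce QF (vc Q*K y x) = vc Q*L (pce QF y) (pce QF x)"
  if x: "cell_in Q*K x f g" and y: "cell_in Q*K y g h" for x f g y h
 proof -
  have xy: "x : cells Q*K" "y : cells Q*K" "vc Q*K y x : cells Q*K" using x y by auto
  obtain a r b s z where z: "x = ((a, r), (b, s), z)" "z : cells K" "ctrg K z = b" using xy(1) by(rule K.Q_cellE)
  obtain a' r' b' s' z' where z': "y = ((a', r'), (b', s'), z')" "z' : cells K" "csrc K z' = a'" using xy(2) by(rule K.Q_cellE)
  have "a' = b" using x y by(auto simp: z(1) z'(1) K.Q_simps)
  then show ?thesis using xy z z' by(simp add: z(1) z'(1) QF_simps K.Q_simps L.Q_simps)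
 qed
 have one: "(one K A, idc K (one K A)) : arrs Q*K" if "A : objs K" for A using that by(simp add: K.Q_simps)
 show "is_iso2 Q*L (punit QF A) (one Q*L (pob QF A)) (par QF (one Q*K A))" if "A : objs Q*K" for A
 proof -
  have A: "A : objs K" using that by(simp add: K.Q_simps)
  show ?thesis unfolding is_iso2_def
  by(intro conjI exI[of _ "((par F (one K A), idc L (par F (one K A))), (one L (pob F A), idc L (one L (pob F A))), L.inv2 (punit F A))"])
  (use A one[OF A] in \<open>simp_all add: QF_simps K.Q_simps L.Q_simps L.Q_cell\<close>)
 qed
 show "is_iso2 Q*L (pcomp QF g f) (cmp Q*L (par QF g) (par QF f)) (par QF (cmp Q*K g f))" if fg: "composable Q*K g f" for g f
 proof -
  obtain a r where f: "f = (a, r)" by(cases f)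
  obtain b s where g: "g = (b, s)" by(cases g)
  have c: "a : arrs K" "r : cells K" "csrc K r = a" "ctrg K r = a" "r .:@K r = r" "b : arrs K" "s : cells K" "csrc K s = b"
  "ctrg K s = b" "s .:@K s = s" "trg K a = src K b" "(a, r) : arrs Q*K" "(b, s) : arrs Q*K" and c': "composable Q*K (b, s) (a, r)"
  using fg by(auto simp: f g composable_def K.Q_simps)
  note [simp] = c
  have h: "(b**@K a, hc K s r) : arrs Q*K" by(simp add: K.Q_simps flip: K.interchange')
  let ?e = "hc L (pce F s) (pce F r)"
  have 1: "pcomp F b a .:@L ?e = pce F (hc K s r) .:@L pcomp F b a" using pc_hc[of r s] by simp
  have 2: "?e .:@L ?e = ?e" using idem[of r a] idem[of s b] by(simp flip: L.interchange')
  have 3: "pce F (hc K s r) .:@L pce F (hc K s r) = pce F (hc K s r)" by(simp flip: P_simps(9) K.interchange')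
  have 4: "?e .:@L L.inv2 (pcomp F b a) = L.inv2 (pcomp F b a) .:@L pce F (hc K s r)" by(rule L.inv2_swap[symmetric]) (simp_all add: 1)
  show ?thesis unfolding is_iso2_def
  \<comment> \<open>In \<open>Qstar\<close> the identity of a 1-cell is its idempotent, so the
    inverse of the coherence cell is the inverse taken in \<open>L\<close> followed by the
    idempotent \<open>?e\<close>.\<close>
  proof (intro conjI exI[of _ "((par F (b**@K a), pce F (hc K s r)), (par F b**@L par F a, ?e), ?e .:@L L.inv2 (pcomp F b a))"])
  show "cell_in Q*L (pcomp QF g f) (cmp Q*L (par QF g) (par QF f)) (par QF (cmp Q*K g f))"
  using h 2 3 L.vx2[OF 2] L.vx2[OF 3] L.vx2[OF 1[symmetric]] by(simp add: f g QF_simps c' K.Q_simps L.Q_simps L.Q_cell 1)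
  show "cell_in Q*L ((par F (b**@K a), pce F (hc K s r)), (par F b**@L par F a, ?e), ?e .:@L L.inv2 (pcomp F b a))
  (par QF (cmp Q*K g f)) (cmp Q*L (par QF g) (par QF f))"
  using h 2 3 L.vx2[OF 2] by(simp add: f g QF_simps K.Q_simps L.Q_simps L.Q_cell 4 L.vx2[OF 4])
  have "?e .:@L L.inv2 (pcomp F b a) .:@L pcomp F b a .:@L ?e = ?e" using 2 by simp
  then show "vc Q*L ((par F (b**@K a), pce F (hc K s r)), (par F b**@L par F a, ?e), ?e .:@L L.inv2 (pcomp F b a)) (pcomp QF g f) =
  idc Q*L (cmp Q*L (par QF g) (par QF f))"
  using h by(simp add: f g QF_simps c' K.Q_simps L.Q_simps)
  have "(pcomp F b a .:@L ?e) .:@L ?e .:@L L.inv2 (pcomp F b a) = pce F (hc K s r)" using L.vx2[OF 2] 3 by(simp add: 4 L.vx2[OF 4] L.vx2[OF 3])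
  then show "vc Q*L (pcomp QF g f) ((par F (b**@K a), pce F (hc K s r)), (par F b**@L par F a, ?e), ?e .:@L L.inv2 (pcomp F b a)) =
  idc Q*L (par QF (cmp Q*K g f))"
  using h by(simp add: f g QF_simps c' K.Q_simps L.Q_simps)
  qed
 qed
 show "vc Q*L (pce QF (hc Q*K y x)) (pcomp QF g f) = vc Q*L (pcomp QF g' f') (hc Q*L (pce QF y) (pce QF x))"
  if x: "cell_in Q*K x f f'" and y: "cell_in Q*K y g g'" and fg: "composable Q*K g f" for x f f' y g g'
 proof -
  have xy: "x : cells Q*K" "y : cells Q*K" using x y by auto
  obtain a r b s z where z: "x = ((a, r), (b, s), z)" and
  c: "a : arrs K" "r : cells K" "csrc K r = a" "ctrg K r = a" "b : arrs K" "s : cells K" "csrc K s = b"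
  "ctrg K s = b" "z : cells K" "csrc K z = a" "ctrg K z = b" "s .:@K z = z" "z .:@K r = z" "src K b = src K a" "trg K b = trg K a"
  using xy(1) by(rule K.Q_cellE)
  obtain a' r' b' s' z' where z': "y = ((a', r'), (b', s'), z')" and
  c': "a' : arrs K" "r' : cells K" "csrc K r' = a'" "ctrg K r' = a'" "b' : arrs K" "s' : cells K" "csrc K s' = b'"
  "ctrg K s' = b'" "z' : cells K" "csrc K z' = a'" "ctrg K z' = b'" "s' .:@K z' = z'" "z' .:@K r' = z'" "src K b' = src K a'" "trg K b' = trg K a'"
  using xy(2) by(rule K.Q_cellE)
  have e: "f = (a, r)" "f' = (b, s)" "g = (a', r')" "g' = (b', s')" using x y by(simp_all add: z z' K.Q_simps)
  note [simp] = c c'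
  have [simp]: "trg K a = src K a'" using fg by(simp add: e composable_def K.Q_simps)
  have co: "composable Q*K (a', r') (a, r)" "composable Q*K (b', s') (b, s)" using fg xy by(simp_all add: e composable_def K.Q_simps z z' K.Q_cell)
  have hx: "hc Q*K y x : cells Q*K" using QK.hc_simps(1)[OF xy] fg by(simp add: z z' K.Q_simps)
  have f1: "pce F z .:@L pce F r = pce F z" "pce F z' .:@L pce F r' = pce F z'" "pce F s .:@L pce F z = pce F z" "pce F s' .:@L pce F z' = pce F z'"
  using P_simps(9)[of r z] P_simps(9)[of r' z'] P_simps(9)[of z s] P_simps(9)[of z' s'] by simp+
  have 1: "hc L (pce F z') (pce F z) .:@L hc L (pce F r') (pce F r) = hc L (pce F z') (pce F z)"
  "hc L (pce F s') (pce F s) .:@L hc L (pce F z') (pce F z) = hc L (pce F z') (pce F z)" using f1 by(simp_all flip: L.interchange')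
  have 2: "pce F (hc K z' z) .:@L pcomp F a' a = pcomp F b' b .:@L hc L (pce F z') (pce F z)" using pc_nat[of z z'] by simp
  show ?thesis
  using hx co xy by(simp add: z z' e QF_simps K.Q_simps L.Q_simps L.vx2[OF 2] 1)
 qed
 show "vc Q*L (pcomp QF (cmp Q*K h g) f) (pcomp QF h g |>@Q*L par QF f) =
  vc Q*L (pcomp QF h (cmp Q*K g f)) (par QF h <|@Q*L pcomp QF g f)"
  if hg: "composable Q*K h g" and gf: "composable Q*K g f" for h g f
 proof -
  obtain a r where f: "f = (a, r)" by(cases f)
  obtain b s where g: "g = (b, s)" by(cases g)
  obtain d t where h: "h = (d, t)" by(cases h)
  have c: "a : arrs K" "r : cells K" "csrc K r = a" "ctrg K r = a" "b : arrs K" "s : cells K" "csrc K s = b"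
  "ctrg K s = b" "trg K a = src K b" "d : arrs K" "t : cells K" "csrc K t = d" "ctrg K t = d" "trg K b = src K d"
  "(a, r) : arrs Q*K" "(b, s) : arrs Q*K" "(d, t) : arrs Q*K" "r .:@K r = r" "s .:@K s = s" "t .:@K t = t"
  using hg gf by(auto simp: f g h composable_def K.Q_simps)
  note [simp] = c
  have q: "(b**@K a, hc K s r) : arrs Q*K" "(d**@K b, hc K t s) : arrs Q*K" by(simp_all add: K.Q_simps flip: K.interchange')
  have co: "composable Q*K (b, s) (a, r)" "composable Q*K (d, t) (b, s)" "composable Q*K (d**@K b, hc K t s) (a, r)"
  "composable Q*K (d, t) (b**@K a, hc K s r)" using q by(simp_all add: composable_def K.Q_simps(3,4))
  let ?r = "pce F r" and ?s = "pce F s" and ?t = "pce F t"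
  have i: "?r .:@L ?r = ?r" "?s .:@L ?s = ?s" "?t .:@L ?t = ?t" using idem[of r a] idem[of s b] idem[of t d] by simp+
  have pr: "pcomp F d b .:@L hc L ?t ?s = pce F (hc K t s) .:@L pcomp F d b" "pcomp F b a .:@L hc L ?s ?r = pce F (hc K s r) .:@L pcomp F b a" using pc_hc[of s t] pc_hc[of r s] by simp+
  have ii: "hc L ?t ?s .:@L hc L ?t ?s = hc L ?t ?s" "hc L ?s ?r .:@L hc L ?s ?r = hc L ?s ?r" using i by(simp_all flip: L.interchange')
  have 1: "hc L (pce F (hc K t s)) ?r .:@L hc L (pcomp F d b .:@L hc L ?t ?s) ?r = hc L (pcomp F d b .:@L hc L ?t ?s) ?r"
  proof -
  have "hc L (pce F (hc K t s)) ?r .:@L hc L (pcomp F d b .:@L hc L ?t ?s) ?r = hc L (pce F (hc K t s) .:@L pcomp F d b .:@L hc L ?t ?s) (?r .:@L ?r)" by(simp add: L.interchange')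
  also have "pce F (hc K t s) .:@L pcomp F d b .:@L hc L ?t ?s = pcomp F d b .:@L hc L ?t ?s" using L.vx2[OF pr(1)[symmetric]] ii(1) by simp
  finally show ?thesis by(simp add: i)
  qed
  have 2: "hc L (pcomp F d b .:@L hc L ?t ?s) ?r = (pcomp F d b|>@L par F a) .:@L hc L (hc L ?t ?s) ?r" by(simp add: rwhisk_def flip: L.interchange')
  have 3: "hc L ?t (pce F (hc K s r)) .:@L hc L ?t (pcomp F b a .:@L hc L ?s ?r) = hc L ?t (pcomp F b a .:@L hc L ?s ?r)"
  proof -
  have "hc L ?t (pce F (hc K s r)) .:@L hc L ?t (pcomp F b a .:@L hc L ?s ?r) = hc L (?t .:@L ?t) (pce F (hc K s r) .:@L pcomp F b a .:@L hc L ?s ?r)" by(simp add: L.interchange')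
  also have "pce F (hc K s r) .:@L pcomp F b a .:@L hc L ?s ?r = pcomp F b a .:@L hc L ?s ?r" using L.vx2[OF pr(2)[symmetric]] ii(2) by simp
  finally show ?thesis by(simp add: i)
  qed
  have 4: "hc L ?t (pcomp F b a .:@L hc L ?s ?r) = (par F d<|@L pcomp F b a) .:@L hc L ?t (hc L ?s ?r)" by(simp add: lwhisk_def flip: L.interchange')
  have a1: "pcomp F (d**@K b) a .:@L(pcomp F d b|>@L par F a) = pcomp F d (b**@K a) .:@L(par F d<|@L pcomp F b a)" using pc_assoc[of a b d] by simp
  have "(pcomp F (d**@K b) a .:@L hc L (pce F (hc K t s)) ?r) .:@L hc L (pcomp F d b .:@L hc L ?t ?s) ?r =
  (pcomp F d (b**@K a) .:@L hc L ?t (pce F (hc K s r))) .:@L hc L ?t (pcomp F b a .:@L hc L ?s ?r)"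
  proof -
  have "(pcomp F (d**@K b) a .:@L hc L (pce F (hc K t s)) ?r) .:@L hc L (pcomp F d b .:@L hc L ?t ?s) ?r =
  pcomp F (d**@K b) a .:@L hc L (pcomp F d b .:@L hc L ?t ?s) ?r" using 1 by simp
  also have "... = (pcomp F (d**@K b) a .:@L(pcomp F d b|>@L par F a)) .:@L hc L (hc L ?t ?s) ?r" unfolding 2 by simp
  also have "... = pcomp F d (b**@K a) .:@L hc L ?t (pcomp F b a .:@L hc L ?s ?r)" unfolding a1 4 by(simp add: L.hc_assoc')
  also have "... = (pcomp F d (b**@K a) .:@L hc L ?t (pce F (hc K s r))) .:@L hc L ?t (pcomp F b a .:@L hc L ?s ?r)" using 3 by simp
  finally show ?thesis .
  qed
  then show ?thesis
  using q by(simp add: f g h QF_simps co K.Q_simps(8) L.Q_simps(8-11) lwhisk_def[of "Q*L"] rwhisk_def[of "Q*L"] K.hc_assoc' L.hc_assoc')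
 qed
 show "vc Q*L (pcomp QF (one Q*K B) f) (punit QF B |>@Q*L par QF f) = idc Q*L (par QF f)"
  "vc Q*L (pcomp QF f (one Q*K A)) (par QF f <|@Q*L punit QF A) = idc Q*L (par QF f)"
  if f0: "arr_in Q*K f A B" for f A B
 proof -
  obtain a r where f: "f = (a, r)" by(cases f)
  have c: "a : arrs K" "r : cells K" "csrc K r = a" "ctrg K r = a" "src K a = A" "trg K a = B" "(a, r) : arrs Q*K" "A : objs K" "B : objs K"
  and rr: "r .:@K r = r" using f0 by(auto simp: f K.Q_simps)
  note [simp] = c
  have co: "composable Q*K (one K B, idc K (one K B)) (a, r)" "composable Q*K (a, r) (one K A, idc K (one K A))" by(simp_all add: composable_def one K.Q_simps(3,4))
  let ?r = "pce F r"
  have i: "?r .:@L ?r = ?r" using idem[of r a] rr by simp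
  have k: "hc K (idc K (one K B)) r = r" "hc K r (idc K (one K A)) = r" by(simp_all flip: lwhisk_def rwhisk_def)
  have 1: "hc L (idc L (par F (one K B))) ?r .:@L hc L (punit F B) ?r = (punit F B|>@L par F a) .:@L hc L (idc L (one L (pob F B))) ?r"
  using i by(simp add: rwhisk_def flip: L.interchange')
  have 2: "hc L ?r (idc L (par F (one K A))) .:@L hc L ?r (punit F A) = (par F a<|@L punit F A) .:@L hc L ?r (idc L (one L (pob F A)))"
  using i by(simp add: lwhisk_def flip: L.interchange')
  have 3: "hc L (idc L (one L (pob F B))) ?r = ?r" "hc L ?r (idc L (one L (pob F A))) = ?r" by(simp_all flip: lwhisk_def rwhisk_def)
  have 4: "pcomp F (one K B) a .:@L(punit F B|>@L par F a) = idc L (par F a)" "pcomp F a (one K A) .:@L(par F a<|@L punit F A) = idc L (par F a)" by(rule pu_left pu_right; simp)+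
  show "vc Q*L (pcomp QF (one Q*K B) f) (punit QF B |>@Q*L par QF f) = idc Q*L (par QF f)"
  using L.vx2[OF 4(1), of ?r] 1 by(simp add: f QF_simps co K.Q_simps(7) L.Q_simps(8-11) rwhisk_def[of "Q*L"] k 3)
  show "vc Q*L (pcomp QF f (one Q*K A)) (par QF f <|@Q*L punit QF A) = idc Q*L (par QF f)"
  using L.vx2[OF 4(2), of ?r] 2 by(simp add: f QF_simps co K.Q_simps(7) L.Q_simps(8-11) lwhisk_def[of "Q*L"] k 3)
 qed
qed

end

lemma (in two_category) Q_strict_fun: "strict_fun K Q*K (%A. A) (Qa K) (Qc K)"
 by(intro strict_fun.intro two_category_axioms Qstar_two_category strict_fun_axioms.intro) (simp_all add: Qa_def Qc_def Q_simps Q_cell)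

context pseudofunctor
begin

text \<open>The two monads are equal, not just isomorphic, because embedded 1-cells carry identities
  as idempotents.\<close>

lemma QF_monad:
 assumes T: "monad_in K T"
 shows "pfun_monad Q*L QF (K.Qm T) = L.Qm (pfun_monad L F T)"
proof -
 interpret Q: strict_fun K "Q*K" "%A. A" "Qa K" "Qc K" by(rule K.Q_strict_fun)
 interpret Q': strict_fun L "Q*L" "%A. A" "Qa L" "Qc L" by(rule L.Q_strict_fun)
 note [simp] = T
 let ?t = "endo T"
 have ar: "(?t, idc K ?t) : arrs Q*K" by(simp add: K.Q_simps)
 have co: "composable Q*K (?t, idc K ?t) (?t, idc K ?t)" using ar by(simp add: composable_def K.Q_simps(3,4))
 have ce: "((?t**@K ?t, idc K (?t**@K ?t)), (?t, idc K ?t), mult T) : cells Q*K"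
  "((one K (base T), idc K (one K (base T))), (?t, idc K ?t), eta T) : cells Q*K" by(simp_all add: K.Q_cell)
 show ?thesis unfolding Q.Fm_def Q'.Fm_def
  using ar ce by(simp add: pfun_monad_def QF_simps co Qa_def Qc_def L.Q_simps)
qed

lemma QF_alg:
 assumes T: "monad_in K T" and a: "alg K T X u a"
 shows "pfun_alg Q*L QF (K.Qm T) (Qa K u, Qc K a) = (Qa L (par F u), Qc L (pce F a .:@L pcomp F (endo T) u))"
proof -
 interpret Q: strict_fun K "Q*K" "%A. A" "Qa K" "Qc K" by(rule K.Q_strict_fun)
 note [simp] = T K.algD(1-6)[OF a]
 let ?t = "endo T"
 have ar: "(?t, idc K ?t) : arrs Q*K" "(u, idc K u) : arrs Q*K" by(simp_all add: K.Q_simps)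
 have co: "composable Q*K (?t, idc K ?t) (u, idc K u)" using ar by(simp add: composable_def K.Q_simps(3,4))
 have ce: "((?t**@K u, idc K (?t**@K u)), (u, idc K u), a) : cells Q*K" by(simp add: K.Q_cell)
 show ?thesis using ar ce by(simp add: pfun_alg_def QF_simps co Qa_def Qc_def L.Q_simps)
qed

text \<open>The embeddings into \<open>Qstar\<close> translate universality on both sides, and the
  isomorphism \<open>i\<close> in the definition of preservation identifies the image algebra with
  the universal one.\<close>

lemma preserves_universal:
 assumes ccK: "Cat_cc_category K" and ccL: "Cat_cc_category L" and pres: "preserves_demi_EM_objects K L F"
  and T: "monad_in K T" and u: "universal K T u a"
 shows "universal L (pfun_monad L F T) (par F u) (pce F a .:@L pcomp F (endo T) u)"
proof -
 interpret QK: loc_equiv K "Q*K" "%A. A" "Qa K" "Qc K" "objs K" by(rule K.Q_loc_equiv[OF ccK])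
 interpret QL: loc_equiv L "Q*L" "%A. A" "Qa L" "Qc L" "objs L" by(rule L.Q_loc_equiv[OF ccL])
 have a: "alg K T (src K u) u a" using u by(simp add: universal_def)
 note T' = QK.F_monad[OF T] and FT = P_monad[OF T] and Fa = P_alg[OF T a]
 note [simp] = K.algD(1)[OF a]
 have sQ: "src Q*K (Qa K u) = src K u" by simp
 obtain \<Phi> \<Theta> where E: "EM_object Q*K (K.Qm T) (src K u) \<Phi> \<Theta>" "fob (\<Phi> (src K u)) (one Q*K (src K u)) = (Qa K u, Qc K a)"
  using QK.B.EM_objectI[OF T' iffD1[OF K.Q_universal_iff[OF ccK T a] u]] unfolding sQ by(elim exE conjE)
 have dT: "demimonad K (K.Qm T)" using T' by(simp add: demimonad_def)
 obtain \<Psi> \<Xi> i where P: "EM_object Q*L (L.Qm (pfun_monad L F T)) (pob F (src K u)) \<Psi> \<Xi>"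
  "is_iso (hom_algs Q*L (L.Qm (pfun_monad L F T)) (pob F (src K u))) i
  (Qa L (par F u), Qc L (pce F a .:@L pcomp F (endo T) u)) (fob (\<Psi> (pob F (src K u))) (one Q*L (pob F (src K u))))"
  using pres[unfolded preserves_demi_EM_objects_def Let_def, rule_format, OF conjI[OF dT E(1)]]
  unfolding E(2) QF_monad[OF T] QF_alg[OF T a] by blast
 obtain v c where vc: "fob (\<Psi> (pob F (src K u))) (one Q*L (pob F (src K u))) = (v, c)" by(metis surj_pair)
 note U = QL.B.EM_objectD[OF P(1) vc]
 note FT' = QL.F_monad[OF FT] and Fa' = QL.F_alg[OF FT Fa]
 obtain h where h: "algm Q*L (L.Qm (pfun_monad L F T)) (Qa L (par F u)) (Qc L (pce F a .:@L pcomp F (endo T) u)) v c h" "QL.B.iso2 h"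
  "alg Q*L (L.Qm (pfun_monad L F T)) (pob F (src K u)) v c"
  using P(2) unfolding QL.B.is_iso_algs[OF FT'] vc by auto
 have Fs: "src L (par F u) = pob F (src K u)" by simp
 have "universal Q*L (L.Qm (pfun_monad L F T)) (Qa L (par F u)) (Qc L (pce F a .:@L pcomp F (endo T) u))" unfolding universal_def
 proof (intro conjI ballI)
  show "alg Q*L (L.Qm (pfun_monad L F T)) (src Q*L (Qa L (par F u))) (Qa L (par F u)) (Qc L (pce F a .:@L pcomp F (endo T) u))" using Fa' by simp
  show "univ Q*L (L.Qm (pfun_monad L F T)) (Qa L (par F u)) (Qc L (pce F a .:@L pcomp F (endo T) u)) X" if "X : objs Q*L" for X
  using QL.B.univ_change_alg[OF FT' _ _ QL.B.algm_inv[OF FT' Fa' h(3,1,2)], of X] U that Fa' h(2) by(simp add: universal_def)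
 qed
 then show ?thesis using L.Q_universal_iff[OF ccL FT Fa[folded Fs]] by simp
qed

text \<open>A demimonad and its universal algebra are isomorphic to embedded ones, to which
  \<open>pres\<close> applies. \<open>P_alg_nat\<close> carries the isomorphisms through
  \<open>QF\<close>, and \<open>univ_transport\<close> returns to the given data.\<close>

lemma preserves_demi_EM_objectsI:
 assumes ccK: "Cat_cc_category K" and ccL: "Cat_cc_category L"
  and pres: "!!T u a. monad_in K T ==> universal K T u a ==>
  universal L (pfun_monad L F T) (par F u) (pce F a .:@L pcomp F (endo T) u)"
 shows "preserves_demi_EM_objects K L F"
 unfolding preserves_demi_EM_objects_def Let_def
proof (intro allI impI; elim conjE)
 interpret QK: loc_equiv K "Q*K" "%A. A" "Qa K" "Qc K" "objs K" by(rule K.Q_loc_equiv[OF ccK])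
 interpret QL: loc_equiv L "Q*L" "%A. A" "Qa L" "Qc L" "objs L" by(rule L.Q_loc_equiv[OF ccL])
 interpret QF: pseudofunctor "Q*K" "Q*L" QF by(rule QF_pseudofunctor)
 fix T C \<Phi> \<Theta> assume "demimonad K T" and E: "EM_object Q*K T C \<Phi> \<Theta>"
 then have T: "monad_in Q*K T" by(simp add: demimonad_def)
 obtain z c where zc: "fob (\<Phi> C) (one Q*K C) = (z, c)" by(metis surj_pair)
 have U: "universal Q*K T z c" and sz: "src Q*K z = C" using QK.B.EM_objectD[OF E zc] by auto
 then have c: "alg Q*K T C z c" by(simp add: universal_def)
 have C: "C : objs K" using E by(simp add: EM_object_def K.Q_simps)
 have "base T : objs K" using QK.B.monad_types(1)[OF T] by(simp add: K.Q_simps)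
 then obtain w k where w: "monad_in K w" and k: "monad_iso Q*K (K.Qm w) T k" using QK.monad_replete[OF T] by blast
 note w' = QK.F_monad[OF w]
 let ?c = "vc Q*K c (k |>@Q*K z)"
 have c': "alg Q*K (K.Qm w) C z ?c" by(rule QK.B.alg_change[OF k c])
 obtain x b h where b: "alg K w C x b" and h: "QK.B.iso2 h" "algm Q*K (K.Qm w) (Qa K x) (Qc K b) z ?c h"
  using QK.alg_ess[OF w C c'] by blast
 note Fb = QK.F_alg[OF w b]
 note [simp] = K.algD(1-6)[OF b] QK.B.algD(1-3)[OF c]
 have ux: "univ Q*K (K.Qm w) (Qa K x) (Qc K b) X" if "X : objs Q*K" for X
 proof -
  have "univ Q*K (K.Qm w) z ?c X" using QK.B.univ_change_monad[OF k] U that by(simp add: universal_def)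
  then show ?thesis using QK.B.univ_change_alg[OF w' _ _ QK.B.algm_inv[OF w' Fb c' h(2,1)], of X] Fb h(1) by simp
 qed
 have b': "alg K w (src K x) x b" using b by simp
 have "universal K w x b" using K.Q_universal_iff[OF ccK w b'] ux Fb by(simp add: universal_def)
 note UL = pres[OF w this]
 note FT = P_monad[OF w] and Fa = P_alg[OF w b]
 have Fa1: "alg L (pfun_monad L F w) (src L (par F x)) (par F x) (pce F b .:@L pcomp F (endo w) x)" using Fa by simp
 have UQ: "universal Q*L (L.Qm (pfun_monad L F w)) (Qa L (par F x)) (Qc L (pce F b .:@L pcomp F (endo w) x))" using UL L.Q_universal_iff[OF ccL FT Fa1] by simp
 have eqs: "par QF (Qa K x) = Qa L (par F x)" "vc Q*L (pce QF (Qc K b)) (pcomp QF (endo (K.Qm w)) (Qa K x)) = Qc L (pce F b .:@L pcomp F (endo w) x)"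
  using QF_alg[OF w b] by(simp_all add: pfun_alg_def)
 let ?FT = "pfun_monad Q*L QF T" and ?z = "par QF z" and ?d = "vc Q*L (pce QF c) (pcomp QF (endo T) z)"
 have mi: "monad_iso Q*L (L.Qm (pfun_monad L F w)) ?FT (pce QF k)" using QF.P_monad_iso[OF k] unfolding QF_monad[OF w] .
 have d: "alg Q*L ?FT (pob QF C) ?z ?d" by(rule QF.P_alg[OF T c])
 have pC: "pob QF C = pob F C" using C by(simp add: QF_simps)
 note hh = QK.B.algmD[OF h(2)]
 note kk = QK.B.monad_isoD(1-7)[OF k]
 have nat: "vc Q*L (pce QF h) (vc Q*L (pce QF (Qc K b)) (pcomp QF (endo (K.Qm w)) (Qa K x))) =
  vc Q*L ?d (vc Q*L (pce QF k |>@Q*L par QF z) (par QF (endo (K.Qm w)) <|@Q*L pce QF h))"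
 proof (rule QF.P_alg_nat[OF w', of T k z C "Qc K b" "Qa K x" c h])
  show "vc Q*K h (Qc K b) = vc Q*K c (vc Q*K (k |>@Q*K z) (endo (K.Qm w) <|@Q*K h))" using hh kk QK.B.algD[OF c] w w' by simp
 qed (use hh kk QK.B.algD[OF c] QK.B.algD[OF Fb] w w' in simp_all)
 have "univ Q*L ?FT ?z ?d X" if X: "X : objs Q*L" for X
 proof (rule QL.B.univ_transport[OF mi])
  show "univ Q*L (L.Qm (pfun_monad L F w)) (Qa L (par F x)) (Qc L (pce F b .:@L pcomp F (endo w) x)) X" using UQ X by(simp add: universal_def)
  show "alg Q*L ?FT (src Q*L (Qa L (par F x))) ?z ?d" using d by(simp add: pC)
  show "is_iso2 Q*L (pce QF h) (Qa L (par F x)) ?z" unfolding QL.B.is_iso2_iff eqs(1)[symmetric] using QF.pce_iso(1)[OF h(1)] hh by simp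
  have "endo (L.Qm (pfun_monad L F w)) = par QF (endo (K.Qm w))" by(simp flip: QF_monad[OF w])
  then show "vc Q*L (pce QF h) (Qc L (pce F b .:@L pcomp F (endo w) x)) =
  vc Q*L ?d (vc Q*L (pce QF k |>@Q*L ?z) (endo (L.Qm (pfun_monad L F w)) <|@Q*L pce QF h))"
  using nat unfolding eqs(2) by simp
 qed
 moreover have s: "src Q*L ?z = pob F C" using pC by simp
 ultimately have UF: "universal Q*L ?FT ?z ?d" using d by(simp add: universal_def pC)
 note FT' = QF.P_monad[OF T]
 obtain \<Psi> \<Xi> where P: "EM_object Q*L ?FT (pob F C) \<Psi> \<Xi>" "fob (\<Psi> (pob F C)) (one Q*L (pob F C)) = (?z, ?d)"
  using QL.B.EM_objectI[OF FT' UF] unfolding s by(elim exE conjE)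
 note [simp] = QL.B.algD(1-6)[OF d]
 have "is_iso (hom_algs Q*L ?FT (pob F C)) ((?z, ?d), (?z, ?d), idc Q*L ?z) (?z, ?d) (?z, ?d)" using d QL.B.algm_idc[OF FT' d] unfolding QL.B.is_iso_algs[OF FT'] by(simp add: pC)
 then show "EX \<Psi> \<Xi> i. EM_object Q*L ?FT (pob F C) \<Psi> \<Xi> &
  is_iso (hom_algs Q*L ?FT (pob F C)) i (pfun_alg Q*L QF T (fob (\<Phi> C) (one Q*K C))) (fob (\<Psi> (pob F C)) (one Q*L (pob F C)))"
  unfolding zc pfun_alg_def prod.case using P(1)
  by(intro exI[of _ \<Psi>] exI[of _ \<Xi>] exI[of _ "((?z, ?d), (?z, ?d), idc Q*L ?z)"]) (simp only: P(2))
qed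

end

section \<open>The 2-category of pseudofunctors\<close>

locale transformation = K: two_category K + L: two_category L + F: pseudofunctor K L "nsrc s" + G: pseudofunctor K L "ntrg s"
 for K :: "('o, 'a, 'c) two_cat" and L :: "('p, 'b, 'd) two_cat" (structure) and s :: "('o, 'a, 'c, 'p, 'b, 'd) pnat" +
 assumes pn: "pseudonat K L s"
begin

lemma ext: "nob s : extensional (objs K)" "nar s : extensional (arrs K)"
 using pn by(simp_all add: pseudonat_def Let_def)

lemma n_simps [simp]:
 "A : objs K ==> nob s A : arrs L" "A : objs K ==> src L (nob s A) = pob (nsrc s) A" "A : objs K ==> trg L (nob s A) = pob (ntrg s) A"
 "u : arrs K ==> L.iso2 (nar s u)" "u : arrs K ==> nar s u : cells L"
 "u : arrs K ==> csrc L (nar s u) = par (ntrg s) u**nob s (src K u)" "u : arrs K ==> ctrg L (nar s u) = nob s (trg K u)**par (nsrc s) u"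
 using pn by(auto simp: pseudonat_def Let_def L.is_iso2_iff)

lemma nat: "x : cells K ==> nar s (ctrg K x).:(pce (ntrg s) x|>nob s (src K (csrc K x))) =
  (nob s (trg K (csrc K x))<|pce (nsrc s) x) .: nar s (csrc K x)"
 using pn[unfolded pseudonat_def Let_def] K.csrc_arrs unfolding arr_in_def cell_in_def by blast

lemma unit: "A : objs K ==> nar s (one K A).:(punit (ntrg s) A|>nob s A) = nob s A<|punit (nsrc s) A"
 using pn by(simp add: pseudonat_def Let_def)

lemma comp: "u : arrs K ==> v : arrs K ==> trg K u = src K v ==>
  nar s (v**@K u).:(pcomp (ntrg s) v u|>nob s (src K u)) =
  (nob s (trg K v)<|pcomp (nsrc s) v u).:(nar s v|>par (nsrc s) u).:(par (ntrg s) v<|nar s u)"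
 using pn by(simp add: pseudonat_def Let_def)

end

lemma transformationI: "two_category K ==> two_category L ==> pseudonat K L s ==> transformation K L s"
 by(auto simp: transformation_def transformation_axioms_def pseudonat_def Let_def)

lemma pseudonatI:
 assumes "pseudofunctor K L (nsrc s)" "pseudofunctor K L (ntrg s)" "nob s : extensional (objs K)" "nar s : extensional (arrs K)"
  "!!A. A : objs K ==> arr_in L (nob s A) (pob (nsrc s) A) (pob (ntrg s) A)"
  "!!u. u : arrs K ==> is_iso2 L (nar s u) (par (ntrg s) u**@L nob s (src K u)) (nob s (trg K u)**@L par (nsrc s) u)"
  "!!x. x : cells K ==> nar s (ctrg K x) .:@L(pce (ntrg s) x|>@L nob s (src K (csrc K x))) =
  (nob s (trg K (csrc K x))<|@L pce (nsrc s) x) .:@L nar s (csrc K x)"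
  "!!A. A : objs K ==> nar s (one K A) .:@L(punit (ntrg s) A|>@L nob s A) = nob s A<|@L punit (nsrc s) A"
  "!!u v. u : arrs K ==> v : arrs K ==> trg K u = src K v ==> nar s (v**@K u) .:@L(pcomp (ntrg s) v u|>@L nob s (src K u)) =
  (nob s (trg K v)<|@L pcomp (nsrc s) v u) .:@L(nar s v|>@L par (nsrc s) u) .:@L(par (ntrg s) v<|@L nar s u)"
 shows "pseudonat K L s"
 unfolding pseudonat_def Let_def arr_in_def cell_in_def
 by(intro conjI allI impI ballI assms(1-4); (elim conjE)?) (use assms(5-9) in \<open>auto simp: arr_in_def\<close>)

lemma modification_iff:
 "modification K L m <-> pseudonat K L (msrc m) & pseudonat K L (mtrg m) & nsrc (mtrg m) = nsrc (msrc m) & ntrg (mtrg m) = ntrg (msrc m) &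
  mob m : extensional (objs K) & (ALL A:objs K. cell_in L (mob m A) (nob (msrc m) A) (nob (mtrg m) A)) &
  (ALL u:arrs K. (mob m (trg K u)|>@L par (nsrc (msrc m)) u) .:@L nar (msrc m) u =
  nar (mtrg m) u .:@L(par (ntrg (msrc m)) u<|@L mob m (src K u)))"
 by(auto simp: modification_def Let_def)

lemma pnat_eqI:
 assumes "nsrc s = nsrc t" "ntrg s = ntrg t" "nob s : extensional (objs K)" "nob t : extensional (objs K)"
  "nar s : extensional (arrs K)" "nar t : extensional (arrs K)"
  "!!A. A : objs K ==> nob s A = nob t A" "!!u. u : arrs K ==> nar s u = nar t u"
 shows "s = (t :: ('o, 'a, 'c, 'p, 'b, 'd) pnat)"
 using assms extensionalityI[of "nob s" "objs K" "nob t"] extensionalityI[of "nar s" "arrs K" "nar t"] by simp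

lemma modn_eqI:
 assumes "msrc m = msrc n" "mtrg m = mtrg n" "mob m : extensional (objs K)" "mob n : extensional (objs K)"
  "!!A. A : objs K ==> mob m A = mob n A"
 shows "m = (n :: ('o, 'a, 'c, 'p, 'b, 'd) modn)"
 using assms extensionalityI[of "mob m" "objs K" "mob n"] by simp

locale homs = K: two_category K + L: two_category L
 for K :: "('o, 'a, 'c) two_cat" and L :: "('p, 'b, 'd) two_cat" (structure)
begin

abbreviation "Ho == Hom K L"
abbreviation "cp == comp_pnat K L"

lemmas trans = transformationI[OF K.two_category_axioms L.two_category_axioms]

lemma comp_pnat_simps [simp]:
 "nsrc (cp t s) = nsrc s" "ntrg (cp t s) = ntrg t"
 "A : objs K ==> nob (cp t s) A = nob t A**nob s A"
 "u : arrs K ==> nar (cp t s) u = (nob t (trg K u)<|nar s u).:(nar t u|>nob s (src K u))"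
 "nob (cp t s) : extensional (objs K)" "nar (cp t s) : extensional (arrs K)"
 by(simp_all add: comp_pnat_def)

lemma Hom_simps:
 "objs Ho = {F. pseudofunctor K L F}" "arrs Ho = {s. pseudonat K L s}" "cells Ho = {m. modification K L m}"
 "src Ho = nsrc" "trg Ho = ntrg" "csrc Ho = msrc" "ctrg Ho = mtrg" "cmp Ho = cp"
 by(simp_all add: Hom_def)

lemma one_simps [simp]:
 "nsrc (one Ho F) = F" "ntrg (one Ho F) = F" "A : objs K ==> nob (one Ho F) A = one L (pob F A)"
 "u : arrs K ==> nar (one Ho F) u = idc L (par F u)"
 "nob (one Ho F) : extensional (objs K)" "nar (one Ho F) : extensional (arrs K)"
 by(simp_all add: Hom_def)

lemma cell_ops_simps [simp]:
 "msrc (idc Ho s) = s" "mtrg (idc Ho s) = s" "A : objs K ==> mob (idc Ho s) A = idc L (nob s A)"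
 "msrc (vc Ho n m) = msrc m" "mtrg (vc Ho n m) = mtrg n" "A : objs K ==> mob (vc Ho n m) A = mob n A .: mob m A"
 "msrc (hc Ho n m) = cp (msrc n) (msrc m)" "mtrg (hc Ho n m) = cp (mtrg n) (mtrg m)"
 "A : objs K ==> mob (hc Ho n m) A = hc L (mob n A) (mob m A)"
 "mob (idc Ho s) : extensional (objs K)" "mob (vc Ho n m) : extensional (objs K)" "mob (hc Ho n m) : extensional (objs K)"
 by(simp_all add: Hom_def)

lemma pseudonat_one:
 assumes "pseudofunctor K L F"
 shows "pseudonat K L (one Ho F)"
proof -
 interpret F: pseudofunctor K L F by(rule assms)
 show ?thesis by(rule pseudonatI) (simp_all add: assms L.is_iso2_iff)
qed

lemma pseudonat_comp:
 assumes s: "pseudonat K L s" and t: "pseudonat K L t" and st: "ntrg s = nsrc t"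
 shows "pseudonat K L (cp t s)"
proof (rule pseudonatI)
 let ?c = "cp t s"
 interpret S: transformation K L s by(rule trans[OF s])
 interpret T: transformation K L t by(rule trans[OF t])
 note [simp] = st
 show "pseudofunctor K L (nsrc ?c)" "pseudofunctor K L (ntrg ?c)" by(simp_all add: S.F.pseudofunctor_axioms T.G.pseudofunctor_axioms)
 show "nob ?c : extensional (objs K)" "nar ?c : extensional (arrs K)" by simp+
 show "arr_in L (nob ?c A) (pob (nsrc ?c) A) (pob (ntrg ?c) A)" if "A : objs K" for A using that by simp
 show "is_iso2 L (nar ?c u) (par (ntrg ?c) u**nob ?c (src K u)) (nob ?c (trg K u)**par (nsrc ?c) u)"
  if "u : arrs K" for u using that by(simp add: L.is_iso2_iff)
 fix x assume x [simp]: "x : cells K"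
 let ?A = "src K (csrc K x)" and ?B = "trg K (csrc K x)"
 have c: "ctrg K x : arrs K" "src K (ctrg K x) = ?A" "trg K (ctrg K x) = ?B" by simp+
 have 1: "(nar t (ctrg K x)|>nob s ?A).:(pce (ntrg t) x|>nob t ?A|>nob s ?A) =
  (nob t ?B<|(pce (nsrc t) x|>nob s ?A)).:(nar t (csrc K x)|>nob s ?A)"
  using L.rcong[OF T.nat[OF x], of "nob s ?A"] by simp
 have 2: "(nob t ?B<|nar s (ctrg K x)).:(nob t ?B<|(pce (nsrc t) x|>nob s ?A)) =
  (nob t ?B<|nob s ?B<|pce (nsrc s) x).:(nob t ?B<|nar s (csrc K x))"
  using L.lcong[OF S.nat[OF x], of "nob t ?B"] by simp
 show "nar (cp t s) (ctrg K x).:(pce (ntrg (cp t s)) x|>nob (cp t s) ?A) =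
  (nob (cp t s) ?B<|pce (nsrc (cp t s)) x) .: nar (cp t s) (csrc K x)"
  by(simp add: 1 L.vx2[OF 2])
next
 interpret S: transformation K L s by(rule trans[OF s])
 interpret T: transformation K L t by(rule trans[OF t])
 note [simp] = st
 fix A assume A [simp]: "A : objs K"
 have "(nar t (one K A)|>nob s A).:(punit (ntrg t) A|>nob t A|>nob s A) = nob t A<|(punit (nsrc t) A|>nob s A)" using L.rcong[OF T.unit[OF A], of "nob s A"] by simp
 moreover have "(nob t A<|nar s (one K A)).:(nob t A<|(punit (nsrc t) A|>nob s A)) = nob t A<|nob s A<|punit (nsrc s) A" using L.lcong[OF S.unit[OF A], of "nob t A"] by simp
 ultimately show "nar (cp t s) (one K A).:(punit (ntrg (cp t s)) A|>nob (cp t s) A) = nob (cp t s) A<|punit (nsrc (cp t s)) A" by simp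
next
 interpret S: transformation K L s by(rule trans[OF s])
 interpret T: transformation K L t by(rule trans[OF t])
 note [simp] = st
 fix u v assume u [simp]: "u : arrs K" "v : arrs K" "trg K u = src K v"
 let ?A = "src K u" and ?C = "trg K v"
 have 1: "(nar t (v**@K u)|>nob s ?A).:(pcomp (ntrg t) v u|>nob t ?A|>nob s ?A) =
  (nob t ?C<|(pcomp (nsrc t) v u|>nob s ?A)).:(nar t v|>par (nsrc t) u|>nob s ?A).:(par (ntrg t) v<|(nar t u|>nob s ?A))"
  using L.rcong[OF T.comp[OF u], of "nob s ?A"] by simp
 have 2: "(nob t ?C<|nar s (v**@K u)).:(nob t ?C<|(pcomp (nsrc t) v u|>nob s ?A)) =
  (nob t ?C<|nob s ?C<|pcomp (nsrc s) v u).:(nob t ?C<|(nar s v|>par (nsrc s) u)).:(nob t ?C<|par (nsrc t) v<|nar s u)"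
  using L.lcong[OF S.comp[OF u], of "nob t ?C"] by simp
 have 3: "(nar t v|>nob s (src K v)|>par (nsrc s) u).:(par (ntrg t) v<|nob t (src K v)<|nar s u) =
  (nob t ?C<|par (nsrc t) v<|nar s u).:(nar t v|>par (nsrc t) u|>nob s ?A)"
  using L.ich[of "nar s u" "nar t v"] by simp
 show "nar (cp t s) (v**@K u).:(pcomp (ntrg (cp t s)) v u|>nob (cp t s) ?A) =
  (nob (cp t s) ?C<|pcomp (nsrc (cp t s)) v u).:(nar (cp t s) v|>par (nsrc (cp t s)) u) .:
  (par (ntrg (cp t s)) v<|nar (cp t s) u)"
  by(simp add: 1 L.vx2[OF 2] L.vx2[OF 3])
qed

lemma modD:
 assumes "modification K L m"
 shows "pseudonat K L (msrc m)" "pseudonat K L (mtrg m)" "nsrc (mtrg m) = nsrc (msrc m)" "ntrg (mtrg m) = ntrg (msrc m)"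
  "mob m : extensional (objs K)" "A : objs K ==> mob m A : cells L" "A : objs K ==> csrc L (mob m A) = nob (msrc m) A"
  "A : objs K ==> ctrg L (mob m A) = nob (mtrg m) A"
  "u : arrs K ==> (mob m (trg K u)|>par (nsrc (msrc m)) u) .: nar (msrc m) u = nar (mtrg m) u .: (par (ntrg (msrc m)) u<|mob m (src K u))"
 using assms by(auto simp: modification_iff)

lemma modification_idc:
 assumes s: "pseudonat K L s"
 shows "modification K L (idc Ho s)"
proof -
 interpret S: transformation K L s by(rule trans[OF s])
 show ?thesis using s by(simp add: modification_iff)
qed

lemma modification_vc:
 assumes m: "modification K L m" and n: "modification K L n" and mn: "mtrg m = msrc n"
 shows "modification K L (vc Ho n m)"
proof -
 interpret S: transformation K L "msrc m" by(rule trans[OF modD(1)[OF m]])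
 interpret T: transformation K L "mtrg m" by(rule trans[OF modD(2)[OF m]])
 interpret U: transformation K L "mtrg n" by(rule trans[OF modD(2)[OF n]])
 note [simp] = modD(1-8)[OF m] modD(1-8)[OF n] mn[symmetric]
 have "(mob n (trg K u)|>par (nsrc (msrc m)) u).:(mob m (trg K u)|>par (nsrc (msrc m)) u) .: nar (msrc m) u =
  nar (mtrg n) u .: (par (ntrg (msrc m)) u<|mob n (src K u)).:(par (ntrg (msrc m)) u<|mob m (src K u))" if [simp]: "u : arrs K" for u
 proof -
  note e = modD(9)[OF n, of u, simplified] modD(9)[OF m, of u, simplified]
  show ?thesis using T.n_simps(5-7)[of u] by(simp add: L.vx2[OF e(1)] e(2))
 qed
 then show ?thesis by(simp add: modification_iff)
qed

lemma modification_hc: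
 assumes m: "modification K L m" and n: "modification K L n" and mn: "ntrg (msrc m) = nsrc (msrc n)"
 shows "modification K L (hc Ho n m)"
proof -
 interpret S: transformation K L "msrc m" by(rule trans[OF modD(1)[OF m]])
 interpret T: transformation K L "mtrg m" by(rule trans[OF modD(2)[OF m]])
 interpret S': transformation K L "msrc n" by(rule trans[OF modD(1)[OF n]])
 interpret T': transformation K L "mtrg n" by(rule trans[OF modD(2)[OF n]])
 note [simp] = modD(1-8)[OF m] modD(1-8)[OF n] mn
 have "(hc L (mob n (trg K u)) (mob m (trg K u))|>par (nsrc (msrc m)) u) .: nar (cp (msrc n) (msrc m)) u =
  nar (cp (mtrg n) (mtrg m)) u .: (par (ntrg (msrc n)) u<|hc L (mob n (src K u)) (mob m (src K u)))" if [simp]: "u : arrs K" for u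
 proof -
  let ?A = "src K u" and ?B = "trg K u" and ?F = "par (nsrc (msrc m)) u" and ?G = "par (nsrc (msrc n)) u" and ?H = "par (ntrg (msrc n)) u"
  have 1: "(nob (msrc n) ?B<|(mob m ?B|>?F)).:(nob (msrc n) ?B<|nar (msrc m) u) =
  (nob (msrc n) ?B<|nar (mtrg m) u).:(nob (msrc n) ?B<|?G<|mob m ?A)"
  using L.lcong[OF modD(9)[OF m, of u], of "nob (msrc n) ?B"] by simp
  have 2: "(mob n ?B|>nob (mtrg m) ?B|>?F).:(nob (msrc n) ?B<|nar (mtrg m) u) =
  (nob (mtrg n) ?B<|nar (mtrg m) u).:(mob n ?B|>?G|>nob (mtrg m) ?A)"
  using L.ich[of "nar (mtrg m) u" "mob n ?B"] by simp
  have 3: "(nob (msrc n) ?B<|?G<|mob m ?A).:(nar (msrc n) u|>nob (msrc m) ?A) =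
  (nar (msrc n) u|>nob (mtrg m) ?A).:(?H<|nob (msrc n) ?A<|mob m ?A)"
  using L.ich[of "mob m ?A" "nar (msrc n) u"] by simp
  have 4: "(mob n ?B|>?G|>nob (mtrg m) ?A).:(nar (msrc n) u|>nob (mtrg m) ?A) =
  (nar (mtrg n) u|>nob (mtrg m) ?A).:(?H<|(mob n ?A|>nob (mtrg m) ?A))"
  using L.rcong[OF modD(9)[OF n, of u], of "nob (mtrg m) ?A"] by simp
  show ?thesis by(simp add: L.hc_whisk(1) L.vx2[OF 1] L.vx2[OF 2] 3 L.vx2[OF 4])
 qed
 then show ?thesis by(simp add: modification_iff pseudonat_comp)
qed

lemma comp_one:
 assumes s: "pseudonat K L s"
 shows "cp s (one Ho (nsrc s)) = s" "cp (one Ho (ntrg s)) s = s"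
proof -
 interpret S: transformation K L s by(rule trans[OF s])
 show "cp s (one Ho (nsrc s)) = s" "cp (one Ho (ntrg s)) s = s" by(rule pnat_eqI[of _ _ K], simp_all add: S.ext)+
qed

lemma comp_assoc:
 assumes s: "pseudonat K L s" and t: "pseudonat K L t" "nsrc t = ntrg s" and u: "pseudonat K L u" "nsrc u = ntrg t"
 shows "cp (cp u t) s = cp u (cp t s)"
proof -
 interpret S: transformation K L s by(rule trans[OF s])
 interpret T: transformation K L t by(rule trans[OF t(1)])
 interpret U: transformation K L u by(rule trans[OF u(1)])
 show ?thesis by(rule pnat_eqI[of _ _ K]) (simp_all add: t(2) u(2))
qed

theorem Hom_two_category: "two_category Ho"
proof
 note [simp] = Hom_simps
 fix s assume s: "s : arrs Ho"
 then show "src Ho s : objs Ho" "trg Ho s : objs Ho" by(simp_all add: pseudonat_def Let_def)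
 show "cell_in Ho (idc Ho s) s s" using modification_idc s by simp
next
 note [simp] = Hom_simps
 fix m assume "m : cells Ho"
 then have m: "modification K L m" by simp
 show "csrc Ho m : arrs Ho" "ctrg Ho m : arrs Ho"
  "src Ho (csrc Ho m) = src Ho (ctrg Ho m)"
  "trg Ho (csrc Ho m) = trg Ho (ctrg Ho m)" using modD(1-4)[OF m] by simp+
next
 show "F : objs Ho ==> arr_in Ho (one Ho F) F F" for F using pseudonat_one by(simp add: Hom_simps)
next
 note [simp] = Hom_simps
 fix s F G assume s: "arr_in Ho s F G"
 have p: "pseudonat K L s" "nsrc s = F" "ntrg s = G" using s by simp+
 show "cmp Ho s (one Ho F) = s" "cmp Ho (one Ho G) s = s" unfolding p(2,3)[symmetric] by(simp_all add: comp_one p(1))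
 fix t H assume t: "arr_in Ho t G H"
 have q: "pseudonat K L t" "nsrc t = ntrg s" "ntrg t = H" using t p by simp+
 show "arr_in Ho (cmp Ho t s) F H" using pseudonat_comp[OF p(1) q(1)] p q by simp
 interpret S: transformation K L s by(rule trans[OF p(1)])
 interpret T: transformation K L t by(rule trans[OF q(1)])
 show "hc Ho (idc Ho t) (idc Ho s) = idc Ho (cmp Ho t s)" by(rule modn_eqI[of _ _ K]) (simp_all add: q)
 fix u H' assume u: "arr_in Ho u H H'"
 show "cmp Ho (cmp Ho u t) s = cmp Ho u (cmp Ho t s)" using comp_assoc[OF p(1) q(1,2)] u q by simp
next
 note [simp] = Hom_simps
 fix m s t assume m0: "cell_in Ho m s t"
 have m: "modification K L m" and st: "s = msrc m" "t = mtrg m" using m0 by auto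
 note md = modD[OF m]
 interpret S: transformation K L "msrc m" by(rule trans[OF modD(1)[OF m]])
 interpret T: transformation K L "mtrg m" by(rule trans[OF modD(2)[OF m]])
 note [simp] = modD(1-8)[OF m]
 have co: "cp (mtrg m) (one Ho (nsrc (msrc m))) = mtrg m" "cp (one Ho (ntrg (msrc m))) (mtrg m) = mtrg m" using comp_one[OF modD(2)[OF m]] by simp+
 show "vc Ho m (idc Ho s) = m" "vc Ho (idc Ho t) m = m" unfolding st by(rule modn_eqI[of _ _ K], simp_all)+
 show "hc Ho m (idc Ho (one Ho (src Ho s))) = m" "hc Ho (idc Ho (one Ho (trg Ho s))) m = m"
  unfolding st by(rule modn_eqI[of _ _ K], simp_all add: comp_one co flip: lwhisk_def[of L] rwhisk_def[of L])+
 fix n u assume n0: "cell_in Ho n t u"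
 have n: "modification K L n" and tu: "mtrg m = msrc n" "u = mtrg n" using n0 st by auto
 show "cell_in Ho (vc Ho n m) s u" using modification_vc[OF m n tu(1)] st tu by simp
 fix p v assume p0: "cell_in Ho p u v"
 have p: "modification K L p" and uv: "mtrg n = msrc p" using p0 tu by auto
 show "vc Ho (vc Ho p n) m = vc Ho p (vc Ho n m)" by(rule modn_eqI[of _ _ K]) (simp_all add: modD(6-8)[OF n] modD(6-8)[OF p] tu[symmetric] uv[symmetric])
next
 note [simp] = Hom_simps
 fix m s s' n t t' assume mn: "cell_in Ho m s s'" "cell_in Ho n t t'" and st: "trg Ho s = src Ho t"
 have m: "modification K L m" "s = msrc m" "s' = mtrg m" and n: "modification K L n" "t = msrc n" "t' = mtrg n" using mn by auto
 interpret S: transformation K L "msrc m" by(rule trans[OF modD(1)[OF m(1)]])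
 interpret T: transformation K L "msrc n" by(rule trans[OF modD(1)[OF n(1)]])
 show "cell_in Ho (hc Ho n m) (cmp Ho t s) (cmp Ho t' s')" using modification_hc[OF m(1) n(1)] st m n by simp
 fix p u u' assume p0: "cell_in Ho p u u'" and tu: "trg Ho t = src Ho u"
 have p: "modification K L p" "u = msrc p" "u' = mtrg p" using p0 by auto
 interpret U: transformation K L "msrc p" by(rule trans[OF modD(1)[OF p(1)]])
 show "hc Ho (hc Ho p n) m = hc Ho p (hc Ho n m)"
  using st tu m n p by(intro modn_eqI[of _ _ K]) (simp_all add: comp_assoc modD(1-8)[OF m(1)] modD(1-8)[OF n(1)] modD(1-8)[OF p(1)] L.hc_assoc')
next
 note [simp] = Hom_simps
 fix m s s' m' s'' n t t' n' t''
 assume mn: "cell_in Ho m s s'" "cell_in Ho m' s' s''" "cell_in Ho n t t'" "cell_in Ho n' t' t''" and st: "trg Ho s = src Ho t"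
 have m: "modification K L m" "s = msrc m" "msrc m' = mtrg m" "modification K L m'"
  and n: "modification K L n" "t = msrc n" "msrc n' = mtrg n" "modification K L n'" using mn by auto
 interpret S: transformation K L "msrc m" by(rule trans[OF modD(1)[OF m(1)]])
 interpret T: transformation K L "msrc n" by(rule trans[OF modD(1)[OF n(1)]])
 interpret S': transformation K L "mtrg m" by(rule trans[OF modD(2)[OF m(1)]])
 interpret T': transformation K L "mtrg n" by(rule trans[OF modD(2)[OF n(1)]])
 show "hc Ho (vc Ho n' n) (vc Ho m' m) = vc Ho (hc Ho n' m') (hc Ho n m)"
  using st m n by(intro modn_eqI[of _ _ K]) (simp_all add: modD(1-8)[OF m(1)] modD(1-8)[OF n(1)] modD(6-8)[OF m(4)] modD(6-8)[OF n(4)] L.interchange')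
qed

text \<open>The pointwise inverses form a modification because both sides of each modification
  square can be inverted by \<open>inv2_swap\<close>.\<close>

lemma Hom_iso2:
 assumes m: "modification K L m" and i: "!!A. A : objs K ==> L.iso2 (mob m A)"
 shows "is_iso2 Ho m (msrc m) (mtrg m)"
proof -
 interpret S: transformation K L "msrc m" by(rule trans[OF modD(1)[OF m]])
 interpret T: transformation K L "mtrg m" by(rule trans[OF modD(2)[OF m]])
 let ?n = "(|msrc = mtrg m, mtrg = msrc m, mob = (\<lambda>A\<in>objs K. L.inv2 (mob m A))|)"
 note [simp] = modD(1-8)[OF m] i
 have "(L.inv2 (mob m (trg K u))|>par (nsrc (msrc m)) u) .: nar (mtrg m) u = nar (msrc m) u .: (par (ntrg (msrc m)) u<|L.inv2 (mob m (src K u)))"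
  if [simp]: "u : arrs K" for u
 proof -
  have "L.inv2 (mob m (trg K u)|>par (nsrc (msrc m)) u) .: nar (mtrg m) u = nar (msrc m) u .: L.inv2 (par (ntrg (msrc m)) u<|mob m (src K u))"
  by(rule L.inv2_swap) (use modD(9)[OF m, of u] T.n_simps(5-7)[of u] in simp_all)
  then show ?thesis by simp
 qed
 then have n: "modification K L ?n" by(simp add: modification_iff)
 have "vc Ho ?n m = idc Ho (msrc m)" "vc Ho m ?n = idc Ho (mtrg m)" by(rule modn_eqI[of _ _ K], simp_all)+
 with m n show ?thesis unfolding is_iso2_def by(intro conjI exI[of _ ?n]) (simp_all add: Hom_simps)
qed

end

section \<open>Restriction along the inclusion\<close>

lemma (in two_category) full_sub_two_category: "two_category (full_sub K S)"
 unfolding full_sub_def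
proof (unfold_locales, simp_all)
qed (auto simp: hc_assoc' interchange' simp flip: lwhisk_def rwhisk_def)

locale em_target = em K + L: two_category L
 for K :: "('o, 'a, 'c) two_cat" (structure) and L :: "('p, 'b, 'd) two_cat"

sublocale em_target \<subseteq> HK: homs K L
 by(intro homs.intro two_category_axioms L.two_category_axioms)

sublocale em_target \<subseteq> HM: homs "E*K" L
 by(intro homs.intro M.two_category_axioms L.two_category_axioms)

context em_target
begin

abbreviation "RF F == comp_pfun K L F inc"
abbreviation "Rn s == restrict_pnat K L inc s"
abbreviation "Rm m == restrict_modn K L inc m"

lemma incl_J:
 "A : objs K ==> pob inc A = idm A"
 "f : arrs K ==> par inc f = Ja K f"
 "x : cells K ==> pce inc x = Jc K x"
 "f : arrs K ==> g : arrs K ==> trg K f = src K g ==> pcomp inc g f = idc M (Ja K (g**f))"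
 "A : objs K ==> punit inc A = idc M (one M (idm A))"
 using J.F_one[of A] by(simp_all add: EM_dm_incl_def Let_def Ja_def Jc_def composable_def)

text \<open>The coherence cells of the inclusion are identities, so those of the restricted
  pseudofunctor are the cells of \<open>F\<close> at included 1-cells.\<close>

lemma R_simps:
 assumes "pseudofunctor M L F"
 shows "A : objs K ==> pob (RF F) A = pob F (idm A)"
  "f : arrs K ==> par (RF F) f = par F (Ja K f)"
  "x : cells K ==> pce (RF F) x = pce F (Jc K x)"
  "f : arrs K ==> g : arrs K ==> trg K f = src K g ==> pcomp (RF F) g f = pcomp F (Ja K g) (Ja K f)"
  "A : objs K ==> punit (RF F) A = punit F (idm A)"
proof -
 interpret F: pseudofunctor M L F by(rule assms)
 have o: "idm A : objs M" if "A : objs K" for A using J.Fo[OF that] .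
 show "A : objs K ==> pob (RF F) A = pob F (idm A)"
  "f : arrs K ==> par (RF F) f = par F (Ja K f)"
  "x : cells K ==> pce (RF F) x = pce F (Jc K x)"
  by(simp_all add: comp_pfun_def incl_J)
 show "A : objs K ==> punit (RF F) A = punit F (idm A)"
 proof -
  assume A: "A : objs K"
  then have "punit (RF F) A = idc L (ctrg L (punit F (idm A))) .:@L punit F (idm A)"
  using F.P_simps(8)[of "one M (idm A)"] M.one_in[OF o[OF A]] F.pu_simps(4)[OF o[OF A]] by(simp add: comp_pfun_def incl_J arr_in_def)
  also have "... = punit F (idm A)" using F.pu_simps(2)[OF o[OF A]] by simp
  finally show ?thesis .
 qed
 assume a: "f : arrs K" "g : arrs K" "trg K f = src K g"
 have "ctrg L (pcomp F (Ja K g) (Ja K f)) = par F (Ja K (g**f))" using F.pc_simps(4)[of "Ja K f" "Ja K g"] a by simp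
 then show "pcomp (RF F) g f = pcomp F (Ja K g) (Ja K f)" using a F.pc_simps[of "Ja K f" "Ja K g"] by(simp add: comp_pfun_def incl_J composable_def)
qed

lemma RF_ext: "pob (RF F) : extensional (objs K)" "par (RF F) : extensional (arrs K)" "pce (RF F) : extensional (cells K)"
 "punit (RF F) : extensional (objs K)" "\<not> composable K g f ==> pcomp (RF F) g f = undefined"
 by(simp_all add: comp_pfun_def)

lemma R_pseudofunctor:
 assumes "pseudofunctor M L F"
 shows "pseudofunctor K L (RF F)"
proof -
 interpret F: pseudofunctor M L F by(rule assms)
 note [simp] = R_simps[OF assms]
 show ?thesis
 proof (intro pseudofunctor.intro two_category_axioms L.two_category_axioms pseudofunctor_axioms.intro RF_ext)
  show "pob (RF F) A : objs L" if "A : objs K" for A using that J.Fo[OF that] F.P_simps(1) by simp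
  show "arr_in L (par (RF F) f) (pob (RF F) A) (pob (RF F) B)" if "arr f A B" for f A B
  using that by auto
  show "cell_in L (pce (RF F) x) (par (RF F) f) (par (RF F) g)" if "cell x f g" for x f g
  using that by auto
  show "pce (RF F) (idc K f) = idc L (par (RF F) f)" if "f : arrs K" for f
  using that by simp
  show "pce (RF F) (y .: x) = pce (RF F) y .:@L pce (RF F) x" if "cell x f g" "cell y g h" for x f g y h
  using that by simp
  show "is_iso2 L (pcomp (RF F) g f) (par (RF F) g**@L par (RF F) f) (par (RF F) (g**f))" if "composable K g f" for g f
  using that F.pc_simps[of "Ja K f" "Ja K g"] by(simp add: composable_def L.is_iso2_iff)
  show "is_iso2 L (punit (RF F) A) (one L (pob (RF F) A)) (par (RF F) (one K A))" if "A : objs K" for A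
  using that F.pu_simps[OF J.Fo[OF that]] by(simp add: L.is_iso2_iff)
  show "pce (RF F) (y \<star> x) .:@L pcomp (RF F) g f = pcomp (RF F) g' f' .:@L hc L (pce (RF F) y) (pce (RF F) x)"
  if "cell x f f'" "cell y g g'" "composable K g f" for x f f' y g g'
  proof -
  have c: "x : cells K" "y : cells K" "f = csrc K x" "f' = ctrg K x" "g = csrc K y" "g' = ctrg K y" "trg K (csrc K x) = src K (csrc K y)" using that by(auto simp: composable_def)
  show ?thesis unfolding c(3-6) using c(1,2,7) F.pc_nat[of "Jc K x" "Jc K y"] by(simp add: J.F_hc)
  qed
  show "pcomp (RF F) (h**g) f .:@L(pcomp (RF F) h g|>@L par (RF F) f) = pcomp (RF F) h (g**f) .:@L(par (RF F) h<|@L pcomp (RF F) g f)"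
  if "composable K h g" "composable K g f" for h g f
  using that F.pc_assoc[of "Ja K f" "Ja K g" "Ja K h"] by(simp add: composable_def)
  show "pcomp (RF F) (one K B) f .:@L(punit (RF F) B|>@L par (RF F) f) = idc L (par (RF F) f)"
  "pcomp (RF F) f (one K A) .:@L(par (RF F) f<|@L punit (RF F) A) = idc L (par (RF F) f)"
  if f: "arr f A B" for f A B
  using F.pu_left[of "Ja K f" "idm B"] F.pu_right[of "Ja K f" "idm A"] f trg_objs[of f] src_objs[of f] by auto
 qed
qed

lemma Rn_simps [simp]:
 "nsrc (Rn s) = RF (nsrc s)" "ntrg (Rn s) = RF (ntrg s)" "A : objs K ==> nob (Rn s) A = nob s (idm A)"
 "u : arrs K ==> nar (Rn s) u = nar s (Ja K u)" "nob (Rn s) : extensional (objs K)" "nar (Rn s) : extensional (arrs K)"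
 by(simp_all add: restrict_pnat_def incl_J)

lemma Rm_simps [simp]:
 "msrc (Rm m) = Rn (msrc m)" "mtrg (Rm m) = Rn (mtrg m)" "A : objs K ==> mob (Rm m) A = mob m (idm A)"
 "mob (Rm m) : extensional (objs K)"
 by(simp_all add: restrict_modn_def incl_J)

lemma R_pnat:
 assumes s: "pseudonat M L s"
 shows "pseudonat K L (Rn s)"
proof (rule pseudonatI)
 interpret S: transformation M L s by(rule HM.trans[OF s])
 note [simp] = R_simps[OF S.F.pseudofunctor_axioms] R_simps[OF S.G.pseudofunctor_axioms]
 have o [simp]: "mon (idm A)" if "A : objs K" for A using J.Fo[OF that] by simp
 show "pseudofunctor K L (nsrc (Rn s))" "pseudofunctor K L (ntrg (Rn s))" by(simp_all add: R_pseudofunctor S.F.pseudofunctor_axioms S.G.pseudofunctor_axioms)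
 show "arr_in L (nob (Rn s) A) (pob (nsrc (Rn s)) A) (pob (ntrg (Rn s)) A)" if "A : objs K" for A using that by simp
 show "is_iso2 L (nar (Rn s) u) (par (ntrg (Rn s)) u**@L nob (Rn s) (src K u)) (nob (Rn s) (trg K u)**@L par (nsrc (Rn s)) u)" if "u : arrs K" for u
  using that by(simp add: L.is_iso2_iff)
 show "nar (Rn s) (ctrg K x) .:@L(pce (ntrg (Rn s)) x|>@L nob (Rn s) (src K (csrc K x))) =
  (nob (Rn s) (trg K (csrc K x))<|@L pce (nsrc (Rn s)) x) .:@L nar (Rn s) (csrc K x)" if "x : cells K" for x
  using that S.nat[of "Jc K x"] by simp
 show "nar (Rn s) (one K A) .:@L(punit (ntrg (Rn s)) A|>@L nob (Rn s) A) = nob (Rn s) A<|@L punit (nsrc (Rn s)) A" if "A : objs K" for A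
  using that S.unit[of "idm A"] by simp
 show "nar (Rn s) (v**u) .:@L(pcomp (ntrg (Rn s)) v u|>@L nob (Rn s) (src K u)) =
  (nob (Rn s) (trg K v)<|@L pcomp (nsrc (Rn s)) v u) .:@L(nar (Rn s) v|>@L par (nsrc (Rn s)) u) .:@L(par (ntrg (Rn s)) v<|@L nar (Rn s) u)"
  if "u : arrs K" "v : arrs K" "trg K u = src K v" for u v
  using that S.comp[of "Ja K u" "Ja K v"] by simp
qed simp_all

lemma R_modn:
 assumes m: "modification M L m"
 shows "modification K L (Rm m)"
proof -
 note d = HM.modD[OF m]
 interpret S: transformation M L "msrc m" by(rule HM.trans[OF d(1)])
 interpret T: transformation M L "mtrg m" by(rule HM.trans[OF d(2)])
 note [simp] = R_simps[OF S.F.pseudofunctor_axioms] R_simps[OF S.G.pseudofunctor_axioms]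
 have o [simp]: "mon (idm A)" if "A : objs K" for A using J.Fo[OF that] by simp
 have "(mob m (idm (trg K u))|>@L par (nsrc (msrc m)) (Ja K u)) .:@L nar (msrc m) (Ja K u) =
  nar (mtrg m) (Ja K u) .:@L(par (ntrg (msrc m)) (Ja K u)<|@L mob m (idm (src K u)))" if "u : arrs K" for u
  using d(9)[of "Ja K u"] that by simp
 then show ?thesis using d(1-8) by(simp add: modification_iff R_pnat)
qed

text \<open>Restriction commutes strictly with all operations and its coherence cells are
  identities, so each axiom reduces to identity laws in \<open>Hom K L\<close>.\<close>

theorem restriction_pseudofunctor:
 assumes D: "D = full_sub HM.Ho S"
 shows "pseudofunctor D HK.Ho (restriction K L inc D)"
proof -
 let ?R = "restriction K L inc D"
 interpret D: two_category D unfolding D by(rule two_category.full_sub_two_category[OF HM.Hom_two_category])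
 interpret HK2: two_category "Hom K L" by(rule HK.Hom_two_category)
 have sub: "F : objs D ==> pseudofunctor M L F" "s : arrs D ==> pseudonat M L s" "m : cells D ==> modification M L m" for F s m
  by(simp_all add: D full_sub_def HM.Hom_simps)
 have ops: "src D = nsrc" "trg D = ntrg" "csrc D = msrc" "ctrg D = mtrg" "cmp D = comp_pnat M L" "one D = one HM.Ho" "idc D = idc HM.Ho"
  "vc D = vc HM.Ho" "hc D = hc HM.Ho"
  by(simp_all add: D full_sub_def HM.Hom_simps)
 have R: "F : objs D ==> pob ?R F = RF F" "s : arrs D ==> par ?R s = Rn s" "m : cells D ==> pce ?R m = Rm m"
  "composable D t s ==> pcomp ?R t s = idc HK.Ho (Rn (cmp D t s))" "F : objs D ==> punit ?R F = idc HK.Ho (one HK.Ho (RF F))" for F s m t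
  by(simp_all add: restriction_def)
 have o [simp]: "mon (idm A)" if "A : objs K" for A using J.Fo[OF that] by simp
 have cR: "Rn (comp_pnat M L t s) = comp_pnat K L (Rn t) (Rn s)" if "s : arrs D" "t : arrs D" for s t
  by(rule pnat_eqI[of _ _ K]) simp_all
 have oR: "Rn (one HM.Ho F) = one HK.Ho (RF F)" if "F : objs D" for F
  using R_simps[OF sub(1)[OF that]] by(intro pnat_eqI[of _ _ K]) simp_all
 have iR: "Rm (idc HM.Ho s) = idc HK.Ho (Rn s)" for s
  by(rule modn_eqI[of _ _ K]) simp_all
 have vR: "Rm (vc HM.Ho n m) = vc HK.Ho (Rm n) (Rm m)" for n m
  by(rule modn_eqI[of _ _ K]) simp_all
 have hR: "Rm (hc HM.Ho n m) = hc HK.Ho (Rm n) (Rm m)" if "m : cells D" "n : cells D" for n m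
  using that by(intro modn_eqI[of _ _ K]) (simp_all add: cR D.csrc_arrs[unfolded ops] D.ctrg_arrs[unfolded ops])
 have H: "s : arrs D ==> Rn s : arrs HK.Ho" "m : cells D ==> Rm m : cells HK.Ho" "F : objs D ==> RF F : objs HK.Ho" for s m F
  using R_pnat sub R_modn R_pseudofunctor by(simp_all add: HK.Hom_simps)
 have Hs: "src HK.Ho = nsrc" "trg HK.Ho = ntrg" "csrc HK.Ho = msrc" "ctrg HK.Ho = mtrg" "cmp HK.Ho = comp_pnat K L" by(simp_all add: HK.Hom_simps)
 have cD: "comp_pnat M L t s : arrs D" if "s : arrs D" "t : arrs D" "ntrg s = nsrc t" for s t
  using D.cmp_in[of s "nsrc s" "ntrg s" t "ntrg t"] that by(simp add: ops)
 show ?thesis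
 proof (intro pseudofunctor.intro D.two_category_axioms HK.Hom_two_category pseudofunctor_axioms.intro)
  show "pob ?R : extensional (objs D)" "par ?R : extensional (arrs D)" "pce ?R : extensional (cells D)" "punit ?R : extensional (objs D)"
  "!!t s. \<not> composable D t s ==> pcomp ?R t s = undefined" by(simp_all add: restriction_def)
  show "pob ?R F : objs HK.Ho" if "F : objs D" for F using that H by(simp add: R)
  show "arr_in HK.Ho (par ?R s) (pob ?R F) (pob ?R G)" if s: "arr_in D s F G" for s F G
  using s H(1)[of s] D.src_objs[of s] D.trg_objs[of s] by(auto simp: R Hs ops)
  show "cell_in HK.Ho (pce ?R m) (par ?R s) (par ?R t)" if m: "cell_in D m s t" for m s t
  using m H(2)[of m] D.csrc_arrs[of m] D.ctrg_arrs[of m] by(auto simp: R Hs ops)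
  show "pce ?R (idc D s) = idc HK.Ho (par ?R s)" if "s : arrs D" for s
  using that D.idc_in[of s] by(simp add: R) (simp add: ops iR)
  show "pce ?R (vc D n m) = vc HK.Ho (pce ?R n) (pce ?R m)" if "cell_in D m s t" "cell_in D n t u" for n m s t u
  using that D.vc_in[of m s t n u] by(simp add: R) (simp add: ops vR)
  show "is_iso2 HK.Ho (pcomp ?R t s) (cmp HK.Ho (par ?R t) (par ?R s)) (par ?R (cmp D t s))" if st: "composable D t s" for t s
  proof -
  have st': "s : arrs D" "t : arrs D" "ntrg s = nsrc t" using st by(simp_all add: composable_def ops)
  show ?thesis using st st' H(1)[OF cD[OF st']] by(simp add: HK2.is_iso2_iff R) (simp add: ops Hs R cD cR)
  qed
  show "is_iso2 HK.Ho (punit ?R F) (one HK.Ho (pob ?R F)) (par ?R (one D F))" if F: "F : objs D" for F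
  using F H(3)[OF F] D.one_in[OF F] by(simp add: HK2.is_iso2_iff R) (simp add: ops oR)
  show "vc HK.Ho (pce ?R (hc D n m)) (pcomp ?R t s) = vc HK.Ho (pcomp ?R t' s') (hc HK.Ho (pce ?R n) (pce ?R m))"
  if mn: "cell_in D m s s'" "cell_in D n t t'" and st: "composable D t s" for m n s s' t t'
  proof -
  have a: "s : arrs D" "t : arrs D" "s' : arrs D" "t' : arrs D" "m : cells D" "n : cells D" "s = msrc m" "t = msrc n" "s' = mtrg m" "t' = mtrg n"
  using mn D.csrc_arrs[of m] D.ctrg_arrs[of m] D.csrc_arrs[of n] D.ctrg_arrs[of n] by(auto simp: ops)
  have b: "ntrg s = nsrc t" "ntrg s' = nsrc t'" using st D.trg_csrc[of m] D.src_csrc[of n] a by(simp_all add: composable_def ops)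
  have st': "composable D t' s'" using a b by(simp add: composable_def ops)
  have h: "hc D n m : cells D" using D.hc_in[OF mn] b by(simp add: ops)
  have e: "Rm (hc D n m) = hc HK.Ho (Rm n) (Rm m)" using hR a by(simp add: ops)
  have f: "Rm (hc D n m) : cells HK.Ho" "csrc HK.Ho (Rm (hc D n m)) = Rn (cmp D t s)" "ctrg HK.Ho (Rm (hc D n m)) = Rn (cmp D t' s')" using H(2)[OF h] a by(simp_all add: Hs ops)
  have "vc HK.Ho (Rm (hc D n m)) (idc HK.Ho (Rn (cmp D t s))) = vc HK.Ho (idc HK.Ho (Rn (cmp D t' s'))) (Rm (hc D n m))"
  using HK2.vc_idc[of "Rm (hc D n m)" _ "Rn (cmp D t' s')"] HK2.idc_vc[of "Rm (hc D n m)" "Rn (cmp D t s)"] f by simp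
  then show ?thesis unfolding R(3)[OF h] R(3)[OF a(5)] R(3)[OF a(6)] R(4)[OF st] R(4)[OF st'] e .
  qed
  \<comment> \<open>The common shape of the associativity and unit axioms once all coherence cells
    are identities.\<close>
  have fin: "vc HK.Ho (idc HK.Ho s) (hc HK.Ho (idc HK.Ho t) (idc HK.Ho u)) = idc HK.Ho s"
  if "t : arrs HK.Ho" "u : arrs HK.Ho" "ntrg u = nsrc t" "comp_pnat K L t u = s" for s t u
  using that HK2.idc_hc_idc[of u t] HK2.cmp_in[of u _ "ntrg u" t "ntrg t"] HK2.vc_idc[of "idc HK.Ho s" s s] HK2.idc_in[of s] by(simp add: Hs)
  show "vc HK.Ho (pcomp ?R (cmp D u t) s) (pcomp ?R u t |>@HK.Ho par ?R s) =
  vc HK.Ho (pcomp ?R u (cmp D t s)) (par ?R u <|@HK.Ho pcomp ?R t s)" if ut: "composable D u t" and ts: "composable D t s" for s t u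
  proof -
  have a: "s : arrs D" "t : arrs D" "u : arrs D" "ntrg s = nsrc t" "ntrg t = nsrc u" using ut ts by(simp_all add: composable_def ops)
  have c: "comp_pnat M L t s : arrs D" "comp_pnat M L u t : arrs D" using cD a by simp+
  have co: "composable D (cmp D u t) s" "composable D u (cmp D t s)" using a c by(simp_all add: composable_def ops)
  have as: "comp_pnat M L (comp_pnat M L u t) s = comp_pnat M L u (comp_pnat M L t s)" using HM.comp_assoc sub(2) a by simp
  have as': "comp_pnat K L (comp_pnat K L (Rn u) (Rn t)) (Rn s) = comp_pnat K L (Rn u) (comp_pnat K L (Rn t) (Rn s))" using HK.comp_assoc R_pnat sub(2) a by simp
  note f = fin[of "Rn (comp_pnat M L u t)" "Rn s" "Rn (comp_pnat M L u (comp_pnat M L t s))"] fin[of "Rn u" "Rn (comp_pnat M L t s)" "Rn (comp_pnat M L u (comp_pnat M L t s))"]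
  show ?thesis using f H(1) a c co ut ts as as' by(simp add: R lwhisk_def[of "Hom K L"] rwhisk_def[of "Hom K L"]) (simp add: ops cR as)
  qed
  show "vc HK.Ho (pcomp ?R (one D G) s) (punit ?R G |>@HK.Ho par ?R s) = idc HK.Ho (par ?R s)"
  "vc HK.Ho (pcomp ?R s (one D F)) (par ?R s <|@HK.Ho punit ?R F) = idc HK.Ho (par ?R s)" if s0: "arr_in D s F G" for s F G
  proof -
  have s: "s : arrs D" "F = nsrc s" "G = ntrg s" using s0 by(auto simp: ops)
  have FG: "F : objs D" "G : objs D" using D.src_objs[OF s(1)] D.trg_objs[OF s(1)] s by(simp_all add: ops)
  have on: "one D F : arrs D" "one D G : arrs D" using D.one_in FG by simp+
  have co: "composable D (one D G) s" "composable D s (one D F)" using on s by(simp_all add: composable_def ops)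
  have cm: "cmp D (one D G) s = s" "cmp D s (one D F) = s" using D.one_cmp[OF s0] D.cmp_one[OF s0] by simp+
  have k: "comp_pnat K L (one HK.Ho (RF G)) (Rn s) = Rn s" "comp_pnat K L (Rn s) (one HK.Ho (RF F)) = Rn s" using HK.comp_one[OF R_pnat[OF sub(2)[OF s(1)]]] s by simp+
  have o1: "one HK.Ho (RF F) : arrs HK.Ho" "one HK.Ho (RF G) : arrs HK.Ho" using HK2.one_in H(3) FG by simp+
  show "vc HK.Ho (pcomp ?R (one D G) s) (punit ?R G |>@HK.Ho par ?R s) = idc HK.Ho (par ?R s)"
  "vc HK.Ho (pcomp ?R s (one D F)) (par ?R s <|@HK.Ho punit ?R F) = idc HK.Ho (par ?R s)"
  using fin[of "one HK.Ho (RF G)" "Rn s" "Rn s"] fin[of "Rn s" "one HK.Ho (RF F)" "Rn s"] k o1 H(1)[OF s(1)] s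
  unfolding R(4)[OF co(1)] R(4)[OF co(2)] R(5)[OF FG(1)] R(5)[OF FG(2)] R(2)[OF s(1)] cm lwhisk_def[of "Hom K L"] rwhisk_def[of "Hom K L"] by simp+
  qed
 qed
qed

end

section \<open>The collage of a pseudofunctor\<close>

text \<open>A strict 1-category with a coherent realisation of its arrows in a 2-category \<open>L\<close> becomes a 2-category
 whose 2-cells are those of \<open>L\<close> between the realisations.\<close>

locale realisation = L: two_category L for L :: "('p, 'b, 'd) two_cat" (structure) +
 fixes X :: "'x set" and A :: "'n set" and s t :: "'n => 'x" and o1 :: "'x => 'n" and c :: "'n => 'n => 'n"
  and Ro :: "'x => 'p" and R :: "'n => 'b" and g :: "'n => 'n => 'd" and i :: "'x => 'd"
 assumes st [simp]: "p : A ==> s p : X" "p : A ==> t p : X"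
  and o1 [simp]: "x : X ==> o1 x : A" "x : X ==> s (o1 x) = x" "x : X ==> t (o1 x) = x"
  and c [simp]: "p : A ==> q : A ==> t p = s q ==> c q p : A" "p : A ==> q : A ==> t p = s q ==> s (c q p) = s p"
  "p : A ==> q : A ==> t p = s q ==> t (c q p) = t q"
  and c1 [simp]: "p : A ==> s p = x ==> c p (o1 x) = p" "p : A ==> t p = x ==> c (o1 x) p = p"
  and ca [simp]: "p : A ==> q : A ==> r : A ==> t p = s q ==> t q = s r ==> c (c r q) p = c r (c q p)"
  and Ro [simp]: "x : X ==> Ro x : objs L"
  and R [simp]: "p : A ==> R p : arrs L" "p : A ==> src L (R p) = Ro (s p)" "p : A ==> trg L (R p) = Ro (t p)"
  and g: "p : A ==> q : A ==> t p = s q ==> is_iso2 L (g q p) (R q**@L R p) (R (c q p))"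
  and i: "x : X ==> is_iso2 L (i x) (one L (Ro x)) (R (o1 x))"
  and ga: "p : A ==> q : A ==> r : A ==> t p = s q ==> t q = s r ==>
  g (c r q) p .:@L(g r q|>@L R p) = g r (c q p) .:@L(R r<|@L g q p)"
  and gi: "p : A ==> g p (o1 (s p)) .:@L(R p<|@L i (s p)) = idc L (R p)" "p : A ==> g (o1 (t p)) p .:@L(i (t p)|>@L R p) = idc L (R p)"
begin

definition N :: "('x, 'n, 'n \<times> 'n \<times> 'd) two_cat" where
 "N = (|objs = X, arrs = A, cells = {(p, q, x). p : A & q : A & s p = s q & t p = t q & cell_in L x (R p) (R q)},
  src = s, trg = t, csrc = (%(p, q, x). p), ctrg = (%(p, q, x). q), one = o1, cmp = c, idc = (%p. (p, p, idc L (R p))),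
  vc = (%(q', r, y) (p, q, x). (p, r, y .: x)),
  hc = (%(q, q', y) (p, p', x). (c q p, c q' p', g q' p' .: hc L y x .: L.inv2 (g q p)))|)"

lemma N_simps:
 "objs N = X" "arrs N = A" "(p, q, x) : cells N <-> p : A & q : A & s p = s q & t p = t q & cell_in L x (R p) (R q)"
 "src N = s" "trg N = t" "csrc N (p, q, x) = p" "ctrg N (p, q, x) = q" "one N = o1" "cmp N = c" "idc N p = (p, p, idc L (R p))"
 "vc N (q', r, y) (p, q, x) = (p, r, y .: x)"
 "hc N (q, q', y) (p, p', x) = (c q p, c q' p', g q' p' .: hc L y x .: L.inv2 (g q p))"
 by(simp_all add: N_def)

lemma g_simps [simp]:
 assumes "p : A" "q : A" "t p = s q"
 shows "L.iso2 (g q p)" "g q p : cells L" "csrc L (g q p) = R q**R p" "ctrg L (g q p) = R (c q p)"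
 using g[OF assms] by(simp_all add: L.is_iso2_iff)

lemma i_simps [simp]:
 assumes "x : X"
 shows "L.iso2 (i x)" "i x : cells L" "csrc L (i x) = one L (Ro x)" "ctrg L (i x) = R (o1 x)"
 using i[OF assms] by(simp_all add: L.is_iso2_iff)

text \<open>The unit laws present a whiskering of \<open>i\<close> as a right inverse of the
  invertible \<open>g\<close>, hence as its inverse. Horizontal composition with an identity cell
  can then be computed.\<close>

lemma inv_gi: "p : A ==> L.inv2 (g p (o1 (s p))) = R p<|i (s p)" "p : A ==> L.inv2 (g (o1 (t p)) p) = i (t p)|>R p"
 using L.inv2_unique(1)[of "R p<|i (s p)" "g p (o1 (s p))"] L.inv2_unique(1)[of "i (t p)|>R p" "g (o1 (t p)) p"] gi
  L.inverse_unique[of "g p (o1 (s p))" "L.inv2 (g p (o1 (s p)))" "R p<|i (s p)"]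
  L.inverse_unique[of "g (o1 (t p)) p" "L.inv2 (g (o1 (t p)) p)" "i (t p)|>R p"] by simp+

lemma N_cellE:
 assumes "z : cells N"
 obtains p q x where "z = (p, q, x)" "p : A" "q : A" "s q = s p" "t q = t p" "x : cells L" "csrc L x = R p" "ctrg L x = R q"
 using assms by(cases z) (auto simp: N_simps)

lemma N_cell:
 assumes "cell_in N z f f'"
 obtains x where "z = (f, f', x)" "f : A" "f' : A" "s f' = s f" "t f' = t f" "x : cells L" "csrc L x = R f" "ctrg L x = R f'"
proof -
 obtain p q x where z: "z = (p, q, x)" by(cases z)
 have m: "(p, q, x) : cells N" using assms by(simp add: z)
 have e: "p = f" "q = f'" using assms by(simp_all add: N_simps(6,7) z)
 show ?thesis using z m[unfolded N_simps(3)] unfolding e by(intro that[of x]) simp_all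
qed

theorem N_two_category: "two_category N"
proof
 fix z assume "z : cells N"
 then obtain p q x where "z = (p, q, x)" "p : A" "q : A" "s q = s p" "t q = t p" by(rule N_cellE)
 then show "csrc N z : arrs N" "ctrg N z : arrs N" "src N (csrc N z) = src N (ctrg N z)" "trg N (csrc N z) = trg N (ctrg N z)" by(simp_all add: N_simps)
next
 fix z f f' assume z0: "cell_in N z f f'"
 obtain x where z: "z = (f, f', x)" "f : A" "f' : A" "s f' = s f" "t f' = t f" "x : cells L" "csrc L x = R f" "ctrg L x = R f'"
  using z0 by(rule N_cell)
 note [simp] = z(2-8)
 show "vc N z (idc N f) = z" "vc N (idc N f') z = z" by(simp_all add: N_simps z(1))
 have "L.inv2 (g f (o1 (s f))) = R f<|i (s f)" "L.inv2 (g (o1 (t f)) f) = i (t f)|>R f" using inv_gi by simp+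
 moreover have "(x|>R (o1 (s f))).:(R f<|i (s f)) = (R f'<|i (s f)) .: x" "(R (o1 (t f))<|x).:(i (t f)|>R f) = (i (t f)|>R f') .: x"
  using L.ich[of "i (s f)" x] L.ich[of x "i (t f)"] by simp+
 moreover have "g f' (o1 (s f)).:(R f'<|i (s f)) .: x = x" "g (o1 (t f)) f' .: (i (t f)|>R f') .: x = x" using L.vx2[OF gi(1)[of f'], of x] L.vx2[OF gi(2)[of f'], of x] by simp+
 ultimately show "hc N z (idc N (one N (src N f))) = z" "hc N (idc N (one N (trg N f))) z = z" by(simp_all add: N_simps z(1) flip: lwhisk_def[of L] rwhisk_def[of L])
 fix w k assume "cell_in N w f' k"
 then obtain y where "w = (f', k, y)" "k : A" "s k = s f'" "t k = t f'" "y : cells L" "csrc L y = R f'" "ctrg L y = R k" by(rule N_cell)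
 then have w: "w = (f', k, y)" "k : A" "s k = s f" "t k = t f" "y : cells L" "csrc L y = R f'" "ctrg L y = R k" by simp+
 then show "cell_in N (vc N w z) f k" by(simp add: N_simps z(1))
 fix v l assume "cell_in N v k l"
 then obtain u where v: "v = (k, l, u)" "u : cells L" "csrc L u = R k" by(rule N_cell)
 then show "vc N (vc N v w) z = vc N v (vc N w z)" using w by(simp add: N_simps z(1))
next
 fix z f f' w h h' assume zz: "cell_in N z f f'" and ww: "cell_in N w h h'" and fh: "trg N f = src N h"
 obtain x where z: "z = (f, f', x)" "f : A" "f' : A" "s f' = s f" "t f' = t f" "x : cells L" "csrc L x = R f" "ctrg L x = R f'"
  using zz by(rule N_cell)
 obtain y where w: "w = (h, h', y)" "h : A" "h' : A" "s h' = s h" "t h' = t h" "y : cells L" "csrc L y = R h" "ctrg L y = R h'"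
  using ww by(rule N_cell)
 have tf [simp]: "t f = s h" using fh by(simp add: N_simps)
 note [simp] = z(2-8) w(2-8)
 show "cell_in N (hc N w z) (cmp N h f) (cmp N h' f')" by(simp add: N_simps z(1) w(1))
 {
  fix v k k' assume vv: "cell_in N v k k'" and hk: "trg N h = src N k"
  obtain u where v: "v = (k, k', u)" "k : A" "k' : A" "s k' = s k" "t k' = t k" "u : cells L" "csrc L u = R k" "ctrg L u = R k'"
  using vv by(rule N_cell)
  have tk [simp]: "t h = s k" using hk by(simp add: N_simps)
  note [simp] = v(2-8)
  have inv: "(L.inv2 (g k h)|>R f) .: L.inv2 (g (c k h) f) = (R k<|L.inv2 (g h f)) .: L.inv2 (g k (c h f))" using arg_cong[OF ga[of f h k], of L.inv2] by simp
  have a: "hc L (g k' h' .: hc L u y .: L.inv2 (g k h)) x = (g k' h'|>R f') .: hc L (hc L u y) x .: (L.inv2 (g k h)|>R f)" by(simp add: L.interchange'[symmetric] rwhisk_def)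
  have b: "hc L u (g h' f' .: hc L y x .: L.inv2 (g h f)) = (R k'<|g h' f') .: hc L u (hc L y x).:(R k<|L.inv2 (g h f))" by(simp add: L.interchange'[symmetric] lwhisk_def)
  have e: "g (c k' h') f' .: (g k' h'|>R f') = g k' (c h' f').:(R k'<|g h' f')" using ga[of f' h' k'] by simp
  show "hc N (hc N v w) z = hc N v (hc N w z)" by(simp add: N_simps z(1) w(1) v(1) a b inv L.vx2[OF e] L.hc_assoc')
 }
 fix z' f2 w' h2 assume zz': "cell_in N z' f' f2" and ww': "cell_in N w' h' h2"
 obtain x' where z': "z' = (f', f2, x')" "f2 : A" "s f2 = s f'" "t f2 = t f'" "x' : cells L" "csrc L x' = R f'" "ctrg L x' = R f2"
  using zz' by(rule N_cell)
 obtain y' where w': "w' = (h', h2, y')" "h2 : A" "s h2 = s h'" "t h2 = t h'" "y' : cells L" "csrc L y' = R h'" "ctrg L y' = R h2"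
  using ww' by(rule N_cell)
 note [simp] = z'(2-) w'(2-)
 show "hc N (vc N w' w) (vc N z' z) = vc N (hc N w' z') (hc N w z)" by(simp add: N_simps z(1) w(1) z'(1) w'(1) L.interchange')
qed (auto simp: N_simps)

end

text \<open>\<open>MA f x\<close> is a formal pair of \<open>x : X -> P A\<close> in
  \<open>L\<close> and \<open>f : A -> B\<close> in \<open>K\<close>. Keeping the pair instead of
  its value \<open>P f x\<close> makes composition with 1-cells of \<open>K\<close> strictly
  associative; different pairs may have the same realisation.\<close>

datatype ('a, 'b) coll = LA 'b | KA 'a | MA 'a 'b

context pseudofunctor
begin

definition cs :: "('a, 'b) coll => 'p + 'o" where
 "cs n = (case n of LA y => Inl (src L y) | KA f => Inr (src K f) | MA f x => Inl (src L x))"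

definition ct :: "('a, 'b) coll => 'p + 'o" where
 "ct n = (case n of LA y => Inl (trg L y) | KA f => Inr (trg K f) | MA f x => Inr (trg K f))"

definition cA :: "('a, 'b) coll set" where
 "cA = LA ` arrs L \<union> KA ` arrs K \<union> {MA f x |f x. f : arrs K & x : arrs L & trg L x = pob F (src K f)}"

definition cone :: "'p + 'o => ('a, 'b) coll" where
 "cone x = (case x of Inl X => LA (one L X) | Inr A => KA (one K A))"

text \<open>The last clause is a default for pairs that are not composable: no 1-cell leads from an
  object of \<open>K\<close> back to an object of \<open>L\<close>.\<close>

fun ccmp :: "('a, 'b) coll => ('a, 'b) coll => ('a, 'b) coll" where
 "ccmp (LA y) (LA x) = LA (y**@L x)"
| "ccmp (KA g) (KA f) = KA (g**@K f)"
| "ccmp (KA g) (MA f x) = MA (g**@K f) x"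
| "ccmp (MA f x) (LA y) = MA f (x**@L y)"
| "ccmp n m = n"

definition cR :: "('a, 'b) coll => 'b" where
 "cR n = (case n of LA y => y | KA f => par F f | MA f x => par F f**@L x)"

text \<open>Realisation fails to be strict only where two 1-cells of \<open>K\<close> meet; there
  the coherence of \<open>F\<close> is inserted.\<close>

fun cg :: "('a, 'b) coll => ('a, 'b) coll => 'd" where
 "cg (KA g) (KA f) = pcomp F g f"
| "cg (KA g) (MA f x) = pcomp F g f|>@L x"
| "cg n m = idc L (cR n**@L cR m)"

lemma coll_simps [simp]:
 "cs (LA y) = Inl (src L y)" "cs (KA f) = Inr (src K f)" "cs (MA f x) = Inl (src L x)"
 "ct (LA y) = Inl (trg L y)" "ct (KA f) = Inr (trg K f)" "ct (MA f x) = Inr (trg K f)"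
 "LA y : cA <-> y : arrs L" "KA f : cA <-> f : arrs K" "MA f x : cA <-> f : arrs K & x : arrs L & trg L x = pob F (src K f)"
 "cone (Inl X) = LA (one L X)" "cone (Inr A) = KA (one K A)" "cR (LA y) = y" "cR (KA f) = par F f" "cR (MA f x) = par F f**@L x"
 by(auto simp: cs_def ct_def cA_def cone_def cR_def)

lemma collage: "realisation L (objs L <+> objs K) cA cs ct cone ccmp (case_sum (%X. X) (pob F)) cR cg (case_sum (%X. idc L (one L X)) (punit F))"
proof
 show "p : cA ==> q : cA ==> r : cA ==> ct p = cs q ==> ct q = cs r ==> ccmp (ccmp r q) p = ccmp r (ccmp q p)" for p q r
  by(cases p; cases q; cases r; simp)
 show "p : cA ==> q : cA ==> ct p = cs q ==> is_iso2 L (cg q p) (cR q**@L cR p) (cR (ccmp q p))" for p q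
  by(cases p; cases q; simp add: L.is_iso2_iff)
 show "p : cA ==> q : cA ==> r : cA ==> ct p = cs q ==> ct q = cs r ==>
  cg (ccmp r q) p .:@L(cg r q|>@L cR p) = cg r (ccmp q p) .:@L(cR r<|@L cg q p)" for p q r
  by(cases p; cases q; cases r; simp add: pc_assoc flip: L.whisk_vc(2)) (use L.rcong[OF pc_assoc] in simp)
 show "p : cA ==> cg p (cone (cs p)) .:@L(cR p<|@L case_sum (%X. idc L (one L X)) (punit F) (cs p)) = idc L (cR p)" for p
  by(cases p; simp add: pu_right)
 show "p : cA ==> cg (cone (ct p)) p .:@L(case_sum (%X. idc L (one L X)) (punit F) (ct p)|>@L cR p) = idc L (cR p)" for p
  by(cases p; simp add: pu_left flip: L.whisk_vc(2))
 show "p : cA ==> q : cA ==> ct p = cs q ==> ccmp q p : cA" "p : cA ==> q : cA ==> ct p = cs q ==> cs (ccmp q p) = cs p"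
  "p : cA ==> q : cA ==> ct p = cs q ==> ct (ccmp q p) = ct q" for p q by(cases p; cases q; simp)+
 show "x : objs L <+> objs K ==> is_iso2 L (case_sum (%X. idc L (one L X)) (punit F) x) (one L (case_sum (%X. X) (pob F) x)) (cR (cone x))" for x
  by(auto simp: L.is_iso2_iff)
 have c1: "p : cA ==> ccmp p (cone (cs p)) = p" "p : cA ==> ccmp (cone (ct p)) p = p" for p by(cases p; simp)+
 show "ccmp p (cone x) = p" if a: "p : cA" "cs p = x" for p x unfolding a(2)[symmetric] by(rule c1(1)[OF a(1)])
 show "ccmp (cone x) p = p" if a: "p : cA" "ct p = x" for p x unfolding a(2)[symmetric] by(rule c1(2)[OF a(1)])
 show "cs p : objs L <+> objs K" "ct p : objs L <+> objs K" if "p : cA" for p using that by(cases p; simp add: Plus_def image_iff)+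
 show "p : cA ==> cR p : arrs L" "p : cA ==> src L (cR p) = case_sum (%X. X) (pob F) (cs p)" "p : cA ==> trg L (cR p) = case_sum (%X. X) (pob F) (ct p)" for p
  by(cases p; simp)+
 show "x : objs L <+> objs K ==> cone x : cA" "x : objs L <+> objs K ==> cs (cone x) = x" "x : objs L <+> objs K ==> ct (cone x) = x"
  "x : objs L <+> objs K ==> case_sum (%X. X) (pob F) x : objs L" for x by auto
qed

end

text \<open>Two out of three: acting by \<open>v\<close> and acting by \<open>v u\<close> are
  equivalences at \<open>X\<close>, hence so is composition with \<open>u\<close>. This turns
  universal algebras into universal arrows.\<close>

lemma (in two_category) univ_cancel:
 assumes T: "mon T" and v: "univ K T v b X" and u: "u : arrs K" "trg K u = src K v" and vu: "univ K T (v**u) (b|>u) X"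
 shows "arr g X (src K u) ==> arr g' X (src K u) ==> cell w (u**g) (u**g') ==> EX! x. cell x g g' & u<|x = w"
  "arr n X (src K v) ==> EX g k. arr g X (src K u) & iso2 k & cell k (u**g) n"
proof -
 note b = univD(1)[OF v]
 note [simp] = T u algD(1,3-6)[OF b]
 {
  assume g: "arr g X (src K u)" "arr g' X (src K u)" and w: "cell w (u**g) (u**g')"
  note [simp] = g[simplified] w[simplified]
  have "algm K T ((v**u)**g) ((b|>u)|>g) ((v**u)**g') ((b|>u)|>g') (v<|w)" using algm_lwhisk[OF T b w, of X] by simp
  from univD(2)[OF vu _ _ this] g have ex: "EX! x. cell x g g' & (v**u)<|x = v<|w" by simp
  have "(v**u)<|x = v<|w <-> u<|x = w" if x: "cell x g g'" for x
  using univ_faithful[OF T v, of "u**g" "u<|x" "u**g'" w] x w by auto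
  with ex show "EX! x. cell x g g' & u<|x = w" by metis
 next
  assume n: "arr n X (src K v)"
  note [simp] = n[simplified]
  have an: "alg K T X (v**n) (b|>n)" using alg_act[OF T b n] .
  obtain g k where g: "arr g X (src K u)" and k: "iso2 k" "algm K T ((v**u)**g) ((b|>u)|>g) (v**n) (b|>n) k"
  using univD(3)[OF vu an] by auto
  note [simp] = g[simplified] k(1)
  have k': "algm K T (v**u**g) (b|>(u**g)) (v**n) (b|>n) k" using k(2) by simp
  have ki: "algm K T (v**n) (b|>n) (v**u**g) (b|>(u**g)) (inv2 k)" using algm_inv[OF T _ an k' k(1)] alg_act[OF T b, of "u**g" X] by simp
  note [simp] = algmD(1-3)[OF k']
  have ug: "arr (u**g) X (src K v)" by simp
  obtain x where x: "cell x (u**g) n" "v<|x = k" using univD(2)[OF v ug n k'] by(elim ex1E conjE)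
  obtain y where y: "cell y n (u**g)" "v<|y = inv2 k" using univD(2)[OF v n ug ki] by(elim ex1E conjE)
  note [simp] = x(1)[simplified] y(1)[simplified]
  have "y .: x = idc K (u**g)" using x(2) y(2) by - (rule univ_faithful[OF T v, of "u**g" _ "u**g"]; simp)
  moreover have "x .: y = idc K n" using x(2) y(2) by - (rule univ_faithful[OF T v, of n _ n]; simp)
  ultimately have "iso2 x" using inv2_unique(2)[of x y] by simp
  then show "EX g k. arr g X (src K u) & iso2 k & cell k (u**g) n" using g x(1) by blast
 }
qed

text \<open>A biuniversal arrow from the 2-functor to \<open>T\<close>: composition with
  \<open>u\<close> makes \<open>A(X,C)\<close> equivalent to \<open>B(Fo X,T)\<close> for every
  \<open>X\<close>.\<close>

definition (in strict_fun) uarr :: "'b => 'o => 'p => bool" where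
 "uarr u C T <-> C : objs A & arr_in B u (Fo C) T &
  (ALL X g g' w. arr_in A g X C & arr_in A g' X C & cell_in B w (u**@B Fa g) (u**@B Fa g') --> (EX! x. cell_in A x g g' & u<|@B Fc x = w)) &
  (ALL X n. X : objs A & arr_in B n (Fo X) T --> (EX g k. arr_in A g X C & B.iso2 k & cell_in B k (u**@B Fa g) n))"

lemma strict_fun_comp:
 assumes "strict_fun A B Fo Fa Fc" "strict_fun B C Go Ga Gc"
 shows "strict_fun A C (%X. Go (Fo X)) (%f. Ga (Fa f)) (%x. Gc (Fc x))"
proof -
 interpret F: strict_fun A B Fo Fa Fc by(rule assms)
 interpret G: strict_fun B C Go Ga Gc by(rule assms)
 show ?thesis by unfold_locales (simp_all add: F.F_hc G.F_hc)
qed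

lemma (in realisation) N_cell_ex: "cell_in N z p q ==> EX x. z = (p, q, x) & cell_in L x (R p) (R q)"
 by(erule N_cell) simp

section \<open>Algebras in the collage\<close>

locale collage = pseudofunctor K L P for K :: "('o, 'a, 'c) two_cat" and L :: "('p, 'b, 'd) two_cat" (structure) and P

sublocale collage \<subseteq> R: realisation L "objs L <+> objs K" cA cs ct cone ccmp "case_sum (%X. X) (pob P)" cR cg "case_sum (%X. idc L (one L X)) (punit P)"
 by(rule collage)

sublocale collage \<subseteq> N: em R.N
 by(rule two_category.em[OF R.N_two_category])

sublocale collage \<subseteq> EK: em K
 by(rule K.em)

sublocale collage \<subseteq> kN: strict_fun K R.N Inr KA "%x. (KA (csrc K x), KA (ctrg K x), pce P x)"
 by unfold_locales (simp_all add: R.N_simps pc_hc L.vx2[OF pc_hc] InrI)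

sublocale collage \<subseteq> lN: strict_fun L R.N Inl LA "%x. (LA (csrc L x), LA (ctrg L x), x)"
 by unfold_locales (simp_all add: R.N_simps InlI)

context collage
begin

declare kN.F_one [simp del] kN.F_cmp [simp del] kN.F_idc [simp del] kN.F_vc [simp del]
 lN.F_one [simp del] lN.F_cmp [simp del] lN.F_idc [simp del] lN.F_vc [simp del]

abbreviation "W == EM_dm R.N"
abbreviation "Jo X == id_monad R.N (Inl X)"
abbreviation "Jla y == Ja R.N (LA y)"
abbreviation "Jlc x == Jc R.N (LA (csrc L x), LA (ctrg L x), x)"

lemma Jl: "strict_fun L W Jo Jla Jlc"
 using strict_fun_comp[OF lN.strict_fun_axioms N.J.strict_fun_axioms] .

lemma I_strict: "strict_fun E*K W kN.Fm kN.EFa kN.EFc"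
 by(rule kN.EF)

lemma N_lw:
 assumes "f : arrs K" "g : arrs K" "g' : arrs K" "src K f = trg K g" "trg K g' = trg K g" "y : arrs L" "y' : arrs L"
  "trg L y = pob P (src K g)" "trg L y' = pob P (src K g')" "cell_in L x (par P g**y) (par P g'**y')"
 shows "KA f <|@(R.N) (MA g y, MA g' y', x) = (MA (f**@K g) y, MA (f**@K g') y', (pcomp P f g'|>y').:(par P f<|x).:(L.inv2 (pcomp P f g)|>y))"
 using assms by(simp add: lwhisk_def[of R.N] R.N_simps flip: lwhisk_def[of L])

lemma N_rw:
 assumes "r : cells K" "g : arrs K" "src K (csrc K r) = trg K g" "y : arrs L" "trg L y = pob P (src K g)" "csrc K r = f" "ctrg K r = f'"
 shows "(KA f, KA f', pce P r) |>@(R.N) MA g y = (MA (f**@K g) y, MA (f'**@K g) y, pce P (r|>@K g)|>y)"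
proof -
 note [simp] = assms(1-5) assms(6,7)[symmetric]
 have "(pcomp P (ctrg K r) g|>y).:(pce P r|>par P g|>y) = (pce P (r|>@K g)|>y).:(pcomp P (csrc K r) g|>y)" using L.rcong[OF pc_rw[of r g], of y] by simp
 from L.vx2[OF this, of "L.inv2 (pcomp P (csrc K r) g)|>y"] show ?thesis by(simp add: rwhisk_def[of R.N] R.N_simps flip: rwhisk_def[of L])
qed

lemma N_LA:
 assumes "f : arrs K" "y : arrs L" "trg L y = pob P (src K f)"
 shows "cell_in L x w w' ==> trg L w = src L y ==>
  MA f y <|@(R.N) (LA w, LA w', x) = (MA f (y**w), MA f (y**w'), par P f<|y<|x)"
  "f' : arrs K ==> y' : arrs L ==> trg L y' = pob P (src K f') ==> cell_in L x (par P f**y) (par P f'**y') ==> w : arrs L ==> trg L w = src L y ==>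
  (MA f y, MA f' y', x) |>@(R.N) LA w = (MA f (y**w), MA f' (y'**w), x|>w)"
proof -
 show "cell_in L x w w' ==> trg L w = src L y ==> MA f y <|@(R.N) (LA w, LA w', x) = (MA f (y**w), MA f (y**w'), par P f<|y<|x)"
  using assms L.cell_simps(1-4)[of x] by(auto simp: lwhisk_def[of R.N] R.N_simps simp flip: lwhisk_def[of L])
 assume a: "f' : arrs K" "y' : arrs L" "trg L y' = pob P (src K f')" "cell_in L x (par P f**y) (par P f'**y')" "w : arrs L" "trg L w = src L y"
 then have "src L y' = src L y" using L.cell_simps(3)[of x] assms by simp
 with a show "(MA f y, MA f' y', x) |>@(R.N) LA w = (MA f (y**w), MA f' (y'**w), x|>w)" using assms by(simp add: rwhisk_def[of R.N] R.N_simps flip: rwhisk_def[of L])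
qed

lemma pu_conj:
 assumes y: "cell_in L x y y'" "y : arrs L" "trg L y = pob P A" "A : objs K"
 shows "(par P (one K A)<|x).:(punit P A|>y) = (punit P A|>y') .: x"
 using L.ich[of x "punit P A"] assms by simp

text \<open>The cell \<open>punit\<close> identifies \<open>P 1\<close> with the identity, so
  whiskering with \<open>P 1\<close> is bijective on 2-cells; the preimage of \<open>h\<close> is
  its conjugate by \<open>punit\<close>.\<close>

lemma pu_conj_ex:
 assumes y: "arr_in L y X (pob P A)" "arr_in L y' X (pob P A)" "A : objs K" and h: "cell_in L h (par P (one K A)**y) (par P (one K A)**y')"
 shows "EX! x. cell_in L x y y' & par P (one K A)<|x = h"
proof -
 note [simp] = y[simplified] h[simplified]
 have iff: "par P (one K A)<|x = h <-> x = (L.inv2 (punit P A)|>y') .: h .: (punit P A|>y)" if x: "cell_in L x y y'" for x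
 proof
  note [simp] = x[simplified]
  have e: "(par P (one K A)<|x).:(punit P A|>y) = (punit P A|>y') .: x" by(rule pu_conj) simp_all
  show "par P (one K A)<|x = h ==> x = (L.inv2 (punit P A)|>y') .: h .: (punit P A|>y)" using e by simp
  assume xe: "x = (L.inv2 (punit P A)|>y') .: h .: (punit P A|>y)"
  have f: "(punit P A|>y') .: x = h .: (punit P A|>y)" unfolding xe by simp
  show "par P (one K A)<|x = h" by(rule L.iso2_cancel_right[of "punit P A|>y"]; simp add: e f)
 qed
 let ?x = "(L.inv2 (punit P A)|>y') .: h .: (punit P A|>y)"
 have x: "cell_in L ?x y y'" by simp
 show ?thesis using x iff by(intro ex1I[of _ ?x]) blast+
qed

context
 fixes T
 assumes T: "monad_in K T"
begin

abbreviation (input) "T' == kN.Fm T"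
abbreviation (input) "PT == pfun_monad L P T"
text \<open>The 1-cell \<open>y : X -> P A\<close> of \<open>L\<close> regarded as an arrow from
  \<open>X\<close> to \<open>A\<close> in the collage. Its realisation is \<open>P 1 y\<close> and
  not \<open>y\<close>, which is why \<open>punit\<close> enters the action
  \<open>qc\<close>.\<close>

abbreviation (input) "q y == MA (one K (base T)) y"
abbreviation (input) "qc y b == (MA (endo T) y, MA (one K (base T)) y, (punit P (base T)|>y) .: b)"

text \<open>The unit coherence of \<open>P\<close> at \<open>endo T\<close> cancels the identity
  hidden in \<open>q\<close> and \<open>qc\<close>, so that plain cells of \<open>L\<close>
  remain.\<close>

lemma N_lw_q:
 assumes y: "arr_in L y X (pob P (base T))" and y': "arr_in L y' X (pob P (base T))" and x: "cell_in L x y y'"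
 shows "KA (endo T) <|@(R.N) (q y, q y', par P (one K (base T))<|x) = (MA (endo T) y, MA (endo T) y', par P (endo T)<|x)"
  "cell_in L b (par P (endo T)**y) y ==> KA (endo T) <|@(R.N) (qc y b) = (MA (endo T**@K endo T) y, MA (endo T) y, (par P (endo T)<|b).:(L.inv2 (pcomp P (endo T) (endo T))|>y))"
proof -
 note [simp] = T y[simplified] y'[simplified] x[simplified]
 let ?t = "endo T" and ?p = "punit P (base T)"
 have u: "pcomp P ?t (one K (base T)).:(par P ?t<|?p) = idc L (par P ?t)" by(rule pu_right) simp_all
 have i: "L.inv2 (pcomp P ?t (one K (base T))) = par P ?t<|?p" using R.inv_gi(1)[of "KA ?t"] by simp
 have u': "(pcomp P ?t (one K (base T))|>z).:(par P ?t<|(?p|>z)) = idc L (par P ?t**z)" if "arr_in L z X (pob P (base T))" for z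
  using L.rcong[OF u, of z] that by simp
 have e: "(par P ?t<|par P (one K (base T))<|x).:(par P ?t<|(?p|>y)) = (par P ?t<|(?p|>y')).:(par P ?t<|x)" using L.lcong[OF pu_conj[OF x, of "base T"], of "par P ?t"] by simp
 show "KA ?t <|@(R.N) (q y, q y', par P (one K (base T))<|x) = (MA ?t y, MA ?t y', par P ?t<|x)" using L.vx2[OF u'[OF y'], of "par P ?t<|x"] by(simp add: N_lw i e)
 show "KA ?t <|@(R.N) (qc y b) = (MA (?t**@K ?t) y, MA ?t y, (par P ?t<|b).:(L.inv2 (pcomp P ?t ?t)|>y))"
  if b: "cell_in L b (par P ?t**y) y"
  using b L.vx2[OF u'[OF y], of "(par P ?t<|b).:(L.inv2 (pcomp P ?t ?t)|>y)"] by(simp add: N_lw)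
qed

text \<open>After the whiskerings are computed, each law in the collage differs from the law in
  \<open>L\<close> only by invertible factors \<open>punit\<close> and \<open>pcomp\<close>, which
  cancel; \<open>algm_q\<close> is the same for morphisms.\<close>

lemma alg_q:
 assumes y: "arr_in L y X (pob P (base T))" and b: "cell_in L b (par P (endo T)**y) y"
 shows "alg L PT X y b <-> alg R.N T' (Inl X) (q y) (qc y b)"
proof -
 note [simp] = T y[simplified] b[simplified]
 let ?t = "endo T" and ?p = "punit P (base T)"
 have 1: "(KA (?t**@K ?t), KA ?t, pce P (mult T)) |>@(R.N) q y = (MA (?t**@K ?t) y, MA ?t y, pce P (mult T)|>y)"
  "(KA (one K (base T)), KA ?t, pce P (eta T)) |>@(R.N) q y = (q y, MA ?t y, pce P (eta T)|>y)"
  using N_rw[of "mult T" "one K (base T)" y] N_rw[of "eta T" "one K (base T)" y] by simp+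
 have "alg R.N T' (Inl X) (q y) (qc y b) <->
  (?p|>y) .: b .: (par P ?t<|b).:(L.inv2 (pcomp P ?t ?t)|>y) = (?p|>y) .: b .: (pce P (mult T)|>y) &
  (?p|>y) .: b .: (pce P (eta T)|>y) = idc L (par P (one K (base T))**y)"
  by(simp add: alg_def 1 N_lw_q(2)[OF y y L.idc_in]) (simp add: R.N_simps)
 also have "... <-> b .: (par P ?t<|b) = b .: (pce P (mult T)|>y).:(pcomp P ?t ?t|>y) &
  b .: (pce P (eta T)|>y).:(?p|>y) = idc L y"
 proof (intro arg_cong2[of _ _ _ _ "(&)"] iffI)
  assume "(?p|>y) .: b .: (par P ?t<|b).:(L.inv2 (pcomp P ?t ?t)|>y) = (?p|>y) .: b .: (pce P (mult T)|>y)"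
  from arg_cong[OF this, of "%z. (L.inv2 ?p|>y) .: z .: (pcomp P ?t ?t|>y)"]
  show "b .: (par P ?t<|b) = b .: (pce P (mult T)|>y).:(pcomp P ?t ?t|>y)" by simp
 next
  assume "b .: (par P ?t<|b) = b .: (pce P (mult T)|>y).:(pcomp P ?t ?t|>y)"
  from arg_cong[OF this, of "%z. (?p|>y) .: z .: (L.inv2 (pcomp P ?t ?t)|>y)"]
  show "(?p|>y) .: b .: (par P ?t<|b).:(L.inv2 (pcomp P ?t ?t)|>y) = (?p|>y) .: b .: (pce P (mult T)|>y)" by simp
 next
  assume "(?p|>y) .: b .: (pce P (eta T)|>y) = idc L (par P (one K (base T))**y)"
  from arg_cong[OF this, of "%z. (L.inv2 ?p|>y) .: z .: (?p|>y)"]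
  show "b .: (pce P (eta T)|>y).:(?p|>y) = idc L y" by simp
 next
  assume "b .: (pce P (eta T)|>y).:(?p|>y) = idc L y"
  from arg_cong[OF this, of "%z. (?p|>y) .: z .: (L.inv2 ?p|>y)"]
  show "(?p|>y) .: b .: (pce P (eta T)|>y) = idc L (par P (one K (base T))**y)" by simp
 qed
 finally show ?thesis by(simp add: alg_def)
qed

lemma algm_q:
 assumes y: "arr_in L y X (pob P (base T))" and b: "cell_in L b (par P (endo T)**y) y"
  and y': "arr_in L y' X (pob P (base T))" and b': "cell_in L b' (par P (endo T)**y') y'" and h: "cell_in L h y y'"
 shows "algm L PT y b y' b' h <-> algm R.N T' (q y) (qc y b) (q y') (qc y' b') (q y, q y', par P (one K (base T))<|h)"
proof -
 note [simp] = T y[simplified] b[simplified] y'[simplified] b'[simplified] h[simplified]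
 let ?t = "endo T" and ?p = "punit P (base T)"
 have e: "(par P (one K (base T))<|h).:(?p|>y) = (?p|>y') .: h" by(rule pu_conj) simp_all
 have "algm R.N T' (q y) (qc y b) (q y') (qc y' b') (q y, q y', par P (one K (base T))<|h) <->
  (?p|>y') .: h .: b = (?p|>y') .: b' .: (par P ?t<|h)"
  by(simp add: algm_def N_lw_q(1)[OF y y' h]) (simp add: R.N_simps L.vx2[OF e])
 also have "... <-> h .: b = b' .: (par P ?t<|h)" using L.iso2_cancel_left[of "?p|>y'" "h .: b" "b' .: (par P ?t<|h)"] by auto
 finally show ?thesis by(simp add: algm_def)
qed

text \<open>By \<open>alg_q\<close>, \<open>algm_q\<close> and \<open>pu_conj_ex\<close>, algebras
  on arrows \<open>q y\<close> are the algebras in \<open>L\<close>. An arbitrary arrow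
  \<open>MA f y0\<close> into \<open>base T\<close> is isomorphic to \<open>q (P f y0)\<close> by a
  coherence cell, so every algebra from \<open>X\<close> is reached.\<close>

lemma univ_q:
 assumes u: "universal L PT u a" and X: "X : objs L"
 shows "univ R.N T' (q u) (qc u a) (Inl X)"
proof (rule N.univI)
 have a: "alg L PT (src L u) u a" using u by(simp add: universal_def)
 note PT = P_monad[OF T]
 note [simp] = T X L.algD(1,3-6)[OF a, simplified]
 let ?t = "endo T" and ?p = "punit P (base T)"
 have act: "q u **@(R.N) LA w = q (u**w)" "qc u a |>@(R.N) LA w = qc (u**w) (a|>w)" if "arr_in L w X (src L u)" for w
  using that N_LA(2)[of ?t u "one K (base T)" u "(?p|>u) .: a" w] by(simp_all add: R.N_simps)
 have LA: "EX w. g = LA w & arr_in L w X (src L u)" if "arr_in R.N g (Inl X) (src R.N (q u))" for g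
 proof -
  have "g : cA" "cs g = Inl X" "ct g = Inl (src L u)" using that by(simp_all add: R.N_simps)
  then show ?thesis by(cases g) simp_all
 qed
 show "alg R.N T' (src R.N (q u)) (q u) (qc u a)" using a alg_q[of u "src L u" a] by(simp add: R.N_simps)
 {
  fix g g' h assume g: "arr_in R.N g (Inl X) (src R.N (q u))" "arr_in R.N g' (Inl X) (src R.N (q u))"
  and h: "algm R.N T' (q u **@(R.N) g) (qc u a |>@(R.N) g) (q u **@(R.N) g') (qc u a |>@(R.N) g') h"
  obtain w w' where w: "g = LA w" "arr_in L w X (src L u)" "g' = LA w'" "arr_in L w' X (src L u)" using LA[OF g(1)] LA[OF g(2)] by blast
  note [simp] = w(2,4)[simplified]
  have h': "algm R.N T' (q (u**w)) (qc (u**w) (a|>w)) (q (u**w')) (qc (u**w') (a|>w')) h" using h unfolding w(1,3) act[OF w(2)] act[OF w(4)] .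
  have hc: "cell_in R.N h (q (u**w)) (q (u**w'))" using N.algmD(1-3)[OF h'] by simp
  obtain hh where hh: "h = (q (u**w), q (u**w'), hh)" "cell_in L hh (par P (one K (base T))**u**w) (par P (one K (base T))**u**w')"
  using R.N_cell_ex[OF hc] by auto
  have kk: "EX! x. cell_in L x (u**w) (u**w') & par P (one K (base T))<|x = hh" by(rule pu_conj_ex[OF _ _ _ hh(2), of X]) simp_all
  obtain k where k: "cell_in L k (u**w) (u**w')" "par P (one K (base T))<|k = hh"
  using kk by(elim ex1E conjE)
  have "algm L PT (u**w) (a|>w) (u**w') (a|>w') k" using algm_q[of "u**w" X "a|>w" "u**w'" "a|>w'" k] k h' hh(1) by simp
  then have ex: "EX! x. cell_in L x w w' & u<|x = k" using L.univD(2)[of PT u a X w w' k] u w(2,4) by(simp add: universal_def)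
  have iff: "q u <|@(R.N) (LA w, LA w', x) = h <-> u<|x = k" if x: "cell_in L x w w'" for x
  proof -
  have kx: "cell_in L (u<|x) (u**w) (u**w')" using x by simp
  have "q u <|@(R.N) (LA w, LA w', x) = h <-> par P (one K (base T))<|u<|x = hh" using N_LA(1)[of "one K (base T)" u x w w'] x hh(1) by simp
  also have "... <-> u<|x = k" using kk k kx by blast
  finally show ?thesis .
  qed
  show "EX! z. cell_in R.N z g g' & q u <|@(R.N) z = h"
  proof -
  obtain x where x: "cell_in L x w w'" "u<|x = k" and uq: "!!x'. cell_in L x' w w' ==> u<|x' = k ==> x' = x" using ex by blast
  show ?thesis
  proof (rule ex1I[of _ "(LA w, LA w', x)"])
  show "cell_in R.N (LA w, LA w', x) g g' & q u <|@(R.N) (LA w, LA w', x) = h" using x iff[OF x(1)] by(simp add: w R.N_simps)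
  fix z assume z: "cell_in R.N z g g' & q u <|@(R.N) z = h"
  then have zc: "cell_in R.N z (LA w) (LA w')" by(simp only: w)
  obtain x' where x': "z = (LA w, LA w', x')" "cell_in L x' w w'" using R.N_cell_ex[OF zc] by auto
  then show "z = (LA w, LA w', x)" using uq[OF x'(2)] iff[OF x'(2)] z by simp
  qed
  qed
 }
 {
  fix x c assume c: "alg R.N T' (Inl X) x c"
  then have xa: "arr_in R.N x (Inl X) (Inr (base T))" by(simp add: alg_def)
  then have "x : cA" "cs x = Inl X" "ct x = Inr (base T)" by(simp_all add: R.N_simps)
  then obtain f y0 where x: "x = MA f y0" and f: "f : arrs K" "trg K f = base T" and y0: "arr_in L y0 X (pob P (src K f))" by(cases x) simp_all
  note [simp] = f y0[simplified]
  let ?y = "par P f**y0"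
  let ?k = "(q ?y, x, pcomp P (one K (base T)) f|>y0)"
  have ki: "N.iso2 ?k" by(rule N.inv2_unique(2)[of _ "(x, q ?y, L.inv2 (pcomp P (one K (base T)) f)|>y0)"]) (simp_all add: x R.N_simps)
  have kc: "cell_in R.N ?k (q ?y) x" by(simp add: x R.N_simps)
  obtain c' where c': "alg R.N T' (Inl X) (q ?y) c'" "algm R.N T' (q ?y) c' x c ?k"
  using N.alg_transport[OF kN.F_monad[OF T] c ki kc] by blast
  have cc': "cell_in R.N c' (MA ?t ?y) (q ?y)" using N.algD(4-6)[OF c'(1)] by(simp add: R.N_simps)
  obtain b0 where b0: "c' = (MA ?t ?y, q ?y, b0)" "b0 : cells L" "csrc L b0 = par P ?t**?y" "ctrg L b0 = par P (one K (base T))**?y"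
  using R.N_cell_ex[OF cc'] by auto
  define b where "b = (L.inv2 ?p|>?y) .: b0"
  have b: "cell_in L b (par P ?t**?y) ?y" "c' = qc ?y b" using b0 by(simp_all add: b_def)
  have yb: "alg L PT X ?y b" using alg_q[of ?y X b] b c'(1) by simp
  obtain w k where w: "arr_in L w X (src L u)" and k: "L.iso2 k" "algm L PT (u**w) (a|>w) ?y b k"
  using L.univD(3)[OF _ yb] u X unfolding universal_def by blast
  note [simp] = w[simplified] L.algmD(1-3)[OF k(2)] b(1)[simplified] k(1)
  have 1: "algm R.N T' (q (u**w)) (qc (u**w) (a|>w)) (q ?y) c' (q (u**w), q ?y, par P (one K (base T))<|k)" using algm_q[of "u**w" X "a|>w" ?y b k] k(2) b by simp
  have "alg R.N T' (Inl X) (q (u**w)) (qc (u**w) (a|>w))" using alg_q[of "u**w" X "a|>w"] L.alg_act[OF PT a w] by simp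
  from N.algm_comp[OF kN.F_monad[OF T] this c'(1) c 1 c'(2)]
  have 2: "algm R.N T' (q u **@(R.N) LA w) (qc u a |>@(R.N) LA w) x c (?k .:@(R.N) (q (u**w), q ?y, par P (one K (base T))<|k))" unfolding act[OF w] .
  have "N.iso2 (q (u**w), q ?y, par P (one K (base T))<|k)" by(rule N.inv2_unique(2)[of _ "(q ?y, q (u**w), par P (one K (base T))<|L.inv2 k)"]) (simp_all add: R.N_simps)
  then have "N.iso2 (?k .:@(R.N) (q (u**w), q ?y, par P (one K (base T))<|k))" using ki by(intro N.iso2_vc) (simp_all add: R.N_simps)
  with 2 show "EX g k. arr_in R.N g (Inl X) (src R.N (q u)) & N.iso2 k & algm R.N T' (q u **@(R.N) g) (qc u a |>@(R.N) g) x c k"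
  using w by(intro exI[of _ "LA w"] exI conjI) (assumption | simp add: R.N_simps)+
 }
qed

end

end

section \<open>Pseudofunctors from universal arrows\<close>

lemma (in two_category) iso2_cancel_iff:
 "iso2 x ==> y : cells K ==> z : cells K ==> csrc K y = ctrg K x ==> csrc K z = ctrg K x ==> y .: x = z .: x <-> y = z"
 "iso2 x ==> y : cells K ==> z : cells K ==> ctrg K y = csrc K x ==> ctrg K z = csrc K x ==> x .: y = x .: z <-> y = z"
 using iso2_cancel_right[of x y z] iso2_cancel_left[of x y z] by blast+

text \<open>Data for a right biadjoint of \<open>J\<close> relative to \<open>I\<close>: a universal
  arrow \<open>U T : J (C T) -> I T\<close> for each \<open>T\<close>, and for each \<open>n\<close>
  a 1-cell \<open>f n\<close> filling the naturality square up to the invertible \<open>k n\<close>.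
  The choices are parameters so that they can be prescribed where the extension must agree with a
  given pseudofunctor.\<close>

locale right_biadj = J: strict_fun L W Jo Ja Jc + I: strict_fun M W Io Ia Ic
 for L :: "('p, 'b, 'd) two_cat" and M :: "('q, 'e, 'g) two_cat" and W :: "('w, 'x, 'y) two_cat" (structure) and Jo Ja Jc Io Ia Ic +
 fixes C :: "'q => 'p" and U :: "'q => 'x" and f :: "'e => 'b" and k :: "'e => 'y"
 assumes ua: "T : objs M ==> J.uarr (U T) (C T) (Io T)"
  and f0: "n : arrs M ==> arr_in L (f n) (C (src M n)) (C (trg M n))"
  and k0: "n : arrs M ==> is_iso2 W (k n) (U (trg M n)**@W Ja (f n)) (Ia n**@W U (src M n))"
begin

lemma b_simps [simp]:
 "T : objs M ==> C T : objs L" "T : objs M ==> U T : arrs W" "T : objs M ==> src W (U T) = Jo (C T)" "T : objs M ==> trg W (U T) = Io T"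
 "n : arrs M ==> f n : arrs L" "n : arrs M ==> src L (f n) = C (src M n)" "n : arrs M ==> trg L (f n) = C (trg M n)"
 "n : arrs M ==> J.B.iso2 (k n)" "n : arrs M ==> k n : cells W" "n : arrs M ==> csrc W (k n) = U (trg M n)**Ja (f n)"
 "n : arrs M ==> ctrg W (k n) = Ia n**U (src M n)"
 using ua f0[of n] k0[of n] by(auto simp: J.uarr_def J.B.is_iso2_iff)

lemma ua_ff: "T : objs M ==> arr_in L g X (C T) ==> arr_in L g' X (C T) ==> cell_in W w (U T**Ja g) (U T**Ja g') ==>
  EX! x. cell_in L x g g' & U T<|Jc x = w"
 using ua[of T] unfolding J.uarr_def by blast

lemma ua_eso: "T : objs M ==> X : objs L ==> arr_in W n (Jo X) (Io T) ==>
  EX g p. arr_in L g X (C T) & J.B.iso2 p & cell_in W p (U T**Ja g) n"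
 using ua[of T] unfolding J.uarr_def by blast

lemma test:
 assumes "T : objs M" "cell_in L x g g'" "cell_in L y g g'" "trg L g = C T" "U T<|Jc x = U T<|Jc y"
 shows "x = y"
proof -
 have [simp]: "x : cells L" "csrc L x = g" "ctrg L x = g'" using assms(2) by auto
 have g: "arr_in L g (src L g) (C T)" "arr_in L g' (src L g) (C T)" using assms(4) J.A.cell_simps(1-4)[of x] by auto
 note [simp] = g[simplified]
 have w: "cell_in W (U T<|Jc x) (U T**Ja g) (U T**Ja g')" using assms(1) by simp
 from ua_ff[OF assms(1) g w] show ?thesis using assms(2,3,5) by metis
qed

text \<open>The uniqueness half of the universal property. The functoriality and coherence equations
  of \<open>F\<close> are proved by whiskering with \<open>U\<close> and composing with
  \<open>k\<close>.\<close>

lemma test_k: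
 assumes n: "n : arrs M" "cell_in L x g (f n)" "cell_in L y g (f n)" and e: "k n .: (U (trg M n)<|Jc x) = k n .: (U (trg M n)<|Jc y)"
 shows "x = y"
proof -
 note [simp] = n(1) n(2,3)[simplified]
 have g [simp]: "trg L g = C (trg M n)" "g : arrs L" using J.A.cell_simps(1,4)[of x] by simp+
 have "U (trg M n)<|Jc x = U (trg M n)<|Jc y" by(rule J.B.iso2_cancel_left[OF _ e]) simp_all
 then show ?thesis using test[of "trg M n" x g "f n" y] by simp
qed

text \<open>The transpose of \<open>w\<close>: the cell whose pasting with \<open>k n\<close> is
  \<open>w\<close>.\<close>

definition tr :: "'e => 'b => 'y => 'd" where
 "tr n g w = (THE x. cell_in L x g (f n) & U (trg M n)<|Jc x = J.B.inv2 (k n) .: w)"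

lemma tr:
 assumes n: "n : arrs M" and g: "arr_in L g (C (src M n)) (C (trg M n))" and w: "cell_in W w (U (trg M n)**Ja g) (Ia n**U (src M n))"
 shows "tr n g w : cells L" "csrc L (tr n g w) = g" "ctrg L (tr n g w) = f n" "k n .: (U (trg M n)<|Jc (tr n g w)) = w"
  "J.B.iso2 w ==> J.A.iso2 (tr n g w)"
proof -
 note [simp] = n g[simplified] w[simplified]
 have w': "cell_in W (J.B.inv2 (k n) .: w) (U (trg M n)**Ja g) (U (trg M n)**Ja (f n))" by simp
 have "EX! x. cell_in L x g (f n) & U (trg M n)<|Jc x = J.B.inv2 (k n) .: w" by(rule ua_ff[OF _ g _ w']) simp_all
 from theI'[OF this] have x: "cell_in L (tr n g w) g (f n)" "U (trg M n)<|Jc (tr n g w) = J.B.inv2 (k n) .: w" unfolding tr_def by blast+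
 then show xs: "tr n g w : cells L" "csrc L (tr n g w) = g" "ctrg L (tr n g w) = f n" "k n .: (U (trg M n)<|Jc (tr n g w)) = w" by simp+
 assume i [simp]: "J.B.iso2 w"
 have v: "cell_in W (J.B.inv2 w .: k n) (U (trg M n)**Ja (f n)) (U (trg M n)**Ja g)" by simp
 obtain y where y: "cell_in L y (f n) g" "U (trg M n)<|Jc y = J.B.inv2 w .: k n"
  using ua_ff[OF _ _ g v] by auto
 note [simp] = xs(1-3) y(1)[simplified]
 have "y .:@L tr n g w = idc L g" by(rule test[of "trg M n" _ g g]) (simp_all add: x(2) y(2))
 moreover have "tr n g w .:@L y = idc L (f n)" by(rule test[of "trg M n" _ "f n" "f n"]) (simp_all add: x(2) y(2))
 ultimately show "J.A.iso2 (tr n g w)" using J.A.inv2_unique(2)[of "tr n g w" y] by simp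
qed

text \<open>Each is the transpose of a pasting that an axiom of pseudonaturality prescribes, so that
  \<open>U\<close> with structure cells \<open>k\<close> satisfies naturality, composition and unit
  laws by construction; these laws are \<open>Fc_k\<close>, \<open>Fp_k\<close> and
  \<open>Fu_k\<close>.\<close>

definition Fc where "Fc x = tr (ctrg M x) (f (csrc M x)) ((Ic x|>U (src M (csrc M x))) .: k (csrc M x))"
definition Fp where "Fp m n = tr (m**@M n) (f m**@L f n) ((Ia m<|k n).:(k m|>Ja (f n)))"
definition Fu where "Fu T = tr (one M T) (one L (C T)) (idc W (U T))"

lemma
 assumes x: "x : cells M"
 shows Fc_simps [simp]: "Fc x : cells L" "csrc L (Fc x) = f (csrc M x)" "ctrg L (Fc x) = f (ctrg M x)"
  and Fc_k: "k (ctrg M x).:(U (trg M (csrc M x))<|Jc (Fc x)) = (Ic x|>U (src M (csrc M x))) .: k (csrc M x)"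
proof -
 note [simp] = x
 note t = tr[of "ctrg M x" "f (csrc M x)" "(Ic x|>U (src M (csrc M x))) .: k (csrc M x)"]
 show "Fc x : cells L" "csrc L (Fc x) = f (csrc M x)" "ctrg L (Fc x) = f (ctrg M x)"
  "k (ctrg M x).:(U (trg M (csrc M x))<|Jc (Fc x)) = (Ic x|>U (src M (csrc M x))) .: k (csrc M x)"
  using t(1-4) unfolding Fc_def[symmetric] by simp+
qed

lemma
 assumes mn: "m : arrs M" "n : arrs M" "trg M n = src M m"
 shows Fp_simps [simp]: "Fp m n : cells L" "csrc L (Fp m n) = f m**@L f n" "ctrg L (Fp m n) = f (m**@M n)" "J.A.iso2 (Fp m n)"
  and Fp_k: "k (m**@M n).:(U (trg M m)<|Jc (Fp m n)) = (Ia m<|k n).:(k m|>Ja (f n))"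
proof -
 note [simp] = mn
 note t = tr[of "m**@M n" "f m**@L f n" "(Ia m<|k n).:(k m|>Ja (f n))"]
 show "Fp m n : cells L" "csrc L (Fp m n) = f m**@L f n" "ctrg L (Fp m n) = f (m**@M n)" "J.A.iso2 (Fp m n)"
  "k (m**@M n).:(U (trg M m)<|Jc (Fp m n)) = (Ia m<|k n).:(k m|>Ja (f n))"
  using t unfolding Fp_def[symmetric] by simp+
qed

lemma
 assumes T: "T : objs M"
 shows Fu_simps [simp]: "Fu T : cells L" "csrc L (Fu T) = one L (C T)" "ctrg L (Fu T) = f (one M T)" "J.A.iso2 (Fu T)"
  and Fu_k: "k (one M T).:(U T<|Jc (Fu T)) = idc W (U T)"
proof -
 note [simp] = T
 note t = tr[of "one M T" "one L (C T)" "idc W (U T)"]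
 show "Fu T : cells L" "csrc L (Fu T) = one L (C T)" "ctrg L (Fu T) = f (one M T)" "J.A.iso2 (Fu T)"
  "k (one M T).:(U T<|Jc (Fu T)) = idc W (U T)"
  using t unfolding Fu_def[symmetric] by simp+
qed

definition F where
 "F = (|pob = (\<lambda>T\<in>objs M. C T), par = (\<lambda>n\<in>arrs M. f n), pce = (\<lambda>x\<in>cells M. Fc x),
  pcomp = (%m n. if composable M m n then Fp m n else undefined), punit = (\<lambda>T\<in>objs M. Fu T)|)"

lemma F_simps:
 "T : objs M ==> pob F T = C T" "n : arrs M ==> par F n = f n" "x : cells M ==> pce F x = Fc x"
 "m : arrs M ==> n : arrs M ==> trg M n = src M m ==> pcomp F m n = Fp m n" "T : objs M ==> punit F T = Fu T"
 by(simp_all add: F_def composable_def)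

lemma Fp_nat:
 assumes xy [simp]: "x : cells M" "y : cells M" "trg M (csrc M x) = src M (csrc M y)"
 shows "Fc (hc M y x) .:@L Fp (csrc M y) (csrc M x) = Fp (ctrg M y) (ctrg M x) .:@L hc L (Fc y) (Fc x)"
proof (rule test_k[of "ctrg M y**@M ctrg M x"])
 let ?n = "csrc M x" and ?n' = "ctrg M x" and ?m = "csrc M y" and ?m' = "ctrg M y"
 let ?U = "U (src M ?n)" and ?V = "U (src M ?m)" and ?R = "U (trg M ?m)"
 have 1: "k (?m'**@M ?n').:(?R<|Jc (Fc (hc M y x))) = (Ic (hc M y x)|>?U) .: k (?m**@M ?n)"
  "k (?m**@M ?n).:(?R<|Jc (Fp ?m ?n)) = (Ia ?m<|k ?n).:(k ?m|>Ja (f ?n))"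
  "k (?m'**@M ?n').:(?R<|Jc (Fp ?m' ?n')) = (Ia ?m'<|k ?n').:(k ?m'|>Ja (f ?n'))"
  using Fc_k[of "hc M y x"] Fp_k[of ?m ?n] Fp_k[of ?m' ?n'] by simp+
 have 2: "(k ?m'|>Ja (f ?n')).:(?R<|(Jc (Fc y)|>Ja (f ?n'))) = (Ic y|>?V|>Ja (f ?n')).:(k ?m|>Ja (f ?n'))" using J.B.rcong[OF Fc_k[of y], of "Ja (f ?n')"] by simp
 have 3: "(k ?m|>Ja (f ?n')).:(?R<|Ja (f ?m)<|Jc (Fc x)) = (Ia ?m<|?V<|Jc (Fc x)).:(k ?m|>Ja (f ?n))" using J.B.ich[of "Jc (Fc x)" "k ?m"] by simp
 have 4: "(Ia ?m'<|k ?n').:(Ic y|>?V|>Ja (f ?n')) = (Ic y|>Ia ?n'|>?U).:(Ia ?m<|k ?n')" using J.B.ich[of "k ?n'" "Ic y"] by simp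
 have 5: "(Ia ?m<|k ?n').:(Ia ?m<|?V<|Jc (Fc x)) = (Ia ?m<|(Ic x|>?U)).:(Ia ?m<|k ?n)" using J.B.lcong[OF Fc_k[of x], of "Ia ?m"] by simp
 have h: "Ic (hc M y x)|>?U = (Ic y|>Ia ?n'|>?U).:(Ia ?m<|(Ic x|>?U))"
  "?R<|Jc (hc L (Fc y) (Fc x)) = (?R<|(Jc (Fc y)|>Ja (f ?n'))).:(?R<|Ja (f ?m)<|Jc (Fc x))"
  by(simp_all add: I.F_hc J.F_hc J.B.hc_whisk(1))
 have "k (?m'**@M ?n').:(?R<|Jc (Fc (hc M y x))).:(?R<|Jc (Fp ?m ?n)) =
  k (?m'**@M ?n').:(?R<|Jc (Fp ?m' ?n')).:(?R<|Jc (hc L (Fc y) (Fc x)))"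
  by(simp add: J.B.vx2[OF 1(1)] 1(2) J.B.vx2[OF 1(3)] h J.B.vx2[OF 2] 3 J.B.vx2[OF 4] J.B.vx2[OF 5])
 then show "k (?m'**@M ?n').:(U (trg M (?m'**@M ?n'))<|Jc (Fc (hc M y x) .:@L Fp ?m ?n)) =
  k (?m'**@M ?n').:(U (trg M (?m'**@M ?n'))<|Jc (Fp ?m' ?n' .:@L hc L (Fc y) (Fc x)))" by simp
qed simp_all

lemma Fp_assoc:
 assumes [simp]: "n : arrs M" "m : arrs M" "l : arrs M" "trg M n = src M m" "trg M m = src M l"
 shows "Fp (l**@M m) n .:@L(Fp l m|>@L f n) = Fp l (m**@M n) .:@L(f l<|@L Fp m n)"
proof (rule test_k[of "l**@M m**@M n"])
 let ?U = "U (src M n)" and ?R = "U (trg M l)"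
 have 1: "k (l**@M m**@M n).:(?R<|Jc (Fp (l**@M m) n)) = (Ia l<|Ia m<|k n).:(k (l**@M m)|>Ja (f n))"
  "k (l**@M m**@M n).:(?R<|Jc (Fp l (m**@M n))) = (Ia l<|k (m**@M n)).:(k l|>Ja (f (m**@M n)))"
  using Fp_k[of "l**@M m" n] Fp_k[of l "m**@M n"] by simp+
 have 2: "(k (l**@M m)|>Ja (f n)).:(?R<|(Jc (Fp l m)|>Ja (f n))) = (Ia l<|(k m|>Ja (f n))).:(k l|>Ja (f m)|>Ja (f n))" using J.B.rcong[OF Fp_k[of l m], of "Ja (f n)"] by simp
 have 3: "(k l|>Ja (f (m**@M n))).:(?R<|Ja (f l)<|Jc (Fp m n)) = (Ia l<|U (src M l)<|Jc (Fp m n)).:(k l|>Ja (f m)|>Ja (f n))" using J.B.ich[of "Jc (Fp m n)" "k l"] by simp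
 have 4: "(Ia l<|k (m**@M n)).:(Ia l<|U (src M l)<|Jc (Fp m n)) = (Ia l<|Ia m<|k n).:(Ia l<|(k m|>Ja (f n)))" using J.B.lcong[OF Fp_k[of m n], of "Ia l"] by simp
 have "k (l**@M m**@M n).:(?R<|Jc (Fp (l**@M m) n)).:(?R<|(Jc (Fp l m)|>Ja (f n))) =
  k (l**@M m**@M n).:(?R<|Jc (Fp l (m**@M n))).:(?R<|Ja (f l)<|Jc (Fp m n))"
  by(simp add: J.B.vx2[OF 1(1)] J.B.vx2[OF 1(2)] 2 3 J.B.vx2[OF 4])
 then show "k (l**@M m**@M n).:(U (trg M (l**@M m**@M n))<|Jc (Fp (l**@M m) n .:@L(Fp l m|>@L f n))) =
  k (l**@M m**@M n).:(U (trg M (l**@M m**@M n))<|Jc (Fp l (m**@M n) .:@L(f l<|@L Fp m n)))" by simp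
qed simp_all

lemma Fp_unit:
 assumes [simp]: "n : arrs M"
 shows "Fp (one M (trg M n)) n .:@L(Fu (trg M n)|>@L f n) = idc L (f n)" "Fp n (one M (src M n)) .:@L(f n<|@L Fu (src M n)) = idc L (f n)"
proof -
 let ?A = "src M n" and ?B = "trg M n"
 have 1: "k n .: (U ?B<|Jc (Fp (one M ?B) n)) = k n .: (k (one M ?B)|>Ja (f n))"
  "k n .: (U ?B<|Jc (Fp n (one M ?A))) = (Ia n<|k (one M ?A)).:(k n|>Ja (f (one M ?A)))"
  using Fp_k[of "one M ?B" n] Fp_k[of n "one M ?A"] by simp+
 have 2: "(k (one M ?B)|>Ja (f n)).:(U ?B<|(Jc (Fu ?B)|>Ja (f n))) = idc W (U ?B**Ja (f n))" using J.B.rcong[OF Fu_k[of ?B], of "Ja (f n)"] by simp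
 have 3: "(k n|>Ja (f (one M ?A))).:(U ?B<|Ja (f n)<|Jc (Fu ?A)) = (Ia n<|U ?A<|Jc (Fu ?A)) .: k n" using J.B.ich[of "Jc (Fu ?A)" "k n"] by simp
 have 4: "(Ia n<|k (one M ?A)).:(Ia n<|U ?A<|Jc (Fu ?A)) = idc W (Ia n**U ?A)" using J.B.lcong[OF Fu_k[of ?A], of "Ia n"] by simp
 show "Fp (one M ?B) n .:@L(Fu ?B|>@L f n) = idc L (f n)" by(rule test_k[of n _ "f n"]) (simp_all add: J.B.vx2[OF 1(1)] 2)
 show "Fp n (one M ?A) .:@L(f n<|@L Fu ?A) = idc L (f n)" by(rule test_k[of n _ "f n"]) (simp_all add: J.B.vx2[OF 1(2)] 3 J.B.vx2[OF 4])
qed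

theorem F_pseudofunctor: "pseudofunctor M L F"
proof (intro pseudofunctor.intro I.A.two_category_axioms J.A.two_category_axioms pseudofunctor_axioms.intro)
 show "pob F : extensional (objs M)" "par F : extensional (arrs M)" "pce F : extensional (cells M)" "punit F : extensional (objs M)"
  "!!m n. \<not> composable M m n ==> pcomp F m n = undefined" by(simp_all add: F_def)
 show "pob F T : objs L" if "T : objs M" for T using that by(simp add: F_simps)
 show "arr_in L (par F n) (pob F A) (pob F B)" if "arr_in M n A B" for n A B using that by(auto simp: F_simps)
 show "cell_in L (pce F x) (par F m) (par F n)" if "cell_in M x m n" for x m n using that by(auto simp: F_simps)
 show "pce F (idc M n) = idc L (par F n)" if n: "n : arrs M" for n
 proof -
  note [simp] = n
  have "Fc (idc M n) = idc L (f n)" by(rule test_k[of n _ "f n"]) (use Fc_k[of "idc M n"] in simp_all)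
  then show ?thesis by(simp add: F_simps)
 qed
 show "pce F (y .:@M x) = pce F y .:@L pce F x" if "cell_in M x l m" "cell_in M y m n" for x y l m n
 proof -
  have c [simp]: "x : cells M" "y : cells M" "ctrg M x = csrc M y" using that by auto
  have 1: "k (ctrg M y).:(U (trg M (csrc M y))<|Jc (Fc y)) = (Ic y|>U (src M (csrc M y))) .: k (csrc M y)" by(rule Fc_k) simp
  have 2: "k (csrc M y).:(U (trg M (csrc M x))<|Jc (Fc x)) = (Ic x|>U (src M (csrc M x))) .: k (csrc M x)" using Fc_k[of x] by simp
  have 3: "src M (csrc M x) = src M (csrc M y)" "trg M (csrc M x) = trg M (csrc M y)" using I.A.cell_simps(3,4)[of x] by simp+
  have "Fc (y .:@M x) = Fc y .:@L Fc x" by(rule test_k[of "ctrg M y" _ "f (csrc M x)"]) (use Fc_k[of "y .:@M x"] in \<open>simp_all add: J.B.vx2[OF 1] 2[unfolded 3] 3\<close>)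
  then show ?thesis by(simp add: F_simps)
 qed
 show "is_iso2 L (pcomp F m n) (par F m**@L par F n) (par F (m**@M n))" if "composable M m n" for m n
  using that by(simp add: composable_def F_simps J.A.is_iso2_iff)
 show "is_iso2 L (punit F T) (one L (pob F T)) (par F (one M T))" if "T : objs M" for T
  using that by(simp add: F_simps J.A.is_iso2_iff)
 show "pce F (hc M y x) .:@L pcomp F g n = pcomp F g' n' .:@L hc L (pce F y) (pce F x)"
  if "cell_in M x n n'" "cell_in M y g g'" "composable M g n" for x n n' y g g'
 proof -
  have c: "x : cells M" "y : cells M" "n = csrc M x" "n' = ctrg M x" "g = csrc M y" "g' = ctrg M y" "trg M (csrc M x) = src M (csrc M y)" using that by(auto simp: composable_def)
  show ?thesis unfolding c(3-6) using c(1,2,7) Fp_nat[of x y] by(simp add: F_simps)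
 qed
 show "pcomp F (h**@M g) n .:@L(pcomp F h g|>@L par F n) = pcomp F h (g**@M n) .:@L(par F h<|@L pcomp F g n)"
  if "composable M h g" "composable M g n" for h g n
  using that Fp_assoc[of n g h] by(simp add: F_simps composable_def)
 show "pcomp F (one M B) n .:@L(punit F B|>@L par F n) = idc L (par F n)" "pcomp F n (one M A) .:@L(par F n<|@L punit F A) = idc L (par F n)"
  if "arr_in M n A B" for n A B
  using that Fp_unit[of n] by(auto simp: F_simps)
qed

text \<open>The \<open>I S\<close>-action on \<open>U x\<close> obtained from an
  \<open>F S\<close>-action \<open>b\<close> on \<open>x\<close>: the inverse of \<open>k\<close>
  exchanges \<open>I t U\<close> for \<open>U J (f t)\<close>, and then \<open>b\<close>
  acts.\<close>

definition Ph where "Ph t x b = (U (trg M t)<|Jc b).:(J.B.inv2 (k t)|>Ja x)"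

lemma Ph_alg:
 assumes S: "monad_in M S" and x: "arr_in L x X (C (base S))"
 shows "alg L (pfun_monad L F S) X x b ==> alg W (I.Fm S) (Jo X) (U (base S)**Ja x) (Ph (endo S) x b)"
  "cell_in L b (f (endo S)**@L x) x ==> arr_in L y X (C (base S)) ==> cell_in L c (f (endo S)**@L y) y ==> cell_in L h x y ==>
  algm W (I.Fm S) (U (base S)**Ja x) (Ph (endo S) x b) (U (base S)**Ja y) (Ph (endo S) y c) (U (base S)<|Jc h) <->
  algm L (pfun_monad L F S) x b y c h"
proof -
 interpret F: pseudofunctor M L F by(rule F_pseudofunctor)
 note [simp] = S x[simplified]
 let ?t = "endo S" and ?U = "U (base S)"
 have X: "X : objs L" using x J.A.src_objs[of x] by simp
 note [simp] = X F_simps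
 {
  assume b: "alg L (pfun_monad L F S) X x b"
  note bb = J.A.algD[OF b, simplified]
  note [simp] = bb(1-6)
  let ?i = "J.B.inv2 (k ?t)|>Ja x"
  have 1: "?i .: (Ia ?t<|?U<|Jc b) = (?U<|Ja (f ?t)<|Jc b).:(J.B.inv2 (k ?t)|>Ja (f ?t)|>Ja x)" using J.B.ich[of "Jc b" "J.B.inv2 (k ?t)"] by simp
  have 2: "(?U<|Jc b).:(?U<|Ja (f ?t)<|Jc b) = (?U<|Jc b).:(?U<|(Jc (Fc (mult S))|>Ja x)).:(?U<|(Jc (Fp ?t ?t)|>Ja x))" using arg_cong[OF bb(7), of "%z. ?U<|Jc z"] by simp
  have "k ?t .: (?U<|Jc (Fc (mult S))).:(?U<|Jc (Fp ?t ?t)) = (Ic (mult S)|>?U).:(Ia ?t<|k ?t).:(k ?t|>Ja (f ?t))"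
  using J.B.vx2[OF Fc_k[of "mult S"], of "?U<|Jc (Fp ?t ?t)"] Fp_k[of ?t ?t] by simp
  from arg_cong[OF this, of "%z. (J.B.inv2 (k ?t) .: z .: (J.B.inv2 (k ?t)|>Ja (f ?t)).:(Ia ?t<|J.B.inv2 (k ?t)))|>Ja x"]
  have 3: "(?U<|(Jc (Fc (mult S))|>Ja x)).:(?U<|(Jc (Fp ?t ?t)|>Ja x)).:(J.B.inv2 (k ?t)|>Ja (f ?t)|>Ja x).:(Ia ?t<|?i) =
  ?i .: (Ic (mult S)|>?U|>Ja x)" by simp
  have "k ?t .: (?U<|Jc (Fc (eta S))).:(?U<|Jc (Fu (base S))) = Ic (eta S)|>?U" using J.B.vx2[OF Fc_k[of "eta S"], of "?U<|Jc (Fu (base S))"] Fu_k[of "base S"] by simp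
  from arg_cong[OF this, of "%z. (J.B.inv2 (k ?t) .: z)|>Ja x"]
  have 4: "?i .: (Ic (eta S)|>?U|>Ja x) = (?U<|(Jc (Fc (eta S))|>Ja x)).:(?U<|(Jc (Fu (base S))|>Ja x))" by simp
  have 5: "(?U<|Jc b).:(?U<|(Jc (Fc (eta S))|>Ja x)).:(?U<|(Jc (Fu (base S))|>Ja x)) = idc W (?U**Ja x)" using arg_cong[OF bb(8), of "%z. ?U<|Jc z"] by simp
  show "alg W (I.Fm S) (Jo X) (?U**Ja x) (Ph ?t x b)" by(simp add: alg_def Ph_def J.B.vx2[OF 1] J.B.vx2[OF 2] 3 4 5)
 }
 {
  assume b: "cell_in L b (f ?t**@L x) x" and y: "arr_in L y X (C (base S))" and c: "cell_in L c (f ?t**@L y) y" and h: "cell_in L h x y"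
  note [simp] = b[simplified] y[simplified] c[simplified] h[simplified]
  have 1: "(J.B.inv2 (k ?t)|>Ja y).:(Ia ?t<|?U<|Jc h) = (?U<|Ja (f ?t)<|Jc h).:(J.B.inv2 (k ?t)|>Ja x)" using J.B.ich[of "Jc h" "J.B.inv2 (k ?t)"] by simp
  have "algm W (I.Fm S) (?U**Ja x) (Ph ?t x b) (?U**Ja y) (Ph ?t y c) (?U<|Jc h) <->
  (?U<|Jc (h .:@L b)).:(J.B.inv2 (k ?t)|>Ja x) = (?U<|Jc (c .:@L(f ?t<|@L h))).:(J.B.inv2 (k ?t)|>Ja x)"
  by(simp add: algm_def Ph_def 1)
  also have "... <-> ?U<|Jc (h .:@L b) = ?U<|Jc (c .:@L(f ?t<|@L h))" by(rule J.B.iso2_cancel_iff(1)) simp_all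
  also have "... <-> h .:@L b = c .:@L(f ?t<|@L h)" by(rule iffI, rule test[of "base S" _ "f ?t**@L x" y]) simp_all
  finally show "algm W (I.Fm S) (?U**Ja x) (Ph ?t x b) (?U**Ja y) (Ph ?t y c) (?U<|Jc h) <-> algm L (pfun_monad L F S) x b y c h" by(simp add: algm_def)
 }
qed

text \<open>Through \<open>Ph\<close> the \<open>F S\<close>-algebras at \<open>X\<close> embed
  fully and faithfully into \<open>I S\<close>-algebras at \<open>J X\<close>, and
  \<open>k V\<close> is an algebra isomorphism between acting by \<open>F V\<close> and acting by
  \<open>I V\<close>. Universality of \<open>I V\<close> at \<open>J X\<close> combined with the
  universal arrows gives universality of \<open>F V\<close> at \<open>X\<close>.\<close>

theorem F_universal:
 assumes S: "monad_in M S" and V: "alg M S (src M V) V b" and u: "!!X. X : objs L ==> univ W (I.Fm S) (Ia V) (Ic b) (Jo X)"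
 shows "universal L (pfun_monad L F S) (par F V) (pce F b .:@L pcomp F (endo S) V)"
proof -
 interpret F: pseudofunctor M L F by(rule F_pseudofunctor)
 note FS = F.P_monad[OF S] and IS = I.F_monad[OF S] and IV = I.F_alg[OF S V]
 let ?t = "endo S" and ?U = "U (base S)" and ?Z = "U (src M V)"
 define a where "a = Fc b .:@L Fp ?t V"
 note [simp] = S I.A.algD(1,3-6)[OF V] F_simps
 have a: "alg L (pfun_monad L F S) (C (src M V)) (f V) a" using F.P_alg[OF S V] by(simp add: a_def)
 note [simp] = J.A.algD(4-6)[OF a, simplified]
 have aW: "alg W (I.Fm S) (Jo X) (?U**Ja (f V**@L g)) (Ph ?t (f V**@L g) (a|>@L g))" if "arr_in L g X (C (src M V))" for g X
  using Ph_alg(1)[OF S _ J.A.alg_act[OF FS a that]] that by simp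
 have VW: "alg W (I.Fm S) (Jo X) (Ia V**?Z**Ja g) (Ic b|>(?Z**Ja g))" if "arr_in L g X (C (src M V))" for g X
  using J.B.alg_act[OF IS IV, of "?Z**Ja g" "Jo X"] that by simp
 have kV: "algm W (I.Fm S) (?U**Ja (f V**@L g)) (Ph ?t (f V**@L g) (a|>@L g)) (Ia V**?Z**Ja g) (Ic b|>(?Z**Ja g)) (k V|>Ja g)"
  if g: "arr_in L g X (C (src M V))" for g X
 proof -
  note [simp] = g[simplified]
  have 1: "k V .: (?U<|Jc (Fc b)) = (Ic b|>?Z) .: k (?t**@M V)" "k (?t**@M V).:(?U<|Jc (Fp ?t V)) = (Ia ?t<|k V).:(k ?t|>Ja (f V))" using Fc_k[of b] Fp_k[of ?t V] by simp+
  have "k V .: (?U<|Jc (Fc b)).:(?U<|Jc (Fp ?t V)).:(J.B.inv2 (k ?t)|>Ja (f V)) = (Ic b|>?Z).:(Ia ?t<|k V)" by(simp add: J.B.vx2[OF 1(1)] J.B.vx2[OF 1(2)])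
  from J.B.rcong[OF this, of "Ja g"] show ?thesis by(simp add: algm_def Ph_def a_def)
 qed
 have kV': "algm W (I.Fm S) (Ia V**?Z**Ja g) (Ic b|>(?Z**Ja g)) (?U**Ja (f V**@L g)) (Ph ?t (f V**@L g) (a|>@L g)) (J.B.inv2 (k V)|>Ja g)"
  if g: "arr_in L g X (C (src M V))" for g X
  using J.B.algm_inv[OF IS aW[OF g] VW[OF g] kV[OF g]] g by simp
 have "univ L (pfun_monad L F S) (f V) a X" if X: "X : objs L" for X
 proof (rule J.A.univI)
  show "alg L (pfun_monad L F S) (src L (f V)) (f V) a" using a by simp
  note uX = u[OF X]
  {
  fix g g' h assume g0: "arr_in L g X (src L (f V))" "arr_in L g' X (src L (f V))" and h: "algm L (pfun_monad L F S) (f V**@L g) (a|>@L g) (f V**@L g') (a|>@L g') h"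
  have g: "arr_in L g X (C (src M V))" "arr_in L g' X (C (src M V))" using g0 by simp+
  note [simp] = g[simplified] J.A.algmD(1-3)[OF h]
  have hW: "algm W (I.Fm S) (?U**Ja (f V**@L g)) (Ph ?t (f V**@L g) (a|>@L g)) (?U**Ja (f V**@L g')) (Ph ?t (f V**@L g') (a|>@L g')) (?U<|Jc h)"
  using Ph_alg(2)[OF S, of "f V**@L g" X "a|>@L g" "f V**@L g'" "a|>@L g'" h] h by simp
  let ?w = "(k V|>Ja g').:(?U<|Jc h).:(J.B.inv2 (k V)|>Ja g)"
  have "algm W (I.Fm S) (Ia V**?Z**Ja g) (Ic b|>(?Z**Ja g)) (Ia V**?Z**Ja g') (Ic b|>(?Z**Ja g')) ?w"
  by(rule J.B.algm_comp[OF IS VW[OF g(1)] aW[OF g(2)] VW[OF g(2)] J.B.algm_comp[OF IS VW[OF g(1)] aW[OF g(1)] aW[OF g(2)] kV'[OF g(1)] hW] kV[OF g(2)]])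
  from J.B.univD(2)[OF uX _ _ this] have ex: "EX! y. cell_in W y (?Z**Ja g) (?Z**Ja g') & Ia V<|y = ?w" by simp
  then obtain y where y: "cell_in W y (?Z**Ja g) (?Z**Ja g')" "Ia V<|y = ?w" by(elim ex1E conjE)
  have iff: "f V<|@L x = h <-> ?Z<|Jc x = y" if x: "cell_in L x g g'" for x
  proof -
  note [simp] = x[simplified]
  have 1: "(k V|>Ja g').:(?U<|Ja (f V)<|Jc x) = (Ia V<|?Z<|Jc x).:(k V|>Ja g)" using J.B.ich[of "Jc x" "k V"] by simp
  have "f V<|@L x = h <-> ?U<|Jc (f V<|@L x) = ?U<|Jc h" by(rule iffI, simp, rule test[of "base S" _ "f V**@L g" "f V**@L g'"]) simp_all
  also have "... <-> (k V|>Ja g').:(?U<|Ja (f V)<|Jc x) = (k V|>Ja g').:(?U<|Jc h)" by(subst J.B.iso2_cancel_iff(2)) simp_all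
  also have "... <-> Ia V<|?Z<|Jc x = ?w" unfolding 1 using J.B.iso2_cancel_iff(1)[of "k V|>Ja g" "Ia V<|?Z<|Jc x" ?w] by simp
  also have "... <-> ?Z<|Jc x = y"
  proof -
  have "cell_in W (?Z<|Jc x) (?Z**Ja g) (?Z**Ja g')" by simp
  with ex y show ?thesis by metis
  qed
  finally show ?thesis .
  qed
  have "EX! x. cell_in L x g g' & ?Z<|Jc x = y" using ua_ff[OF _ g y(1)] by simp
  then show "EX! x. cell_in L x g g' & f V<|@L x = h" using iff by metis
  }
  {
  fix x c assume c: "alg L (pfun_monad L F S) X x c"
  have x: "arr_in L x X (C (base S))" using J.A.algD(1-3)[OF c] by simp
  note [simp] = x[simplified] J.A.algD(4-6)[OF c, simplified]
  note cW = Ph_alg(1)[OF S x c]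
  obtain G l where G: "arr_in W G (Jo X) (src W (Ia V))" and l: "J.B.iso2 l" "algm W (I.Fm S) (Ia V**G) (Ic b|>G) (?U**Ja x) (Ph ?t x c) l"
  using J.B.univD(3)[OF uX cW] by blast
  have G': "arr_in W G (Jo X) (Io (src M V))" using G by simp
  obtain g p where g: "arr_in L g X (C (src M V))" and p: "J.B.iso2 p" "cell_in W p (?Z**Ja g) G"
  using ua_eso[OF _ X G'] by auto
  note [simp] = G'[simplified] g[simplified] p(1) p(2)[simplified] l(1) J.B.algmD(1-3)[OF l(2)]
  let ?w = "l .: (Ia V<|p).:(k V|>Ja g)"
  have 1: "algm W (I.Fm S) (Ia V**?Z**Ja g) (Ic b|>(?Z**Ja g)) (Ia V**G) (Ic b|>G) (Ia V<|p)" using J.B.algm_lwhisk[OF IS IV p(2), of "Jo X"] by simp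
  have aG: "alg W (I.Fm S) (Jo X) (Ia V**G) (Ic b|>G)" using J.B.alg_act[OF IS IV, of G "Jo X"] by simp
  have w: "algm W (I.Fm S) (?U**Ja (f V**@L g)) (Ph ?t (f V**@L g) (a|>@L g)) (?U**Ja x) (Ph ?t x c) ?w"
  by(rule J.B.algm_comp[OF IS aW[OF g] aG cW J.B.algm_comp[OF IS aW[OF g] VW[OF g] aG kV[OF g] 1] l(2)])
  have wc: "cell_in W ?w (?U**Ja (f V**@L g)) (?U**Ja x)" "cell_in W (J.B.inv2 ?w) (?U**Ja x) (?U**Ja (f V**@L g))" by simp+
  have ge: "arr_in L (f V**@L g) X (C (base S))" and bM: "base S : objs M" by simp+
  obtain h where h: "cell_in L h (f V**@L g) x" "?U<|Jc h = ?w" using ua_ff[OF bM ge x wc(1)] by(elim ex1E conjE)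
  obtain h' where h': "cell_in L h' x (f V**@L g)" "?U<|Jc h' = J.B.inv2 ?w" using ua_ff[OF bM x ge wc(2)] by(elim ex1E conjE)
  note [simp] = h(1)[simplified] h'(1)[simplified]
  have "h' .:@L h = idc L (f V**@L g)" by(rule test[of "base S" _ "f V**@L g" "f V**@L g"]) (simp_all add: h(2) h'(2))
  moreover have "h .:@L h' = idc L x" by(rule test[of "base S" _ x x]) (simp_all add: h(2) h'(2))
  ultimately have i: "J.A.iso2 h" using J.A.inv2_unique(2)[of h h'] by simp
  have "algm L (pfun_monad L F S) (f V**@L g) (a|>@L g) x c h" using Ph_alg(2)[OF S ge, of "a|>@L g" x c h] w h(2) by simp
  then show "EX g k. arr_in L g X (src L (f V)) & J.A.iso2 k & algm L (pfun_monad L F S) (f V**@L g) (a|>@L g) x c k" using i g by(intro exI[of _ g] exI[of _ h]) simp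
  }
 qed
 then show ?thesis using a by(simp add: universal_def a_def)
qed

end

section \<open>Extending a pseudofunctor along the inclusion\<close>

context collage
begin

abbreviation "uar == strict_fun.uarr L W Jo Jla Jlc"
text \<open>The identity of \<open>P A\<close> read as an arrow from \<open>P A\<close> to
  \<open>A\<close> in the collage; it is the universal arrow prescribed at an identity
  monad.\<close>

abbreviation "q1 A == MA (one K A) (one L (pob P A))"
abbreviation "lc z == (LA (csrc L z), LA (ctrg L z), z)"
abbreviation "kc x == (KA (csrc K x), KA (ctrg K x), pce P x)"
text \<open>The cell filling the naturality square of \<open>q1\<close> at \<open>f\<close>, given
  by the coherence of \<open>P\<close>.\<close>

abbreviation "k0 f == (MA (one K (trg K f)) (par P f), MA f (one L (pob P (src K f))), pcomp P (one K (trg K f)) f)"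

lemma q1_simps [simp]:
 assumes "A : objs K"
 shows "q1 A : arrs R.N" "src R.N (q1 A) = Inl (pob P A)" "trg R.N (q1 A) = Inr A"
 using assms by(simp_all add: R.N_simps)

lemma k0_simps [simp]:
 assumes f: "f : arrs K"
 shows "N.iso2 (k0 f)" "k0 f : cells R.N" "csrc R.N (k0 f) = q1 (trg K f) **@(R.N) LA (par P f)" "ctrg R.N (k0 f) = KA f **@(R.N) q1 (src K f)"
proof -
 note [simp] = f
 show "N.iso2 (k0 f)" by(rule N.inv2_unique(2)[of _ "(MA f (one L (pob P (src K f))), MA (one K (trg K f)) (par P f), L.inv2 (pcomp P (one K (trg K f)) f))"]) (simp_all add: R.N_simps)
 show "k0 f : cells R.N" "csrc R.N (k0 f) = q1 (trg K f) **@(R.N) LA (par P f)" "ctrg R.N (k0 f) = KA f **@(R.N) q1 (src K f)" by(simp_all add: R.N_simps)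
qed

text \<open>Together with \<open>k0_comp\<close> and \<open>k0_unit\<close> this says that the cells
  of \<open>P\<close> satisfy the equations characterising \<open>Fc\<close>, \<open>Fp\<close> and
  \<open>Fu\<close>. By uniqueness of transposes the extension then agrees strictly with
  \<open>P\<close>.\<close>

lemma k0_nat:
 assumes x: "x : cells K"
 shows "k0 (ctrg K x) .:@(R.N) (q1 (trg K (csrc K x)) <|@(R.N) lc (pce P x)) = (kc x |>@(R.N) q1 (src K (csrc K x))) .:@(R.N) k0 (csrc K x)"
proof -
 note [simp] = x
 have e: "pcomp P (one K (trg K (csrc K x))) (ctrg K x).:(par P (one K (trg K (csrc K x)))<|pce P x) = pce P x .: pcomp P (one K (trg K (csrc K x))) (csrc K x)"
  using pc_lw[of x "one K (trg K (csrc K x))"] by simp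
 show ?thesis
  using N_LA(1)[of "one K (trg K (csrc K x))" "one L (pob P (trg K (csrc K x)))" "pce P x" "par P (csrc K x)" "par P (ctrg K x)"]
  N_rw[of x "one K (src K (csrc K x))" "one L (pob P (src K (csrc K x)))"]
  by(simp add: R.N_simps e)
qed

lemma k0_comp:
 assumes fg: "f : arrs K" "g : arrs K" "trg K f = src K g"
 shows "k0 (g**@K f) .:@(R.N) (q1 (trg K g) <|@(R.N) lc (pcomp P g f)) = (KA g <|@(R.N) k0 f) .:@(R.N) (k0 g |>@(R.N) LA (par P f))"
proof -
 note [simp] = fg
 let ?o = "one K (src K g)" and ?c = "one K (trg K g)"
 have 1: "pcomp P g f .: (pcomp P g ?o|>par P f) = pcomp P g f .: (par P g<|pcomp P ?o f)" using pc_assoc[of f ?o g] by simp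
 have 2: "pcomp P g f .: (pcomp P ?c g|>par P f) = pcomp P ?c (g**@K f).:(par P ?c<|pcomp P g f)" using pc_assoc[of f g ?c] by simp
 show ?thesis
  using N_LA(1)[of ?c "one L (pob P (trg K g))" "pcomp P g f" "par P g**par P f" "par P (g**@K f)"]
  N_lw[of g ?o f "par P f" "one L (pob P (src K f))" "pcomp P ?o f"]
  N_LA(2)[of ?c "par P g" g "one L (pob P (src K g))" "pcomp P ?c g" "par P f"]
  by(simp add: R.N_simps 2[symmetric] L.vx2[OF 1[symmetric]])
qed

lemma k0_unit:
 assumes A: "A : objs K"
 shows "k0 (one K A) .:@(R.N) (q1 A <|@(R.N) lc (punit P A)) = idc R.N (q1 A)"
proof -
 note [simp] = A
 have "pcomp P (one K A) (one K A).:(par P (one K A)<|punit P A) = idc L (par P (one K A))" by(rule pu_right) simp_all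
 then show ?thesis
  using N_LA(1)[of "one K A" "one L (pob P A)" "punit P A" "one L (pob P A)" "par P (one K A)"] by(simp add: R.N_simps)
qed

text \<open>An idempotent on an arrow out of \<open>X\<close> is an idempotent of \<open>L\<close>
  on its realisation, and the splitting in \<open>L\<close> is realised by an arrow of
  \<open>L\<close> or, up to \<open>punit\<close>, by some \<open>MA 1 g\<close>. For arrows between
  objects of \<open>K\<close> the splitting need not be in the image of \<open>P\<close>, hence the
  restriction to sources in \<open>L\<close>.\<close>

lemma N_ess:
 assumes cc: "Cat_cc_category L" and z: "arr_in W z (Jo X) (id_monad R.N Y)" and X: "X : objs L" and Y: "Y : objs R.N"
 shows "EX f k. arr_in R.N f (Inl X) Y & N.M.iso2 k & cell_in W k (Ja R.N f) z"
proof (rule N.J_ess[OF _ z _ Y])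
 show "Inl X : objs R.N" using X by(simp add: R.N_simps InlI)
 fix f e assume f: "arr_in R.N f (Inl X) Y" and e: "cell_in R.N e f f" "e .:@(R.N) e = e"
 obtain e0 where e0: "e = (f, f, e0)" "cell_in L e0 (cR f) (cR f)" using R.N_cell_ex[OF e(1)] by auto
 have ee: "e0 .: e0 = e0" using e(2) by(simp add: e0(1) R.N_simps)
 have fA: "f : cA" "cs f = Inl X" "ct f = Y" using f by(simp_all add: R.N_simps)
 show "EX g r s. arr_in R.N g (Inl X) Y & cell_in R.N r f g & cell_in R.N s g f & s .:@(R.N) r = e & r .:@(R.N) s = idc R.N g"
 proof (cases f)
  case (LA y)
  note [simp] = fA[unfolded LA, simplified]
  obtain g r s where g: "arr_in L g X (trg L y)" "cell_in L r y g" "cell_in L s g y" "s .: r = e0" "r .: s = idc L g"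
  using L.cc_split[OF cc e0(2) _ ee, of X "trg L y"] by(auto simp: LA)
  note [simp] = g(1-3)[simplified]
  show ?thesis
  by(rule exI[of _ "LA g"], rule exI[of _ "(LA y, LA g, r)"], rule exI[of _ "(LA g, LA y, s)"])
  (use fA(3) in \<open>simp add: R.N_simps e0(1) g(4,5) LA\<close>)
 next
  case (KA h)
  then show ?thesis using fA by simp
 next
  case (MA h y)
  note [simp] = fA(1,2)[unfolded MA, simplified]
  let ?p = "punit P (trg K h)" and ?o = "one K (trg K h)"
  obtain g r s where g: "arr_in L g X (pob P (trg K h))" "cell_in L r (par P h**y) g" "cell_in L s g (par P h**y)" "s .: r = e0" "r .: s = idc L g"
  using L.cc_split[OF cc e0(2) _ ee, of X "pob P (trg K h)"] by(auto simp: MA)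
  note [simp] = g(1-3)[simplified]
  have 1: "(?p|>g) .: r .: s .: (L.inv2 ?p|>g) = idc L (par P ?o**g)" using L.vx2[OF g(5), of "L.inv2 ?p|>g"] by simp
  show ?thesis
  by(rule exI[of _ "MA ?o g"], rule exI[of _ "(MA h y, MA ?o g, (?p|>g) .: r)"], rule exI[of _ "(MA ?o g, MA h y, s .: (L.inv2 ?p|>g))"])
  (use fA(3) in \<open>simp add: R.N_simps e0(1) g(4) 1 MA\<close>)
 qed
qed

lemma N_loc:
 assumes cc: "Cat_cc_category L"
 shows "loc_equiv R.N W (id_monad R.N) (Ja R.N) (Jc R.N) (Inl ` objs L)"
proof (intro loc_equiv.intro N.J.strict_fun_axioms loc_equiv_axioms.intro)
 show "Inl ` objs L \<subseteq> objs R.N" by(auto simp: R.N_simps)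
 show "EX r. cell_in R.N r f g & Jc R.N r = y" if "f : arrs R.N" "g : arrs R.N" "cell_in W y (Ja R.N f) (Ja R.N g)" for f g y
  using N.J_full[OF that(3,1,2)] by auto
 show "Jc R.N x = Jc R.N x' ==> x = x'" for x x' by(rule N.J_faithful)
 show "EX f k. arr_in R.N f X Y & N.M.iso2 k & cell_in W k (Ja R.N f) z" if "arr_in W z (id_monad R.N X) (id_monad R.N Y)" "X : Inl ` objs L" "Y : objs R.N" for z X Y
  using that(2)
 proof (rule imageE)
  fix X' assume X': "X = Inl X'" "X' : objs L"
  show ?thesis using that(1,3) N_ess[OF cc _ X'(2)] unfolding X'(1) by blast
 qed
qed

text \<open>The 2-cells of \<open>W\<close> between included 1-cells of \<open>L\<close> are exactly
  the 2-cells of \<open>L\<close>, so unique lifts may be sought in \<open>W\<close>.\<close>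

lemma uarI:
 assumes C: "C : objs L" and u: "arr_in W u (Jo C) S"
  and ff: "!!X g g' w. arr_in L g X C ==> arr_in L g' X C ==> X : objs L ==> cell_in W w (u**@W Jla g) (u**@W Jla g') ==>
  EX! z. cell_in W z (Jla g) (Jla g') & u<|@W z = w"
  and eso: "!!X n. X : objs L ==> arr_in W n (Jo X) S ==> EX g k. arr_in L g X C & N.M.iso2 k & cell_in W k (u**@W Jla g) n"
 shows "uar u C S"
proof -
 interpret Jl: strict_fun L W Jo Jla Jlc by(rule Jl)
 have "EX! x. cell_in L x g g' & u<|@W Jlc x = w" if g: "arr_in L g X C" "arr_in L g' X C" and w: "cell_in W w (u**@W Jla g) (u**@W Jla g')" for X g g' w
 proof -
  have X: "X : objs L" using g(1) L.src_objs[of g] by auto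
  note ex = ff[OF g X w]
  then obtain z where z: "cell_in W z (Jla g) (Jla g')" "u<|@W z = w" by(elim ex1E conjE)
  have LA: "LA g : arrs R.N" "LA g' : arrs R.N" using g by(simp_all add: R.N_simps)
  obtain r where r: "cell_in R.N r (LA g) (LA g')" "z = Jc R.N r" using N.J_full[OF z(1) LA] by blast
  obtain x where x: "r = (LA g, LA g', x)" "cell_in L x g g'" using R.N_cell_ex[OF r(1)] by auto
  show ?thesis
  proof (rule ex1I[of _ x])
  show "cell_in L x g g' & u<|@W Jlc x = w" using x r z by auto
  fix x' assume x': "cell_in L x' g g' & u<|@W Jlc x' = w"
  then have "cell_in W (Jlc x') (Jla g) (Jla g')" using Jl.Fc[of x'] by auto
  with ex z x' have "Jlc x' = z" by blast
  then have "lc x' = r" unfolding r(2) by(rule N.J_faithful)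
  then show "x' = x" by(simp add: x(1))
  qed
 qed
 then show ?thesis using C u eso unfolding Jl.uarr_def by blast
qed

text \<open>The universal algebra \<open>u\<close> of the image monad becomes an algebra of the
  collage, hence by \<open>V_lift\<close> is of the form \<open>V v\<close>. Both \<open>V\<close>
  and \<open>V v\<close> are universal at objects of \<open>L\<close>, so \<open>univ_cancel\<close>
  makes \<open>v\<close> a universal arrow.\<close>

lemma uarr_ex:
 assumes cc: "Cat_cc_category L" and T: "monad_in K T" and u: "universal L (pfun_monad L P T) u a"
 shows "EX v. uar v (src L u) (kN.Fm T)"
proof -
 interpret E: loc_equiv R.N W "id_monad R.N" "Ja R.N" "Jc R.N" "Inl ` objs L" by(rule N_loc[OF cc])
 let ?q = "MA (one K (base T)) u" and ?c = "(MA (endo T) u, MA (one K (base T)) u, (punit P (base T)|>u) .: a)"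
 let ?C = "src L u"
 have a: "alg L (pfun_monad L P T) ?C u a" using u by(simp add: universal_def)
 note T' = kN.F_monad[OF T]
 note [simp] = T T' L.algD(1,3-6)[OF a, simplified]
 have C: "?C : objs L" by simp
 have al: "alg R.N (kN.Fm T) (Inl ?C) ?q ?c" using alg_q[OF T, of u ?C a] a by simp
 have sq: "src R.N ?q = Inl ?C" by(simp add: R.N_simps)
 note alW = N.J.F_alg[OF T' al]
 obtain v where v: "arr_in W v (Jo ?C) (kN.Fm T)" "dmV R.N (kN.Fm T)**@W v = Ja R.N ?q" "dma R.N (kN.Fm T)|>@W v = Jc R.N ?c"
  using N.V_lift[OF T' alW] by blast
 have vu: "univ W (N.Jm (kN.Fm T)) (dmV R.N (kN.Fm T)**@W v) (dma R.N (kN.Fm T)|>@W v) (Jo X)" if X: "X : objs L" for X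
  unfolding v(2,3) using E.univ_iff[OF T' al[folded sq], of "Inl X"] univ_q[OF T u X] X by simp
 have Vu: "univ W (N.Jm (kN.Fm T)) (dmV R.N (kN.Fm T)) (dma R.N (kN.Fm T)) (Jo X)" if X: "X : objs L" for X
  using N.V_univ[OF T', of "Jo X"] N.J.Fo[of "Inl X"] X by(simp add: R.N_simps InlI)
 have vt: "v : arrs W" "trg W v = src W (dmV R.N (kN.Fm T))" and sv: "src W v = Jo ?C" and sV: "src W (dmV R.N (kN.Fm T)) = kN.Fm T" using v(1) by simp+
 note cn = N.M.univ_cancel[OF N.J.F_monad[OF T'] Vu vt vu, unfolded sv sV]
 show ?thesis
 proof (rule exI[of _ v], rule uarI[OF C v(1)])
  fix X g g' w assume g: "arr_in L g X ?C" "arr_in L g' X ?C" and X: "X : objs L" and w: "cell_in W w (v**@W Jla g) (v**@W Jla g')"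
  have "arr_in W (Jla g) (Jo X) (Jo ?C)" "arr_in W (Jla g') (Jo X) (Jo ?C)" using g lN.Fa[of g] lN.Fa[of g'] by simp+
  from cn(1)[OF X X this w] show "EX! z. cell_in W z (Jla g) (Jla g') & v<|@W z = w" .
 next
  fix X n assume X: "X : objs L" and n: "arr_in W n (Jo X) (kN.Fm T)"
  obtain G l where G: "arr_in W G (Jo X) (Jo ?C)" and l: "N.M.iso2 l" "cell_in W l (v**@W G) n" using cn(2)[OF X X n] by blast
  have Co: "Inl ?C : objs R.N" by(simp add: R.N_simps InlI)
  obtain f p where f: "arr_in R.N f (Inl X) (Inl ?C)" and p: "N.M.iso2 p" "cell_in W p (Ja R.N f) G" using N_ess[OF cc G X Co] by blast
  have "f : cA" "cs f = Inl X" "ct f = Inl ?C" using f by(simp_all add: R.N_simps)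
  then obtain g where g: "f = LA g" "arr_in L g X ?C" by(cases f) simp_all
  note [simp] = v(1)[simplified] G[simplified] p(1) p(2)[simplified] l(1) l(2)[simplified]
  have "N.M.iso2 (l .:@W(v<|@W p))" "cell_in W (l .:@W(v<|@W p)) (v**@W Jla g) n" using g by simp+
  then show "EX g k. arr_in L g X ?C & N.M.iso2 k & cell_in W k (v**@W Jla g) n" using g(2) by blast
 qed
qed

text \<open>Up to isomorphism every 1-cell from \<open>X\<close> in \<open>L\<close> to the included
  \<open>A\<close> is \<open>q1 A\<close> after a 1-cell of \<open>L\<close>, and whiskering with
  \<open>P 1\<close> is bijective on 2-cells. At an identity monad the object \<open>P A\<close>
  thus serves without any choice.\<close>

lemma uarr_id:
 assumes cc: "Cat_cc_category L" and A: "A : objs K"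
 shows "uar (Ja R.N (q1 A)) (pob P A) (kN.Fm (id_monad K A))"
 unfolding kN.Fm_id[OF A]
proof (rule uarI)
 note [simp] = A
 show "pob P A : objs L" by simp
 show "arr_in W (Ja R.N (q1 A)) (Jo (pob P A)) (id_monad R.N (Inr A))" by simp
 have q: "Ja R.N (MA (one K A) y) = Ja R.N (q1 A)**@W Jla y" if "arr_in L y X (pob P A)" for y X
 proof -
  have "MA (one K A) y = q1 A **@(R.N) LA y" using that by(simp add: R.N_simps)
  then show ?thesis using that N.J.F_cmp[of "LA y" "q1 A"] by(simp only: q1_simps(1,2)[OF A] lN.Fa arr_in_def)
 qed
 {
  fix X g g' w assume g: "arr_in L g X (pob P A)" "arr_in L g' X (pob P A)" and w: "cell_in W w (Ja R.N (q1 A)**@W Jla g) (Ja R.N (q1 A)**@W Jla g')"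
  note [simp] = g[simplified]
  have w': "cell_in W w (Ja R.N (MA (one K A) g)) (Ja R.N (MA (one K A) g'))" using w unfolding q[OF g(1)] q[OF g(2)] .
  have qa: "MA (one K A) g : arrs R.N" "MA (one K A) g' : arrs R.N" by(simp_all add: R.N_simps)
  obtain r where r: "cell_in R.N r (MA (one K A) g) (MA (one K A) g')" "w = Jc R.N r" using N.J_full[OF w' qa] by blast
  obtain h where h: "r = (MA (one K A) g, MA (one K A) g', h)" "cell_in L h (par P (one K A)**g) (par P (one K A)**g')"
  using R.N_cell_ex[OF r(1)] by auto
  have iff: "Ja R.N (q1 A)<|@W Jlc x = w <-> par P (one K A)<|x = h" if x: "cell_in L x g g'" for x
  proof -
  note [simp] = x[simplified]
  have "Ja R.N (q1 A)<|@W Jlc x = Jc R.N (q1 A <|@(R.N) lc x)" using lN.Fc[of x] by simp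
  also have "q1 A <|@(R.N) lc x = (MA (one K A) g, MA (one K A) g', par P (one K A)<|x)" using N_LA(1)[of "one K A" "one L (pob P A)" x g g'] by simp
  finally have e: "Ja R.N (q1 A)<|@W Jlc x = Jc R.N (MA (one K A) g, MA (one K A) g', par P (one K A)<|x)" .
  show ?thesis unfolding e r(2) h(1) using N.J_faithful by blast
  qed
  have "EX! x. cell_in L x g g' & par P (one K A)<|x = h" by(rule pu_conj_ex[OF g A h(2)])
  then obtain x where x: "cell_in L x g g'" "par P (one K A)<|x = h" and ux: "!!y. cell_in L y g g' ==> par P (one K A)<|y = h ==> y = x" by blast
  show "EX! z. cell_in W z (Jla g) (Jla g') & Ja R.N (q1 A)<|@W z = w"
  proof (rule ex1I[of _ "Jlc x"])
  have xl: "x : cells L" "csrc L x = g" "ctrg L x = g'" using x(1) by simp+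
  have "cell_in W (Jc R.N (lc x)) (Jla g) (Jla g')" using lN.Fc[OF xl(1)] xl by simp
  then show "cell_in W (Jlc x) (Jla g) (Jla g') & Ja R.N (q1 A)<|@W Jlc x = w" using iff[OF x(1)] x(2) by blast
  fix z assume z: "cell_in W z (Jla g) (Jla g') & Ja R.N (q1 A)<|@W z = w"
  have LA: "LA g : arrs R.N" "LA g' : arrs R.N" by simp+
  obtain r' where r': "cell_in R.N r' (LA g) (LA g')" "z = Jc R.N r'" using N.J_full[OF conjunct1[OF z] LA] by blast
  obtain y where y: "r' = (LA g, LA g', y)" "cell_in L y g g'" using R.N_cell_ex[OF r'(1)] by auto
  have yl: "lc y = r'" using y by simp
  have "y = x" using ux[OF y(2)] iff[OF y(2)] z r'(2) yl by simp
  then show "z = Jlc x" using r'(2) yl by simp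
  qed
 }
 fix X n assume X: "X : objs L" and n: "arr_in W n (Jo X) (id_monad R.N (Inr A))"
 have Ao: "Inr A : objs R.N" by(simp add: R.N_simps InrI)
 obtain f p where f: "arr_in R.N f (Inl X) (Inr A)" and p: "N.M.iso2 p" "cell_in W p (Ja R.N f) n" using N_ess[OF cc n X Ao] by blast
 have "f : cA" "cs f = Inl X" "ct f = Inr A" using f by(simp_all add: R.N_simps)
 then obtain h y where h: "f = MA h y" "h : arrs K" "trg K h = A" "arr_in L y X (pob P (src K h))" by(cases f) simp_all
 note [simp] = h(2) h(4)[simplified]
 have g: "arr_in L (par P h**y) X (pob P A)" using h(3) by simp
 let ?k = "(MA (one K A) (par P h**y), f, pcomp P (one K A) h|>y)"
 have kc: "?k : cells R.N" "csrc R.N ?k = MA (one K A) (par P h**y)" "ctrg R.N ?k = f" using h(3) by(simp_all add: h(1) R.N_simps)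
 have ki: "N.iso2 ?k" by(rule N.inv2_unique(2)[of _ "(f, MA (one K A) (par P h**y), L.inv2 (pcomp P (one K A) h)|>y)"]) (use h(3) in \<open>simp_all add: h(1) R.N_simps\<close>)
 note [simp] = p(1) p(2)[simplified]
 have "N.M.iso2 (p .:@W Jc R.N ?k)" "cell_in W (p .:@W Jc R.N ?k) (Ja R.N (q1 A)**@W Jla (par P h**y)) n"
  unfolding q[OF g, symmetric] using kc N.J.F_iso2(1)[OF ki] N.J.Fc[OF kc(1)] by simp+
 then show "EX g k. arr_in L g X (pob P A) & N.M.iso2 k & cell_in W k (Ja R.N (q1 A)**@W Jla g) n" using g by blast
qed

end

section \<open>Existence of a strict extension\<close>

context collage
begin

theorem extension_ex:
 assumes ccK: "Cat_cc_category K" and ccL: "Cat_cc_category L"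
  and hasL: "!!T. monad_in L T ==> EX u a. universal L T u a"
 shows "EX F. pseudofunctor E*K L F & preserves_demi_EM_objects E*K L F & comp_pfun K L F (EM_dm_incl K) = P"
proof -
 interpret I: strict_fun "E*K" W kN.Fm kN.EFa kN.EFc by(rule I_strict)
 interpret Jl: strict_fun L W Jo Jla Jlc by(rule Jl)
 interpret ET: em_target K L by(intro em_target.intro EK.em_axioms L.two_category_axioms)
 \<comment> \<open>At identity monads the universal arrow is forced to be \<open>q1 A\<close>; with
   arbitrary choices the extension would in general not restrict to \<open>P\<close>
   exactly.\<close>
 define Q where "Q T p <-> uar (fst p) (snd p) (kN.Fm T) & (ALL A:objs K. T = id_monad K A --> p = (Ja R.N (q1 A), pob P A))" for T p
 have ex: "EX p. Q T p" if T: "T : objs E*K" for T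
 proof (cases "EX A:objs K. T = id_monad K A")
  case True
  then obtain A where A: "A : objs K" "T = id_monad K A" by blast
  show ?thesis unfolding Q_def
  proof (intro exI[of _ "(Ja R.N (q1 A), pob P A)"] conjI ballI impI)
  show "uar (fst (Ja R.N (q1 A), pob P A)) (snd (Ja R.N (q1 A), pob P A)) (kN.Fm T)" using uarr_id[OF ccL A(1)] A(2) by simp
  fix B assume "T = id_monad K B"
  then have "A = B" using arg_cong[of "id_monad K A" "id_monad K B" base] A(2) by(simp add: id_monad_def)
  then show "(Ja R.N (q1 A), pob P A) = (Ja R.N (q1 B), pob P B)" by simp
  qed
 next
  case False
  have T': "monad_in K T" using T by simp
  obtain u a where "universal L (pfun_monad L P T) u a" using hasL[OF P_monad[OF T']] by blast
  then obtain v where "uar v (src L u) (kN.Fm T)" using uarr_ex[OF ccL T'] by blast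
  then have p: "uar (fst (v, src L u)) (snd (v, src L u)) (kN.Fm T)" by simp
  show ?thesis unfolding Q_def by(rule exI[of _ "(v, src L u)"], rule conjI[OF p]) (use False in blast)
 qed
 define UC where "UC T = (SOME p. Q T p)" for T
 have UC: "Q T (UC T)" if "T : objs E*K" for T unfolding UC_def by(rule someI_ex[OF ex[OF that]])
 define U where "U T = fst (UC T)" for T
 define C where "C T = snd (UC T)" for T
 have ua: "uar (U T) (C T) (kN.Fm T)" if "T : objs E*K" for T using UC[OF that] by(simp add: U_def C_def Q_def)
 have id [simp]: "U (id_monad K A) = Ja R.N (q1 A)" "C (id_monad K A) = pob P A" if "A : objs K" for A
 proof -
  have "UC (id_monad K A) = (Ja R.N (q1 A), pob P A)" using UC[OF EK.J.Fo[OF that]] that unfolding Q_def by blast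
  then show "U (id_monad K A) = Ja R.N (q1 A)" "C (id_monad K A) = pob P A" by(simp_all add: U_def C_def)
 qed
 note uaD = ua[unfolded Jl.uarr_def, THEN conjunct2, THEN conjunct1] ua[unfolded Jl.uarr_def, THEN conjunct1]
 let ?good = "%n p. arr_in L (fst p) (C (src E*K n)) (C (trg E*K n)) &
  is_iso2 W (snd p) (U (trg E*K n)**@W Jla (fst p)) (kN.EFa n**@W U (src E*K n))"
 have kf: "?good (Ja K f) (par P f, Jc R.N (k0 f))" if f: "f : arrs K" for f
  using f k0_simps[OF f] N.J.Fc[OF k0_simps(2)[OF f]] N.J.F_iso2(1)[OF k0_simps(1)[OF f]] by(simp add: kN.EF_simps N.M.is_iso2_iff)
 \<comment> \<open>In the same way the square at an included 1-cell is forced to be filled by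
   \<open>P f\<close> and the coherence cell \<open>k0 f\<close>.\<close>
 define Q' where "Q' n p <-> ?good n p & (ALL f:arrs K. n = Ja K f --> p = (par P f, Jc R.N (k0 f)))" for n p
 have ex': "EX p. Q' n p" if n: "n : arrs E*K" for n
 proof (cases "EX f:arrs K. n = Ja K f")
  case True
  then obtain f where f: "f : arrs K" "n = Ja K f" by blast
  have "f' = f" if "n = Ja K f'" for f' using that f(2) by(simp add: Ja_def)
  then show ?thesis unfolding Q'_def using kf[OF f(1)] f(2) by(intro exI[of _ "(par P f, Jc R.N (k0 f))"]) blast
 next
  case False
  let ?S = "src E*K n" and ?T = "trg E*K n"
  have ST: "?S : objs E*K" "?T : objs E*K" using n EK.M.src_objs EK.M.trg_objs by blast+
  have "arr_in W (kN.EFa n**@W U ?S) (Jo (C ?S)) (kN.Fm ?T)" using uaD(1)[OF ST(1)] n by simp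
  then obtain g k where "arr_in L g (C ?S) (C ?T)" "N.M.iso2 k" "cell_in W k (U ?T**@W Jla g) (kN.EFa n**@W U ?S)" using ua[OF ST(2)] uaD(2)[OF ST(1)] unfolding Jl.uarr_def by blast
  then have p: "?good n (g, k)" by(simp add: N.M.is_iso2_iff)
  show ?thesis unfolding Q'_def by(rule exI[of _ "(g, k)"], rule conjI[OF p]) (use False in blast)
 qed
 define FK where "FK n = (SOME p. Q' n p)" for n
 have FK: "Q' n (FK n)" if "n : arrs E*K" for n unfolding FK_def by(rule someI_ex[OF ex'[OF that]])
 define f where "f n = fst (FK n)" for n
 define k where "k n = snd (FK n)" for n
 have fJ [simp]: "f (Ja K h) = par P h" "k (Ja K h) = Jc R.N (k0 h)" if "h : arrs K" for h
 proof -
  have "FK (Ja K h) = (par P h, Jc R.N (k0 h))" using FK[OF EK.J.Fa(1)[OF that]] that unfolding Q'_def by blast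
  then show "f (Ja K h) = par P h" "k (Ja K h) = Jc R.N (k0 h)" by(simp_all add: f_def k_def)
 qed
 interpret B: right_biadj L "E*K" W Jo Jla Jlc kN.Fm kN.EFa kN.EFc C U f k
 proof (intro right_biadj.intro Jl.strict_fun_axioms I.strict_fun_axioms right_biadj_axioms.intro)
  show "uar (U T) (C T) (kN.Fm T)" if "T : objs E*K" for T by(rule ua[OF that])
  show "arr_in L (f n) (C (src E*K n)) (C (trg E*K n))" "is_iso2 W (k n) (U (trg E*K n)**@W Jla (f n)) (kN.EFa n**@W U (src E*K n))"
  if "n : arrs E*K" for n using FK[OF that] unfolding f_def k_def Q'_def by blast+
 qed
 have F: "pseudofunctor E*K L B.F" by(rule B.F_pseudofunctor)
 interpret F: pseudofunctor "E*K" L B.F by(rule F)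
 have "preserves_demi_EM_objects E*K L B.F"
 proof (rule F.preserves_demi_EM_objectsI[OF K.EM_dm_Cat_cc ccL])
  fix S u a assume S: "monad_in E*K S" and u: "universal E*K S u a"
  \<comment> \<open>A universal algebra passes to \<open>EM_dm\<close> of the collage by its
    certificate, and from there to \<open>L\<close> by the right biadjoint.\<close>
  have ui: "universal W (I.Fm S) (kN.EFa u) (kN.EFc a)" by(rule kN.EM_image_universal[OF ccK u S])
  have "univ W (I.Fm S) (kN.EFa u) (kN.EFc a) (Jo X)" if "X : objs L" for X
  using ui Jl.Fo[OF that] unfolding universal_def by blast
  moreover have "alg E*K S (src E*K u) u a" using u by(simp add: universal_def)
  ultimately show "universal L (pfun_monad L B.F S) (par B.F u) (pce B.F a .: pcomp B.F (endo S) u)" using B.F_universal[OF S] by blast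
 qed
 moreover have "comp_pfun K L B.F (EM_dm_incl K) = P"
 proof -
  note R = ET.R_simps[OF F] and e = ET.RF_ext[where F = B.F]
  have o [simp]: "monad_in K (id_monad K A)" if "A : objs K" for A using EK.J.Fo[OF that] by simp
  have arr [simp]: "Ja K h : arrs E*K" "src E*K (Ja K h) = id_monad K (src K h)" "trg E*K (Ja K h) = id_monad K (trg K h)"
  if "h : arrs K" for h using that by simp+
  have 1: "pob (ET.RF B.F) A = pob P A" if "A : objs K" for A using that by(simp add: R B.F_simps)
  have 2: "par (ET.RF B.F) h = par P h" if "h : arrs K" for h using that by(simp add: R B.F_simps)
  have 3: "pce (ET.RF B.F) x = pce P x" if x: "x : cells K" for x
  proof -
  note [simp] = x
  have "B.Fc (Jc K x) = pce P x"
  proof (rule B.test_k[of "Ja K (ctrg K x)" _ "par P (csrc K x)"])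
  have "Jc R.N (k0 (ctrg K x)) .:@W(Ja R.N (q1 (trg K (csrc K x)))<|@W Jlc (pce P x)) = (kN.EFc (Jc K x)|>@W Ja R.N (q1 (src K (csrc K x)))) .:@W Jc R.N (k0 (csrc K x))"
  using arg_cong[OF k0_nat[OF x], of "Jc R.N"] lN.Fc[of "pce P x"] kN.Fc[of x] k0_simps[of "ctrg K x"] by(simp add: kN.EF_simps)
  then show "k (Ja K (ctrg K x)) .:@W(U (trg E*K (Ja K (ctrg K x)))<|@W Jlc (B.Fc (Jc K x))) =
  k (Ja K (ctrg K x)) .:@W(U (trg E*K (Ja K (ctrg K x)))<|@W Jlc (pce P x))"
  using B.Fc_k[of "Jc K x"] by simp
  qed (simp_all)
  then show ?thesis by(simp add: R B.F_simps)
  qed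
  have 4: "pcomp (ET.RF B.F) g h = pcomp P g h" if gh: "h : arrs K" "g : arrs K" "trg K h = src K g" for g h
  proof -
  note [simp] = gh
  have c: "Ja K (g**@K h) = Ja K g **@E*K Ja K h" by simp
  have "B.Fp (Ja K g) (Ja K h) = pcomp P g h"
  proof (rule B.test_k[of "Ja K (g**@K h)" _ "par P g**par P h"])
  have "Jc R.N (k0 (g**@K h)) .:@W(Ja R.N (q1 (trg K g))<|@W Jlc (pcomp P g h)) = (kN.EFa (Ja K g)<|@W Jc R.N (k0 h)) .:@W(Jc R.N (k0 g)|>@W Jla (par P h))"
  using arg_cong[OF k0_comp[OF gh], of "Jc R.N"] lN.Fc[of "pcomp P g h"] k0_simps[of "g**@K h"] k0_simps[of h] by(simp add: kN.EF_simps)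
  then show "k (Ja K (g**@K h)) .:@W(U (trg E*K (Ja K (g**@K h)))<|@W Jlc (B.Fp (Ja K g) (Ja K h))) =
  k (Ja K (g**@K h)) .:@W(U (trg E*K (Ja K (g**@K h)))<|@W Jlc (pcomp P g h))"
  using B.Fp_k[of "Ja K g" "Ja K h"] fJ[of "g**@K h"] by simp
  qed (use fJ[of "g**@K h"] in \<open>simp_all del: EK.J.F_cmp add: c[symmetric]\<close>)
  then show ?thesis by(simp add: R B.F_simps)
  qed
  have 5: "punit (ET.RF B.F) A = punit P A" if A: "A : objs K" for A
  proof -
  note [simp] = A
  have c: "one E*K (id_monad K A) = Ja K (one K A)" by simp
  have "B.Fu (id_monad K A) = punit P A"
  proof (rule B.test_k[of "Ja K (one K A)" _ "one L (pob P A)"])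
  have "Jc R.N (k0 (one K A)) .:@W(Ja R.N (q1 A)<|@W Jlc (punit P A)) = idc W (Ja R.N (q1 A))"
  using arg_cong[OF k0_unit[OF A], of "Jc R.N"] lN.Fc[of "punit P A"] k0_simps[of "one K A"] by simp
  then show "k (Ja K (one K A)) .:@W(U (trg E*K (Ja K (one K A)))<|@W Jlc (B.Fu (id_monad K A))) =
  k (Ja K (one K A)) .:@W(U (trg E*K (Ja K (one K A)))<|@W Jlc (punit P A))"
  using B.Fu_k[of "id_monad K A"] fJ[of "one K A"] by simp
  qed (use fJ[of "one K A"] in simp_all)
  then show ?thesis by(simp add: R B.F_simps)
  qed
  have "pcomp (ET.RF B.F) = pcomp P"
  proof (intro HOL.ext)
  fix g h show "pcomp (ET.RF B.F) g h = pcomp P g h"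
  using 4[of h g] e(5)[of g h] ext(5)[of g h] by(cases "composable K g h") (auto simp: composable_def)
  qed
  then show ?thesis
  using extensionalityI[OF e(1) ext(1) 1] extensionalityI[OF e(2) ext(2) 2] extensionalityI[OF e(3) ext(3) 3] extensionalityI[OF e(4) ext(4) 5]
  by(intro pfun.equality) simp_all
 qed
 ultimately show ?thesis using F by blast
qed

end

section \<open>Restriction is locally an equivalence\<close>

locale em_pair = em_target K L + F: pseudofunctor "E*K" L F + G: pseudofunctor "E*K" L G
 for K :: "('o, 'a, 'c) two_cat" and L :: "('p, 'b, 'd) two_cat" (structure) and F G +
 assumes gu: "monad_in K T ==> universal L (pfun_monad L G (strict_fun.Fm (id_monad K) (Ja K) (Jc K) T)) (par G (dmV K T))
  (pce G (dma K T) .:@L pcomp G (Ja K (endo T)) (dmV K T))"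
begin

abbreviation "cF == pcomp F"
abbreviation "pF == par F"
abbreviation "xF == pce F"
abbreviation "uF == punit F"
abbreviation "cG == pcomp G"
abbreviation "pG == par G"
abbreviation "xG == pce G"
abbreviation "uG == punit G"
abbreviation "J A == idm A"
abbreviation "gV T == pG (dV T)"
abbreviation "fV T == pF (dV T)"
abbreviation "gJ f == pG (Ja K f)"
abbreviation "fJ f == pF (Ja K f)"
abbreviation "aG T == xG (dma K T) .: cG (Ja K (endo T)) (dV T)"
abbreviation "aF T == xF (dma K T) .: cF (Ja K (endo T)) (dV T)"
abbreviation "PG T == pfun_monad L G (Jm T)"

lemma J_obj [simp]: "A : objs K ==> mon (J A)"
 using J.Fo by simp

lemma aG_univ:
 assumes T: "mon T"
 shows "monad_in L (PG T)" "alg L (PG T) (pob G T) (gV T) (aG T)" "X : objs L ==> univ L (PG T) (gV T) (aG T) X"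
 using gu[OF T] G.P_monad[OF J.F_monad[OF T]] T by(simp_all add: universal_def)

lemma gV_test:
 assumes T: "mon T" and x: "cell_in L x g g'" "cell_in L y g g'" "trg L g = pob G T" "gV T<|x = gV T<|y"
 shows "x = y"
proof -
 have g: "arr_in L g (src L g) (src L (gV T))" "src L g : objs L" using x(1,3) T L.cell_simps(1)[of x] by auto
 show ?thesis by(rule L.univ_faithful[OF aG_univ(1)[OF T] aG_univ(3)[OF T g(2)] g(1) x(1,2,4)])
qed

lemma gV_ex:
 assumes T: "mon T" and g: "arr_in L g X (pob G T)" "arr_in L g' X (pob G T)" and w: "cell_in L w (gV T**g) (gV T**g')"
  and e: "w .: (aG T|>g) = (aG T|>g').:(gJ (endo T)<|w)"
 shows "EX x. cell_in L x g g' & gV T<|x = w"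
proof -
 have X: "X : objs L" using g(1) by auto
 have "algm L (PG T) (gV T**g) (aG T|>g) (gV T**g') (aG T|>g') w" using w e by(simp add: algm_def)
 from L.univD(2)[OF aG_univ(3)[OF T X] _ _ this] g T have "EX! x. cell_in L x g g' & gV T<|x = w" by simp
 then show ?thesis by(rule ex1_implies_ex)
qed

text \<open>The action of \<open>G t\<close> on \<open>h_A (F V)\<close>: the structure cell of
  \<open>\<theta>\<close> moves \<open>G t\<close> across, and then the image under \<open>F\<close>
  of the action on \<open>V\<close> is applied. Only the restricted transformation enters.\<close>

definition th where "th \<theta> T = (nob \<theta> (base T)<|aF T).:(nar \<theta> (endo T)|>fV T)"

definition pn where "pn s <-> pseudonat M L s & nsrc s = F & ntrg s = G"

definition pr where "pr \<theta> <-> pseudonat K L \<theta> & nsrc \<theta> = RF F & ntrg \<theta> = RF G"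

lemmas FR = R_simps[OF F.pseudofunctor_axioms]
lemmas GR = R_simps[OF G.pseudofunctor_axioms]

lemma pr_simps:
 assumes "pr \<theta>"
 shows "A : objs K ==> nob \<theta> A : arrs L" "A : objs K ==> src L (nob \<theta> A) = pob F (J A)" "A : objs K ==> trg L (nob \<theta> A) = pob G (J A)"
  "f : arrs K ==> L.iso2 (nar \<theta> f)" "f : arrs K ==> nar \<theta> f : cells L"
  "f : arrs K ==> csrc L (nar \<theta> f) = gJ f**nob \<theta> (src K f)" "f : arrs K ==> ctrg L (nar \<theta> f) = nob \<theta> (trg K f)**fJ f"
  and pr_nat: "x : cells K ==> nar \<theta> (ctrg K x).:(xG (Jc K x)|>nob \<theta> (src K (csrc K x))) = (nob \<theta> (trg K (csrc K x))<|xF (Jc K x)) .: nar \<theta> (csrc K x)"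
  and pr_unit: "A : objs K ==> nar \<theta> (one K A).:(uG (J A)|>nob \<theta> A) = nob \<theta> A<|uF (J A)"
  and pr_comp: "f : arrs K ==> g : arrs K ==> trg K f = src K g ==> nar \<theta> (g**@K f).:(cG (Ja K g) (Ja K f)|>nob \<theta> (src K f)) =
  (nob \<theta> (trg K g)<|cF (Ja K g) (Ja K f)).:(nar \<theta> g|>fJ f).:(gJ g<|nar \<theta> f)"
proof -
 have e: "nsrc \<theta> = RF F" "ntrg \<theta> = RF G" using assms by(simp_all add: pr_def)
 interpret H: transformation K L \<theta> using assms by(intro HK.trans) (simp add: pr_def)
 show "A : objs K ==> nob \<theta> A : arrs L" "A : objs K ==> src L (nob \<theta> A) = pob F (J A)" "A : objs K ==> trg L (nob \<theta> A) = pob G (J A)"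
  "f : arrs K ==> L.iso2 (nar \<theta> f)" "f : arrs K ==> nar \<theta> f : cells L"
  "f : arrs K ==> csrc L (nar \<theta> f) = gJ f**nob \<theta> (src K f)" "f : arrs K ==> ctrg L (nar \<theta> f) = nob \<theta> (trg K f)**fJ f"
  "A : objs K ==> nar \<theta> (one K A).:(uG (J A)|>nob \<theta> A) = nob \<theta> A<|uF (J A)"
  using H.unit[of A] by(simp_all add: e FR GR)
 show "x : cells K ==> nar \<theta> (ctrg K x).:(xG (Jc K x)|>nob \<theta> (src K (csrc K x))) = (nob \<theta> (trg K (csrc K x))<|xF (Jc K x)) .: nar \<theta> (csrc K x)"
  using H.nat[of x] by(simp add: e FR GR)
 show "f : arrs K ==> g : arrs K ==> trg K f = src K g ==> nar \<theta> (g**@K f).:(cG (Ja K g) (Ja K f)|>nob \<theta> (src K f)) =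
  (nob \<theta> (trg K g)<|cF (Ja K g) (Ja K f)).:(nar \<theta> g|>fJ f).:(gJ g<|nar \<theta> f)"
  using H.comp[of f g] by(simp add: e FR GR)
qed

lemma pn_trans: "pn s ==> transformation M L s"
 by(intro HM.trans) (simp add: pn_def)

text \<open>Naturality at the action cell and the composition axiom show that the structure cell at
  \<open>V\<close> is linear, from \<open>G V s_T\<close> to the action \<open>th\<close>. As
  \<open>G V\<close> is universal, the restriction determines the component at \<open>T\<close> up
  to isomorphism.\<close>

lemma pn_alg:
 assumes s: "pn s" and T: "mon T"
 shows "nar s (dV T).:(aG T|>nob s T) = th (Rn s) T .: (gJ (endo T)<|nar s (dV T))"
proof -
 interpret S: transformation M L s by(rule pn_trans[OF s])
 have [simp]: "nsrc s = F" "ntrg s = G" using s by(simp_all add: pn_def)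
 note [simp] = T
 let ?t = "Ja K (endo T)" and ?V = "dV T"
 have 1: "nar s ?V .: (xG (dma K T)|>nob s T) = (nob s (J (base T))<|xF (dma K T)) .: nar s (cmp M ?t ?V)" using S.nat[of "dma K T"] by simp
 have 2: "nar s (cmp M ?t ?V).:(cG ?t ?V|>nob s T) =
  (nob s (J (base T))<|cF ?t ?V).:(nar s ?t|>pF ?V).:(pG ?t<|nar s ?V)"
  using S.comp[of ?V ?t] by simp
 show ?thesis by(simp add: th_def L.vx2[OF 1] 2)
qed

text \<open>The modification axiom at a single 1-cell \<open>n\<close>, isolated so that it can be
  propagated through composites and retracts.\<close>

definition ax where
 "ax s s' m n <-> (m (trg M n)|>pF n) .: nar s n = nar s' n .: (pG n<|m (src M n))"

section \<open>Propagation of the modification axiom\<close>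

context
 fixes s s' m
 assumes s: "pn s" and s': "pn s'" and m0: "!!T. monad_in K T ==> cell_in L (m T) (nob s T) (nob s' T)"
begin

interpretation S: transformation M L s by(rule pn_trans[OF s])
interpretation S': transformation M L s' by(rule pn_trans[OF s'])

lemma ss [simp]: "nsrc s = F" "ntrg s = G" "nsrc s' = F" "ntrg s' = G"
 using s s' by(simp_all add: pn_def)

lemma m_simps [simp]: "mon T ==> m T : cells L" "mon T ==> csrc L (m T) = nob s T" "mon T ==> ctrg L (m T) = nob s' T"
 using m0 by auto

lemma M_obj [simp]: "n : arrs M ==> mon (src M n)" "n : arrs M ==> mon (trg M n)"
 using M.src_objs[of n] M.trg_objs[of n] by simp+

text \<open>The composition axioms of both transformations peel off \<open>p\<close>, leaving the
  axiom at \<open>n\<close> whiskered by \<open>G p\<close>. For \<open>p = J f\<close> it is read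
  from right to left, and for \<open>p = V\<close>, where \<open>G V\<close> is faithful, from left
  to right.\<close>

lemma ax_comp_iff:
 assumes n: "n : arrs M" "p : arrs M" "trg M n = src M p" and p: "ax s s' m p"
 shows "ax s s' m (cmp M p n) <-> pG p<|((m (trg M n)|>pF n) .: nar s n) = pG p<|(nar s' n .: (pG n<|m (src M n)))"
proof -
 note [simp] = n
 let ?T = "src M n" and ?S = "src M p" and ?R = "trg M p"
 have sp [simp]: "mon ?S" by simp
 let ?x = "(nob s' ?R<|cF p n).:(nar s' p|>pF n)"
 have 1: "nar s (cmp M p n).:(cG p n|>nob s ?T) = (nob s ?R<|cF p n).:(nar s p|>pF n).:(pG p<|nar s n)"
  "nar s' (cmp M p n).:(cG p n|>nob s' ?T) = (nob s' ?R<|cF p n).:(nar s' p|>pF n).:(pG p<|nar s' n)"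
  using S.comp[of n p] S'.comp[of n p] by simp+
 have 2: "(m ?R|>pF (cmp M p n)).:(nob s ?R<|cF p n) = (nob s' ?R<|cF p n).:(m ?R|>pF p|>pF n)" using L.ich[of "cF p n" "m ?R"] by simp
 have 3: "(m ?R|>pF p|>pF n).:(nar s p|>pF n) = (nar s' p|>pF n).:(pG p<|(m ?S|>pF n))" using L.rcong[OF p[unfolded ax_def], of "pF n"] by simp
 have 4: "(pG (cmp M p n)<|m ?T).:(cG p n|>nob s ?T) = (cG p n|>nob s' ?T).:(pG p<|pG n<|m ?T)" using L.ich[of "m ?T" "cG p n"] by simp
 have st: "src M (cmp M p n) = ?T" "trg M (cmp M p n) = ?R" by simp+
 have "ax s s' m (cmp M p n) <-> ((m ?R|>pF (cmp M p n)) .: nar s (cmp M p n)).:(cG p n|>nob s ?T) =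
  (nar s' (cmp M p n).:(pG (cmp M p n)<|m ?T)).:(cG p n|>nob s ?T)"
  unfolding ax_def st by(subst L.iso2_cancel_iff(1)) (simp_all)
 also have "... <-> ?x .: (pG p<|((m ?S|>pF n) .: nar s n)) = ?x .: (pG p<|(nar s' n .: (pG n<|m ?T)))" by(simp add: 1(1) L.vx2[OF 2] L.vx2[OF 3] 4 L.vx2[OF 1(2)])
 also have "... <-> pG p<|((m ?S|>pF n) .: nar s n) = pG p<|(nar s' n .: (pG n<|m ?T))" by(rule L.iso2_cancel_iff(2)) simp_all
 finally show ?thesis by simp
qed

text \<open>Naturality in \<open>r\<close> and \<open>q\<close> conjugates the axiom at
  \<open>p\<close> into the axiom at \<open>n\<close>, because \<open>q\<close> after
  \<open>r\<close> is the identity.\<close>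

lemma ax_retract:
 assumes r: "cell_in M r n p" "cell_in M q p n" "vc M q r = idc M n" and p: "ax s s' m p"
 shows "ax s s' m n"
proof -
 have c [simp]: "r : cells M" "csrc M r = n" "ctrg M r = p" "q : cells M" "csrc M q = p" "ctrg M q = n" using r by auto
 have a [simp]: "n : arrs M" "p : arrs M" "src M p = src M n" "trg M p = trg M n" using M.cell_simps(1-4)[of r] by simp+
 let ?T = "src M n" and ?S = "trg M n"
 have e: "xF q .: xF r = idc L (pF n)" "xG q .: xG r = idc L (pG n)" using arg_cong[OF r(3), of "xF"] arg_cong[OF r(3), of "xG"] by simp+
 have 1: "nar s p .: (xG r|>nob s ?T) = (nob s ?S<|xF r) .: nar s n" "nar s' n .: (xG q|>nob s' ?T) = (nob s' ?S<|xF q) .: nar s' p" using S.nat[of r] S'.nat[of q] by simp+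
 have 2: "(pG n<|m ?T).:(xG q|>nob s ?T) = (xG q|>nob s' ?T).:(pG p<|m ?T)" using L.ich[of "m ?T" "xG q"] by simp
 have 3: "(nob s' ?S<|xF q).:(m ?S|>pF p) = (m ?S|>pF n).:(nob s ?S<|xF q)" using L.ich[of "xF q" "m ?S"] by simp
 have p': "(m ?S|>pF p) .: nar s p = nar s' p .: (pG p<|m ?T)" using p by(simp add: ax_def)
 have "nar s' n .: (pG n<|m ?T) = nar s' n .: (pG n<|m ?T).:(xG q|>nob s ?T).:(xG r|>nob s ?T)" using L.rcong[OF e(2), of "nob s ?T"] by simp
 also have "... = (m ?S|>pF n).:(nob s ?S<|xF q).:(nob s ?S<|xF r) .: nar s n" by(simp add: L.vx2[OF 2] L.vx2[OF 1(2)] L.vx2[OF p'[symmetric]] 1(1) L.vx2[OF 3])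
 also have "... = (m ?S|>pF n) .: nar s n"
 proof -
  have "(nob s ?S<|xF q).:(nob s ?S<|xF r) = idc L (nob s ?S**pF n)" using L.lcong[OF e(1), of "nob s ?S"] by simp
  from L.vx2[OF this, of "nar s n"] show ?thesis by simp
 qed
 finally show ?thesis by(simp add: ax_def)
qed

text \<open>For a 1-cell \<open>n\<close> into \<open>S\<close> the composite \<open>V n\<close> is
  a retract of some \<open>f V\<close>, so the axiom holds at \<open>V n\<close>; faithfulness of
  \<open>G V\<close> then removes \<open>V\<close>.\<close>

lemma ax_all:
 assumes J: "!!f. f : arrs K ==> ax s s' m (Ja K f)" and V: "!!T. mon T ==> ax s s' m (dV T)" and n: "n : arrs M"
 shows "ax s s' m n"
proof -
 have 1: "ax s s' m p" if p: "arr_in M p T (J B)" "mon T" for p T B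
 proof -
  note r = retract[OF p(1)]
  have f: "dmf p : arrs K" "src K (dmf p) = base T" using r(1) by auto
  note [simp] = f p(2)
  have "ax s s' m (cmp M (Ja K (dmf p)) (dV T))" by(subst ax_comp_iff[OF _ _ _ J[OF f(1)]]) (simp_all only: V[OF p(2), unfolded ax_def], simp_all)
  then show ?thesis by(rule ax_retract[OF r(2-4)])
 qed
 note [simp] = n
 let ?S = "trg M n"
 have S: "mon ?S" by simp
 note [simp] = S
 have "ax s s' m (cmp M (dV ?S) n)" by(rule 1[of _ "src M n" "base ?S"]) simp_all
 then have e: "gV ?S<|((m ?S|>pF n) .: nar s n) = gV ?S<|(nar s' n .: (pG n<|m (src M n)))" using ax_comp_iff[of n "dV ?S"] V[OF S] by simp
 show ?thesis unfolding ax_def by(rule gV_test[OF S _ _ _ e, of "pG n**nob s (src M n)" "nob s' ?S**pF n"]) simp_all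
qed

end

text \<open>At \<open>V\<close> the modification axiom forces \<open>G V\<close> whiskered with
  \<open>m T\<close> to be the conjugate of \<open>d\<close> by the structure cells at
  \<open>V\<close>. This conjugate is linear by \<open>pn_alg\<close>, so it lifts uniquely through
  the universal \<open>G V\<close>.\<close>

theorem restriction_ff:
 assumes s: "pn s" and s': "pn s'" and d: "modification K L d" "msrc d = Rn s" "mtrg d = Rn s'"
 shows "EX! m. modification M L m & msrc m = s & mtrg m = s' & Rm m = d"
proof -
 interpret S: transformation M L s by(rule pn_trans[OF s])
 interpret S': transformation M L s' by(rule pn_trans[OF s'])
 have [simp]: "nsrc s = F" "ntrg s = G" "nsrc s' = F" "ntrg s' = G" using s s' unfolding pn_def by blast+
 have dA [simp]: "mob d A : cells L" "csrc L (mob d A) = nob s (J A)" "ctrg L (mob d A) = nob s' (J A)" if "A : objs K" for A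
  using HK.modD(6-8)[OF d(1) that] that by(simp_all add: d)
 have dJ: "(mob d (trg K f)|>fJ f) .: nar s (Ja K f) = nar s' (Ja K f).:(gJ f<|mob d (src K f))" if "f : arrs K" for f
  using HK.modD(9)[OF d(1) that] that by(simp add: d FR GR)
 let ?w = "%T. L.inv2 (nar s' (dV T)).:(mob d (base T)|>fV T) .: nar s (dV T)"
 have ex: "EX x. cell_in L x (nob s T) (nob s' T) & gV T<|x = ?w T" if T: "mon T" for T
 proof (rule gV_ex[OF T])
  note [simp] = T
  let ?t = "Ja K (endo T)" and ?A = "J (base T)"
  show "arr_in L (nob s T) (pob F T) (pob G T)" "arr_in L (nob s' T) (pob F T) (pob G T)" "cell_in L (?w T) (gV T**nob s T) (gV T**nob s' T)" by simp+
  have 1: "(mob d (base T)|>fV T).:(nob s ?A<|aF T) = (nob s' ?A<|aF T).:(mob d (base T)|>pF ?t|>fV T)" using L.ich[of "aF T" "mob d (base T)"] by simp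
  have 2: "(mob d (base T)|>pF ?t|>fV T).:(nar s ?t|>fV T) = (nar s' ?t|>fV T).:(pG ?t<|(mob d (base T)|>fV T))" using L.rcong[OF dJ[of "endo T"], of "fV T"] by simp
  have 3: "(mob d (base T)|>fV T) .: th (Rn s) T = th (Rn s') T .: (pG ?t<|(mob d (base T)|>fV T))"
  proof -
  have "(mob d (base T)|>fV T) .: th (Rn s) T = ((mob d (base T)|>fV T).:(nob s ?A<|aF T)).:(nar s ?t|>fV T)" by(simp add: th_def)
  also have "... = (nob s' ?A<|aF T).:(mob d (base T)|>pF ?t|>fV T).:(nar s ?t|>fV T)" unfolding 1 by simp
  finally show ?thesis unfolding 2 by(simp add: th_def)
  qed
  have t: "th (Rn s) T : cells L" "csrc L (th (Rn s) T) = pG ?t**nob s ?A**fV T" "ctrg L (th (Rn s) T) = nob s ?A**fV T"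
  "th (Rn s') T : cells L" "csrc L (th (Rn s') T) = pG ?t**nob s' ?A**fV T" "ctrg L (th (Rn s') T) = nob s' ?A**fV T" by(simp_all add: th_def)
  note 4 = pn_alg[OF s T] pn_alg[OF s' T]
  have a: "aG T : cells L" "csrc L (aG T) = pG ?t**gV T" "ctrg L (aG T) = gV T" by simp+
  have 5: "L.inv2 (nar s' (dV T)) .: th (Rn s') T = (aG T|>nob s' T).:(pG ?t<|L.inv2 (nar s' (dV T)))"
  using L.inv2_swap[of "pG ?t<|nar s' (dV T)" "nar s' (dV T)" "th (Rn s') T" "aG T|>nob s' T"] 4(2)[symmetric] t a by simp
  have "?w T .: (aG T|>nob s T) = L.inv2 (nar s' (dV T)).:((mob d (base T)|>fV T) .: th (Rn s) T).:(pG ?t<|nar s (dV T))" using t a by(simp add: 4(1) del: L.whisk_vc)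
  also have "... = (L.inv2 (nar s' (dV T)) .: th (Rn s') T).:(pG ?t<|(mob d (base T)|>fV T)).:(pG ?t<|nar s (dV T))" unfolding 3 using t by simp
  also have "... = (aG T|>nob s' T).:(pG ?t<|?w T)" unfolding 5 by simp
  finally show "?w T .: (aG T|>nob s T) = (aG T|>nob s' T).:(pG ?t<|?w T)" .
 qed
 define m where "m T = (SOME x. cell_in L x (nob s T) (nob s' T) & gV T<|x = ?w T)" for T
 have m: "cell_in L (m T) (nob s T) (nob s' T)" "gV T<|m T = ?w T" if "mon T" for T
  using someI_ex[OF ex[OF that]] unfolding m_def by blast+
 note ms [simp] = m_simps[OF s s' m(1)]
 \<comment> \<open>The first disjunct implies the second; it is listed so that the axiom at
   \<open>V\<close> follows directly from \<open>mJ\<close>.\<close>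
 have axV: "ax s s' m (dV T) <-> m (J (base T)) = mob d (base T) \<or> (m (J (base T))|>fV T) = (mob d (base T)|>fV T)" if T: "mon T" for T
 proof -
  note [simp] = T
  have "nar s' (dV T).:(gV T<|m T) = (mob d (base T)|>fV T) .: nar s (dV T)" using m(2)[OF T] by simp
  then have "ax s s' m (dV T) <-> (m (J (base T))|>fV T) .: nar s (dV T) = (mob d (base T)|>fV T) .: nar s (dV T)" by(simp add: ax_def)
  also have "... <-> (m (J (base T))|>fV T) = (mob d (base T)|>fV T)" by(rule L.iso2_cancel_iff(1)) simp_all
  finally show ?thesis by auto
 qed
 have VJ: "dV (J A) = Ja K (one K A)" "base (J A) = A" if "A : objs K" for A using that by(simp_all add: dmV_def Ja_def id_monad_def)
 \<comment> \<open>At an identity monad \<open>V\<close> is the included identity, so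
   \<open>m\<close> and \<open>d\<close> agree after whiskering with \<open>G V\<close> by the axiom
   of \<open>d\<close> itself.\<close>
 have mJ [simp]: "m (J A) = mob d A" if A: "A : objs K" for A
 proof (rule gV_test[of "J A" _ "nob s (J A)" "nob s' (J A)"])
  note [simp] = A
  have "nar s' (Ja K (one K A)).:(gJ (one K A)<|m (J A)) = nar s' (Ja K (one K A)).:(gJ (one K A)<|mob d A)"
  using m(2)[of "J A"] dJ[of "one K A"] J.Fa[of "one K A"] by(simp add: VJ del: J.F_one)
  then show "gV (J A)<|m (J A) = gV (J A)<|mob d A" unfolding VJ[OF A]
  using J.Fa[of "one K A"] by(subst (asm) L.iso2_cancel_iff(2)) (simp_all del: J.F_one)
 qed (use A in simp_all)
 have ax: "ax s s' m n" if "n : arrs M" for n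
 proof (rule ax_all[OF s s' m(1) _ _ that])
  show "ax s s' m (Ja K f)" if "f : arrs K" for f using dJ[OF that] that by(simp add: ax_def)
  show "ax s s' m (dV T)" if "mon T" for T using axV[OF that] that by simp
 qed
 let ?m = "(|msrc = s, mtrg = s', mob = restrict m (objs M)|)"
 have mod: "modification M L ?m" using s s' m(1) ax M.src_objs M.trg_objs unfolding modification_iff pn_def ax_def by simp
 have R: "Rm ?m = d" by(rule modn_eqI[of _ _ K]) (simp_all add: d HK.modD(5)[OF d(1)])
 show ?thesis
 proof (rule ex1I[of _ ?m])
  show "modification M L ?m & msrc ?m = s & mtrg ?m = s' & Rm ?m = d" using mod R by simp
  fix n assume n: "modification M L n & msrc n = s & mtrg n = s' & Rm n = d"
  then have nm: "modification M L n" by simp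
  have "mob n T = m T" if T: "mon T" for T
  proof (rule gV_test[OF T, of _ "nob s T" "nob s' T"])
  note [simp] = T
  have b: "mob n (J (base T)) = mob d (base T)" using n Rm_simps(3)[of "base T" n] by simp
  have nT: "cell_in L (mob n T) (nob s T) (nob s' T)" using HM.modD(6-8)[OF nm, of T] n by simp
  then show "cell_in L (mob n T) (nob s T) (nob s' T)" .
  have "nar s' (dV T).:(gV T<|mob n T) = (mob d (base T)|>fV T) .: nar s (dV T)" using HM.modD(9)[OF nm, of "dV T"] n b by simp
  from arg_cong[OF this, of "%z. L.inv2 (nar s' (dV T)) .: z"] show "gV T<|mob n T = gV T<|m T" using m(2)[OF T] nT by simp
  qed (use T in simp_all)
  then show "n = ?m" using n HM.modD(5)[OF nm] by(intro modn_eqI[of _ _ M]) simp_all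
 qed
qed

end

text \<open>The seed of an extension of \<open>h\<close>: \<open>u T\<close> is the component at
  \<open>T\<close> and \<open>q T\<close> its structure cell at \<open>V\<close>, which is linear
  into \<open>th\<close>. The structure cells at all other 1-cells are derived from these, for
  \<open>f V\<close> in \<open>K0\<close>, for 1-cells into identity monads in \<open>kn\<close>,
  and in general in \<open>sm\<close>.\<close>

locale em_ext = em_pair +
 fixes h and u :: "('a, 'b, 'c) mnd => 'e" and q :: "('a, 'b, 'c) mnd => 'f"
 assumes h: "pr h"
  and u: "monad_in K T ==> arr_in L (u T) (pob F T) (pob G T)"
  and q: "monad_in K T ==> is_iso2 L (q T) (gV T**@L u T) (nob h (base T)**@L fV T)"
  and q_alg: "monad_in K T ==> q T .:@L(aG T|>@L u T) = th h T .:@L(gJ (endo T)<|@L q T)"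
begin

lemma u_simps [simp]:
 "mon T ==> u T : arrs L" "mon T ==> src L (u T) = pob F T" "mon T ==> trg L (u T) = pob G T"
 "mon T ==> L.iso2 (q T)" "mon T ==> q T : cells L" "mon T ==> csrc L (q T) = gV T**u T"
 "mon T ==> ctrg L (q T) = nob h (base T)**fV T"
 using u[of T] q[of T] by(auto simp: L.is_iso2_iff)

lemmas h_simps [simp] = pr_simps[OF h]

abbreviation "Jf f T == cmp M (Ja K f) (dV T)"

text \<open>The structure cell at \<open>J f V\<close> that the composition axiom dictates:
  coherence of \<open>G\<close>, then \<open>q\<close> at \<open>V\<close>, then \<open>h\<close> at
  \<open>f\<close>, then coherence of \<open>F\<close>.\<close>

definition "K0 f T = (nob h (trg K f)<|cF (Ja K f) (dV T)).:(nar h f|>fV T).:(gJ f<|q T).:(L.inv2 (cG (Ja K f) (dV T))|>u T)"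

lemma K0_simps [simp]:
 assumes "mon T" "f : arrs K" "src K f = base T"
 shows "L.iso2 (K0 f T)" "K0 f T : cells L" "csrc L (K0 f T) = pG (Jf f T)**u T" "ctrg L (K0 f T) = nob h (trg K f)**pF (Jf f T)"
 using assms by(simp_all add: K0_def)

lemma K0_eq:
 assumes "mon T" "f : arrs K" "src K f = base T"
 shows "K0 f T .: (cG (Ja K f) (dV T)|>u T) = (nob h (trg K f)<|cF (Ja K f) (dV T)).:(nar h f|>fV T).:(gJ f<|q T)"
 using assms by(simp add: K0_def)

text \<open>The composition axiom for \<open>J g\<close> after \<open>J f V\<close>; it reduces to
  the composition axiom of \<open>h\<close> and to associativity coherence of \<open>F\<close> and
  \<open>G\<close>.\<close>

lemma K0_compat:
 assumes T: "mon T" and fg: "f : arrs K" "src K f = base T" "g : arrs K" "trg K f = src K g"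
 shows "K0 (g**@K f) T .: (cG (Ja K g) (Jf f T)|>u T) =
  (nob h (trg K g)<|cF (Ja K g) (Jf f T)).:(nar h g|>pF (Jf f T)).:(gJ g<|K0 f T)"
proof -
 note [simp] = T fg
 let ?V = "dV T" and ?f = "Ja K f" and ?g = "Ja K g" and ?C = "nob h (trg K g)"
 have gf [simp]: "Ja K (g**@K f) = cmp M ?g ?f" by simp
 have aG: "cG ?g (Jf f T).:(gJ g<|cG ?f ?V) = cG (cmp M ?g ?f) ?V .: (cG ?g ?f|>gV T)" using G.pc_assoc[of ?V ?f ?g] by simp
 have aF: "cF (cmp M ?g ?f) ?V .: (cF ?g ?f|>fV T) = cF ?g (Jf f T).:(fJ g<|cF ?f ?V)" using F.pc_assoc[of ?V ?f ?g] by simp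
 have 1: "K0 (g**@K f) T .: (cG (cmp M ?g ?f) ?V|>u T) = (?C<|cF (cmp M ?g ?f) ?V).:(nar h (g**@K f)|>fV T).:(pG (cmp M ?g ?f)<|q T)" using K0_eq[OF T, of "g**@K f"] by simp
 have 2: "(pG (cmp M ?g ?f)<|q T).:(cG ?g ?f|>gV T|>u T) = (cG ?g ?f|>nob h (base T)|>fV T).:(gJ g<|gJ f<|q T)" using L.ich[of "q T" "cG ?g ?f"] by simp
 have 3: "(nar h (g**@K f)|>fV T).:(cG ?g ?f|>nob h (base T)|>fV T) = (?C<|(cF ?g ?f|>fV T)).:(nar h g|>fJ f|>fV T).:(gJ g<|(nar h f|>fV T))"
  using L.rcong[OF pr_comp[OF h, of f g], of "fV T"] by simp
 have 4: "(?C<|cF (cmp M ?g ?f) ?V).:(?C<|(cF ?g ?f|>fV T)) = (?C<|cF ?g (Jf f T)).:(?C<|fJ g<|cF ?f ?V)" using L.lcong[OF aF, of ?C] by simp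
 have 5: "(nar h g|>pF (Jf f T)).:(gJ g<|nob h (src K g)<|cF ?f ?V) = (?C<|fJ g<|cF ?f ?V).:(nar h g|>fJ f|>fV T)" using L.ich[of "cF ?f ?V" "nar h g"] by simp
 have 7: "(gJ g<|K0 f T).:(gJ g<|(cG ?f ?V|>u T)) = (gJ g<|nob h (src K g)<|cF ?f ?V).:(gJ g<|(nar h f|>fV T)).:(gJ g<|gJ f<|q T)" using L.lcong[OF K0_eq[OF T fg(1,2)], of "gJ g"] by simp
 have 8: "(cG ?g (Jf f T)|>u T).:(gJ g<|(cG ?f ?V|>u T)) = (cG (cmp M ?g ?f) ?V|>u T).:(cG ?g ?f|>gV T|>u T)" using L.rcong[OF aG, of "u T"] by simp
 have k: "K0 (g**@K f) T : cells L" "csrc L (K0 (g**@K f) T) = pG (cmp M ?g (Jf f T))**u T" "ctrg L (K0 (g**@K f) T) = ?C**pF (cmp M ?g (Jf f T))"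
  using K0_simps[OF T, of "g**@K f"] by simp+
 show ?thesis
 proof (rule L.iso2_cancel_right[of "gJ g<|(cG ?f ?V|>u T)"])
  show "(K0 (g**@K f) T .: (cG ?g (Jf f T)|>u T)).:(gJ g<|(cG ?f ?V|>u T)) =
  ((?C<|cF ?g (Jf f T)).:(nar h g|>pF (Jf f T)).:(gJ g<|K0 f T)).:(gJ g<|(cG ?f ?V|>u T))"
  using k by(simp add: 7 8 L.vx2[OF 1] 2 L.vx2[OF 3] L.vx2[OF 4] L.vx2[OF 5])
 qed (use k in simp_all)
qed

text \<open>By \<open>JV_cell\<close> a 2-cell from \<open>f V\<close> to \<open>g V\<close> is an
  included cell followed by the action. Naturality for the former is that of \<open>h\<close>, for
  the latter it is the linearity \<open>q_alg\<close>.\<close>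

lemma K0_nat:
 assumes T: "mon T" and f: "f : arrs K" "src K f = base T" and g: "arr g (base T) (trg K f)" and x: "cell_in M x (Jf f T) (Jf g T)"
 shows "K0 g T .: (xG x|>u T) = (nob h (trg K f)<|xF x) .: K0 f T"
proof -
 obtain r where r: "cell r f (g**@K endo T)" and xr: "x = vc M (Ja K g<|@M dma K T) (Jc K r|>@M dV T)" using JV_cell[OF T f g x] by blast
 note [simp] = T f g[simplified] r[simplified]
 let ?V = "dV T" and ?t = "endo T" and ?B = "nob h (trg K f)" and ?d = "dma K T"
 let ?g = "Ja K g" and ?f = "Ja K f"
 let ?gt = "g**@K ?t"
 have y: "K0 ?gt T .: (xG (Jc K r|>@M ?V)|>u T) = (?B<|xF (Jc K r|>@M ?V)) .: K0 f T"
 proof -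
  have k: "L.iso2 (K0 ?gt T)" "K0 ?gt T : cells L" "csrc L (K0 ?gt T) = pG (Jf ?gt T)**u T" "ctrg L (K0 ?gt T) = ?B**pF (Jf ?gt T)" using K0_simps[OF T, of ?gt] by simp+
  have 1: "(xG (Jc K r|>@M ?V)|>u T).:(cG ?f ?V|>u T) = (cG (Ja K ?gt) ?V|>u T).:(xG (Jc K r)|>gV T|>u T)" using L.rcong[OF G.pc_rw[of "Jc K r" ?V], of "u T"] by simp
  have 2: "K0 ?gt T .: (cG (Ja K ?gt) ?V|>u T) = (?B<|cF (Ja K ?gt) ?V).:(nar h ?gt|>fV T).:(gJ ?gt<|q T)" using K0_eq[OF T, of ?gt] by simp
  have 3: "(gJ ?gt<|q T).:(xG (Jc K r)|>gV T|>u T) = (xG (Jc K r)|>nob h (base T)|>fV T).:(gJ f<|q T)" using L.ich[of "q T" "xG (Jc K r)"] by simp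
  have 4: "(nar h ?gt|>fV T).:(xG (Jc K r)|>nob h (base T)|>fV T) = (?B<|(xF (Jc K r)|>fV T)).:(nar h f|>fV T)" using L.rcong[OF pr_nat[OF h, of r], of "fV T"] by simp
  have 5: "(?B<|xF (Jc K r|>@M ?V)).:(?B<|cF ?f ?V) = (?B<|cF (Ja K ?gt) ?V).:(?B<|(xF (Jc K r)|>fV T))" using L.lcong[OF F.pc_rw[of "Jc K r" ?V], of ?B] by simp
  show ?thesis
  proof (rule L.iso2_cancel_right[of "cG ?f ?V|>u T"])
  show "(K0 ?gt T .: (xG (Jc K r|>@M ?V)|>u T)).:(cG ?f ?V|>u T) = ((?B<|xF (Jc K r|>@M ?V)) .: K0 f T).:(cG ?f ?V|>u T)"
  using k 2 3 4 5 L.vx2[OF 2] L.vx2[OF 4] L.vx2[OF 5] by(simp add: 1 K0_eq)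
  qed (use k in simp_all)
 qed
 have z: "K0 g T .: (xG (?g<|@M ?d)|>u T) = (?B<|xF (?g<|@M ?d)) .: K0 ?gt T"
 proof -
  have k: "K0 ?gt T : cells L" "csrc L (K0 ?gt T) = pG (cmp M ?g (Jf ?t T))**u T" "ctrg L (K0 ?gt T) = ?B**pF (cmp M ?g (Jf ?t T))" using K0_simps[OF T, of ?gt] by simp+
  have a: "q T .: (xG ?d|>u T) = (nob h (base T)<|xF ?d) .: K0 ?t T"
  proof (rule L.iso2_cancel_right[of "cG (Ja K ?t) ?V|>u T"])
  show "(q T .: (xG ?d|>u T)).:(cG (Ja K ?t) ?V|>u T) = ((nob h (base T)<|xF ?d) .: K0 ?t T).:(cG (Ja K ?t) ?V|>u T)" using q_alg[OF T] by(simp add: K0_eq th_def)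
  qed simp_all
  have 1: "(xG (?g<|@M ?d)|>u T).:(cG ?g (Jf ?t T)|>u T) = (cG ?g ?V|>u T).:(gJ g<|(xG ?d|>u T))" using L.rcong[OF G.pc_lw[of ?d ?g], of "u T"] by simp
  have 2: "(gJ g<|q T).:(gJ g<|(xG ?d|>u T)) = (gJ g<|nob h (base T)<|xF ?d).:(gJ g<|K0 ?t T)" using L.lcong[OF a, of "gJ g"] by simp
  have 3: "(nar h g|>fV T).:(gJ g<|nob h (base T)<|xF ?d) = (?B<|fJ g<|xF ?d).:(nar h g|>pF (Jf ?t T))" using L.ich[of "xF ?d" "nar h g"] by simp
  have 4: "(?B<|xF (?g<|@M ?d)).:(?B<|cF ?g (Jf ?t T)) = (?B<|cF ?g ?V).:(?B<|fJ g<|xF ?d)" using L.lcong[OF F.pc_lw[of ?d ?g], of ?B] by simp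
  have 5: "K0 ?gt T .: (cG ?g (Jf ?t T)|>u T) = (?B<|cF ?g (Jf ?t T)).:(nar h g|>pF (Jf ?t T)).:(gJ g<|K0 ?t T)" using K0_compat[OF T, of ?t g] by simp
  have 6: "K0 g T .: (cG ?g ?V|>u T) = (?B<|cF ?g ?V).:(nar h g|>fV T).:(gJ g<|q T)" using K0_eq[OF T, of g] by simp
  show ?thesis
  proof (rule L.iso2_cancel_right[of "cG ?g (Jf ?t T)|>u T"])
  show "(K0 g T .: (xG (?g<|@M ?d)|>u T)).:(cG ?g (Jf ?t T)|>u T) = ((?B<|xF (?g<|@M ?d)) .: K0 ?gt T).:(cG ?g (Jf ?t T)|>u T)"
  using k by(simp add: 1 L.vx2[OF 6] 2 L.vx2[OF 3] 5 L.vx2[OF 4])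
  qed (use k in simp_all)
 qed
 have k: "K0 ?gt T : cells L" "csrc L (K0 ?gt T) = pG (cmp M ?g (Jf ?t T))**u T" "ctrg L (K0 ?gt T) = ?B**pF (cmp M ?g (Jf ?t T))" using K0_simps[OF T, of ?gt] by simp+
 show ?thesis using k y by(simp add: xr L.vx2[OF z])
qed

text \<open>The structure cell at a 1-cell into an identity monad, transported from
  \<open>f V\<close> along the retraction; naturality leaves no other choice.\<close>

definition "kn n = (nob h (base (trg M n))<|xF (ret_out n)) .: K0 (dmf n) (src M n).:(xG (ret_in n)|>u (src M n))"

lemma ret_simps:
 assumes n: "arr_in M n T (J B)" and T: "mon T"
 shows "n : arrs M" "src M n = T" "trg M n = J B" "dmf n : arrs K" "src K (dmf n) = base T" "trg K (dmf n) = B"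
  "ret_in n : cells M" "csrc M (ret_in n) = n" "ctrg M (ret_in n) = Jf (dmf n) T" "ret_out n : cells M" "csrc M (ret_out n) = Jf (dmf n) T" "ctrg M (ret_out n) = n"
  "vc M (ret_out n) (ret_in n) = idc M n" "base (J B) = B" "B : objs K"
proof -
 note r = retract[OF n]
 show "n : arrs M" "src M n = T" "trg M n = J B" "dmf n : arrs K" "src K (dmf n) = base T" "trg K (dmf n) = B"
  "ret_in n : cells M" "csrc M (ret_in n) = n" "ctrg M (ret_in n) = Jf (dmf n) T" "ret_out n : cells M" "csrc M (ret_out n) = Jf (dmf n) T" "ctrg M (ret_out n) = n"
  "vc M (ret_out n) (ret_in n) = idc M n" using n r by auto
 then show "B : objs K" using trg_objs[of "dmf n"] by simp
 show "base (J B) = B" by(simp add: id_monad_def)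
qed

lemma ret_FG:
 assumes n: "arr_in M n T (J B)" and T: "mon T"
 shows "xF (ret_out n) .: xF (ret_in n) = idc L (pF n)" "xG (ret_out n) .: xG (ret_in n) = idc L (pG n)"
proof -
 note [simp] = ret_simps[OF assms]
 show "xF (ret_out n) .: xF (ret_in n) = idc L (pF n)" "xG (ret_out n) .: xG (ret_in n) = idc L (pG n)"
  using F.P_simps(9)[of "ret_in n" "ret_out n"] G.P_simps(9)[of "ret_in n" "ret_out n"] by simp+
qed

text \<open>The idempotent \<open>ret_in\<close> after \<open>ret_out\<close> commutes with
  \<open>K0\<close> by \<open>K0_nat\<close>, so the inverse of \<open>K0\<close>, transported along
  the same retraction, is an inverse of \<open>kn n\<close>.\<close>

lemma kn_simps:
 assumes n: "arr_in M n T (J B)" and T: "mon T"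
 shows "L.iso2 (kn n)" "kn n : cells L" "csrc L (kn n) = pG n**u T" "ctrg L (kn n) = nob h B**pF n"
proof -
 note [simp] = T ret_simps[OF n T]
 let ?i = "ret_in n" and ?o = "ret_out n" and ?f = "dmf n" and ?B = "nob h B" and ?K = "K0 (dmf n) T"
 show c: "kn n : cells L" "csrc L (kn n) = pG n**u T" "ctrg L (kn n) = ?B**pF n" by(simp_all add: kn_def)
 have e: "(?B<|xF ?o).:(?B<|xF ?i) = idc L (?B**pF n)" "(xG ?o|>u T).:(xG ?i|>u T) = idc L (pG n**u T)"
  using L.lcong[OF ret_FG(1)[OF n T], of ?B] L.rcong[OF ret_FG(2)[OF n T], of "u T"] by simp+
 have N: "?K .: (xG ?i|>u T).:(xG ?o|>u T) = (?B<|xF ?i).:(?B<|xF ?o) .: ?K" using K0_nat[OF T, of ?f ?f "vc M ?i ?o"] by simp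
 have N': "(xG ?i|>u T).:(xG ?o|>u T) .: L.inv2 ?K = L.inv2 ?K .: (?B<|xF ?i).:(?B<|xF ?o)" using arg_cong[OF N, of "%z. L.inv2 ?K .: z .: L.inv2 ?K"] by simp
 let ?k = "(xG ?o|>u T) .: L.inv2 ?K .: (?B<|xF ?i)"
 show "L.iso2 (kn n)"
 proof (rule L.inv2_unique(2)[of _ ?k])
  have "kn n .: ?k = (?B<|xF ?o) .: ?K .: ((xG ?i|>u T).:(xG ?o|>u T) .: L.inv2 ?K).:(?B<|xF ?i)" by(simp add: kn_def)
  also have "... = idc L (?B**pF n)" unfolding N' using e(1) by(simp add: L.vx2[OF e(1)])
  finally show "kn n .: ?k = idc L (ctrg L (kn n))" by(simp add: c)
  have "?k .: kn n = (xG ?o|>u T) .: L.inv2 ?K .: ((?B<|xF ?i).:(?B<|xF ?o) .: ?K).:(xG ?i|>u T)" by(simp add: kn_def)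
  also have "... = idc L (pG n**u T)" unfolding N[symmetric] using e(2) by(simp add: L.vx2[OF e(2)])
  finally show "?k .: kn n = idc L (csrc L (kn n))" by(simp add: c)
 qed (simp_all add: c)
qed

lemma kn_nat:
 assumes T: "mon T" and n: "arr_in M n T (J B)" and x: "cell_in M x n n'"
 shows "kn n' .: (xG x|>u T) = (nob h B<|xF x) .: kn n"
proof -
 have n': "arr_in M n' T (J B)" using n x M.cell_simps(2-4)[of x] by auto
 note [simp] = T ret_simps[OF n T] ret_simps[OF n' T] x[simplified]
 let ?i = "ret_in n" and ?o = "ret_out n" and ?i' = "ret_in n'" and ?o' = "ret_out n'" and ?B = "nob h B"
 have e: "(?B<|xF ?o').:(?B<|xF ?i') = idc L (?B**pF n')" "(xG ?o|>u T).:(xG ?i|>u T) = idc L (pG n**u T)"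
  using L.lcong[OF ret_FG(1)[OF n' T], of ?B] L.rcong[OF ret_FG(2)[OF n T], of "u T"] by simp+
 have N: "K0 (dmf n') T .: (xG ?i'|>u T).:(xG x|>u T).:(xG ?o|>u T) = (?B<|xF ?i').:(?B<|xF x).:(?B<|xF ?o) .: K0 (dmf n) T"
  using K0_nat[OF T, of "dmf n" "dmf n'" "vc M ?i' (vc M x ?o)"] by simp
 have "kn n' .: (xG x|>u T) = (?B<|xF ?o').:(K0 (dmf n') T .: (xG ?i'|>u T).:(xG x|>u T).:(xG ?o|>u T)).:(xG ?i|>u T)" using e(2) by(simp add: kn_def)
 also have "... = (?B<|xF x) .: kn n" unfolding N by(simp add: kn_def L.vx2[OF e(1)])
 finally show ?thesis .
qed

text \<open>The definition of \<open>kn\<close> still passes through a retraction here; naturality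
  of \<open>K0\<close> at \<open>ret_out\<close> absorbs it.\<close>

lemma kn_J:
 assumes T: "mon T" and f: "f : arrs K" "src K f = base T"
 shows "kn (Jf f T) = K0 f T"
proof -
 note [simp] = T f
 have n: "arr_in M (Jf f T) T (J (trg K f))" by simp
 note [simp] = ret_simps(4-14)[OF n T]
 note r = ret_FG(2)[OF n T]
 have e: "(xG (ret_out (Jf f T))|>u T).:(xG (ret_in (Jf f T))|>u T) = idc L (pG (Jf f T)**u T)" using L.rcong[OF r, of "u T"] by simp
 have "K0 f T .: (xG (ret_out (Jf f T))|>u T) = (nob h (trg K f)<|xF (ret_out (Jf f T))) .: K0 (dmf (Jf f T)) T" using K0_nat[OF T, of "dmf (Jf f T)" f "ret_out (Jf f T)"] by simp
 from L.vx2[OF this[symmetric], of "xG (ret_in (Jf f T))|>u T"] show ?thesis using e by(simp add: kn_def)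
qed

lemma kn_compat:
 assumes T: "mon T" and n: "arr_in M n T (J B)" and g: "g : arrs K" "src K g = B"
 shows "kn (cmp M (Ja K g) n).:(cG (Ja K g) n|>u T) = (nob h (trg K g)<|cF (Ja K g) n).:(nar h g|>pF n).:(gJ g<|kn n)"
proof -
 note [simp] = T ret_simps[OF n T] g
 let ?i = "ret_in n" and ?o = "ret_out n" and ?f = "dmf n" and ?C = "nob h (trg K g)" and ?g = "Ja K g" and ?m = "cmp M (Ja K g) n"
 have m: "arr_in M ?m T (J (trg K g))" and mf: "arr_in M (cmp M ?g (Jf ?f T)) T (J (trg K g))" by simp+
 note [simp] = kn_simps[OF m T] kn_simps[OF mf T]
 have kf: "kn (cmp M ?g (Jf ?f T)) = K0 (g**@K ?f) T" using kn_J[OF T, of "g**@K ?f"] by simp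
 have 1: "kn (cmp M ?g (Jf ?f T)).:(cG ?g (Jf ?f T)|>u T) = (?C<|cF ?g (Jf ?f T)).:(nar h g|>pF (Jf ?f T)).:(gJ g<|K0 ?f T)" unfolding kf using K0_compat[OF T, of ?f g] by simp
 have 2: "(nar h g|>pF n).:(gJ g<|nob h B<|xF ?o) = (?C<|fJ g<|xF ?o).:(nar h g|>pF (Jf ?f T))" using L.ich[of "xF ?o" "nar h g"] by simp
 have 3: "(?C<|cF ?g n).:(?C<|fJ g<|xF ?o) = (?C<|xF (?g<|@M ?o)).:(?C<|cF ?g (Jf ?f T))" using L.lcong[OF F.pc_lw[of ?o ?g], of ?C] by simp
 have 4: "(cG ?g (Jf ?f T)|>u T).:(gJ g<|(xG ?i|>u T)) = (xG (?g<|@M ?i)|>u T).:(cG ?g n|>u T)" using L.rcong[OF G.pc_lw[of ?i ?g], of "u T"] by simp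
 have 5: "kn (cmp M ?g (Jf ?f T)).:(xG (?g<|@M ?i)|>u T) = (?C<|xF (?g<|@M ?i)) .: kn ?m" by(rule kn_nat[OF T m]) simp
 have "vc M (?g<|@M ?o) (?g<|@M ?i) = idc M ?m" by(subst M.whisk_vc(1)[symmetric]) simp_all
 then have "xF (?g<|@M ?o) .: xF (?g<|@M ?i) = idc L (pF ?m)" using F.P_simps(9)[of "?g<|@M ?i" "?g<|@M ?o"] by simp
 from L.lcong[OF this, of ?C] have 6: "(?C<|xF (?g<|@M ?o)).:(?C<|xF (?g<|@M ?i)) = idc L (?C**pF ?m)" by simp
 have "(?C<|cF ?g n).:(nar h g|>pF n).:(gJ g<|kn n) =
  (?C<|xF (?g<|@M ?o)).:(kn (cmp M ?g (Jf ?f T)).:(cG ?g (Jf ?f T)|>u T)).:(gJ g<|(xG ?i|>u T))"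
  unfolding 1 by(simp add: kn_def L.vx2[OF 2] L.vx2[OF 3])
 also have "... = kn ?m .: (cG ?g n|>u T)" by(simp add: 4 L.vx2[OF 5] L.vx2[OF 6])
 finally show ?thesis by simp
qed

end

context em_ext
begin

lemma dm_types: "mon S ==> m : arrs M ==> trg M m = S ==> arr_in M (cmp M (dV S) m) (src M m) (J (base S))"
 "m : arrs M ==> mon (src M m)" "m : arrs M ==> mon (trg M m)"
 using M.src_objs[of m] M.trg_objs[of m] by auto

text \<open>After composition with \<open>V\<close> the structure cell is known from
  \<open>kn\<close>. The required cell is the lift through \<open>G V\<close> of the comparison of
  \<open>?r\<close> with \<open>?i\<close>; both are linear into the same action \<open>?Z\<close>,
  so the comparison and its inverse are linear and lift.\<close>

lemma sm_ex:
 assumes m: "m : arrs M"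
 shows "EX x. cell_in L x (pG m**u (src M m)) (u (trg M m)**pF m) & L.iso2 x &
  (nob h (base (trg M m))<|cF (dV (trg M m)) m).:(q (trg M m)|>pF m).:(gV (trg M m)<|x) =
  kn (cmp M (dV (trg M m)) m).:(cG (dV (trg M m)) m|>u (src M m))"
proof -
 let ?T = "src M m" and ?S = "trg M m"
 let ?V = "dV ?S" and ?t = "Ja K (endo ?S)" and ?d = "dma K ?S" and ?A = "nob h (base ?S)" and ?b = "base ?S"
 note [simp] = m dm_types(2,3)[OF m]
 have n: "arr_in M (cmp M ?V m) ?T (J ?b)" and tn: "arr_in M (cmp M ?t (cmp M ?V m)) ?T (J ?b)" by simp+
 note [simp] = kn_simps[OF n] kn_simps[OF tn]
 let ?r = "kn (cmp M ?V m).:(cG ?V m|>u ?T)"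
 let ?i = "(?A<|cF ?V m).:(q ?S|>pF m)"
 let ?w = "L.inv2 ?i .: ?r"
 have th [simp]: "th h ?S : cells L" "csrc L (th h ?S) = gJ (endo ?S)**?A**fV ?S" "ctrg L (th h ?S) = ?A**fV ?S" by(simp_all add: th_def)
 have 1: "(cG ?V m|>u ?T).:(xG ?d|>pG m|>u ?T) = (xG (?d|>@M m)|>u ?T).:(cG (cmp M ?t ?V) m|>u ?T)" using L.rcong[OF G.pc_rw[of ?d m], of "u ?T"] by simp
 have 2: "(cG (cmp M ?t ?V) m|>u ?T).:(cG ?t ?V|>pG m|>u ?T) = (cG ?t (cmp M ?V m)|>u ?T).:(pG ?t<|(cG ?V m|>u ?T))" using L.rcong[OF G.pc_assoc[of m ?V ?t], of "u ?T"] by simp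
 have 3: "kn (cmp M ?V m).:(xG (?d|>@M m)|>u ?T) = (?A<|xF (?d|>@M m)) .: kn (cmp M ?t (cmp M ?V m))" using kn_nat[OF _ tn, of "?d|>@M m" "cmp M ?V m"] by simp
 have 4: "kn (cmp M ?t (cmp M ?V m)).:(cG ?t (cmp M ?V m)|>u ?T) = (?A<|cF ?t (cmp M ?V m)).:(nar h (endo ?S)|>pF (cmp M ?V m)).:(pG ?t<|kn (cmp M ?V m))"
  using kn_compat[OF _ n, of "endo ?S"] by simp
 have r: "?r .: (aG ?S|>pG m|>u ?T) = (?A<|xF (?d|>@M m)).:(?A<|cF ?t (cmp M ?V m)).:(nar h (endo ?S)|>pF (cmp M ?V m)).:(pG ?t<|?r)" by(simp add: L.vx2[OF 1] 1 2 L.vx2[OF 3] L.vx2[OF 4])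
 have 5: "(?A<|cF ?V m).:(?A<|(xF ?d|>pF m)) = (?A<|xF (?d|>@M m)).:(?A<|cF (cmp M ?t ?V) m)" using L.lcong[OF F.pc_rw[of ?d m], of ?A] by simp
 have 6: "(?A<|cF (cmp M ?t ?V) m).:(?A<|(cF ?t ?V|>pF m)) = (?A<|cF ?t (cmp M ?V m)).:(?A<|pF ?t<|cF ?V m)" using L.lcong[OF F.pc_assoc[of m ?V ?t], of ?A] by simp
 have 7: "(?A<|pF ?t<|cF ?V m).:(nar h (endo ?S)|>fV ?S|>pF m) = (nar h (endo ?S)|>pF (cmp M ?V m)).:(pG ?t<|?A<|cF ?V m)" using L.ich[of "cF ?V m" "nar h (endo ?S)"] by simp
 have 8: "(q ?S|>pF m).:(aG ?S|>u ?S|>pF m) = (th h ?S|>pF m).:(pG ?t<|(q ?S|>pF m))" using L.rcong[OF q_alg[of ?S], of "pF m"] by simp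
 have i: "?i .: (aG ?S|>u ?S|>pF m) = (?A<|xF (?d|>@M m)).:(?A<|cF ?t (cmp M ?V m)).:(nar h (endo ?S)|>pF (cmp M ?V m)).:(pG ?t<|?i)"
 proof -
  have "?i .: (aG ?S|>u ?S|>pF m) = (?A<|cF ?V m).:(th h ?S|>pF m).:(pG ?t<|(q ?S|>pF m))" using 8 by simp
  then show ?thesis by(simp add: th_def L.vx2[OF 5] L.vx2[OF 6] L.vx2[OF 7])
 qed
 have ii: "L.iso2 ?i" "?i : cells L" "csrc L ?i = gV ?S**u ?S**pF m" "ctrg L ?i = ?A**pF (cmp M ?V m)" by simp+
 have rr: "L.iso2 ?r" "?r : cells L" "csrc L ?r = gV ?S**pG m**u ?T" "ctrg L ?r = ?A**pF (cmp M ?V m)" by simp+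
 let ?Z = "(?A<|xF (?d|>@M m)).:(?A<|cF ?t (cmp M ?V m)).:(nar h (endo ?S)|>pF (cmp M ?V m))"
 have Z: "?Z : cells L" "csrc L ?Z = pG ?t**?A**pF (cmp M ?V m)" "ctrg L ?Z = ?A**pF (cmp M ?V m)" by simp+
 \<comment> \<open>Two invertible cells that are linear into the same action differ by a linear
   cell. Applied in both orders this yields \<open>x\<close> and its inverse.\<close>
 have conj: "(L.inv2 b .: a).:(aG ?S|>g) = (aG ?S|>g').:(pG ?t<|(L.inv2 b .: a))"
  if a: "L.iso2 a" "a : cells L" "csrc L a = gV ?S**g" "ctrg L a = ?A**pF (cmp M ?V m)" "a .: (aG ?S|>g) = ?Z .: (pG ?t<|a)"
  and b: "L.iso2 b" "b : cells L" "csrc L b = gV ?S**g'" "ctrg L b = ?A**pF (cmp M ?V m)" "b .: (aG ?S|>g') = ?Z .: (pG ?t<|b)"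
  and g: "arr_in L g (pob F ?T) (pob G ?S)" "arr_in L g' (pob F ?T) (pob G ?S)" for a b g g'
 proof -
  define Z where "Z = ?Z"
  have Zt [simp]: "Z : cells L" "csrc L Z = pG ?t**?A**pF (cmp M ?V m)" "ctrg L Z = ?A**pF (cmp M ?V m)" using Z by(simp_all add: Z_def)
  define c where "c = aG ?S"
  have [simp]: "c : cells L" "csrc L c = pG ?t**gV ?S" "ctrg L c = gV ?S" by(simp_all add: c_def)
  note [simp] = a(1-4) b(1-4) g[simplified]
  have e: "a .: (c|>g) = Z .: (pG ?t<|a)" "b .: (c|>g') = Z .: (pG ?t<|b)" using a(5) b(5) unfolding Z_def c_def by simp+
  have s: "L.inv2 b .: Z = (c|>g').:(pG ?t<|L.inv2 b)" using L.inv2_swap[of "pG ?t<|b" b Z "c|>g'"] e(2) by simp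
  have "(L.inv2 b .: a).:(c|>g) = (L.inv2 b .: Z).:(pG ?t<|a)" using e(1) by simp
  then show ?thesis unfolding s c_def[symmetric] by simp
 qed
 have g: "arr_in L (pG m**u ?T) (pob F ?T) (pob G ?S)" "arr_in L (u ?S**pF m) (pob F ?T) (pob G ?S)" by simp+
 have r5: "?r .: (aG ?S|>(pG m**u ?T)) = ?Z .: (pG ?t<|?r)" using r by simp
 have i5: "?i .: (aG ?S|>(u ?S**pF m)) = ?Z .: (pG ?t<|?i)" using i by simp
 have S: "mon ?S" by simp
 have wc: "cell_in L ?w (gV ?S**pG m**u ?T) (gV ?S**u ?S**pF m)" "cell_in L (L.inv2 ?r .: ?i) (gV ?S**u ?S**pF m) (gV ?S**pG m**u ?T)" by simp+
 obtain x where x: "cell_in L x (pG m**u ?T) (u ?S**pF m)" "gV ?S<|x = ?w"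
  using gV_ex[OF S g wc(1) conj[OF rr r5 ii i5 g]] by blast
 obtain y where y: "cell_in L y (u ?S**pF m) (pG m**u ?T)" "gV ?S<|y = L.inv2 ?r .: ?i"
  using gV_ex[OF S g(2,1) wc(2) conj[OF ii i5 rr r5 g(2,1)]] by blast
 note [simp] = x(1)[simplified] y(1)[simplified]
 have "y .: x = idc L (pG m**u ?T)" by(rule gV_test[OF S, of _ "pG m**u ?T" "pG m**u ?T"]) (simp_all add: x(2) y(2))
 moreover have "x .: y = idc L (u ?S**pF m)" by(rule gV_test[OF S, of _ "u ?S**pF m" "u ?S**pF m"]) (simp_all add: x(2) y(2))
 ultimately have "L.iso2 x" using L.inv2_unique(2)[of x y] by simp
 moreover have "(?A<|cF ?V m).:(q ?S|>pF m).:(gV ?S<|x) = ?r" using x(2) by simp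
 ultimately show ?thesis using x(1) by blast
qed

definition "sm m = (SOME x. cell_in L x (pG m**u (src M m)) (u (trg M m)**pF m) & L.iso2 x &
  (nob h (base (trg M m))<|cF (dV (trg M m)) m).:(q (trg M m)|>pF m).:(gV (trg M m)<|x) =
  kn (cmp M (dV (trg M m)) m).:(cG (dV (trg M m)) m|>u (src M m)))"

lemma
 assumes m: "m : arrs M"
 shows sm_simps [simp]: "sm m : cells L" "csrc L (sm m) = pG m**u (src M m)" "ctrg L (sm m) = u (trg M m)**pF m" "L.iso2 (sm m)"
  and sm_eq: "trg M m = S ==> (nob h (base S)<|cF (dV S) m).:(q S|>pF m).:(gV S<|sm m) =
  kn (cmp M (dV S) m).:(cG (dV S) m|>u (src M m))"
 using someI_ex[OF sm_ex[OF m], folded sm_def] unfolding cell_in_def by blast+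

text \<open>The prefix of \<open>sm_eq\<close> is invertible and \<open>G V\<close> is faithful, so
  cells into the target of \<open>sm m\<close> may be compared after both are added. The axioms for
  \<open>sm\<close> are verified in this way.\<close>

lemma sm_test:
 assumes m: "m : arrs M" "trg M m = S" and x: "cell_in L x g (u S**pF m)" "cell_in L y g (u S**pF m)"
  and e: "(nob h (base S)<|cF (dV S) m).:(q S|>pF m).:(gV S<|x) = (nob h (base S)<|cF (dV S) m).:(q S|>pF m).:(gV S<|y)"
 shows "x = y"
proof -
 have S: "mon S" using dm_types(3)[OF m(1)] m(2) by simp
 note [simp] = m S x[simplified] dm_types(2)[OF m(1)]
 have g [simp]: "trg L g = pob G S" "g : arrs L" using L.cell_simps(1,4)[of x] by simp+
 have "((nob h (base S)<|cF (dV S) m).:(q S|>pF m)).:(gV S<|x) = ((nob h (base S)<|cF (dV S) m).:(q S|>pF m)).:(gV S<|y)" using e by simp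
 then have "gV S<|x = gV S<|y" by(subst (asm) L.iso2_cancel_iff(2)) simp_all
 then show ?thesis by(rule gV_test[OF S x(1,2) g(1)])
qed

text \<open>\<open>V\<close> is the included identity followed after \<open>V\<close>, so
  \<open>kn\<close> is \<open>K0\<close> at an identity, which the unit laws of \<open>h\<close>,
  \<open>F\<close> and \<open>G\<close> reduce to \<open>q\<close>.\<close>

lemma kn_V:
 assumes T: "mon T"
 shows "kn (dV T) = q T"
proof -
 note [simp] = T
 let ?o = "one K (base T)" and ?V = "dV T" and ?A = "nob h (base T)"
 have o: "Ja K ?o = one M (J (base T))" by simp
 have V: "Jf ?o T = ?V" by simp
 have k: "kn ?V = K0 ?o T" using kn_J[OF T, of ?o] by simp
 have 1: "K0 ?o T .: (cG (Ja K ?o) ?V|>u T) = (?A<|cF (Ja K ?o) ?V).:(nar h ?o|>fV T).:(gJ ?o<|q T)" using K0_eq[OF T, of ?o] by simp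
 have pu: "cG (Ja K ?o) ?V .: (uG (J (base T))|>gV T) = idc L (gV T)" "cF (Ja K ?o) ?V .: (uF (J (base T))|>fV T) = idc L (fV T)"
  using G.pu_left[of ?V "J (base T)"] F.pu_left[of ?V "J (base T)"] by simp+
 have 2: "(cG (Ja K ?o) ?V|>u T).:(uG (J (base T))|>gV T|>u T) = idc L (gV T**u T)" using L.rcong[OF pu(1), of "u T"] by simp
 have 3: "(gJ ?o<|q T).:(uG (J (base T))|>gV T|>u T) = (uG (J (base T))|>?A|>fV T) .: q T" using L.ich[of "q T" "uG (J (base T))"] by simp
 have 4: "(nar h ?o|>fV T).:(uG (J (base T))|>?A|>fV T) = ?A<|(uF (J (base T))|>fV T)" using L.rcong[OF pr_unit[OF h, of "base T"], of "fV T"] by(simp del: h_simps(9))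
 have 5: "(?A<|cF (Ja K ?o) ?V).:(?A<|(uF (J (base T))|>fV T)) = idc L (?A**fV T)" using L.lcong[OF pu(2), of ?A] by simp
 have "K0 ?o T = (K0 ?o T .: (cG (Ja K ?o) ?V|>u T)).:(uG (J (base T))|>gV T|>u T)" using 2 by simp
 also have "... = q T" unfolding 1 using 3 5 L.vx2[OF 4] L.vx2[OF 5] by simp
 finally show ?thesis using k by simp
qed

text \<open>The composition axiom for a 1-cell \<open>n\<close> into an identity monad after an
  arbitrary \<open>m\<close>. It holds for \<open>f V\<close> by \<open>sm_eq\<close> and
  \<open>kn_compat\<close>, and passes to the retract \<open>n\<close>.\<close>

lemma kn_comp:
 assumes m: "m : arrs M" "trg M m = S" and n: "arr_in M n S (J B)"
 shows "kn (cmp M n m).:(cG n m|>u (src M m)) = (nob h B<|cF n m).:(kn n|>pF m).:(pG n<|sm m)"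
proof -
 let ?T = "src M m"
 have T: "mon ?T" and S: "mon S" using dm_types(2,3)[OF m(1)] m(2) by simp+
 note [simp] = m T S ret_simps[OF n S]
 let ?i = "ret_in n" and ?o = "ret_out n" and ?f = "dmf n" and ?B = "nob h B" and ?A = "nob h (base S)"
 let ?V = "dV S" and ?J = "Ja K ?f" and ?nf = "Jf ?f S"
 have nV: "arr_in M (cmp M ?V m) ?T (J (base S))" and nm: "arr_in M (cmp M n m) ?T (J B)" and nfm: "arr_in M (cmp M ?J (cmp M ?V m)) ?T (J B)" and nf: "arr_in M ?nf S (J B)" by simp+
 note [simp] = kn_simps[OF nV T] kn_simps[OF nm T] kn_simps[OF nfm T] kn_simps[OF nf S]
 have A: "kn (cmp M ?J (cmp M ?V m)).:(cG ?nf m|>u ?T) = (?B<|cF ?nf m).:(K0 ?f S|>pF m).:(pG ?nf<|sm m)"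
 proof -
  have 1: "(cG ?nf m|>u ?T).:(cG ?J ?V|>pG m|>u ?T) = (cG ?J (cmp M ?V m)|>u ?T).:(gJ ?f<|(cG ?V m|>u ?T))" using L.rcong[OF G.pc_assoc[of m ?V ?J], of "u ?T"] by simp
  have 2: "kn (cmp M ?J (cmp M ?V m)).:(cG ?J (cmp M ?V m)|>u ?T) = (?B<|cF ?J (cmp M ?V m)).:(nar h ?f|>pF (cmp M ?V m)).:(gJ ?f<|kn (cmp M ?V m))"
  using kn_compat[OF T nV, of ?f] by simp
  have 3: "(gJ ?f<|kn (cmp M ?V m)).:(gJ ?f<|(cG ?V m|>u ?T)) = (gJ ?f<|?A<|cF ?V m).:(gJ ?f<|(q S|>pF m)).:(gJ ?f<|gV S<|sm m)"
  using L.lcong[OF sm_eq[OF m, symmetric], of "gJ ?f"] by simp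
  have 4: "(nar h ?f|>pF (cmp M ?V m)).:(gJ ?f<|?A<|cF ?V m) = (?B<|fJ ?f<|cF ?V m).:(nar h ?f|>fV S|>pF m)" using L.ich[of "cF ?V m" "nar h ?f"] by simp
  have 5: "(?B<|cF ?nf m).:(?B<|(cF ?J ?V|>pF m)) = (?B<|cF ?J (cmp M ?V m)).:(?B<|fJ ?f<|cF ?V m)" using L.lcong[OF F.pc_assoc[of m ?V ?J], of ?B] by simp
  have 6: "(pG ?nf<|sm m).:(cG ?J ?V|>pG m|>u ?T) = (cG ?J ?V|>u S|>pF m).:(gJ ?f<|gV S<|sm m)" using L.ich[of "sm m" "cG ?J ?V"] by simp
  have 7: "(K0 ?f S|>pF m).:(cG ?J ?V|>u S|>pF m) = (?B<|(cF ?J ?V|>pF m)).:(nar h ?f|>fV S|>pF m).:(gJ ?f<|(q S|>pF m))" using L.rcong[OF K0_eq[OF S, of ?f], of "pF m"] by simp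
  show ?thesis
  by(rule L.iso2_cancel_right[of "cG ?J ?V|>pG m|>u ?T"]) (simp_all add: 1 L.vx2[OF 2] 3 L.vx2[OF 4] 6 L.vx2[OF 7] L.vx2[OF 5])
 qed
 have 1: "(cG ?nf m|>u ?T).:(xG ?i|>pG m|>u ?T) = (xG (?i|>@M m)|>u ?T).:(cG n m|>u ?T)" using L.rcong[OF G.pc_rw[of ?i m], of "u ?T"] by simp
 have 2: "kn (cmp M ?J (cmp M ?V m)).:(xG (?i|>@M m)|>u ?T) = (?B<|xF (?i|>@M m)) .: kn (cmp M n m)" using kn_nat[OF T nm, of "?i|>@M m" "cmp M ?J (cmp M ?V m)"] by simp
 have 3: "(xG ?i|>u S|>pF m).:(pG n<|sm m) = (pG ?nf<|sm m).:(xG ?i|>pG m|>u ?T)" using L.ich[of "sm m" "xG ?i"] by simp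
 have 4: "(?B<|cF n m).:(?B<|(xF ?o|>pF m)) = (?B<|xF (?o|>@M m)).:(?B<|cF ?nf m)" using L.lcong[OF F.pc_rw[of ?o m], of ?B] by simp
 have "vc M (?o|>@M m) (?i|>@M m) = idc M (cmp M n m)" by(subst M.whisk_vc(2)[symmetric]) simp_all
 then have "xF (?o|>@M m) .: xF (?i|>@M m) = idc L (pF (cmp M n m))" using F.P_simps(9)[of "?i|>@M m" "?o|>@M m"] by simp
 from L.lcong[OF this, of ?B] have 6: "(?B<|xF (?o|>@M m)).:(?B<|xF (?i|>@M m)) = idc L (?B**pF (cmp M n m))" by simp
 have "(?B<|cF n m).:(kn n|>pF m).:(pG n<|sm m) =
  (?B<|xF (?o|>@M m)).:((?B<|cF ?nf m).:(K0 ?f S|>pF m).:(pG ?nf<|sm m)).:(xG ?i|>pG m|>u ?T)"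
  by(simp add: kn_def 3 L.vx2[OF 4])
 also have "... = kn (cmp M n m).:(cG n m|>u ?T)" unfolding A[symmetric] by(simp add: 1 L.vx2[OF 2] L.vx2[OF 6])
 finally show ?thesis by simp
qed

lemma sm_nat:
 assumes x [simp]: "x : cells M"
 shows "sm (ctrg M x).:(xG x|>u (src M (csrc M x))) = (u (trg M (csrc M x))<|xF x) .: sm (csrc M x)"
proof (rule sm_test[of "ctrg M x" "trg M (csrc M x)"])
 let ?m = "csrc M x" and ?m' = "ctrg M x" and ?T = "src M (csrc M x)" and ?S = "trg M (csrc M x)"
 have a [simp]: "mon ?T" "mon ?S" using dm_types(2,3)[of ?m] by simp+
 let ?V = "dV ?S" and ?A = "nob h (base ?S)"
 have n: "arr_in M (cmp M ?V ?m) ?T (J (base ?S))" and n': "arr_in M (cmp M ?V ?m') ?T (J (base ?S))" by simp+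
 note [simp] = kn_simps[OF n] kn_simps[OF n']
 have 1: "(?A<|cF ?V ?m').:(q ?S|>pF ?m').:(gV ?S<|sm ?m') = kn (cmp M ?V ?m').:(cG ?V ?m'|>u ?T)"
  "(?A<|cF ?V ?m).:(q ?S|>pF ?m).:(gV ?S<|sm ?m) = kn (cmp M ?V ?m).:(cG ?V ?m|>u ?T)"
  using sm_eq[of ?m' ?S] sm_eq[of ?m ?S] by simp+
 have 2: "(cG ?V ?m'|>u ?T).:(gV ?S<|(xG x|>u ?T)) = (xG (?V<|@M x)|>u ?T).:(cG ?V ?m|>u ?T)" using L.rcong[OF G.pc_lw[of x ?V], of "u ?T"] by simp
 have 3: "kn (cmp M ?V ?m').:(xG (?V<|@M x)|>u ?T) = (?A<|xF (?V<|@M x)) .: kn (cmp M ?V ?m)" using kn_nat[OF _ n, of "?V<|@M x" "cmp M ?V ?m'"] by simp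
 have 4: "(?A<|xF (?V<|@M x)).:(?A<|cF ?V ?m) = (?A<|cF ?V ?m').:(?A<|fV ?S<|xF x)" using L.lcong[OF F.pc_lw[of x ?V], of ?A] by simp
 have 5: "(?A<|fV ?S<|xF x).:(q ?S|>pF ?m) = (q ?S|>pF ?m').:(gV ?S<|u ?S<|xF x)" using L.ich[of "xF x" "q ?S"] by simp
 have "(?A<|cF ?V ?m').:(q ?S|>pF ?m').:(gV ?S<|sm ?m').:(gV ?S<|(xG x|>u ?T)) =
  (?A<|xF (?V<|@M x)).:(?A<|cF ?V ?m).:(q ?S|>pF ?m).:(gV ?S<|sm ?m)"
  by(simp add: L.vx3[OF 1(1)] 2 L.vx2[OF 3] 1(2))
 also have "... = (?A<|cF ?V ?m').:(q ?S|>pF ?m').:(gV ?S<|u ?S<|xF x).:(gV ?S<|sm ?m)" by(simp add: L.vx2[OF 4] L.vx2[OF 5])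
 finally show "(?A<|cF ?V ?m').:(q ?S|>pF ?m').:(gV ?S<|(sm ?m' .: (xG x|>u ?T))) =
  (?A<|cF ?V ?m').:(q ?S|>pF ?m').:(gV ?S<|((u ?S<|xF x) .: sm ?m))" by simp
 show "cell_in L (sm ?m' .: (xG x|>u ?T)) (pG ?m**u ?T) (u ?S**pF ?m')"
  "cell_in L ((u ?S<|xF x) .: sm ?m) (pG ?m**u ?T) (u ?S**pF ?m')" by simp+
qed simp_all

lemma sm_unit:
 assumes T: "mon T"
 shows "sm (one M T).:(uG T|>u T) = u T<|uF T"
proof (rule sm_test[of "one M T" T])
 note [simp] = T kn_V[OF T]
 let ?V = "dV T" and ?A = "nob h (base T)"
 have 1: "(?A<|cF ?V (one M T)).:(q T|>pF (one M T)).:(gV T<|sm (one M T)) = q T .: (cG ?V (one M T)|>u T)" using sm_eq[of "one M T" T] by simp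
 have pu: "cG ?V (one M T).:(gV T<|uG T) = idc L (gV T)" "cF ?V (one M T).:(fV T<|uF T) = idc L (fV T)" using G.pu_right[of ?V T] F.pu_right[of ?V T] by simp+
 have 2: "(cG ?V (one M T)|>u T).:(gV T<|(uG T|>u T)) = idc L (gV T**u T)" using L.rcong[OF pu(1), of "u T"] by simp
 have 3: "(q T|>pF (one M T)).:(gV T<|u T<|uF T) = (?A<|fV T<|uF T) .: q T" using L.ich[of "uF T" "q T"] by simp
 have 4: "(?A<|cF ?V (one M T)).:(?A<|fV T<|uF T) = idc L (?A**fV T)" using L.lcong[OF pu(2), of ?A] by simp
 show "(?A<|cF ?V (one M T)).:(q T|>pF (one M T)).:(gV T<|(sm (one M T).:(uG T|>u T))) =
  (?A<|cF ?V (one M T)).:(q T|>pF (one M T)).:(gV T<|u T<|uF T)"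
  by(simp add: L.vx3[OF 1] 2 3 L.vx2[OF 4])
 show "cell_in L (sm (one M T).:(uG T|>u T)) (u T) (u T**pF (one M T))" "cell_in L (u T<|uF T) (u T) (u T**pF (one M T))" by simp+
qed (use T in simp_all)

lemma sm_comp:
 assumes mn [simp]: "m : arrs M" "n : arrs M" "trg M m = src M n"
 shows "sm (cmp M n m).:(cG n m|>u (src M m)) = (u (trg M n)<|cF n m).:(sm n|>pF m).:(pG n<|sm m)"
proof (rule sm_test[of "cmp M n m" "trg M n"])
 let ?T = "src M m" and ?S = "src M n" and ?R = "trg M n"
 have a [simp]: "mon ?T" "mon ?S" "mon ?R" using dm_types(2,3)[of m] dm_types(3)[of n] by simp+
 let ?V = "dV ?R" and ?A = "nob h (base ?R)"
 have v: "arr_in M (cmp M ?V n) ?S (J (base ?R))" and vm: "arr_in M (cmp M ?V (cmp M n m)) ?T (J (base ?R))" by simp+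
 note [simp] = kn_simps[OF v] kn_simps[OF vm]
 have 1: "(?A<|cF ?V (cmp M n m)).:(q ?R|>pF (cmp M n m)).:(gV ?R<|sm (cmp M n m)) = kn (cmp M ?V (cmp M n m)).:(cG ?V (cmp M n m)|>u ?T)" using sm_eq[of "cmp M n m" ?R] by simp
 have 2: "(cG ?V (cmp M n m)|>u ?T).:(gV ?R<|(cG n m|>u ?T)) = (cG (cmp M ?V n) m|>u ?T).:(cG ?V n|>pG m|>u ?T)" using L.rcong[OF G.pc_assoc[of m n ?V], of "u ?T"] by simp
 have 3: "kn (cmp M ?V (cmp M n m)).:(cG (cmp M ?V n) m|>u ?T) = (?A<|cF (cmp M ?V n) m).:(kn (cmp M ?V n)|>pF m).:(pG (cmp M ?V n)<|sm m)"
  using kn_comp[of m ?S "cmp M ?V n" "base ?R"] by simp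
 have 4: "(pG (cmp M ?V n)<|sm m).:(cG ?V n|>pG m|>u ?T) = (cG ?V n|>u ?S|>pF m).:(gV ?R<|pG n<|sm m)" using L.ich[of "sm m" "cG ?V n"] by simp
 have 5: "(kn (cmp M ?V n)|>pF m).:(cG ?V n|>u ?S|>pF m) = (?A<|(cF ?V n|>pF m)).:(q ?R|>pF n|>pF m).:(gV ?R<|(sm n|>pF m))" using L.rcong[OF sm_eq[of n ?R, symmetric], of "pF m"] by simp
 have 6: "(?A<|cF (cmp M ?V n) m).:(?A<|(cF ?V n|>pF m)) = (?A<|cF ?V (cmp M n m)).:(?A<|fV ?R<|cF n m)" using L.lcong[OF F.pc_assoc[of m n ?V], of ?A] by simp
 have 7: "(?A<|fV ?R<|cF n m).:(q ?R|>pF n|>pF m) = (q ?R|>pF (cmp M n m)).:(gV ?R<|u ?R<|cF n m)" using L.ich[of "cF n m" "q ?R"] by simp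
 show "(?A<|cF ?V (cmp M n m)).:(q ?R|>pF (cmp M n m)).:(gV ?R<|(sm (cmp M n m).:(cG n m|>u ?T))) =
  (?A<|cF ?V (cmp M n m)).:(q ?R|>pF (cmp M n m)).:(gV ?R<|((u ?R<|cF n m).:(sm n|>pF m).:(pG n<|sm m)))"
  by(simp add: L.vx3[OF 1] 2 L.vx2[OF 3] 4 L.vx2[OF 5] L.vx2[OF 6] L.vx2[OF 7])
 show "cell_in L (sm (cmp M n m).:(cG n m|>u ?T)) (pG n**pG m**u ?T) (u ?R**pF (cmp M n m))"
  "cell_in L ((u ?R<|cF n m).:(sm n|>pF m).:(pG n<|sm m)) (pG n**pG m**u ?T) (u ?R**pF (cmp M n m))"
  by simp+
qed simp_all

text \<open>The cells \<open>sm\<close> make \<open>u\<close> a transformation, and its restriction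
  is compared with \<open>h\<close> at identity monads, where \<open>V\<close> is an identity
  1-cell.\<close>

theorem restriction_eso: "EX s d. pn s & is_iso2 (Hom K L) d (Rn s) h"
proof -
 define s where "s = (|nsrc = F, ntrg = G, nob = restrict u (objs M), nar = restrict sm (arrs M)|)"
 have ss [simp]: "nsrc s = F" "ntrg s = G" "mon T ==> nob s T = u T" "m : arrs M ==> nar s m = sm m" for T m by(simp_all add: s_def)
 note [simp] = dm_types(2,3)
 have "pseudonat M L s"
 proof (rule pseudonatI)
  show "pseudofunctor M L (nsrc s)" "pseudofunctor M L (ntrg s)" by(simp_all add: F.pseudofunctor_axioms G.pseudofunctor_axioms)
  show "nob s : extensional (objs M)" "nar s : extensional (arrs M)" by(simp_all add: s_def)
  show "arr_in L (nob s T) (pob (nsrc s) T) (pob (ntrg s) T)" if "T : objs M" for T using that by simp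
  show "is_iso2 L (nar s m) (par (ntrg s) m**nob s (src M m)) (nob s (trg M m)**par (nsrc s) m)" if "m : arrs M" for m
  using that by(simp add: L.is_iso2_iff)
  show "nar s (ctrg M x).:(pce (ntrg s) x|>nob s (src M (csrc M x))) = (nob s (trg M (csrc M x))<|pce (nsrc s) x) .: nar s (csrc M x)" if "x : cells M" for x
  using that sm_nat[OF that] dm_types(2,3)[of "csrc M x"] by simp
  show "nar s (one M T).:(punit (ntrg s) T|>nob s T) = nob s T<|punit (nsrc s) T" if "T : objs M" for T using that sm_unit by simp
  show "nar s (cmp M n m).:(pcomp (ntrg s) n m|>nob s (src M m)) =
  (nob s (trg M n)<|pcomp (nsrc s) n m).:(nar s n|>par (nsrc s) m).:(par (ntrg s) n<|nar s m)"
  if "m : arrs M" "n : arrs M" "trg M m = src M n" for m n using that sm_comp[OF that] dm_types(3)[of m] by simp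
 qed
 then have pn: "pn s" by(simp add: pn_def)
 have b [simp]: "base (J A) = A" for A by(simp add: id_monad_def)
 have V1: "dV (J A) = one M (J A)" if "A : objs K" for A using J.F_one[OF that] that by(simp add: dmV_def Ja_def id_monad_def)
 have qs: "q (J A) : cells L" "L.iso2 (q (J A))" "csrc L (q (J A)) = pG (one M (J A))**u (J A)" "ctrg L (q (J A)) = nob h A**pF (one M (J A))" if "A : objs K" for A
  using u_simps(4-7)[of "J A"] that by(simp_all add: V1)
 \<comment> \<open>The cell \<open>q (J A)\<close> runs from \<open>G 1\<close> after
   \<open>u\<close> to \<open>h\<close> after \<open>F 1\<close>; the unit cells remove both images
   of the identity.\<close>
 define d where "d A = (nob h A<|L.inv2 (uF (J A))) .: q (J A).:(uG (J A)|>u (J A))" for A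
 have d [simp]: "L.iso2 (d A)" "d A : cells L" "csrc L (d A) = u (J A)" "ctrg L (d A) = nob h A" if "A : objs K" for A
  using that qs[OF that] by(simp_all add: d_def)
 have dq: "q (J A).:(uG (J A)|>u (J A)) = (nob h A<|uF (J A)) .: d A" if "A : objs K" for A
  using that qs[OF that] by(simp add: d_def)
 \<comment> \<open>\<open>kn\<close> at the included \<open>f\<close> is evaluated twice: with an
   identity composed after it through \<open>sm_eq\<close>, and with an identity composed before it
   through \<open>kn_compat\<close>. The two values are the sides of the modification axiom.\<close>
 have dJ: "(d (trg K f)|>fJ f) .: sm (Ja K f) = nar h f .: (gJ f<|d (src K f))" if f: "f : arrs K" for f
 proof -
  let ?A = "src K f" and ?B = "trg K f" and ?m = "Ja K f"
  note [simp] = f V1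
  have m: "arr_in M ?m (J ?A) (J ?B)" by simp
  note [simp] = kn_simps[OF m]
  have 1: "(nob h ?B<|cF (one M (J ?B)) ?m).:(q (J ?B)|>fJ f).:(pG (one M (J ?B))<|sm ?m) = kn ?m .: (cG (one M (J ?B)) ?m|>u (J ?A))" using sm_eq[of ?m "J ?B"] by(simp add: V1)
  have 2: "(pG (one M (J ?B))<|sm ?m).:(uG (J ?B)|>gJ f|>u (J ?A)) = (uG (J ?B)|>u (J ?B)|>fJ f) .: sm ?m" using L.ich[of "sm ?m" "uG (J ?B)"] by simp
  have pl: "cG (one M (J ?B)) ?m .: (uG (J ?B)|>gJ f) = idc L (gJ f)" "cF (one M (J ?B)) ?m .: (uF (J ?B)|>fJ f) = idc L (fJ f)"
  "cG ?m (one M (J ?A)).:(gJ f<|uG (J ?A)) = idc L (gJ f)" "cF ?m (one M (J ?A)).:(fJ f<|uF (J ?A)) = idc L (fJ f)"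
  using G.pu_left[of ?m "J ?B"] F.pu_left[of ?m "J ?B"] G.pu_right[of ?m "J ?A"] F.pu_right[of ?m "J ?A"] by simp+
  have 3: "(cG (one M (J ?B)) ?m|>u (J ?A)).:(uG (J ?B)|>gJ f|>u (J ?A)) = idc L (gJ f**u (J ?A))"
  "(nob h ?B<|cF (one M (J ?B)) ?m).:(nob h ?B<|(uF (J ?B)|>fJ f)) = idc L (nob h ?B**fJ f)"
  "(cG ?m (one M (J ?A))|>u (J ?A)).:(gJ f<|(uG (J ?A)|>u (J ?A))) = idc L (gJ f**u (J ?A))"
  "(nob h ?B<|cF ?m (one M (J ?A))).:(nob h ?B<|fJ f<|uF (J ?A)) = idc L (nob h ?B**fJ f)"
  using L.rcong[OF pl(1), of "u (J ?A)"] L.lcong[OF pl(2), of "nob h ?B"] L.rcong[OF pl(3), of "u (J ?A)"] L.lcong[OF pl(4), of "nob h ?B"] by simp+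
  have 4: "(q (J ?B)|>fJ f).:(uG (J ?B)|>u (J ?B)|>fJ f) = (nob h ?B<|(uF (J ?B)|>fJ f)).:(d ?B|>fJ f)" using L.rcong[OF dq[of ?B], of "fJ f"] by simp
  have k: "kn (one M (J ?A)) = q (J ?A)" using kn_V[of "J ?A"] by(simp add: V1)
  have 5: "kn ?m .: (cG ?m (one M (J ?A))|>u (J ?A)) = (nob h ?B<|cF ?m (one M (J ?A))).:(nar h f|>pF (one M (J ?A))).:(gJ f<|q (J ?A))"
  using kn_compat[of "J ?A" "one M (J ?A)" ?A f] k by simp
  have 6: "(gJ f<|q (J ?A)).:(gJ f<|(uG (J ?A)|>u (J ?A))) = (gJ f<|nob h ?A<|uF (J ?A)).:(gJ f<|d ?A)" using L.lcong[OF dq[of ?A], of "gJ f"] by simp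
  have 7: "(nar h f|>pF (one M (J ?A))).:(gJ f<|nob h ?A<|uF (J ?A)) = (nob h ?B<|fJ f<|uF (J ?A)) .: nar h f" using L.ich[of "uF (J ?A)" "nar h f"] by simp
  have "kn ?m = (kn ?m .: (cG (one M (J ?B)) ?m|>u (J ?A))).:(uG (J ?B)|>gJ f|>u (J ?A))" using 3(1) by simp
  also have "... = (d ?B|>fJ f) .: sm ?m" unfolding 1[symmetric] by(simp add: 2 L.vx2[OF 4] L.vx2[OF 3(2)])
  finally have e: "kn ?m = (d ?B|>fJ f) .: sm ?m" .
  have "kn ?m = (kn ?m .: (cG ?m (one M (J ?A))|>u (J ?A))).:(gJ f<|(uG (J ?A)|>u (J ?A)))" using 3(3) by simp
  also have "... = nar h f .: (gJ f<|d ?A)" unfolding 5 by(simp add: 6 L.vx2[OF 7] L.vx2[OF 3(4)])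
  finally show ?thesis using e by simp
 qed
 let ?d = "(|msrc = Rn s, mtrg = h, mob = restrict d (objs K)|)"
 have hh: "pseudonat K L h" "nsrc h = RF F" "ntrg h = RF G" using HK.modD h by(simp_all add: pr_def)
 have "modification K L ?d" using R_pnat[of s] pn hh dJ by(simp add: modification_iff pn_def FR GR)
 from HK.Hom_iso2[OF this] have "is_iso2 (Hom K L) ?d (Rn s) h" by simp
 with pn show ?thesis by blast
qed

end

context em_pair
begin

text \<open>The laws are those of the image under \<open>F\<close> of the action on
  \<open>V\<close>, moved across \<open>h\<close> by its naturality at \<open>mult T\<close> and
  \<open>eta T\<close> and by its composition and unit axioms.\<close>

lemma th_alg:
 assumes h: "pr h" and T: "mon T"
 shows "alg L (PG T) (pob F T) (nob h (base T)**fV T) (th h T)"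
proof -
 note [simp] = T pr_simps(1-7)[OF h]
 let ?t = "Ja K (endo T)" and ?V = "dV T" and ?A = "nob h (base T)" and ?n = "nar h (endo T)"
 have aF: "alg L (pfun_monad L F (Jm T)) (pob F T) (fV T) (aF T)" using F.P_alg[OF J.F_monad[OF T] V_alg[OF T]] by simp
 have F7: "(?A<|aF T).:(?A<|pF ?t<|aF T) = (?A<|aF T).:(?A<|((xF (Jc K (mult T)) .: cF ?t ?t)|>fV T))"
  and F8: "(?A<|aF T).:(?A<|((xF (Jc K (eta T)) .: uF (J (base T)))|>fV T)) = idc L (?A**fV T)"
  using L.lcong[OF L.algD(7)[OF aF], of ?A] L.lcong[OF L.algD(8)[OF aF], of ?A] by simp+
 have 1: "(?n|>fV T).:(pG ?t<|?A<|aF T) = (?A<|pF ?t<|aF T).:(?n|>pF ?t|>fV T)" using L.ich[of "aF T" ?n] by simp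
 have 2: "(?A<|(cF ?t ?t|>fV T)).:(?n|>pF ?t|>fV T).:(pG ?t<|(?n|>fV T)) = (nar h (endo T**@K endo T)|>fV T).:(cG ?t ?t|>?A|>fV T)"
  using L.rcong[OF pr_comp[OF h, of "endo T" "endo T", symmetric], of "fV T"] pr_simps(4-7)[OF h, of "endo T**@K endo T"] by simp
 have 3: "(?n|>fV T).:(xG (Jc K (mult T))|>?A|>fV T) = (?A<|(xF (Jc K (mult T))|>fV T)).:(nar h (endo T**@K endo T)|>fV T)"
  using L.rcong[OF pr_nat[OF h, of "mult T"], of "fV T"] pr_simps(4-7)[OF h, of "endo T**@K endo T"] by simp
 have 4: "(?n|>fV T).:(xG (Jc K (eta T))|>?A|>fV T) = (?A<|(xF (Jc K (eta T))|>fV T)).:(nar h (one K (base T))|>fV T)"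
  using L.rcong[OF pr_nat[OF h, of "eta T"], of "fV T"] pr_simps(4-7)[OF h, of "one K (base T)"] by simp
 have 5: "(nar h (one K (base T))|>fV T).:(uG (J (base T))|>?A|>fV T) = ?A<|(uF (J (base T))|>fV T)"
  using L.rcong[OF pr_unit[OF h, of "base T"], of "fV T"] pr_simps(4-7)[OF h, of "one K (base T)"] by simp
 have n2: "nar h (endo T**@K endo T) : cells L" "csrc L (nar h (endo T**@K endo T)) = pG (cmp M ?t ?t)**?A" "ctrg L (nar h (endo T**@K endo T)) = ?A**pF (cmp M ?t ?t)"
  "nar h (one K (base T)) : cells L" "csrc L (nar h (one K (base T))) = pG (one M (J (base T)))**?A" "ctrg L (nar h (one K (base T))) = ?A**pF (one M (J (base T)))"
  using pr_simps(5-7)[OF h, of "endo T**@K endo T"] pr_simps(5-7)[OF h, of "one K (base T)"] by simp+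
 define a where "a = ?A<|aF T"
 have [simp]: "a : cells L" "csrc L a = ?A**pF ?t**fV T" "ctrg L a = ?A**fV T" by(simp_all add: a_def)
 have F7': "a .: (?A<|pF ?t<|aF T) = a .: (?A<|(xF (Jc K (mult T))|>fV T)).:(?A<|(cF ?t ?t|>fV T))" using F7 unfolding a_def[symmetric] by simp
 have F8': "a .: (?A<|(xF (Jc K (eta T))|>fV T)).:(?A<|(uF (J (base T))|>fV T)) = idc L (?A**fV T)" using F8 unfolding a_def[symmetric] by simp
 have t: "th h T = a .: (?n|>fV T)" by(simp add: th_def a_def)
 have "th h T .: (pG ?t<|th h T) = a .: ((?n|>fV T).:(pG ?t<|?A<|aF T)).:(pG ?t<|(?n|>fV T))" by(simp add: th_def a_def)
 also have "... = (a .: (?A<|pF ?t<|aF T)).:(?n|>pF ?t|>fV T).:(pG ?t<|(?n|>fV T))" unfolding 1 by simp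
 also have "... = a .: (?A<|(xF (Jc K (mult T))|>fV T)).:((?A<|(cF ?t ?t|>fV T)).:(?n|>pF ?t|>fV T).:(pG ?t<|(?n|>fV T)))" unfolding F7' by simp
 also have "... = th h T .: ((xG (Jc K (mult T)) .: cG ?t ?t)|>(?A**fV T))" unfolding 2 t using n2 by(simp add: L.vx2[OF 3])
 finally have m: "th h T .: (pG ?t<|th h T) = th h T .: ((xG (Jc K (mult T)) .: cG ?t ?t)|>(?A**fV T))" .
 have e: "th h T .: ((xG (Jc K (eta T)) .: uG (J (base T)))|>(?A**fV T)) = idc L (?A**fV T)" unfolding t using n2 F8' by(simp add: L.vx2[OF 4] 5)
 have c: "arr_in L (?A**fV T) (pob F T) (pob G (J (base T)))" "cell_in L (th h T) (pG ?t**?A**fV T) (?A**fV T)" by(simp_all add: t)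
 show ?thesis unfolding alg_def G.pfun_monad_simps J.Fm_simps using c m e by simp
qed

text \<open>Universality of \<open>G V\<close>, applied to the algebra \<open>th\<close>, supplies
  the data \<open>u\<close> and \<open>q\<close> of \<open>em_ext\<close>; choice makes them
  functions of \<open>T\<close>.\<close>

theorem restriction_eso:
 assumes h: "pr h"
 shows "EX s d. pn s & is_iso2 (Hom K L) d (Rn s) h"
proof -
 define Q where "Q T g k <-> arr_in L g (pob F T) (pob G T) & is_iso2 L k (gV T**g) (nob h (base T)**fV T) &
  k .: (aG T|>g) = th h T .: (gJ (endo T)<|k)" for T g k
 have ex: "EX g k. Q T g k" if T: "mon T" for T
 proof -
  have X: "pob F T : objs L" using T by simp
  obtain g k where g: "arr_in L g (pob F T) (src L (gV T))" "L.iso2 k" "algm L (PG T) (gV T**g) (aG T|>g) (nob h (base T)**fV T) (th h T) k"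
  using L.univD(3)[OF aG_univ(3)[OF T X] th_alg[OF h T]] by blast
  have "Q T g k" using g(1,2) L.algmD[OF g(3)] T by(simp add: Q_def L.is_iso2_iff)
  then show ?thesis by(intro exI)
 qed
 define u where "u T = (SOME g. EX k. Q T g k)" for T
 define q where "q T = (SOME k. Q T (u T) k)" for T
 have Q: "Q T (u T) (q T)" if "mon T" for T
  unfolding q_def by(rule someI_ex[of "%k. Q T (u T) k"]) (unfold u_def, rule someI_ex[of "%g. EX k. Q T g k"], rule ex[OF that])
 interpret E: em_ext K L F G h u q
  using Q h unfolding Q_def by unfold_locales blast+
 show ?thesis by(rule E.restriction_eso)
qed

end

section \<open>Assembly of the biequivalence\<close>

lemma (in two_category) equivalent_objs_refl:
 assumes "A : objs K"
 shows "equivalent_objs K A A"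
 using assms unfolding equivalent_objs_def
 by(intro exI[of _ "one K A"] exI[of _ "idc K (one K A)"]) (simp add: is_iso2_iff)

lemma (in pseudofunctor) hom_functor:
 "is_functor (hom_cat K A B) (hom_cat L (pob F A) (pob F B)) (|fob = par F, fmo = pce F|)"
 unfolding is_functor_def by(simp add: K.category_hom L.category_hom K.mor_in_hom L.mor_in_hom K.hom_cat_simps L.hom_cat_simps)

context em_pair
begin

lemma local_equivalence:
 assumes D: "D = full_sub (Hom M L) S" and FG: "F : S" "G : S"
  and R: "pseudofunctor D (Hom K L) R" and Re: "R = restriction K L inc D"
 shows "is_equivalence (hom_cat D F G) (hom_cat (Hom K L) (pob R F) (pob R G)) (|fob = par R, fmo = pce R|)"
proof -
 have D2: "two_category D" unfolding D by(rule two_category.full_sub_two_category[OF HM.Hom_two_category])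
 note H2 = HK.Hom_two_category
 note DS = two_category.hom_cat_simps[OF D2]
 have oD: "F : objs D" "G : objs D" using FG F.pseudofunctor_axioms G.pseudofunctor_axioms by(simp_all add: D full_sub_def HM.Hom_simps)
 have Rs: "H : objs D ==> pob R H = RF H" "s : arrs D ==> par R s = Rn s" "m : cells D ==> pce R m = Rm m" for H s m
  by(simp_all add: Re restriction_def)
 have ops: "arrs D = {s. pseudonat M L s & nsrc s : S & ntrg s : S}" "src D = nsrc" "trg D = ntrg"
  "cells D = {m. modification M L m & nsrc (msrc m) : S & ntrg (msrc m) : S}" "csrc D = msrc" "ctrg D = mtrg"
  unfolding D full_sub_def HM.Hom_simps by(simp_all add: HM.Hom_simps(2-7))
 have aD: "arr_in D s F G <-> pn s" for s
  unfolding arr_in_def pn_def ops using FG by blast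
 have cD: "cell_in D m s s' <-> modification M L m & msrc m = s & mtrg m = s'" if p: "pn s" "pn s'" for m s s'
 proof -
  have e: "nsrc s : S" "ntrg s : S" using p(1) FG unfolding pn_def by blast+
  show ?thesis unfolding cell_in_def ops using e by blast
 qed
 show ?thesis
 proof (rule equivalenceI[OF pseudofunctor.hom_functor[OF R]])
  fix s s' n assume s0: "s : Ob (hom_cat D F G)" "s' : Ob (hom_cat D F G)"
  and n: "mor_in (hom_cat (Hom K L) (pob R F) (pob R G)) n (fob (|fob = par R, fmo = pce R|) s) (fob (|fob = par R, fmo = pce R|) s')"
  have sa: "arr_in D s F G" "arr_in D s' F G" using s0 unfolding DS by blast+
  have s: "pn s" "pn s'" using sa aD by simp+
  have sA: "s : arrs D" "s' : arrs D" using sa by(simp_all add: arr_in_def)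
  have "cell_in (Hom K L) n (Rn s) (Rn s')" using n unfolding two_category.mor_in_hom[OF H2] fctr.simps Rs(2)[OF sA(1)] Rs(2)[OF sA(2)] by blast
  then have "modification K L n & msrc n = Rn s & mtrg n = Rn s'" unfolding cell_in_def HK.Hom_simps by blast
  then have ex: "EX! m. modification M L m & msrc m = s & mtrg m = s' & Rm m = n" using restriction_ff[OF s] by blast
  have iff: "mor_in (hom_cat D F G) m s s' & fmo (|fob = par R, fmo = pce R|) m = n <-> modification M L m & msrc m = s & mtrg m = s' & Rm m = n" for m
  proof -
  have "mor_in (hom_cat D F G) m s s' <-> cell_in D m s s'" using sa unfolding two_category.mor_in_hom[OF D2] by blast
  moreover have "cell_in D m s s' ==> pce R m = Rm m" using Rs(3) by(simp add: cell_in_def)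
  ultimately show ?thesis using cD[OF s, of m] unfolding fctr.simps by metis
  qed
  show "EX! m. mor_in (hom_cat D F G) m s s' & fmo (|fob = par R, fmo = pce R|) m = n" unfolding iff by(rule ex)
 next
  fix h assume h0: "h : Ob (hom_cat (Hom K L) (pob R F) (pob R G))"
  have h: "arr_in (Hom K L) h (RF F) (RF G)" using h0 unfolding two_category.hom_cat_simps[OF H2] Rs(1)[OF oD(1)] Rs(1)[OF oD(2)] by blast
  then have "pr h" unfolding pr_def arr_in_def HK.Hom_simps by blast
  then obtain s d where s: "pn s" "is_iso2 (Hom K L) d (Rn s) h" using restriction_eso by blast
  have sa: "arr_in D s F G" using aD s(1) by simp
  then have sA: "s : arrs D" by(simp add: arr_in_def)
  have "arr_in (Hom K L) (Rn s) (RF F) (RF G)" using pseudofunctor.par_in[OF R sa] unfolding Rs(2)[OF sA] Rs(1)[OF oD(1)] Rs(1)[OF oD(2)] .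
  then have i: "is_iso (hom_cat (Hom K L) (pob R F) (pob R G)) d (fob (|fob = par R, fmo = pce R|) s) h"
  using s(2) h unfolding two_category.is_iso_hom[OF H2] fctr.simps Rs(2)[OF sA] Rs(1)[OF oD(1)] Rs(1)[OF oD(2)] by blast
  have "s : Ob (hom_cat D F G)" using sa unfolding DS by blast
  then show "EX c:Ob (hom_cat D F G). EX i. is_iso (hom_cat (Hom K L) (pob R F) (pob R G)) i (fob (|fob = par R, fmo = pce R|) c) h" using i by blast
 qed
qed

end

context em_target
begin

lemma em_pairI:
 assumes ccL: "Cat_cc_category L" and F: "pseudofunctor M L F" and G: "pseudofunctor M L G" "preserves_demi_EM_objects M L G"
 shows "em_pair K L F G"
proof (intro em_pair.intro em_target_axioms F G(1) em_pair_axioms.intro)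
 note pu = pseudofunctor.preserves_universal[OF G(1) EM_dm_Cat_cc ccL G(2)]
 fix T assume T: "mon T"
 have "universal M (Jm T) (dV T) (dma K T)" using V_univ[OF T] V_alg[OF T] T by(simp add: universal_def)
 from pu[OF J.F_monad[OF T] this]
 show "universal L (pfun_monad L G (Jm T)) (par G (dV T)) (pce G (dma K T) .:@L pcomp G (Ja K (endo T)) (dV T))" unfolding J.Fm_simps .
qed

text \<open>Locally this is \<open>local_equivalence\<close>. On objects restriction is even
  surjective, since \<open>extension_ex\<close> returns a pseudofunctor restricting to
  \<open>P\<close> exactly, so reflexivity of equivalence suffices.\<close>

theorem restriction_biequivalence:
 assumes ccK: "Cat_cc_category K" and ccL: "Cat_cc_category L" and demi: "has_demi_EM_objects L"
  and D: "D = full_sub (Hom M L) {F. preserves_demi_EM_objects M L F}"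
 shows "biequivalence D (Hom K L) (restriction K L inc D)"
 unfolding biequivalence_def
proof (intro conjI ballI)
 let ?R = "restriction K L inc D"
 show R: "pseudofunctor D (Hom K L) ?R" by(rule restriction_pseudofunctor[OF D])
 have oD: "F : objs D <-> pseudofunctor M L F & preserves_demi_EM_objects M L F" for F
  unfolding D full_sub_def by(simp add: HM.Hom_simps)
 show "is_equivalence (hom_cat D F G) (hom_cat (Hom K L) (pob ?R F) (pob ?R G)) (|fob = par ?R, fmo = pce ?R|)"
  if "F : objs D" "G : objs D" for F G
 proof -
  have FG: "pseudofunctor M L F" "preserves_demi_EM_objects M L F" "pseudofunctor M L G" "preserves_demi_EM_objects M L G" using that unfolding oD by blast+
  show ?thesis
  by(rule em_pair.local_equivalence[OF em_pairI[OF ccL FG(1,3,4)] D _ _ R refl]) (simp_all add: FG(2,4))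
 qed
 fix P assume P: "P : objs (Hom K L)"
 then have "pseudofunctor K L P" by(simp add: HK.Hom_simps)
 then have "collage K L P" by(rule collage.intro)
 from collage.extension_ex[OF this ccK ccL L.universal_of_has_demi[OF ccL demi]]
 obtain F where F: "pseudofunctor M L F" "preserves_demi_EM_objects M L F" "RF F = P" by blast
 then have "F : objs D" using oD by blast
 moreover from this have "pob ?R F = P" using F(3) by(simp add: restriction_def)
 ultimately show "EX F:objs D. equivalent_objs (Hom K L) (pob ?R F) P" using two_category.equivalent_objs_refl[OF HK.Hom_two_category P] by metis
qed

end

theorem corollary5p3:
  fixes K :: "('o, 'a, 'c) two_cat"
  assumes "Cat_cc_category K"
  shows "two_functor K (EM_dm K) (EM_dm_incl K) \<and>
    Cat_cc_category (EM_dm K) \<and>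
    has_demi_EM_objects (EM_dm K) \<and>
    (\<forall>L :: ('p, 'b, 'd) two_cat.
       Cat_cc_category L \<and> has_demi_EM_objects L \<longrightarrow>
       (let D = full_sub (Hom (EM_dm K) L) {F. preserves_demi_EM_objects (EM_dm K) L F}
        in biequivalence D (Hom K L) (restriction K L (EM_dm_incl K) D)))"
proof -
 interpret K: two_category K using assms by(simp add: Cat_cc_category_def)
 interpret E: em K by(rule K.em)
 have "has_demi_EM_objects E*K" using E.M.has_demi_of_universal[OF K.EM_dm_Cat_cc] K.EM_dm_universal_ex[OF assms] by blast
 moreover have "biequivalence D (Hom K L) (restriction K L (EM_dm_incl K) D)"
  if "Cat_cc_category L" "has_demi_EM_objects L" "D = full_sub (Hom E*K L) {F. preserves_demi_EM_objects E*K L F}"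
  for L :: "('p, 'b, 'd) two_cat" and D
 proof -
  have "two_category L" using that(1) by(simp add: Cat_cc_category_def)
  then interpret ET: em_target K L by(intro em_target.intro E.em_axioms)
  show ?thesis by(rule ET.restriction_biequivalence[OF assms that])
 qed
 ultimately show ?thesis using K.EM_dm_incl_two_functor K.EM_dm_Cat_cc by(simp add: Let_def)
qed

end
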